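(* Let $f:E\to E$ be a nonuniformly expanding map with basis $Y$, reference measure $m$, return time $R$ and associated $f$-invariant probability $\mu$ (see context), and let $p>1$. Assume that there exist a slowly varying function $s$ at infinity and a sequence $(u_n)_{n\ge1}$ of positive reals tending to $0$ such that for all $n\ge1$ $$e^{-nu_n}\le m(R>n)\le n^{-p}s(n).$$ Then for any Hölder continuous observable $\varphi:E\to\mathbb R$, the $\tau$-mixing coefficients $\tau_\varphi(n)$ of $(\varphi\circ f^n)_{n\ge0}$ on $(E,\mu)$ satisfy $$\tau_\varphi(n)=O(n^{1-p}s(n))\quad\text{as } n\to\infty.$$
   Context: **Nonuniformly expanding map.** $(E,d)$ is a complete bounded separable metric space with its Borel $\sigma$-algebra, and $f:E\to E$ is measurable, with an inducing scheme: a closed subset $Y\subset E$ (the basis) equipped with a (Borel) measure $m$; a countable (infinite) measurable partition $\Gamma$ of $Y$ with $m(a)>0$ for all $a\in\Gamma$; an $m$-integrable return time $R:Y\to\mathbb N^*=\{1,2,\dots\}$ with $\gcd\{R(y):y\in Y\}=1$, constant on each $a\in\Gamma$ with value $R(a)$, such that $f^{R(a)}(y)\in Y$ for all $y\in a$. Let $F_Y:Y\to Y$, $F_Y(y)=f^{R(y)}(y)$. There exist $\lambda>1$, $K>0$ such that for all $a\in\Gamma$ and $x,y\in a$: - $F_Y$ restricts to a (measure-theoretic) bijection from $a$ to $Y$; - $d(F_Y(x),F_Y(y))\ge\lambda d(x,y)$; - $d(f^k(x),f^k(y))\le K d(F_Y(x),F_Y(y))$ for $0\le k\le R(a)$; -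 $|\log|\zeta_a(x)|-\log|\zeta_a(y)||\le K d(F_Y(x),F_Y(y))$, where $\zeta_a=dm/(dm\circ F_Y)$ is the inverse Jacobian of $F_Y:a\to Y$; - $m(Y_\omega)=m(\overline{Y_\omega})$ for every finite word $\omega=a_0a_1\cdots a_n$ in $\Gamma$, where $Y_\omega=\bigcap_{k=0}^nF_Y^{-k}(a_k)$. For such maps there is a unique $F_Y$-invariant probability $\nu_Y$ on $Y$ absolutely continuous with respect to $m$ (with $c^{-1}\le d\nu_Y/dm\le c$ for some $c>0$). The $f$-invariant probability is $\mu=\big(\int_YR\,d\nu_Y\big)^{-1}\sum_{n\ge0}(f^n)_*\big(\nu_Y|_{\{R>n\}}\big)$. **Slowly varying.** A measurable $s:(0,\infty)\to(0,\infty)$ is slowly varying at infinity if $s(\lambda x)/s(x)\to1$ as $x\to\infty$ for every $\lambda>0$. **$\tau$-mixing coefficients.** On the probability space $(E,\mu)$, for a random vector $Z$ in $\mathbb R^k$ and a $\sigma$-algebra $\mathcal M$, $$\tau(\mathcal M,Z)=\Big\|\sup\{|P_{Z|\mathcal M}(g)-P_Z(g)|:g\in\Lambda_1(\mathbb R^k)\}\Big\|_1,$$ where $P_Z$ is the law of $Z$, $P_{Z|\mathcal M}$ its regular conditional law given $\mathcal M$, and $\Lambda_1(\mathbb R^k)$ is the set of functions $\mathbb R^k\to\mathbb R$ that are $1$-Lipschitz for the $\ell^1$ distance. Then $$\tau_\varphi(n)=\sup_{l\ge1}\frac1l\sup_{1\le i_1<\cdots<i_l}\tau\big(\sigma(\varphi\circ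 f^j:j\ge i_l+n),(\varphi\circ f^{i_1},\dots,\varphi\circ f^{i_l})\big).$$ *)

theory Defs
  imports "HOL-Probability.Probability" "HOL-Library.Landau_Symbols"
begin

section \<open>Nonuniformly expanding maps\<close>

definition induced_map :: "('a \<Rightarrow> 'a) \<Rightarrow> ('a \<Rightarrow> nat) \<Rightarrow> 'a \<Rightarrow> 'a" where
  "induced_map f R y = (f ^^ R y) y"

definition cylinder :: "('a \<Rightarrow> 'a) \<Rightarrow> 'a set \<Rightarrow> 'a set list \<Rightarrow> 'a set" where
  "cylinder F Y w = {y \<in> Y. \<forall>k < length w. (F ^^ k) y \<in> w ! k}"

text \<open>A bijection in the measure-theoretic sense: a bimeasurable bijection after discarding a null
  set on either side.\<close>

definition mt_bijection :: "('a \<Rightarrow> 'b) \<Rightarrow> 'a measure \<Rightarrow> 'b measure \<Rightarrow> bool" where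
  "mt_bijection F M N \<longleftrightarrow> (\<exists>A \<in> sets M. \<exists>B \<in> sets N.
      emeasure M (space M - A) = 0 \<and> emeasure N (space N - B) = 0 \<and> bij_betw F A B \<and>
      F \<in> restrict_space M A \<rightarrow>\<^sub>M restrict_space N B \<and>
      the_inv_into A F \<in> restrict_space N B \<rightarrow>\<^sub>M restrict_space M A)"

text \<open>The measure \<open>m \<circ> F\<close> on \<open>a\<close>, that is \<open>A \<mapsto> m (F ` A)\<close> for measurable \<open>A \<subseteq> a\<close>. It is only used
  for maps \<open>F\<close> that are injective on \<open>a\<close> and send measurable subsets of \<open>a\<close> to measurable sets.\<close>

definition comp_measure :: "'a measure \<Rightarrow> ('a \<Rightarrow> 'a) \<Rightarrow> 'a set \<Rightarrow> 'a measure" where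
  "comp_measure m F a = measure_of a (sets (restrict_space m a)) (\<lambda>A. emeasure m (F ` A))"

text \<open>\<open>\<zeta>\<close> is a version, positive and finite everywhere on \<open>a\<close>, of the density \<open>dm / d(m \<circ> F)\<close> on \<open>a\<close>.\<close>

definition inverse_jacobian :: "'a measure \<Rightarrow> ('a \<Rightarrow> 'a) \<Rightarrow> 'a set \<Rightarrow> ('a \<Rightarrow> real) \<Rightarrow> bool" where
  "inverse_jacobian m F a \<zeta> \<longleftrightarrow>
      \<zeta> \<in> borel_measurable (restrict_space m a) \<and> (\<forall>x \<in> a. 0 < \<zeta> x) \<and>
      density (comp_measure m F a) (\<lambda>x. ennreal (\<zeta> x)) = restrict_space m a"

text \<open>The metric space \<open>E\<close> is the whole type \<open>'a\<close>. The reference measure \<open>m\<close> lives on \<open>Y\<close>; it is finite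
  because \<open>R \<ge> 1\<close> is integrable. Since densities are only determined almost everywhere, the
  distortion bound is required of some version of the inverse Jacobian.\<close>

locale nonuniformly_expanding =
  fixes f :: "'a::polish_space \<Rightarrow> 'a"
    and Y :: "'a set"
    and m :: "'a measure"
    and \<Gamma> :: "'a set set"
    and R :: "'a \<Rightarrow> nat"
  assumes bounded_space: "bounded (UNIV :: 'a set)"
    and f_measurable: "f \<in> borel_measurable borel"
    and closed_Y: "closed Y"
    and space_m: "space m = Y"
    and sets_m: "sets m = sets (restrict_space borel Y)"
    and countable_\<Gamma>: "countable \<Gamma>"
    and infinite_\<Gamma>: "infinite \<Gamma>"
    and partition: "partition_on Y \<Gamma>"
    and measurable_\<Gamma>: "\<And>a. a \<in> \<Gamma> \<Longrightarrow> a \<in> sets m"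
    and positive_\<Gamma>: "\<And>a. a \<in> \<Gamma> \<Longrightarrow> 0 < emeasure m a"
    and R_ge_1: "\<And>y. y \<in> Y \<Longrightarrow> 1 \<le> R y"
    and R_constant: "\<And>a x y. a \<in> \<Gamma> \<Longrightarrow> x \<in> a \<Longrightarrow> y \<in> a \<Longrightarrow> R x = R y"
    and R_integrable: "integrable m (\<lambda>y. real (R y))"
    and R_gcd: "Gcd (R ` Y) = 1"
    and returns: "\<And>y. y \<in> Y \<Longrightarrow> (f ^^ R y) y \<in> Y"
    and mt_bij: "\<And>a. a \<in> \<Gamma> \<Longrightarrow> mt_bijection (induced_map f R) (restrict_space m a) m"
    and expansion_distortion: "\<exists>L > 1. \<exists>K > 0. \<forall>a \<in> \<Gamma>.
          (\<forall>x \<in> a. \<forall>y \<in> a.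
              dist (induced_map f R x) (induced_map f R y) \<ge> L * dist x y \<and>
              (\<forall>k \<le> R x. dist ((f ^^ k) x) ((f ^^ k) y)
                           \<le> K * dist (induced_map f R x) (induced_map f R y))) \<and>
          (\<exists>\<zeta>. inverse_jacobian m (induced_map f R) a \<zeta> \<and>
              (\<forall>x \<in> a. \<forall>y \<in> a. \<bar>ln \<bar>\<zeta> x\<bar> - ln \<bar>\<zeta> y\<bar>\<bar>
                           \<le> K * dist (induced_map f R x) (induced_map f R y)))"
    and closure_cylinder: "\<And>w. w \<noteq> [] \<Longrightarrow> set w \<subseteq> \<Gamma> \<Longrightarrow>
          emeasure m (cylinder (induced_map f R) Y w)
            = emeasure m (closure (cylinder (induced_map f R) Y w))"

text \<open>For the induced map of a nonuniformly expanding map there is exactly one such \<open>\<nu>\<close>.\<close>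

definition abs_cont_invariant_prob :: "'a measure \<Rightarrow> ('a \<Rightarrow> 'a) \<Rightarrow> 'a measure \<Rightarrow> bool" where
  "abs_cont_invariant_prob m F \<nu> \<longleftrightarrow> prob_space \<nu> \<and> sets \<nu> = sets m \<and>
      F \<in> \<nu> \<rightarrow>\<^sub>M \<nu> \<and> distr \<nu> \<nu> F = \<nu> \<and> absolutely_continuous m \<nu>"

text \<open>The measure \<open>(\<integral>R d\<nu>)\<^sup>-\<^sup>1 \<Sum>n. (f\<^sup>n)\<^sub>* (\<nu> restricted to {R > n})\<close> on the whole space.\<close>

definition lifted_measure ::
    "('a::topological_space \<Rightarrow> 'a) \<Rightarrow> ('a \<Rightarrow> nat) \<Rightarrow> 'a measure \<Rightarrow> 'a measure" where
  "lifted_measure f R \<nu> =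
     scale_measure (inverse (\<integral>\<^sup>+ y. of_nat (R y) \<partial>\<nu>))
       (measure_of UNIV (sets borel)
          (\<lambda>A. \<Sum>n. emeasure (distr (restrict_space \<nu> {y. R y > n}) borel (f ^^ n)) A))"

section \<open>Slow variation and Hoelder continuity\<close>

definition slowly_varying :: "(real \<Rightarrow> real) \<Rightarrow> bool" where
  "slowly_varying s \<longleftrightarrow> s \<in> borel_measurable (restrict_space borel {0<..}) \<and> (\<forall>x > 0. 0 < s x) \<and>
      (\<forall>c > 0. ((\<lambda>x. s (c * x) / s x) \<longlongrightarrow> 1) at_top)"

definition hoelder_continuous :: "('a::metric_space \<Rightarrow> real) \<Rightarrow> bool" where
  "hoelder_continuous \<phi> \<longleftrightarrow> (\<exists>\<alpha> C. 0 < \<alpha> \<and> \<alpha> \<le> 1 \<and>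
      (\<forall>x y. \<bar>\<phi> x - \<phi> y\<bar> \<le> C * dist x y powr \<alpha>))"

section \<open>The \<open>\<tau>\<close>-mixing coefficients\<close>

text \<open>Vectors in \<open>\<real>\<^sup>k\<close> are points of the product space \<open>\<Pi>\<^sub>M i\<in>{1..k}. borel\<close>, because \<open>k\<close> varies
  within a single definition.\<close>

definition real_vectors :: "nat \<Rightarrow> (nat \<Rightarrow> real) measure" where
  "real_vectors k = (\<Pi>\<^sub>M i\<in>{1..k}. borel)"

definition lipschitz_l1 :: "nat \<Rightarrow> ((nat \<Rightarrow> real) \<Rightarrow> real) set" where
  "lipschitz_l1 k = {g. \<forall>x \<in> space (real_vectors k). \<forall>y \<in> space (real_vectors k).
      \<bar>g x - g y\<bar> \<le> (\<Sum>i = 1..k. \<bar>x i - y i\<bar>)}"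

definition regular_cond_law ::
    "'a measure \<Rightarrow> 'a measure \<Rightarrow> 'b measure \<Rightarrow> ('a \<Rightarrow> 'b) \<Rightarrow> ('a \<Rightarrow> 'b measure) \<Rightarrow> bool" where
  "regular_cond_law M G N Z \<kappa> \<longleftrightarrow> \<kappa> \<in> G \<rightarrow>\<^sub>M prob_algebra N \<and>
      (\<forall>B \<in> sets N. AE x in M.
          measure (\<kappa> x) B = real_cond_exp M G (indicator (Z -` B \<inter> space M)) x)"

text \<open>The choice of the version of the conditional law is immaterial: two versions agree almost surely
  since \<open>\<real>\<^sup>k\<close> is standard Borel. The value is in \<open>[0, \<infinity>]\<close>, so that no supremum below is truncated.\<close>

definition tau :: "'a measure \<Rightarrow> 'a measure \<Rightarrow> nat \<Rightarrow> ('a \<Rightarrow> nat \<Rightarrow> real) \<Rightarrow> ennreal" where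
  "tau M G k Z =
     (let \<kappa> = (SOME \<kappa>. regular_cond_law M G (real_vectors k) Z \<kappa>);
          P = distr M (real_vectors k) Z
      in \<integral>\<^sup>+ x. (SUP g \<in> lipschitz_l1 k. ennreal \<bar>(\<integral>z. g z \<partial>\<kappa> x) - (\<integral>z. g z \<partial>P)\<bar>) \<partial>M)"

definition generated_algebra :: "'a measure \<Rightarrow> (nat \<Rightarrow> 'a \<Rightarrow> real) \<Rightarrow> nat set \<Rightarrow> 'a measure" where
  "generated_algebra M X J = sigma (space M) {X j -` B \<inter> space M | j B. j \<in> J \<and> B \<in> sets borel}"

definition tau_coeff :: "'a measure \<Rightarrow> (nat \<Rightarrow> 'a \<Rightarrow> real) \<Rightarrow> nat \<Rightarrow> ennreal" where
  "tau_coeff M X n =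
     (SUP l \<in> {1..}. ennreal (1 / real l) *
        (SUP i \<in> {i :: nat \<Rightarrow> nat. 1 \<le> i 1 \<and> strict_mono_on {1..l} i}.
           tau M (generated_algebra M X {i l + n..}) l (\<lambda>x. \<lambda>r\<in>{1..l}. X (i r) x)))"

end

theory Submission
  imports Defs
begin

text \<open>
  The idea is to read the process \<open>\<phi>, \<phi> \<circ> f, \<phi> \<circ> f\<^sup>2, \<dots>\<close> backwards in time. Pass to the tower of
  points \<open>(y, k)\<close> with \<open>y \<in> Y\<close> and \<open>k < R y\<close>, which projects to \<open>E\<close> by \<open>(y, k) \<mapsto> f\<^sup>k y\<close> and on
  which the dynamics climbs one level at a time until it returns to the base. Conditionally on the
  position \<open>z\<close> on the tower at time \<open>N\<close>, the positions at the times \<open>N, N - 1, \<dots>, 0\<close> form a Markov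
  chain: from \<open>(y, k + 1)\<close> it goes down to \<open>(y, k)\<close>, and from \<open>(y, 0)\<close> it jumps to the top of the
  column over a preimage \<open>s\<^sub>n y\<close> of \<open>y\<close> under the induced map. That preimage is chosen with
  probability \<open>p\<^sub>y(n) = J\<^sub>n(y) h(s\<^sub>n y) / h(y)\<close>, where \<open>h = d\<nu>/dm\<close> and \<open>J\<^sub>n\<close> is the inverse
  Jacobian at \<open>s\<^sub>n y\<close> (\<open>path_duality\<close>).

  The future \<open>\<sigma>(\<phi> \<circ> f\<^sup>j : j \<ge> N)\<close> consists of \<open>f\<^sup>N\<close>-preimages, so it only sees the starting point
  \<open>z\<close> of this chain. Hence \<open>\<tau>\<^sub>\<phi>(n)\<close> is controlled as soon as the observations made by two such
  chains, started from two points \<open>z\<close>, \<open>z'\<close>, after \<open>n\<close> steps or later, have nearly the same law in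
  the Wasserstein sense (\<open>tower_tau_bound\<close>).

  That closeness is obtained by coupling. Bounded distortion gives \<open>p\<^sub>y \<le> exp(C d(y, y')) p\<^sub>y\<^sub>'\<close>,
  so two chains at the base can choose the same branch with probability \<open>exp(-C d(y, y'))\<close>, and
  then their distance contracts. After a mismatch they sit at different levels. Because the return
  times have \<open>gcd\<close> equal to \<open>1\<close> and an integrable tail, renewal theory bounds from below the
  probability that both are at the base again at any given late time (\<open>renewal_lower_bound\<close>). With
  \<open>Q i = (\<Sum>j\<ge>i. T j)\<close>, where \<open>T j\<close> bounds the probability of a jump longer than \<open>j\<close>, this turns a
  bound \<open>M\<close> after \<open>n\<close> steps into a bound \<open>\<theta> M + C1 Q i\<close> after \<open>n + i + t0\<close> steps, with \<open>\<theta> < 1\<close>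
  (\<open>profile_step\<close>). Iterating with \<open>i\<close> proportional to \<open>n\<close> yields the rate \<open>O(\<Psi> n)\<close> for every
  majorant \<open>\<Psi>\<close> of \<open>Q\<close> that decreases at most polynomially (\<open>coupling_rate\<close>). When
  \<open>m(R > n) \<le> n\<^sup>-\<^sup>p s(n)\<close>, such a majorant of order \<open>n\<^sup>1\<^sup>-\<^sup>p s(n)\<close> exists by the theory of slowly
  varying functions (\<open>tail_sum_slowly_varying\<close>, \<open>regular_majorant\<close>).

  Two more ingredients are needed. The coefficient \<open>\<tau>\<close> is defined through regular conditional
  laws; it is reduced to estimates of \<open>\<integral>\<^sub>A (g(Z) - E g(Z)) d\<mu>\<close> over events \<open>A\<close> and Lipschitz \<open>g\<close>
  in \<open>tau_le_superadditive\<close>. And the distortion bound for \<open>p\<^sub>y\<close> requires \<open>h\<close> to be positive and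
  log-Lipschitz on an invariant set of full measure (\<open>invariant_density\<close>).
\<close>

section \<open>Discrete laws and other preliminaries\<close>

lemma pmf_integrable_bdd:
  fixes f :: "'a \<Rightarrow> real"
  assumes "\<And>x. x \<in> set_pmf p \<Longrightarrow> \<bar>f x\<bar> \<le> b"
  shows "integrable (measure_pmf p) f"
  by (rule measure_pmf.integrable_const_bound[where B = b]) (use assms in \<open>auto simp: AE_measure_pmf_iff\<close>)

lemma pmf_integral_mono:
  fixes f g :: "'a \<Rightarrow> real"
  assumes "\<And>x. x \<in> set_pmf p \<Longrightarrow> \<bar>f x\<bar> \<le> b" "\<And>x. x \<in> set_pmf p \<Longrightarrow> \<bar>g x\<bar> \<le> b'"
    and "\<And>x. x \<in> set_pmf p \<Longrightarrow> f x \<le> g x"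
  shows "(\<integral>x. f x \<partial>measure_pmf p) \<le> (\<integral>x. g x \<partial>measure_pmf p)"
  by (rule integral_mono_AE[OF pmf_integrable_bdd[OF assms(1)] pmf_integrable_bdd[OF assms(2)]])
    (use assms in \<open>auto simp: AE_measure_pmf_iff\<close>)

lemma pmf_integral_cong:
  fixes f g :: "'a \<Rightarrow> real"
  assumes "\<And>x. x \<in> set_pmf p \<Longrightarrow> f x = g x"
  shows "(\<integral>x. f x \<partial>measure_pmf p) = (\<integral>x. g x \<partial>measure_pmf p)"
  by (rule integral_cong_AE) (use assms in \<open>auto simp: AE_measure_pmf_iff\<close>)

lemma pmf_integral_bind:
  fixes f :: "'b \<Rightarrow> real"
  assumes "\<And>x y. x \<in> set_pmf p \<Longrightarrow> y \<in> set_pmf (q x) \<Longrightarrow> \<bar>f y\<bar> \<le> b"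
  shows "(\<integral>y. f y \<partial>measure_pmf (bind_pmf p q)) = (\<integral>x. \<integral>y. f y \<partial>measure_pmf (q x) \<partial>measure_pmf p)"
proof -
  define g where "g y = max (-b) (min b (f y))" for y
  have gf: "g y = f y" if "x \<in> set_pmf p" "y \<in> set_pmf (q x)" for x y
    using assms[OF that] by (auto simp: g_def)
  obtain x0 y0 where "x0 \<in> set_pmf p" "y0 \<in> set_pmf (q x0)" by (meson ex_in_conv set_pmf_not_empty)
  then have b: "b \<ge> 0" using assms by (smt (verit) abs_ge_zero)
  have "(\<integral>y. f y \<partial>measure_pmf (bind_pmf p q)) = (\<integral>y. g y \<partial>measure_pmf (bind_pmf p q))"
    by (rule pmf_integral_cong) (use gf in auto)
  also have "\<dots> = (\<integral>x. \<integral>y. g y \<partial>measure_pmf (q x) \<partial>measure_pmf p)"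
    unfolding measure_pmf_bind
    by (rule integral_bind[where K = "count_space UNIV" and B = b and B' = 1])
      (use b in \<open>auto simp: g_def measure_pmf.emeasure_space_1[simplified] intro!: measure_pmf_in_subprob_algebra\<close>)
  also have "\<dots> = (\<integral>x. \<integral>y. f y \<partial>measure_pmf (q x) \<partial>measure_pmf p)"
    by (rule pmf_integral_cong, rule pmf_integral_cong) (use gf in auto)
  finally show ?thesis .
qed

lemma pmf_integral_le_const:
  fixes f :: "'a \<Rightarrow> real"
  assumes "\<And>x. x \<in> set_pmf p \<Longrightarrow> \<bar>f x\<bar> \<le> b" "\<And>x. x \<in> set_pmf p \<Longrightarrow> f x \<le> c"
  shows "(\<integral>x. f x \<partial>measure_pmf p) \<le> c"
  by (rule measure_pmf.integral_le_const[OF pmf_integrable_bdd]) (use assms in \<open>auto simp: AE_measure_pmf_iff\<close>)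

lemma pmf_integral_ge_const:
  fixes f :: "'a \<Rightarrow> real"
  assumes "\<And>x. x \<in> set_pmf p \<Longrightarrow> \<bar>f x\<bar> \<le> b" "\<And>x. x \<in> set_pmf p \<Longrightarrow> c \<le> f x"
  shows "c \<le> (\<integral>x. f x \<partial>measure_pmf p)"
  by (rule measure_pmf.integral_ge_const[OF pmf_integrable_bdd]) (use assms in \<open>auto simp: AE_measure_pmf_iff\<close>)

lemma pmf_integral_abs_le:
  fixes f :: "'a \<Rightarrow> real"
  assumes "\<And>x. x \<in> set_pmf p \<Longrightarrow> \<bar>f x\<bar> \<le> b"
  shows "\<bar>\<integral>x. f x \<partial>measure_pmf p\<bar> \<le> b"
proof -
  have "(\<integral>x. f x \<partial>measure_pmf p) \<le> b" "- b \<le> (\<integral>x. f x \<partial>measure_pmf p)"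
    using pmf_integral_le_const[of p f b b] pmf_integral_ge_const[of p f b "-b"] assms
    by (auto simp: abs_le_iff minus_le_iff)
  then show ?thesis by auto
qed

lemma pmf_prob_bind:
  "measure_pmf.prob (bind_pmf p q) A = (\<integral>x. measure_pmf.prob (q x) A \<partial>measure_pmf p)"
  using pmf_integral_bind[of p q "indicator A" 1] by simp

lemma pair_bind_pmf:
  "pair_pmf (bind_pmf A f) (bind_pmf B g) = bind_pmf (pair_pmf A B) (\<lambda>x. pair_pmf (f (fst x)) (g (snd x)))"
  unfolding pair_pmf_def bind_assoc_pmf bind_return_pmf fst_conv snd_conv
  by (intro bind_pmf_cong refl) (subst bind_commute_pmf, rule refl)

lemma pair_pmf_prob_prod:
  "(\<integral>x. indicator A (fst x) * indicator B (snd x) \<partial>measure_pmf (pair_pmf M N))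
     = measure_pmf.prob M A * (measure_pmf.prob N B :: real)"
proof -
  have "(\<integral>x. indicator A (fst x) * (indicator B (snd x) :: real) \<partial>measure_pmf (pair_pmf M N))
    = (\<integral>x. (\<integral>y. indicator A x * indicator B y \<partial>measure_pmf N) \<partial>measure_pmf M)"
    unfolding pair_pmf_def
    by (subst pmf_integral_bind[where b = 1], simp split: split_indicator,
        subst pmf_integral_bind[where b = 1]) (auto split: split_indicator)
  also have "\<dots> = (\<integral>x. indicator A x * measure_pmf.prob N B \<partial>measure_pmf M)" by simp
  also have "\<dots> = measure_pmf.prob M A * measure_pmf.prob N B" by simp
  finally show ?thesis .
qed

text \<open>
  The differences of elements of \<open>S \<union> {0}\<close> form a subgroup of the integers, generated by its least
  positive element, which divides every element of \<open>S\<close> and so is \<open>1\<close>. Hence \<open>S \<union> {0}\<close> contains two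
  consecutive numbers \<open>b\<close> and \<open>b + 1\<close>, and their combinations fill a half-line.
\<close>

lemma additive_set_cofinite:
  fixes S :: "nat set"
  assumes add: "\<And>i j. i \<in> S \<Longrightarrow> j \<in> S \<Longrightarrow> i + j \<in> S" and gcd: "Gcd S = 1" and pos: "0 \<notin> S"
  shows "\<exists>N. \<forall>n\<ge>N. n \<in> S"
proof -
  have S0: "insert 0 S \<noteq> {}" by simp
  define D where "D = {i - j |i j :: int. i \<in> int ` insert 0 S \<and> j \<in> int ` insert 0 S}"
  have DI: "i - j \<in> D" if "i \<in> int ` insert 0 S" "j \<in> int ` insert 0 S" for i j
    unfolding D_def using that by blast
  have addS: "i + j \<in> int ` insert 0 S" if "i \<in> int ` insert 0 S" "j \<in> int ` insert 0 S" for i j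
  proof -
    from that obtain a b where "i = int a" "j = int b" "a \<in> insert 0 S" "b \<in> insert 0 S" by blast
    then have "i + j = int (a + b)" "a + b \<in> insert 0 S" using add by auto
    then show ?thesis by blast
  qed
  have Dadd: "a + b \<in> D" if "a \<in> D" "b \<in> D" for a b
  proof -
    from that(1) obtain i j where 1: "a = i - j" "i \<in> int ` insert 0 S" "j \<in> int ` insert 0 S"
      unfolding D_def by blast
    from that(2) obtain k l where 2: "b = k - l" "k \<in> int ` insert 0 S" "l \<in> int ` insert 0 S"
      unfolding D_def by blast
    note * = 1 2
    then have "a + b = (i + k) - (j + l)" by simp
    with DI[OF addS[OF 1(2) 2(2)] addS[OF 1(3) 2(3)]] show ?thesis by simp
  qed
  have Dneg: "- a \<in> D" if "a \<in> D" for a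
  proof -
    from that obtain i j where "a = i - j" "i \<in> int ` insert 0 S" "j \<in> int ` insert 0 S"
      unfolding D_def by blast
    with DI[of j i] show ?thesis by simp
  qed
  have D0: "0 \<in> D" using DI[of 0 0] by simp
  have Dmult: "int n * a \<in> D" if "a \<in> D" for n a
    by (induction n) (use that D0 Dadd in \<open>auto simp: algebra_simps\<close>)
  have SD: "int i \<in> D" if "i \<in> S" for i
  proof -
    have "int i \<in> int ` insert 0 S" "(0::int) \<in> int ` insert 0 S" using that by auto
    with DI[of "int i" 0] show ?thesis by simp
  qed
  have Sne: "S \<noteq> {}" using gcd by auto
  then obtain i0 where i0: "i0 \<in> S" by auto
  then have "int i0 \<in> D \<and> int i0 > 0" using SD pos by (metis gr0I of_nat_0_less_iff)
  then have ex: "\<exists>g. int g \<in> D \<and> g > 0" by auto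
  define g where "g = (LEAST g. int g \<in> D \<and> g > 0)"
  have g: "int g \<in> D" "g > 0" unfolding g_def using LeastI_ex[OF ex] by auto
  have gmin: "g \<le> k" if "int k \<in> D" "k > 0" for k
    unfolding g_def using that by (intro Least_le) auto
  have "g dvd i" if "i \<in> S" for i
  proof (rule ccontr)
    assume "\<not> g dvd i"
    then have m: "i mod g > 0" by (simp add: dvd_eq_mod_eq_0)
    have "int (i mod g) = int i + (- (int (i div g) * int g))"
      by (simp add: zmod_int zdiv_int minus_mult_div_eq_mod[symmetric] mult.commute)
    then have "int (i mod g) \<in> D" using Dadd[OF SD[OF that] Dneg[OF Dmult[OF g(1)]]] by simp
    then have "g \<le> i mod g" using gmin m by blast
    with mod_less_divisor[OF g(2), of i] show False by simp
  qed
  then have "g dvd Gcd S" by (rule Gcd_greatest)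
  then have "g = 1" using gcd by simp
  with g(1) have "1 \<in> D" by simp
  then obtain i j where ij: "1 = i - j" "i \<in> int ` insert 0 S" "j \<in> int ` insert 0 S"
    unfolding D_def by blast
  then obtain a b where "i = int a" "j = int b" "a \<in> insert 0 S" "b \<in> insert 0 S" by blast
  with ij have ab: "a \<in> insert 0 S" "b \<in> insert 0 S" "int a - int b = 1" by auto
  then have a: "a = b + 1" "a \<in> S" by auto
  have mS: "n * x \<in> S" if "x \<in> S" "n > 0" for n x
    using that(2) by (induction n rule: nat_induct_non_zero) (use that(1) add in auto)
  show ?thesis
  proof (cases "b = 0")
    case True
    then have "n \<in> S" if "n \<ge> 1" for n using mS[of 1 n] a that by simp
    then show ?thesis by blast
  next
    case False
    then have b: "b \<in> S" "b > 0" using ab by auto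
    \<comment> \<open>write \<open>n = q b + t\<close> with \<open>t < b\<close>; then \<open>n = (q - t) b + t (b + 1)\<close>\<close>
    have "n \<in> S" if n: "n \<ge> b * b + b" for n
    proof -
      define q t where "q = n div b" and "t = n mod b"
      have t: "t < b" "n = q * b + t" using b by (auto simp: q_def t_def)
      have "q \<ge> b"
      proof (rule ccontr)
        assume "\<not> b \<le> q"
        then have "q * b \<le> b * b" by simp
        then show False using n t by linarith
      qed
      then have qt: "q - t > 0" "q \<ge> t" using t by auto
      have "n = (q - t) * b + t * a" using t qt a
        by (simp add: algebra_simps diff_mult_distrib)
      moreover have "(q - t) * b \<in> S" using mS b qt by auto
      moreover have "t = 0 \<or> t * a \<in> S" using mS[of a t] a by auto
      ultimately show ?thesis using add by (metis add.right_neutral mult_zero_left)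
    qed
    then show ?thesis by blast
  qed
qed

lemma one_minus_exp_le: "1 - exp (- x) \<le> (x::real)"
  using exp_ge_add_one_self[of "-x"] by simp

text \<open>
  Estimates on the tower are proved for integrals in \<open>[0, \<infinity>]\<close> of functions made nonnegative by
  adding a constant; this brings them back to differences of real integrals.
\<close>

lemma ennreal_abs_diff_le:
  fixes u v :: real
  assumes "0 \<le> u" "0 \<le> v" "ennreal u \<le> ennreal v + L" "ennreal v \<le> ennreal u + L"
  shows "ennreal \<bar>u - v\<bar> \<le> L"
proof (cases L)
  case (real l)
  then have "u \<le> v + l" "v \<le> u + l" using assms by (simp_all add: ennreal_plus[symmetric] del: ennreal_plus)
  then show ?thesis using real by (auto intro: ennreal_leI)
qed simp

lemma suminf_finite_tendsto_0:
  fixes E :: "nat \<Rightarrow> ennreal"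
  assumes "(\<Sum>k. E k) \<noteq> \<infinity>"
  shows "E \<longlonglongrightarrow> 0"
proof -
  have fin: "E k \<noteq> \<infinity>" for k
    using assms sum_le_suminf[of E "{k}"] by (auto simp: top_unique)
  have E: "E = (\<lambda>k. ennreal (enn2real (E k)))" using fin by (simp add: less_top)
  then have "(\<Sum>k. ennreal (enn2real (E k))) \<noteq> \<infinity>" using assms by simp
  then have "summable (\<lambda>k. enn2real (E k))" by (intro summable_suminf_not_top) auto
  then have "(\<lambda>k. enn2real (E k)) \<longlonglongrightarrow> 0" by (rule summable_LIMSEQ_zero)
  then have "(\<lambda>k. ennreal (enn2real (E k))) \<longlonglongrightarrow> ennreal 0" by (rule tendsto_ennrealI)
  then show ?thesis using E by simp
qed

section \<open>The backward chain and its renewal probabilities\<close>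

text \<open>
  The backward chain stripped of the dynamics: \<open>p y\<close> is the law of the branch taken from the base
  point \<open>y\<close>, \<open>s a y\<close> the preimage of \<open>y\<close> along the branch \<open>a\<close>, and \<open>r a\<close> its return time. The
  metric data are reduced to a contracting function \<open>d\<close> that controls the ratios of transition
  probabilities. All hypotheses are restricted to a forward invariant set \<open>G\<close>, because for the
  dynamics they only hold almost everywhere.
\<close>

locale branch_chain =
  fixes G :: "'a set" and p :: "'a \<Rightarrow> 'b pmf" and s :: "'b \<Rightarrow> 'a \<Rightarrow> 'a" and r :: "'b \<Rightarrow> nat"
    and d :: "'a \<Rightarrow> 'a \<Rightarrow> real" and D C L :: real and T :: "nat \<Rightarrow> real"
  assumes G_ne: "G \<noteq> {}"
    and s_in: "\<And>y a. y \<in> G \<Longrightarrow> s a y \<in> G"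
    and r_ge: "\<And>a. 1 \<le> r a"
    and d_nonneg: "\<And>y y'. y \<in> G \<Longrightarrow> y' \<in> G \<Longrightarrow> 0 \<le> d y y'"
    and d_le: "\<And>y y'. y \<in> G \<Longrightarrow> y' \<in> G \<Longrightarrow> d y y' \<le> D"
    and d_sym: "\<And>y y'. d y y' = d y' y"
    and L_gt: "1 < L" and C_pos: "0 < C"
    and contr: "\<And>y y' a. y \<in> G \<Longrightarrow> y' \<in> G \<Longrightarrow> d (s a y) (s a y') \<le> d y y' / L"
    and ratio: "\<And>y y' a. y \<in> G \<Longrightarrow> y' \<in> G \<Longrightarrow> pmf (p y) a \<le> exp (C * d y y') * pmf (p y') a"
    and p_pos: "\<And>y a. y \<in> G \<Longrightarrow> 0 < pmf (p y) a"
    and r_gcd: "Gcd (range r) = 1"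
    and tail: "\<And>y n. y \<in> G \<Longrightarrow> measure_pmf.prob (p y) {a. n < r a} \<le> T n"
    and T_summable: "summable T"
begin

lemma D_nonneg: "0 \<le> D"
  using G_ne d_nonneg d_le by (metis ex_in_conv order_trans)

lemma T_nonneg: "0 \<le> T n"
  using G_ne tail measure_nonneg by (metis ex_in_conv order_trans)

text \<open>
  A jump along \<open>a\<close> lands at level \<open>r a - 1\<close>: the point \<open>f (f\<^sup>r\<^sup>-\<^sup>1 (s a y))\<close> is \<open>y\<close>.
\<close>

fun step :: "'a \<times> nat \<Rightarrow> ('a \<times> nat) pmf" where
  "step (y, 0) = map_pmf (\<lambda>a. (s a y, r a - 1)) (p y)"
| "step (y, Suc k) = return_pmf (y, k)"

primrec iter :: "nat \<Rightarrow> 'a \<times> nat \<Rightarrow> ('a \<times> nat) pmf" where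
  "iter 0 z = return_pmf z"
| "iter (Suc k) z = bind_pmf (step z) (iter k)"

lemma iter_add: "iter (j + k) z = bind_pmf (iter j z) (iter k)"
  by (induction j arbitrary: z) (simp_all add: bind_return_pmf bind_assoc_pmf cong: bind_pmf_cong)

lemma iter_flight: "k \<le> l \<Longrightarrow> iter k (y, l) = return_pmf (y, l - k)"
proof (induction k arbitrary: l)
  case (Suc k)
  then obtain l' where "l = Suc l'" by (cases l) auto
  with Suc show ?case by (auto simp: bind_return_pmf)
qed simp

lemma iter_flight_add: "iter (l + k) (y, l) = iter k (y, 0)"
  by (simp add: iter_add iter_flight bind_return_pmf)

lemma iter_base:
  assumes "0 < k"
  shows "iter k (y, 0) = bind_pmf (p y) (\<lambda>a. if r a \<le> k then iter (k - r a) (s a y, 0)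
           else return_pmf (s a y, r a - k))"
proof -
  have "iter (k - 1) (s a y, r a - 1)
      = (if r a \<le> k then iter (k - r a) (s a y, 0) else return_pmf (s a y, r a - k))" for a
  proof (cases "r a \<le> k")
    case True
    then have "k - 1 = (r a - 1) + (k - r a)" using r_ge[of a] by simp
    with True show ?thesis using iter_flight_add[of "r a - 1" "k - r a"] by simp
  next
    case False
    then show ?thesis using assms iter_flight[of "k - 1" "r a - 1"] r_ge[of a] by simp
  qed
  moreover have "iter k (y, 0) = bind_pmf (p y) (\<lambda>a. iter (k - 1) (s a y, r a - 1))"
    using assms by (cases k) (auto simp: bind_map_pmf)
  ultimately show ?thesis by simp
qed

lemma step_closed: "w \<in> set_pmf (step z) \<Longrightarrow> fst z \<in> G \<Longrightarrow> fst w \<in> G"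
  by (cases z rule: step.cases) (auto intro: s_in)

lemma iter_closed: "w \<in> set_pmf (iter k z) \<Longrightarrow> fst z \<in> G \<Longrightarrow> fst w \<in> G"
  by (induction k arbitrary: z) (auto dest: step_closed)

definition ren :: "nat \<Rightarrow> 'a \<Rightarrow> real" where
  "ren k y = measure_pmf.prob (iter k (y, 0)) {z. snd z = 0}"

lemma ren_nonneg: "0 \<le> ren k y" and ren_le_1: "ren k y \<le> 1"
  by (auto simp: ren_def)

lemma ren_0: "ren 0 y = 1"
  by (simp add: ren_def)

lemma ren_rec:
  assumes "0 < k"
  shows "ren k y = (\<integral>a. (if r a \<le> k then ren (k - r a) (s a y) else 0) \<partial>measure_pmf (p y))"
  unfolding ren_def iter_base[OF assms] pmf_prob_bind
  by (intro pmf_integral_cong) auto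

lemma pmf_integral_ratio:
  fixes f g :: "'b \<Rightarrow> real"
  assumes "y \<in> G" "y' \<in> G" "\<And>a. 0 \<le> f a" "\<And>a. f a \<le> b" "\<And>a. 0 \<le> g a" "\<And>a. g a \<le> b'" "\<And>a. f a \<le> c * g a" "0 \<le> c"
  shows "(\<integral>a. f a \<partial>measure_pmf (p y)) \<le> exp (C * d y y') * c * (\<integral>a. g a \<partial>measure_pmf (p y'))"
proof -
  have int: "integrable (measure_pmf (p y)) f" "integrable (measure_pmf (p y')) g"
    using pmf_integrable_bdd[of "p y" f b] pmf_integrable_bdd[of "p y'" g b'] assms by auto
  have "ennreal (\<integral>a. f a \<partial>measure_pmf (p y)) = (\<integral>\<^sup>+a. f a \<partial>measure_pmf (p y))"
    using int assms by (intro nn_integral_eq_integral[symmetric]) auto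
  also have "\<dots> = (\<integral>\<^sup>+a. pmf (p y) a * f a \<partial>count_space UNIV)"
    using assms by (auto simp: nn_integral_measure_pmf ennreal_mult intro!: nn_integral_cong)
  also have "\<dots> \<le> (\<integral>\<^sup>+a. ennreal (exp (C * d y y') * c) * (pmf (p y') a * g a) \<partial>count_space UNIV)"
  proof (rule nn_integral_mono)
    fix a
    have "pmf (p y) a * f a \<le> (exp (C * d y y') * pmf (p y') a) * (c * g a)"
      using assms ratio[of y y' a] by (intro mult_mono) auto
    then show "ennreal (pmf (p y) a * f a) \<le> ennreal (exp (C * d y y') * c) * ennreal (pmf (p y') a * g a)"
      using assms by (subst ennreal_mult[symmetric]) (auto intro!: ennreal_leI simp: mult_ac)
  qed
  also have "\<dots> = ennreal (exp (C * d y y') * c) * (\<integral>\<^sup>+a. pmf (p y') a * g a \<partial>count_space UNIV)"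
    by (rule nn_integral_cmult) auto
  also have "(\<integral>\<^sup>+a. pmf (p y') a * g a \<partial>count_space UNIV) = (\<integral>\<^sup>+a. g a \<partial>measure_pmf (p y'))"
    using assms by (auto simp: nn_integral_measure_pmf ennreal_mult intro!: nn_integral_cong)
  also have "\<dots> = ennreal (\<integral>a. g a \<partial>measure_pmf (p y'))"
    using int assms by (intro nn_integral_eq_integral) auto
  finally show ?thesis
    using assms by (subst (asm) ennreal_mult[symmetric]) (auto simp: integral_nonneg_AE)
qed

text \<open>
  The sum of the geometric series \<open>C + C/L + C/L\<^sup>2 + \<dots>\<close>: the distortion accumulated along a whole
  backward orbit whose distances contract by \<open>L\<close>. It is characterised by \<open>C + C'/L = C'\<close>.
\<close>

definition C' :: real where "C' = C * L / (L - 1)"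

lemma C'_pos: "0 < C'" and C'_eq: "C + C' / L = C'"
  using L_gt C_pos by (auto simp: C'_def field_simps)

text \<open>
  Induction on \<open>k\<close> along the recursion \<open>ren_rec\<close>: one transition costs the factor \<open>exp(C d)\<close>, and
  the induction hypothesis at the contracted points costs \<open>exp(C' d/L)\<close>. The product is
  \<open>exp(C' d)\<close>.
\<close>

lemma ren_ratio: "y \<in> G \<Longrightarrow> y' \<in> G \<Longrightarrow> ren k y \<le> exp (C' * d y y') * ren k y'"
proof (induction k arbitrary: y y' rule: less_induct)
  case (less k)
  show ?case
  proof (cases "k = 0")
    case True
    then show ?thesis using less.prems d_nonneg C'_pos by (simp add: ren_0)
  next
    case False
    have *: "(if r a \<le> k then ren (k - r a) (s a y) else 0)
       \<le> exp (C' * (d y y' / L)) * (if r a \<le> k then ren (k - r a) (s a y') else 0)" for a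
    proof -
      have "ren (k - r a) (s a y) \<le> exp (C' * d (s a y) (s a y')) * ren (k - r a) (s a y')"
        using False r_ge[of a] less.prems by (intro less.IH) (auto intro: s_in)
      also have "\<dots> \<le> exp (C' * (d y y' / L)) * ren (k - r a) (s a y')"
        using mult_left_mono[OF contr[OF less.prems, of a], of C'] C'_pos
        by (intro mult_right_mono) (auto simp: ren_nonneg)
      finally show ?thesis by auto
    qed
    have "ren k y \<le> exp (C * d y y') * exp (C' * (d y y' / L)) * ren k y'"
      unfolding ren_rec[OF False[unfolded neq0_conv]] using * less.prems
      by (intro pmf_integral_ratio[where b = 1 and b' = 1]) (auto simp: ren_nonneg ren_le_1)
    also have "exp (C * d y y') * exp (C' * (d y y' / L)) = exp (C' * d y y')"
      by (subst exp_add[symmetric]) (metis C'_eq distrib_right times_divide_eq_left times_divide_eq_right)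
    finally show ?thesis .
  qed
qed

definition Cr :: real where "Cr = exp (C' * D)"

lemma Cr_ge: "1 \<le> Cr" unfolding Cr_def using C'_pos D_nonneg by auto

lemma ren_ratio': "y \<in> G \<Longrightarrow> y' \<in> G \<Longrightarrow> ren k y \<le> Cr * ren k y'"
  using ren_ratio[of y y' k] d_le[of y y'] C'_pos unfolding Cr_def
  by (smt (verit) exp_le_cancel_iff mult_left_mono mult_right_mono ren_nonneg)

text \<open>
  Decompose according to the last visit to the base up to time \<open>k\<close>: if it happens at time \<open>i\<close>, the
  next jump is longer than \<open>k - i\<close>, which has probability at most \<open>T (k - i)\<close>; the term \<open>i = 0\<close> is
  \<open>T k\<close>. The proof replaces this decomposition by induction on the first jump.
\<close>

lemma renewal_ge: "y \<in> G \<Longrightarrow> 1 \<le> T k + (\<Sum>i\<in>{1..k}. T (k - i) * ren i y)"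
proof (induction k arbitrary: y rule: less_induct)
  case (less k)
  let ?f = "\<lambda>i a. if r a \<le> i then ren (i - r a) (s a y) else 0"
  have bdd: "\<bar>?f i a\<bar> \<le> 1" for i a by (auto simp: ren_nonneg ren_le_1)
  have int: "integrable (measure_pmf (p y)) (?f i)" for i by (rule pmf_integrable_bdd[OF bdd])
  have pt: "indicator {a. r a \<le> k} a \<le> (\<Sum>i\<in>{1..k}. T (k - i) * ?f i a)"  for a
  proof (cases "r a \<le> k")
    case True
    have T0: "1 \<le> T 0"
    proof -
      obtain y where "y \<in> G" using G_ne by auto
      moreover have "{a. 0 < r a} = UNIV" using r_ge by (auto simp: Suc_le_eq)
      ultimately show ?thesis using tail[of y 0] by simp
    qed
    have 1: "1 \<le> T (k - r a) + (\<Sum>i\<in>{1..k - r a}. T (k - r a - i) * ren i (s a y))"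
      using less.prems r_ge[of a] True by (intro less.IH) (auto intro: s_in)
    have "(\<Sum>i\<in>{1..k - r a}. T (k - r a - i) * ren i (s a y)) + T (k - r a)
        = (\<Sum>i\<in>{0..k - r a}. T (k - r a - i) * ren i (s a y))"
      by (simp add: sum.atLeast_Suc_atMost ren_0)
    also have "\<dots> = (\<Sum>i\<in>{r a..k}. T (k - i) * ?f i a)"
      by (rule sum.reindex_bij_witness[of _ "\<lambda>i. i - r a" "\<lambda>i. i + r a"])
        (use True in \<open>auto simp: add.commute\<close>)
    also have "\<dots> \<le> (\<Sum>i\<in>{1..k}. T (k - i) * ?f i a)"
      using r_ge[of a] by (intro sum_mono2) (auto simp: T_nonneg ren_nonneg)
    finally show ?thesis using 1 True by simp
  next
    case False
    then show ?thesis by (auto intro!: sum_nonneg simp: T_nonneg ren_nonneg)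
  qed
  have "1 = measure_pmf.prob (p y) ({a. k < r a} \<union> {a. r a \<le> k})"
  proof -
    have "{a. k < r a} \<union> {a. r a \<le> k} = UNIV" by auto
    then show ?thesis by simp
  qed
  also have "\<dots> = measure_pmf.prob (p y) {a. k < r a} + measure_pmf.prob (p y) {a. r a \<le> k}"
    by (intro measure_pmf.finite_measure_Union) auto
  also have "measure_pmf.prob (p y) {a. r a \<le> k} = (\<integral>a. indicator {a. r a \<le> k} a \<partial>measure_pmf (p y))"
    by simp
  also have "\<dots> \<le> (\<integral>a. (\<Sum>i\<in>{1..k}. T (k - i) * ?f i a) \<partial>measure_pmf (p y))"
    by (rule integral_mono[OF pmf_integrable_bdd[where b = 1]]) (use int pt in auto)
  also have "\<dots> = (\<Sum>i\<in>{1..k}. T (k - i) * (\<integral>a. ?f i a \<partial>measure_pmf (p y)))"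
    using int by simp
  also have "\<dots> = (\<Sum>i\<in>{1..k}. T (k - i) * ren i y)"
    by (intro sum.cong) (auto simp: ren_rec)
  finally show ?case using tail[OF less.prems, of k] by simp
qed

lemma ren_add:
  assumes "y \<in> G" "0 \<le> c" "\<And>y. y \<in> G \<Longrightarrow> c \<le> ren j y"
  shows "ren i y * c \<le> ren (i + j) y"
proof -
  let ?A = "{z. snd z = (0::nat)}"
  have "c * indicator ?A w \<le> measure_pmf.prob (iter j w) ?A" if "w \<in> set_pmf (iter i (y, 0))" for w
  proof (cases "snd w = 0")
    case True
    then have "w = (fst w, 0)" by (cases w) auto
    with iter_closed[OF that] assms(1) assms(3)[of "fst w"] show ?thesis
      using True by (simp add: ren_def)
  qed simp
  then have "(\<integral>w. c * indicator ?A w \<partial>measure_pmf (iter i (y, 0)))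
      \<le> (\<integral>w. measure_pmf.prob (iter j w) ?A \<partial>measure_pmf (iter i (y, 0)))"
    using assms(2) by (intro pmf_integral_mono[where b = c and b' = 1]) (auto split: split_indicator)
  then show ?thesis by (simp add: ren_def iter_add pmf_prob_bind mult.commute)
qed

text \<open>
  A quantitative renewal theorem. The times at which the base is visited with positive probability
  form an additive set containing all return times, so they contain a half-line. By summability of
  \<open>T\<close>, the renewal inequality \<open>renewal_ge\<close> forces some \<open>ren i\<close> with \<open>i\<close> in each window of bounded
  length to exceed a fixed constant; the visits in the half-line then fill the gap from \<open>i\<close> to
  \<open>k\<close>. Distortion makes the bound uniform in the starting point.
\<close>

lemma renewal_lower_bound:
  obtains c t0 where "0 < c" "c \<le> 1" "\<And>k y. t0 \<le> k \<Longrightarrow> y \<in> G \<Longrightarrow> c \<le> ren k y"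
proof -
  obtain y0 where y0: "y0 \<in> G" using G_ne by auto
  have Crp: "0 < Cr" using Cr_ge by simp
  define S where "S = {k. 0 < k \<and> 0 < ren k y0}"
  have low: "ren k y0 / Cr \<le> ren k y" if "y \<in> G" for k y
    using ren_ratio'[OF y0 that, of k] Crp by (simp add: field_simps)
  have r_S: "r a \<in> S" for a
  proof -
    have "0 < pmf (p y0) a" by (rule p_pos[OF y0])
    also have "\<dots> = (\<integral>b. indicator {a} b \<partial>measure_pmf (p y0))" by (simp add: measure_pmf_single)
    also have "\<dots> \<le> (\<integral>b. (if r b \<le> r a then ren (r a - r b) (s b y0) else 0) \<partial>measure_pmf (p y0))"
      by (intro pmf_integral_mono[where b = 1 and b' = 1])
        (auto simp: ren_nonneg ren_le_1 ren_0 split: split_indicator)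
    also have "\<dots> = ren (r a) y0" using r_ge[of a] by (intro ren_rec[symmetric]) simp
    finally show ?thesis using r_ge[of a] by (simp add: S_def Suc_le_eq)
  qed
  have "\<exists>N. \<forall>n\<ge>N. n \<in> S"
  proof (rule additive_set_cofinite)
    fix i j assume ij: "i \<in> S" "j \<in> S"
    have "0 < ren i y0 * (ren j y0 / Cr)" using ij Crp by (auto simp: S_def)
    also have "\<dots> \<le> ren (i + j) y0"
      using low by (intro ren_add[OF y0]) (auto simp: ren_nonneg Crp less_imp_le)
    finally show "i + j \<in> S" using ij by (auto simp: S_def)
  next
    have "Gcd S dvd Gcd (range r)" by (rule Gcd_greatest) (use r_S in auto)
    then show "Gcd S = 1" using r_gcd by simp
  qed (simp add: S_def)
  then obtain N where N: "\<And>n. n \<ge> N \<Longrightarrow> n \<in> S" by auto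
  obtain M where M: "(\<Sum>n. T (n + M)) < 1/2"
  proof -
    have "(\<lambda>M. \<Sum>n. T (n + M)) \<longlonglongrightarrow> 0" by (rule suminf_exist_split2[OF T_summable])
    then have "eventually (\<lambda>M. (\<Sum>n. T (n + M)) < 1/2) sequentially"
      by (rule order_tendstoD) simp
    then show ?thesis using that by (auto simp: eventually_sequentially)
  qed
  define B where "B = 1 + (\<Sum>j<M. T j)"
  have B: "B > 0" "\<And>j. j < M \<Longrightarrow> T j \<le> B"
    using member_le_sum[of _ "{..<M}" T] by (auto simp: B_def T_nonneg sum_nonneg add_pos_nonneg intro: order_trans[OF member_le_sum[of _ "{..<M}" T]])
  \<comment> \<open>otherwise all terms of the renewal inequality with \<open>j < M\<close> add up to at most \<open>1/2\<close>, and the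
    others are bounded by the tail of \<open>T\<close> beyond \<open>M\<close>\<close>
  have window: "\<exists>i\<in>{k-M..k}. 1 / (2 * B * (M + 1)) \<le> ren i y0" for k
  proof (rule ccontr)
    assume "\<not> ?thesis"
    then have neg: "ren i y0 < 1 / (2 * B * (M + 1))" if "i \<in> {k-M..k}" for i
      using that by (auto simp: not_le)
    have Bp: "1 / (2 * B * (M + 1)) > 0" using B by simp
    have "1 \<le> T k + (\<Sum>i\<in>{1..k}. T (k - i) * ren i y0)" by (rule renewal_ge[OF y0])
    also have "\<dots> = (\<Sum>i\<in>{0..k}. T (k - i) * ren i y0)" by (simp add: sum.atLeast_Suc_atMost ren_0)
    also have "\<dots> = (\<Sum>j\<in>{0..k}. T j * ren (k - j) y0)"
      by (rule sum.reindex_bij_witness[of _ "\<lambda>i. k - i" "\<lambda>i. k - i"]) auto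
    also have "\<dots> \<le> (\<Sum>j\<in>{0..k}. (if j < M then 1 / (2 * (M + 1)) else T j))"
    proof (rule sum_mono)
      fix j assume j: "j \<in> {0..k}"
      show "T j * ren (k - j) y0 \<le> (if j < M then 1 / (2 * (M + 1)) else T j)"
      proof (cases "j < M")
        case True
        then have "T j * ren (k - j) y0 \<le> B * (1 / (2 * B * (M + 1)))"
          using B neg[of "k - j"] j diff_le_mono2[of j M k] True
          by (intro mult_mono) (auto simp: ren_nonneg T_nonneg less_imp_le)
        also have "\<dots> = 1 / (2 * (M + 1))" using B by simp
        finally show ?thesis using True by simp
      next
        case False
        then show ?thesis using ren_le_1[of "k-j" y0] T_nonneg[of j] by (simp add: mult_left_le)
      qed
    qed
    also have "\<dots> = (\<Sum>j\<in>{0..k} \<inter> {j. j < M}. 1 / (2 * (M + 1))) + (\<Sum>j\<in>{0..k} \<inter> - {j. j < M}. T j)"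
      by (subst sum.If_cases) auto
    also have "(\<Sum>j\<in>{0..k} \<inter> {j. j < M}. 1 / (2 * (M + 1))) \<le> 1/2"
    proof -
      have "card ({0..k} \<inter> {j. j < M}) \<le> M" using card_mono[of "{..<M}" "{0..k} \<inter> {j. j < M}"] by auto
      then show ?thesis by (simp add: field_simps)
    qed
    also have "(\<Sum>j\<in>{0..k} \<inter> - {j. j < M}. T j) \<le> (\<Sum>n. T (n + M))"
    proof -
      have "(\<Sum>j\<in>{0..k} \<inter> - {j. j < M}. T j) \<le> (\<Sum>n<k+1. T (n + M))"
      proof -
        have "(\<Sum>n<k+1. T (n + M)) = (\<Sum>j\<in>{M..<M+k+1}. T j)"
          by (rule sum.reindex_bij_witness[of _ "\<lambda>j. j - M" "\<lambda>n. n + M"]) auto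
        moreover have "(\<Sum>j\<in>{0..k} \<inter> - {j. j < M}. T j) \<le> (\<Sum>j\<in>{M..<M+k+1}. T j)"
          by (intro sum_mono2) (auto simp: T_nonneg)
        ultimately show ?thesis by linarith
      qed
      also have "\<dots> \<le> (\<Sum>n. T (n + M))"
        using T_summable by (intro sum_le_suminf) (auto simp: T_nonneg summable_iff_shift)
      finally show ?thesis .
    qed
    finally show False using M by simp
  qed
  define e where "e = Min ((\<lambda>k. ren k y0) ` {N..N + M})"
  have e: "e > 0" "\<And>k. k \<in> {N..N+M} \<Longrightarrow> e \<le> ren k y0"
    using N by (auto simp: e_def S_def)
  define c where "c = 1 / (2 * B * (M + 1)) * (e / Cr) / Cr"
  have c: "c > 0" using B e Crp by (auto simp: c_def)
  have main: "c \<le> ren k y" if k: "N + M \<le> k" and y: "y \<in> G" for k y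
  proof -
    \<comment> \<open>choose \<open>i\<close> so that the remaining time \<open>k - i\<close> lies in \<open>{N..N + M}\<close>\<close>
    obtain i where i: "i \<in> {k-N-M..k-N}" "1 / (2 * B * (M + 1)) \<le> ren i y0" using window[of "k - N"] by auto
    have j: "k - i \<in> {N..N+M}" "i \<le> k" using i(1) k by auto
    have "ren i y0 * (e / Cr) \<le> ren (i + (k - i)) y0"
    proof (rule ren_add[OF y0])
      fix y assume "y \<in> G"
      have "e / Cr \<le> ren (k - i) y0 / Cr" using e(2)[OF j(1)] Crp by (simp add: divide_right_mono)
      also have "\<dots> \<le> ren (k - i) y" by (rule low[OF \<open>y \<in> G\<close>])
      finally show "e / Cr \<le> ren (k - i) y" .
    qed (use e Crp in auto)
    then have "ren i y0 * (e / Cr) / Cr \<le> ren k y0 / Cr"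
      using j Crp divide_right_mono[of "ren i y0 * (e / Cr)" "ren k y0" Cr] by simp
    also have "\<dots> \<le> ren k y" by (rule low[OF y])
    finally have "ren i y0 * (e / Cr) / Cr \<le> ren k y" .
    moreover have "c \<le> ren i y0 * (e / Cr) / Cr"
      unfolding c_def using i(2) e Crp by (intro divide_right_mono mult_right_mono) auto
    ultimately show ?thesis by simp
  qed
  have "c \<le> 1" using main[OF order_refl y0] ren_le_1 order_trans by blast
  with c main that show ?thesis by blast
qed

definition Q :: "nat \<Rightarrow> real" where "Q n = (\<Sum>i. T (i + n))"

lemma T_summable': "summable (\<lambda>i. T (i + n))"
  using T_summable by (simp add: summable_iff_shift)

lemma Q_nonneg: "0 \<le> Q n"
  unfolding Q_def by (intro suminf_nonneg T_summable') (simp add: T_nonneg)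

lemma T_le_Q: "T n \<le> Q n"
  unfolding Q_def using sum_le_suminf[OF T_summable'[of n], of "{0}"] by (auto simp: T_nonneg)

text \<open>
  If the chain is above level \<open>j\<close> at time \<open>k\<close>, the last jump, made \<open>i\<close> steps before with
  \<open>1 \<le> i \<le> k\<close>, was longer than \<open>i + j\<close>.
\<close>

lemma level_tail_sum: "y \<in> G \<Longrightarrow> measure_pmf.prob (iter k (y, 0)) {z. j < snd z} \<le> (\<Sum>i\<in>{1..k}. T (i + j))"
proof (induction k arbitrary: y rule: less_induct)
  case (less k)
  show ?case
  proof (cases "k = 0")
    case False
    let ?P = "\<lambda>k y. measure_pmf.prob (iter k (y, 0)) {z. j < snd z}"
    have "?P k y = (\<integral>a. measure_pmf.prob (if r a \<le> k then iter (k - r a) (s a y, 0)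
           else return_pmf (s a y, r a - k)) {z. j < snd z} \<partial>measure_pmf (p y))"
      using False by (simp add: iter_base pmf_prob_bind)
    also have "\<dots> \<le> (\<integral>a. indicator {a. k + j < r a} a + (\<Sum>i\<in>{1..k-1}. T (i + j)) \<partial>measure_pmf (p y))"
    proof (rule pmf_integral_mono[where b = 1 and b' = "1 + (\<Sum>i\<in>{1..k-1}. T (i + j))"])
      fix a
      show "measure_pmf.prob (if r a \<le> k then iter (k - r a) (s a y, 0)
           else return_pmf (s a y, r a - k)) {z. j < snd z}
         \<le> indicator {a. k + j < r a} a + (\<Sum>i\<in>{1..k-1}. T (i + j))"
      proof (cases "r a \<le> k")
        case True
        have "?P (k - r a) (s a y) \<le> (\<Sum>i\<in>{1..k - r a}. T (i + j))"
          using False r_ge[of a] less.prems by (intro less.IH) (auto intro: s_in)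
        also have "\<dots> \<le> (\<Sum>i\<in>{1..k-1}. T (i + j))"
          using r_ge[of a] by (intro sum_mono2) (auto simp: T_nonneg)
        finally show ?thesis using True by simp
      next
        case False
        have "0 \<le> (\<Sum>i\<in>{1..k-1}. T (i + j))" by (simp add: sum_nonneg T_nonneg)
        then show ?thesis using False by (auto split: split_indicator)
      qed
    qed (auto simp: sum_nonneg T_nonneg split: split_indicator)
    also have "\<dots> = measure_pmf.prob (p y) {a. k + j < r a} + (\<Sum>i\<in>{1..k-1}. T (i + j))"
      by (subst Bochner_Integration.integral_add) (auto intro!: pmf_integrable_bdd[where b = 1] split: split_indicator)
    also have "\<dots> \<le> T (k + j) + (\<Sum>i\<in>{1..k-1}. T (i + j))"
      using tail[OF less.prems] by simp
    also have "\<dots> = (\<Sum>i\<in>{1..k}. T (i + j))"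
      using False by (cases k) auto
    finally show ?thesis .
  qed simp
qed

lemma level_tail: 
  assumes "y \<in> G"
  shows "measure_pmf.prob (iter k (y, 0)) {z. j < snd z} \<le> Q j"
proof -
  have "(\<Sum>i\<in>{1..k}. T (i + j)) \<le> Q j"
    unfolding Q_def by (intro sum_le_suminf T_summable') (auto simp: T_nonneg)
  with level_tail_sum[OF assms, of k j] show ?thesis by simp
qed

text \<open>
  Since \<open>p y \<ge> e p y'\<close> pointwise, \<open>p y\<close> is the mixture of \<open>p y'\<close> with weight \<open>e\<close> and of a residual
  law. The reverse inequality \<open>p y' \<ge> e p y\<close> bounds the residual law by \<open>(1 + e) p y \<le> 2 p y\<close>, so
  it inherits the tail of return times. At distance \<open>0\<close> the two laws agree and the residual law is
  arbitrary.
\<close>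

lemma minorization_splitting:
  assumes y: "y \<in> G" "y' \<in> G"
  defines "e \<equiv> exp (- (C * d y y'))"
  obtains \<rho> where "bind_pmf (bernoulli_pmf e) (\<lambda>b. if b then p y' else \<rho>) = p y"
    and "\<And>n. measure_pmf.prob \<rho> {a. n < r a} \<le> 2 * T n"
proof (cases "d y y' = 0")
  case True
  have "pmf (p y) a = pmf (p y') a" for a
    using ratio[OF y, of a] ratio[OF y(2,1), of a] True d_sym[of y y'] by simp
  then have "p y = p y'" by (rule pmf_eqI)
  moreover have "(\<lambda>b. if b then p y' else p y') = (\<lambda>b. p y')" by auto
  moreover have "measure_pmf.prob (p y') {a. n < r a} \<le> 2 * T n" for n
    using tail[OF y(2), of n] T_nonneg[of n] by simp
  ultimately show ?thesis using that[of "p y'"] by (simp add: bind_pmf_const)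
next
  case False
  then have e: "0 < e" "e < 1" using d_nonneg[OF y] C_pos by (auto simp: e_def)
  define f where "f a = (pmf (p y) a - e * pmf (p y') a) / (1 - e)" for a
  have ee: "e * exp (C * d y y') = 1" by (simp add: e_def mult_exp_exp)
  have le1: "e * pmf (p y') a \<le> pmf (p y) a" for a
  proof -
    have "e * pmf (p y') a \<le> e * (exp (C * d y y') * pmf (p y) a)"
      using ratio[OF y(2,1), of a] e d_sym[of y y'] by (intro mult_left_mono) auto
    then show ?thesis using ee by (simp add: mult.assoc[symmetric])
  qed
  have le2: "e * pmf (p y) a \<le> pmf (p y') a" for a
  proof -
    have "e * pmf (p y) a \<le> e * (exp (C * d y y') * pmf (p y') a)"
      using ratio[OF y, of a] e by (intro mult_left_mono) auto
    then show ?thesis using ee by (simp add: mult.assoc[symmetric])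
  qed
  have f0: "0 \<le> f a" for a using le1 e by (simp add: f_def)
  have f2: "f a \<le> 2 * pmf (p y) a" for a
  proof -
    have "pmf (p y) a - e * pmf (p y') a \<le> pmf (p y) a - e * (e * pmf (p y) a)"
      using mult_left_mono[OF le2[of a], of e] e by simp
    also have "\<dots> = (1 - e) * ((1 + e) * pmf (p y) a)" by (simp add: algebra_simps)
    also have "\<dots> \<le> (1 - e) * (2 * pmf (p y) a)" using e by (intro mult_left_mono mult_right_mono) auto
    finally show ?thesis using e by (simp add: f_def field_simps)
  qed
  have int: "integrable (count_space UNIV) (pmf q)" for q :: "'b pmf" by (rule integrable_pmf)
  have "(\<integral>\<^sup>+a. f a \<partial>count_space UNIV) = ennreal (\<integral>a. f a \<partial>count_space UNIV)"
    unfolding f_def by (intro nn_integral_eq_integral) (use int f0 in \<open>auto simp: f_def\<close>)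
  also have "(\<integral>a. f a \<partial>count_space UNIV) = 1"
    unfolding f_def using int e
    by (simp add: integral_pmf diff_divide_distrib[symmetric])
  finally have nn: "(\<integral>\<^sup>+a. f a \<partial>count_space UNIV) = 1" by simp
  define \<rho> where "\<rho> = embed_pmf f"
  have pmf_rho: "pmf \<rho> a = f a" for a unfolding \<rho>_def by (rule pmf_embed_pmf) (use f0 nn in auto)
  show ?thesis
  proof (rule that[of \<rho>])
    show "bind_pmf (bernoulli_pmf e) (\<lambda>b. if b then p y' else \<rho>) = p y"
    proof (rule pmf_eqI)
      fix a
      show "pmf (bind_pmf (bernoulli_pmf e) (\<lambda>b. if b then p y' else \<rho>)) a = pmf (p y) a"
        using e by (simp add: pmf_bind pmf_rho f_def)
    qed
    fix n
    have "ennreal (measure_pmf.prob \<rho> {a. n < r a}) = (\<integral>\<^sup>+a\<in>{a. n < r a}. ennreal (f a) \<partial>count_space UNIV)"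
      by (simp add: measure_pmf.emeasure_eq_measure[symmetric] nn_integral_pmf[symmetric] nn_integral_count_space_indicator pmf_rho)
    also have "\<dots> \<le> (\<integral>\<^sup>+a. ennreal 2 * (ennreal (pmf (p y) a) * indicator {a. n < r a} a) \<partial>count_space UNIV)"
    proof (rule nn_integral_mono)
      fix a
      have "ennreal (f a) \<le> ennreal 2 * ennreal (pmf (p y) a)"
        using f2[of a] by (subst ennreal_mult[symmetric]) (auto intro: ennreal_leI)
      then show "ennreal (f a) * indicator {a. n < r a} a
           \<le> ennreal 2 * (ennreal (pmf (p y) a) * indicator {a. n < r a} a)"
        by (auto split: split_indicator)
    qed
    also have "\<dots> = ennreal 2 * (\<integral>\<^sup>+a. ennreal (pmf (p y) a) * indicator {a. n < r a} a \<partial>count_space UNIV)"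
      by (rule nn_integral_cmult) auto
    also have "(\<integral>\<^sup>+a. ennreal (pmf (p y) a) * indicator {a. n < r a} a \<partial>count_space UNIV)
        = ennreal (measure_pmf.prob (p y) {a. n < r a})"
      by (simp add: measure_pmf.emeasure_eq_measure[symmetric] nn_integral_pmf[symmetric] nn_integral_count_space_indicator)
    also have "ennreal 2 * \<dots> \<le> ennreal (2 * T n)"
      using tail[OF y(1), of n] T_nonneg[of n] by (subst ennreal_mult[symmetric]) (auto intro!: ennreal_leI)
    finally show "measure_pmf.prob \<rho> {a. n < r a} \<le> 2 * T n" using T_nonneg[of n] by simp
  qed
qed

end

section \<open>Closeness of the observed laws\<close>

text \<open>
  The chain is now observed through a bounded function \<open>\<Phi>\<close> which is Lipschitz for \<open>d\<close> when two
  points lie at the same level of the same branch. The pair \<open>(s a y, k)\<close> is compared with the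
  distance of \<open>y\<close> and \<open>y'\<close>, not of their preimages: this is all that expansion at the return time
  gives for a Hoelder observable.
\<close>

locale observed_chain = branch_chain G p s r d D C L T
  for G :: "'a set" and p :: "'a \<Rightarrow> 'b pmf" and s r d D C L T +
  fixes \<Phi> :: "'a \<times> nat \<Rightarrow> real" and b C\<Phi> :: real
  assumes \<Phi>_bdd: "\<And>z. \<bar>\<Phi> z\<bar> \<le> b"
    and C\<Phi>_nonneg: "0 \<le> C\<Phi>"
    and \<Phi>_base: "\<And>y y'. y \<in> G \<Longrightarrow> y' \<in> G \<Longrightarrow> \<bar>\<Phi> (y, 0) - \<Phi> (y', 0)\<bar> \<le> C\<Phi> * d y y'"
    and \<Phi>_flight: "\<And>y y' a k. y \<in> G \<Longrightarrow> y' \<in> G \<Longrightarrow> k < r a \<Longrightarrow>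
           \<bar>\<Phi> (s a y, k) - \<Phi> (s a y', k)\<bar> \<le> C\<Phi> * d y y'"
begin

lemma b_nonneg: "0 \<le> b"
  using \<Phi>_bdd order_trans abs_ge_zero by blast

text \<open>
  The law of the values of \<open>\<Phi>\<close> along \<open>N\<close> backward steps. Coordinates beyond \<open>N\<close> repeat the last
  value, so that paths of all lengths share the type of sequences.
\<close>

primrec obs :: "nat \<Rightarrow> 'a \<times> nat \<Rightarrow> (nat \<Rightarrow> real) pmf" where
  "obs 0 z = return_pmf (\<lambda>_. \<Phi> z)"
| "obs (Suc N) z = bind_pmf (step z) (\<lambda>w. map_pmf (case_nat (\<Phi> z)) (obs N w))"

lemma obs_bdd: "\<omega> \<in> set_pmf (obs N z) \<Longrightarrow> \<bar>\<omega> j\<bar> \<le> b"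
  by (induction N arbitrary: z \<omega> j) (auto simp: \<Phi>_bdd split: nat.split)

definition lip :: "nat \<Rightarrow> (nat \<Rightarrow> real) \<Rightarrow> ((nat \<Rightarrow> real) \<Rightarrow> real) \<Rightarrow> bool" where
  "lip N c H \<longleftrightarrow> (\<forall>\<omega> \<omega>'. \<bar>H \<omega> - H \<omega>'\<bar> \<le> (\<Sum>j\<le>N. c j * \<bar>\<omega> j - \<omega>' j\<bar>))"

text \<open>
  A Wasserstein estimate for the observations from step \<open>n\<close> on, normalised by the total weight:
  \<open>H\<close> may depend on the coordinates \<open>n, \<dots>, N\<close> with Lipschitz weights \<open>c\<close>. The weights are needed
  because several coordinates of the vector in the definition of \<open>\<tau>\<close> are compared at once, and the
  error must be proportional to their number.
\<close>

definition close :: "nat \<Rightarrow> nat \<Rightarrow> 'a \<times> nat \<Rightarrow> 'a \<times> nat \<Rightarrow> real \<Rightarrow> bool" where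
  "close N n z z' v \<longleftrightarrow> (\<forall>c H. (\<forall>j. 0 \<le> c j) \<longrightarrow> (\<forall>j<n. c j = 0) \<longrightarrow> lip N c H \<longrightarrow>
     \<bar>(\<integral>\<omega>. H \<omega> \<partial>measure_pmf (obs N z)) - (\<integral>\<omega>. H \<omega> \<partial>measure_pmf (obs N z'))\<bar> \<le> v * (\<Sum>j\<le>N. c j))"

definition close_all :: "nat \<Rightarrow> 'a \<times> nat \<Rightarrow> 'a \<times> nat \<Rightarrow> real \<Rightarrow> bool" where
  "close_all n z z' v \<longleftrightarrow> (\<forall>N. close N n z z' v)"

lemma lip_bdd:
  assumes "lip N c H" "\<And>j. 0 \<le> c j" "\<And>j. \<bar>\<omega> j\<bar> \<le> b"
  shows "\<bar>H \<omega>\<bar> \<le> \<bar>H (\<lambda>_. 0)\<bar> + (\<Sum>j\<le>N. c j) * b"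
proof -
  have "\<bar>H \<omega> - H (\<lambda>_. 0)\<bar> \<le> (\<Sum>j\<le>N. c j * \<bar>\<omega> j - 0\<bar>)" using assms(1) unfolding lip_def by blast
  also have "\<dots> \<le> (\<Sum>j\<le>N. c j * b)" using assms by (intro sum_mono mult_left_mono) auto
  finally show ?thesis by (auto simp: sum_distrib_right)
qed

lemma obs_H_bdd:
  assumes "lip N c H" "\<And>j. 0 \<le> c j" "\<omega> \<in> set_pmf (obs M z)"
  shows "\<bar>H \<omega>\<bar> \<le> \<bar>H (\<lambda>_. 0)\<bar> + (\<Sum>j\<le>N. c j) * b"
  using lip_bdd[OF assms(1,2)] obs_bdd[OF assms(3)] by auto

lemma close_trivial: "close N n z z' (2 * b)"
  unfolding close_def
proof (intro allI impI)
  fix c H assume c: "\<forall>j. 0 \<le> c j" "\<forall>j<n. c j = 0" and H: "lip N c H"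
  define H0 where "H0 = H (\<lambda>_. 0)"
  have 1: "\<bar>H \<omega> - H0\<bar> \<le> (\<Sum>j\<le>N. c j) * b" if "\<omega> \<in> set_pmf (obs N z)" for \<omega> z
  proof -
    have "\<bar>H \<omega> - H0\<bar> \<le> (\<Sum>j\<le>N. c j * \<bar>\<omega> j - 0\<bar>)" using H unfolding lip_def H0_def by blast
    also have "\<dots> \<le> (\<Sum>j\<le>N. c j * b)" using c obs_bdd[OF that] by (intro sum_mono mult_left_mono) auto
    finally show ?thesis by (auto simp: sum_distrib_right)
  qed
  have int: "integrable (measure_pmf (obs N z)) H" for z
    by (rule pmf_integrable_bdd[OF obs_H_bdd[OF H]]) (use c in auto)
  have 2: "\<bar>(\<integral>\<omega>. H \<omega> \<partial>measure_pmf (obs N z)) - H0\<bar> \<le> (\<Sum>j\<le>N. c j) * b" for z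
    using pmf_integral_abs_le[of "obs N z" "\<lambda>\<omega>. H \<omega> - H0", OF 1] int[of z] by simp
  show "\<bar>(\<integral>\<omega>. H \<omega> \<partial>measure_pmf (obs N z)) - (\<integral>\<omega>. H \<omega> \<partial>measure_pmf (obs N z'))\<bar> \<le> 2 * b * (\<Sum>j\<le>N. c j)"
    using 2[of z] 2[of z'] by (simp add: mult_ac)
qed

lemma close_sym: "close N n z z' v \<Longrightarrow> close N n z' z v"
  unfolding close_def by (simp add: abs_minus_commute)

lemma close_mono: "close N n z z' v \<Longrightarrow> v \<le> v' \<Longrightarrow> n \<le> n' \<Longrightarrow> close N n' z z' v'"
  unfolding close_def
  by (meson mult_right_mono order_less_le_trans order_trans sum_nonneg)

lemma close_vac: "N < n \<Longrightarrow> 0 \<le> v \<Longrightarrow> close N n z z' v"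
  unfolding close_def
proof (intro allI impI)
  fix c H assume c: "\<forall>j. 0 \<le> c j" "\<forall>j<n. c j = 0" and H: "lip N c H" and "N < n" "0 \<le> v"
  then have "\<bar>H \<omega> - H \<omega>'\<bar> \<le> 0" for \<omega> \<omega>'
    unfolding lip_def by (metis (no_types, lifting) atMost_iff le_less_trans mult_zero_left sum.neutral)
  then have "H = (\<lambda>_. H (\<lambda>_. 0))" by (intro ext) (simp add: eq_iff)
  then have "(\<integral>\<omega>. H \<omega> \<partial>measure_pmf (obs N z)) = H (\<lambda>_. 0)" for z
    by (metis (no_types) measure_pmf.prob_space lebesgue_integral_const scaleR_one space_measure_pmf)
  then show "\<bar>(\<integral>\<omega>. H \<omega> \<partial>measure_pmf (obs N z)) - (\<integral>\<omega>. H \<omega> \<partial>measure_pmf (obs N z'))\<bar> \<le> v * (\<Sum>j\<le>N. c j)"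
    using \<open>0 \<le> v\<close> c by (simp add: sum_nonneg)
qed

lemma close_0: "\<bar>\<Phi> z - \<Phi> z'\<bar> \<le> v \<Longrightarrow> close 0 0 z z' v"
  unfolding close_def lip_def
proof (intro allI impI)
  fix c :: "nat \<Rightarrow> real" and H
  assume a: "\<bar>\<Phi> z - \<Phi> z'\<bar> \<le> v" "\<forall>j. 0 \<le> c j" "\<forall>\<omega> \<omega>'. \<bar>H \<omega> - H \<omega>'\<bar> \<le> (\<Sum>j\<le>0. c j * \<bar>\<omega> j - \<omega>' j\<bar>)"
  have "\<bar>H (\<lambda>_. \<Phi> z) - H (\<lambda>_. \<Phi> z')\<bar> \<le> (\<Sum>j\<le>0. c j * \<bar>(\<lambda>_. \<Phi> z) j - (\<lambda>_. \<Phi> z') j\<bar>)"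
    using a(3) by blast
  also have "\<dots> \<le> c 0 * v" using a by (auto intro: mult_left_mono)
  finally show "\<bar>(\<integral>\<omega>. H \<omega> \<partial>measure_pmf (obs 0 z)) - (\<integral>\<omega>. H \<omega> \<partial>measure_pmf (obs 0 z'))\<bar> \<le> v * (\<Sum>j\<le>0. c j)"
    by (simp add: mult.commute)
qed

lemma lip_Suc: "lip (Suc N) c H \<Longrightarrow> lip N (\<lambda>j. c (Suc j)) (\<lambda>\<omega>. H (case_nat x \<omega>))"
  unfolding lip_def
proof (intro allI)
  fix \<omega> \<omega>' assume H: "\<forall>\<omega> \<omega>'. \<bar>H \<omega> - H \<omega>'\<bar> \<le> (\<Sum>j\<le>Suc N. c j * \<bar>\<omega> j - \<omega>' j\<bar>)"
  have "\<bar>H (case_nat x \<omega>) - H (case_nat x \<omega>')\<bar>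
      \<le> (\<Sum>j\<le>Suc N. c j * \<bar>case_nat x \<omega> j - case_nat x \<omega>' j\<bar>)" using H by blast
  then show "\<bar>H (case_nat x \<omega>) - H (case_nat x \<omega>')\<bar> \<le> (\<Sum>j\<le>N. c (Suc j) * \<bar>\<omega> j - \<omega>' j\<bar>)"
    by (simp only: sum.atMost_Suc_shift) simp
qed

text \<open>
  Coupling one backward step: if both chains move by a joint law \<open>q\<close>, the new estimate is the mean
  of the estimates after the step. The first coordinate contributes \<open>c 0\<close> times the difference of
  the current observations, and only if it is among the observed ones.
\<close>

lemma close_couple:
  fixes q :: "'c pmf"
  assumes f: "map_pmf f q = step z" and g: "map_pmf g q = step z'"
    and cl: "\<And>x. x \<in> set_pmf q \<Longrightarrow> close N (n - 1) (f x) (g x) (v x)"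
    and v: "\<And>x. x \<in> set_pmf q \<Longrightarrow> 0 \<le> v x" "\<And>x. x \<in> set_pmf q \<Longrightarrow> v x \<le> bv"
    and V: "(\<integral>x. v x \<partial>measure_pmf q) \<le> V" and \<Phi>: "0 < n \<or> \<bar>\<Phi> z - \<Phi> z'\<bar> \<le> V"
  shows "close (Suc N) n z z' V"
  unfolding close_def
proof (intro allI impI)
  fix c H assume c: "\<forall>j. 0 \<le> c j" "\<forall>j<n. c j = 0" and H: "lip (Suc N) c H"
  define S where "S = (\<Sum>j\<le>N. c (Suc j))"
  have S: "0 \<le> S" "(\<Sum>j\<le>Suc N. c j) = c 0 + S"
    using c by (auto simp: S_def sum_nonneg sum.atMost_Suc_shift simp del: sum.atMost_Suc)
  define K where "K = \<bar>H (\<lambda>_. 0)\<bar> + (\<Sum>j\<le>Suc N. c j) * b"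
  have Hb: "\<bar>H (case_nat (\<Phi> u) \<omega>)\<bar> \<le> K" if "\<omega> \<in> set_pmf (obs N w)" for \<omega> u w
    unfolding K_def using c \<Phi>_bdd obs_bdd[OF that]
    by (intro lip_bdd[OF H]) (auto split: nat.split)
  define A where "A u w = (\<integral>\<omega>. H (case_nat (\<Phi> u) \<omega>) \<partial>measure_pmf (obs N w))" for u w
  have Ab: "\<bar>A u w\<bar> \<le> K" for u w unfolding A_def using Hb by (intro pmf_integral_abs_le) auto
  have E1: "(\<integral>\<omega>. H \<omega> \<partial>measure_pmf (obs (Suc N) u)) = (\<integral>w. A u w \<partial>measure_pmf (step u))" for u
    unfolding A_def obs.simps
    by (subst pmf_integral_bind[where b = K]) (auto intro: Hb)
  have E: "(\<integral>\<omega>. H \<omega> \<partial>measure_pmf (obs (Suc N) z)) = (\<integral>x. A z (f x) \<partial>measure_pmf q)"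
     "(\<integral>\<omega>. H \<omega> \<partial>measure_pmf (obs (Suc N) z')) = (\<integral>x. A z' (g x) \<partial>measure_pmf q)"
    unfolding E1 f[symmetric] g[symmetric] by simp_all
  have int: "integrable (measure_pmf q) (\<lambda>x. A z (f x))" "integrable (measure_pmf q) (\<lambda>x. A z' (g x))"
    by (auto intro!: pmf_integrable_bdd Ab)
  have intv: "integrable (measure_pmf q) v"
    by (rule pmf_integrable_bdd[where b = bv]) (use v in auto)
  \<comment> \<open>change the chain that continues first, and the current observation second\<close>
  have pt: "\<bar>A z (f x) - A z' (g x)\<bar> \<le> v x * S + c 0 * \<bar>\<Phi> z - \<Phi> z'\<bar>" if "x \<in> set_pmf q" for x
  proof -
    have "\<bar>A z (f x) - A z (g x)\<bar> \<le> v x * S"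
      using cl[OF that] lip_Suc[OF H, of "\<Phi> z"] c unfolding close_def A_def S_def
      by (auto dest!: spec[of _ "\<lambda>j. c (Suc j)"] spec[of _ "\<lambda>\<omega>. H (case_nat (\<Phi> z) \<omega>)"])
    moreover have "\<bar>A z (g x) - A z' (g x)\<bar> \<le> c 0 * \<bar>\<Phi> z - \<Phi> z'\<bar>"
    proof -
      have i: "integrable (measure_pmf (obs N (g x))) (\<lambda>\<omega>. H (case_nat (\<Phi> u) \<omega>))" for u
        by (rule pmf_integrable_bdd[where b = K]) (rule Hb)
      have "A z (g x) - A z' (g x) = (\<integral>\<omega>. H (case_nat (\<Phi> z) \<omega>) - H (case_nat (\<Phi> z') \<omega>) \<partial>measure_pmf (obs N (g x)))"
        unfolding A_def using i by simp
      also have "\<bar>\<dots>\<bar> \<le> c 0 * \<bar>\<Phi> z - \<Phi> z'\<bar>"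
      proof (rule pmf_integral_abs_le)
        fix \<omega>
        have "\<bar>H (case_nat (\<Phi> z) \<omega>) - H (case_nat (\<Phi> z') \<omega>)\<bar>
          \<le> (\<Sum>j\<le>Suc N. c j * \<bar>case_nat (\<Phi> z) \<omega> j - case_nat (\<Phi> z') \<omega> j\<bar>)"
          using H unfolding lip_def by blast
        then show "\<bar>H (case_nat (\<Phi> z) \<omega>) - H (case_nat (\<Phi> z') \<omega>)\<bar> \<le> c 0 * \<bar>\<Phi> z - \<Phi> z'\<bar>"
          by (simp only: sum.atMost_Suc_shift) simp
      qed
      finally show ?thesis .
    qed
    ultimately show ?thesis by linarith
  qed
  have "\<bar>(\<integral>\<omega>. H \<omega> \<partial>measure_pmf (obs (Suc N) z)) - (\<integral>\<omega>. H \<omega> \<partial>measure_pmf (obs (Suc N) z'))\<bar>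
      = \<bar>\<integral>x. A z (f x) - A z' (g x) \<partial>measure_pmf q\<bar>" unfolding E using int by simp
  also have "\<dots> \<le> (\<integral>x. \<bar>A z (f x) - A z' (g x)\<bar> \<partial>measure_pmf q)" by (rule integral_abs_bound)
  also have "\<dots> \<le> (\<integral>x. v x * S + c 0 * \<bar>\<Phi> z - \<Phi> z'\<bar> \<partial>measure_pmf q)"
    by (intro integral_mono_AE) (use int intv pt in \<open>auto simp: AE_measure_pmf_iff\<close>)
  also have "\<dots> = (\<integral>x. v x \<partial>measure_pmf q) * S + c 0 * \<bar>\<Phi> z - \<Phi> z'\<bar>" using intv by simp
  also have "\<dots> \<le> V * S + c 0 * V"
    using V S \<Phi> c by (intro add_mono mult_right_mono) (auto intro: mult_left_mono)
  also have "\<dots> = V * (\<Sum>j\<le>Suc N. c j)" unfolding S(2) by (simp add: algebra_simps)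
  finally show "\<bar>(\<integral>\<omega>. H \<omega> \<partial>measure_pmf (obs (Suc N) z)) - (\<integral>\<omega>. H \<omega> \<partial>measure_pmf (obs (Suc N) z'))\<bar>
     \<le> V * (\<Sum>j\<le>Suc N. c j)" .
qed

lemma close_all_couple:
  fixes q :: "'c pmf"
  assumes f: "map_pmf f q = step z" and g: "map_pmf g q = step z'"
    and cl: "\<And>x. x \<in> set_pmf q \<Longrightarrow> close_all n (f x) (g x) (v x)"
    and v: "\<And>x. x \<in> set_pmf q \<Longrightarrow> 0 \<le> v x" "\<And>x. x \<in> set_pmf q \<Longrightarrow> v x \<le> bv"
    and V: "(\<integral>x. v x \<partial>measure_pmf q) \<le> V"
  shows "close_all (Suc n) z z' V"
  unfolding close_all_def
proof
  fix N
  show "close N (Suc n) z z' V"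
  proof (cases N)
    case 0
    have "0 \<le> (\<integral>x. v x \<partial>measure_pmf q)"
      by (rule integral_nonneg_AE) (use v in \<open>auto simp: AE_measure_pmf_iff\<close>)
    with V 0 show ?thesis by (intro close_vac) auto
  next
    case (Suc N')
    show ?thesis unfolding Suc
      by (rule close_couple[OF f g _ v V]) (use cl in \<open>auto simp: close_all_def\<close>)
  qed
qed

lemma close_all_trivial: "close_all n z z' (2 * b)"
  by (simp add: close_all_def close_trivial)

lemma close_all_sym: "close_all n z z' v \<Longrightarrow> close_all n z' z v"
  by (simp add: close_all_def close_sym)

lemma close_all_mono: "close_all n z z' v \<Longrightarrow> v \<le> v' \<Longrightarrow> n \<le> n' \<Longrightarrow> close_all n' z z' v'"
  by (auto simp: close_all_def intro: close_mono)

text \<open>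
  Two chains above the base move down deterministically, and each step is a trivial coupling.
\<close>

lemma close_all_down:
  "k \<le> l \<Longrightarrow> k \<le> l' \<Longrightarrow> 0 \<le> v \<Longrightarrow> close_all n (x, l - k) (x', l' - k) v \<Longrightarrow> close_all (n + k) (x, l) (x', l') v"
proof (induction k arbitrary: l l')
  case (Suc k)
  obtain m m' where l: "l = Suc m" "l' = Suc m'" using Suc.prems by (cases l; cases l') auto
  have "close_all (n + k) (x, m) (x', m') v" using Suc l by auto
  then have "close_all (Suc (n + k)) (x, l) (x', l') v"
    using Suc.prems l
    by (intro close_all_couple[where q = "return_pmf ()" and f = "\<lambda>_. (x, m)" and g = "\<lambda>_. (x', m')" and v = "\<lambda>_. v" and bv = v]) auto
  then show ?case by simp
qed simp

text \<open>
  Each step is coupled by the product of the two transition laws, so that the chains run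
  independently of each other.
\<close>

lemma close_all_indep:
  assumes v: "\<And>w w'. 0 \<le> v (w, w')" "\<And>w w'. v (w, w') \<le> bv" and G: "fst z \<in> G" "fst z' \<in> G"
    and cl: "\<And>w w'. fst w \<in> G \<Longrightarrow> fst w' \<in> G \<Longrightarrow> close_all m w w' (v (w, w'))"
  shows "close_all (m + k) z z' (\<integral>x. v x \<partial>measure_pmf (pair_pmf (iter k z) (iter k z')))"
  using G
proof (induction k arbitrary: z z')
  case 0
  then show ?case using cl by simp
next
  case (Suc k)
  define V where "V w w' = (\<integral>x. v x \<partial>measure_pmf (pair_pmf (iter k w) (iter k w')))" for w w'
  have vb: "\<bar>v x\<bar> \<le> bv" for x using v by (cases x) auto
  have V: "0 \<le> V w w'" "V w w' \<le> bv" for w w'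
    using pmf_integral_ge_const[of _ v bv 0] pmf_integral_le_const[of _ v bv bv] v vb
    by (auto simp: V_def abs_le_iff)
  have eq: "(\<integral>x. V (fst x) (snd x) \<partial>measure_pmf (pair_pmf (step z) (step z')))
     = (\<integral>x. v x \<partial>measure_pmf (pair_pmf (iter (Suc k) z) (iter (Suc k) z')))"
    unfolding V_def iter.simps pair_bind_pmf
    by (rule pmf_integral_bind[symmetric, where b = bv]) (rule vb)
  have "close_all (Suc (m + k)) z z' (\<integral>x. V (fst x) (snd x) \<partial>measure_pmf (pair_pmf (step z) (step z')))"
  proof (rule close_all_couple[where f = fst and g = snd and bv = bv])
    fix x assume x: "x \<in> set_pmf (pair_pmf (step z) (step z'))"
    then have "fst (fst x) \<in> G" "fst (snd x) \<in> G"
      using Suc.prems step_closed[of "fst x" z] step_closed[of "snd x" z'] by auto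
    then show "close_all (m + k) (fst x) (snd x) (V (fst x) (snd x))"
      unfolding V_def by (rule Suc.IH)
  qed (use V in \<open>auto simp: map_fst_pair_pmf map_snd_pair_pmf\<close>)
  then show ?case unfolding eq by simp
qed

text \<open>
  The coupling of two chains at the base: with probability \<open>e\<close> both take the same branch
  (estimates \<open>vm\<close>), otherwise the branches are drawn independently from the residual law and
  \<open>p y'\<close> (estimates \<open>vu\<close>). Return times above the threshold \<open>i\<close> are allowed an extra error; the
  factor \<open>3\<close> is \<open>2\<close> for the residual law plus \<open>1\<close> for \<open>p y'\<close>.
\<close>

lemma close_base:
  assumes y: "y \<in> G" "y' \<in> G"
  defines "e \<equiv> exp (- (C * d y y'))"
  assumes m: "\<And>a. close N (n - 1) (s a y, r a - 1) (s a y', r a - 1) (if r a \<le> i then vm1 else vm1 + vm2)"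
    and u: "\<And>a a'. close N (n - 1) (s a y, r a - 1) (s a' y', r a' - 1) (if r a \<le> i \<and> r a' \<le> i then vu1 else vu1 + vu2)"
    and nn: "0 \<le> vm1" "0 \<le> vm2" "0 \<le> vu1" "0 \<le> vu2"
    and V: "e * (vm1 + vm2 * T i) + (1 - e) * (vu1 + vu2 * (3 * T i)) \<le> V"
    and \<Phi>: "0 < n \<or> \<bar>\<Phi> (y, 0) - \<Phi> (y', 0)\<bar> \<le> V"
  shows "close (Suc N) n (y, 0) (y', 0) V"
proof -
  obtain \<rho> where \<rho>: "bind_pmf (bernoulli_pmf e) (\<lambda>b. if b then p y' else \<rho>) = p y"
     "\<And>n. measure_pmf.prob \<rho> {a. n < r a} \<le> 2 * T n"
    using minorization_splitting[OF y] unfolding e_def by blast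
  have e: "0 \<le> e" "e \<le> 1" using C_pos d_nonneg[OF y] by (auto simp: e_def)
  \<comment> \<open>the joint law, tagged by a Boolean telling whether the branches agree\<close>
  define qq where "qq t = (if t then map_pmf (\<lambda>a. (t, a, a)) (p y') else map_pmf (Pair t) (pair_pmf \<rho> (p y')))" for t
  define q where "q = bind_pmf (bernoulli_pmf e) qq"
  define f where "f = (\<lambda>(t::bool, a, a'::'b). (s a y, r a - 1))"
  define g where "g = (\<lambda>(t::bool, a::'b, a'). (s a' y', r a' - 1))"
  define v where "v = (\<lambda>(t, a, a'). if t then (if r a \<le> i then vm1 else vm1 + vm2) else (if r a \<le> i \<and> r a' \<le> i then vu1 else vu1 + vu2))"
  define bv where "bv = vm1 + vm2 + vu1 + vu2"
  have vb: "0 \<le> v x" "v x \<le> bv" for x using nn by (auto simp: v_def bv_def split: prod.split)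
  then have vab: "\<bar>v x\<bar> \<le> bv" for x by (auto simp: abs_le_iff intro: order_trans[of _ 0])
  show ?thesis
  proof (rule close_couple[where q = q and f = f and g = g and v = v and bv = bv])
    have "map_pmf (\<lambda>(t, a, a'). a) (qq t) = (if t then p y' else \<rho>)" for t
      using map_fst_pair_pmf[of \<rho> "p y'"]
      by (auto simp: qq_def pmf.map_comp o_def case_prod_unfold)
    then have "map_pmf (\<lambda>(t, a, a'). a) q = p y"
      unfolding q_def map_bind_pmf using \<rho>(1) by simp
    then have "map_pmf (\<lambda>a. (s a y, r a - 1)) (map_pmf (\<lambda>(t, a, a'). a) q) = step (y, 0)" by simp
    then show "map_pmf f q = step (y, 0)"
      by (simp add: pmf.map_comp o_def case_prod_unfold f_def)
    have "map_pmf (\<lambda>(t, a, a'). a') (qq t) = p y'" for t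
      using map_snd_pair_pmf[of \<rho> "p y'"]
      by (auto simp: qq_def pmf.map_comp o_def case_prod_unfold)
    then have "map_pmf (\<lambda>(t, a, a'). a') q = p y'"
      unfolding q_def map_bind_pmf by (simp add: bind_pmf_const)
    then have "map_pmf (\<lambda>a. (s a y', r a - 1)) (map_pmf (\<lambda>(t, a, a'). a') q) = step (y', 0)" by simp
    then show "map_pmf g q = step (y', 0)"
      by (simp add: pmf.map_comp o_def case_prod_unfold g_def)
  next
    fix x assume "x \<in> set_pmf q"
    obtain t a a' where x: "x = (t, a, a')" by (cases x)
    with \<open>x \<in> set_pmf q\<close> have "t \<longrightarrow> a = a'" by (auto simp: q_def qq_def split: if_splits)
    then show "close N (n - 1) (f x) (g x) (v x)"
      using m[of a] u[of a a'] by (auto simp: x f_def g_def v_def)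
  next
    have T: "measure_pmf.prob (p y') {a. i < r a} \<le> T i" by (rule tail[OF y(2)])
    have "(\<integral>x. v x \<partial>measure_pmf q) = (\<integral>t. (\<integral>x. v x \<partial>measure_pmf (qq t)) \<partial>measure_pmf (bernoulli_pmf e))"
      unfolding q_def by (rule pmf_integral_bind) (rule vab)
    also have "\<dots> = (\<integral>x. v x \<partial>measure_pmf (qq True)) * e + (\<integral>x. v x \<partial>measure_pmf (qq False)) * (1 - e)"
      using e by simp
    also have "(\<integral>x. v x \<partial>measure_pmf (qq True)) = (\<integral>a. (if r a \<le> i then vm1 else vm1 + vm2) \<partial>measure_pmf (p y'))"
      by (simp add: qq_def v_def)
    also have "\<dots> \<le> (\<integral>a. vm1 + vm2 * indicator {a. i < r a} a \<partial>measure_pmf (p y'))"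
      using nn by (intro pmf_integral_mono[where b = "vm1 + vm2" and b' = "vm1 + vm2"]) (auto split: split_indicator)
    also have "\<dots> = vm1 + vm2 * measure_pmf.prob (p y') {a. i < r a}"
    proof -
      have "integrable (measure_pmf (p y')) (\<lambda>a. indicator {a. i < r a} a :: real)"
        by (auto intro!: pmf_integrable_bdd[where b = 1] split: split_indicator)
      then show ?thesis by simp
    qed
    also have "\<dots> \<le> vm1 + vm2 * T i" using T nn by (intro add_left_mono mult_left_mono)
    also have "(\<integral>x. v x \<partial>measure_pmf (qq False)) = (\<integral>x. (if r (fst x) \<le> i \<and> r (snd x) \<le> i then vu1 else vu1 + vu2) \<partial>measure_pmf (pair_pmf \<rho> (p y')))"
      by (simp add: qq_def v_def case_prod_unfold)
    also have "\<dots> \<le> (\<integral>x. vu1 + vu2 * (indicator {a. i < r a} (fst x) + indicator {a. i < r a} (snd x)) \<partial>measure_pmf (pair_pmf \<rho> (p y')))"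
      using nn by (intro pmf_integral_mono[where b = "vu1 + vu2" and b' = "vu1 + 2 * vu2"]) (auto split: split_indicator)
    also have "\<dots> = vu1 + vu2 * ((\<integral>x. indicator {a. i < r a} (fst x) \<partial>measure_pmf (pair_pmf \<rho> (p y')))
         + (\<integral>x. indicator {a. i < r a} (snd x) \<partial>measure_pmf (pair_pmf \<rho> (p y'))))"
    proof -
      have "integrable (measure_pmf (pair_pmf \<rho> (p y'))) (\<lambda>x. indicator {a. i < r a} (fst x) :: real)"
        "integrable (measure_pmf (pair_pmf \<rho> (p y'))) (\<lambda>x. indicator {a. i < r a} (snd x) :: real)"
        by (auto intro!: pmf_integrable_bdd[where b = 1] split: split_indicator)
      then show ?thesis by simp
    qed
    also have "(\<integral>x. indicator {a. i < r a} (fst x) \<partial>measure_pmf (pair_pmf \<rho> (p y'))) = measure_pmf.prob \<rho> {a. i < r a}"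
      by (subst integral_map_pmf[symmetric]) (simp add: map_fst_pair_pmf)
    also have "(\<integral>x. indicator {a. i < r a} (snd x) \<partial>measure_pmf (pair_pmf \<rho> (p y'))) = measure_pmf.prob (p y') {a. i < r a}"
      by (subst integral_map_pmf[symmetric]) (simp add: map_snd_pair_pmf)
    also have "vu1 + vu2 * (measure_pmf.prob \<rho> {a. i < r a} + measure_pmf.prob (p y') {a. i < r a}) \<le> vu1 + vu2 * (3 * T i)"
      using \<rho>(2)[of i] T nn by (intro add_left_mono mult_left_mono) auto
    finally have "(\<integral>x. v x \<partial>measure_pmf q) \<le> (vm1 + vm2 * T i) * e + (vu1 + vu2 * (3 * T i)) * (1 - e)"
      using e by (auto simp: mult_right_mono)
    then show "(\<integral>x. v x \<partial>measure_pmf q) \<le> V" using V by (simp add: mult.commute)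
  qed (use vb \<Phi> in auto)
qed

section \<open>A contracting gauge of the distance\<close>

definition gauge_rate :: real where "gauge_rate = C' + 1"

text \<open>
  The distance is measured through a function that vanishes at \<open>0\<close> like \<open>t\<close> and has the form of a
  mismatch probability. As its rate exceeds \<open>C'\<close>, one coupled step contracts it even when the risk
  \<open>1 - exp(-C t)\<close> of a mismatch, counted at cost \<open>1\<close>, is added (\<open>gauge_contraction\<close>).
\<close>

definition gauge :: "real \<Rightarrow> real" where "gauge t = 1 - exp (- (gauge_rate * t))"

lemma gauge_rate_pos: "0 < gauge_rate" using C'_pos by (simp add: gauge_rate_def)

lemma gauge_nonneg: "0 \<le> t \<Longrightarrow> 0 \<le> gauge t" and gauge_le_1: "gauge t \<le> 1" and gauge_mono: "t \<le> t' \<Longrightarrow> gauge t \<le> gauge t'"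
  using gauge_rate_pos by (auto simp: gauge_def)

lemma gauge_contraction:
  obtains \<theta> where "0 \<le> \<theta>" "\<theta> < 1"
    "\<And>t. 0 \<le> t \<Longrightarrow> t \<le> D \<Longrightarrow> exp (- (C * t)) * gauge (t / L) + (1 - exp (- (C * t))) \<le> \<theta> * gauge t"
proof -
  \<comment> \<open>the left-hand side equals \<open>1 - exp(-B' t)\<close> with this \<open>B'\<close>, which is smaller than the
    rate because the rate lies above the fixed point \<open>C'\<close> of \<open>x \<mapsto> C + x/L\<close>\<close>
  define B' where "B' = C + gauge_rate / L"
  have "gauge_rate - B' = 1 - 1 / L"
    using C'_eq by (simp add: gauge_rate_def B'_def add_divide_distrib)
  then have B': "B' < gauge_rate" "0 < B'" using L_gt C_pos gauge_rate_pos by (auto simp: B'_def field_simps add_pos_pos)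
  define k where "k = (gauge_rate - B') / gauge_rate"
  have k: "0 < k" "k < 1" using B' gauge_rate_pos by (auto simp: k_def)
  define \<theta> where "\<theta> = 1 - exp (- (B' * D)) * k"
  have "exp (- (B' * D)) * k \<le> 1 * 1" using k B' D_nonneg by (intro mult_mono) auto
  then have th: "0 \<le> \<theta>" "\<theta> < 1" using k by (auto simp: \<theta>_def)
  have "exp (- (C * t)) * gauge (t / L) + (1 - exp (- (C * t))) \<le> \<theta> * gauge t" if t: "0 \<le> t" "t \<le> D" for t
  proof -
    have "exp (- (C * t)) * exp (- (gauge_rate * (t / L))) = exp (- (B' * t))"
      by (subst exp_add[symmetric]) (simp add: B'_def algebra_simps)
    then have 1: "exp (- (C * t)) * gauge (t / L) + (1 - exp (- (C * t))) = 1 - exp (- (B' * t))"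
      by (simp add: gauge_def algebra_simps)
    have cvx: "exp (- (k * (gauge_rate * t))) \<le> k * exp (- (gauge_rate * t)) + (1 - k)"
    proof -
      have "convex_on UNIV (exp :: real \<Rightarrow> real)" by (rule exp_convex)
      from convex_onD[OF this, of k "0" "- (gauge_rate * t)"] k show ?thesis by (simp add: algebra_simps)
    qed
    have 2: "k * gauge t \<le> 1 - exp (- (k * (gauge_rate * t)))" using cvx by (simp add: gauge_def algebra_simps)
    have kB: "k * (gauge_rate * t) = gauge_rate * t - B' * t" using gauge_rate_pos by (simp add: k_def field_simps)
    have "exp (- (B' * D)) * (k * gauge t) \<le> exp (- (B' * t)) * (1 - exp (- (k * (gauge_rate * t))))"
      using t B' k 2 by (intro mult_mono) (auto simp: gauge_nonneg)
    also have "\<dots> = exp (- (B' * t)) - exp (- (gauge_rate * t))"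
      unfolding kB by (simp add: algebra_simps exp_add[symmetric])
    finally have "exp (- (B' * D)) * (k * gauge t) \<le> exp (- (B' * t)) - exp (- (gauge_rate * t))" .
    then show ?thesis unfolding 1 by (simp add: \<theta>_def gauge_def algebra_simps)
  qed
  with th that show ?thesis by blast
qed

text \<open>
  Bounds the ratio of \<open>t\<close> to its gauge on \<open>[0, D]\<close>.
\<close>

definition gauge_slope :: real where "gauge_slope = exp (gauge_rate * D) / gauge_rate"

lemma gauge_slope_pos: "0 < gauge_slope" using gauge_rate_pos by (simp add: gauge_slope_def)

lemma le_gauge: 
  assumes "0 \<le> t" "t \<le> D"
  shows "t \<le> gauge_slope * gauge t"
proof -
  have "(1 + gauge_rate * t) * exp (- (gauge_rate * t)) \<le> exp (gauge_rate * t) * exp (- (gauge_rate * t))"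
    using exp_ge_add_one_self[of "gauge_rate * t"] by (intro mult_right_mono) auto
  then have "gauge_rate * t * exp (- (gauge_rate * t)) \<le> gauge t" by (simp add: gauge_def algebra_simps mult_exp_exp)
  then have "exp (gauge_rate * t) * (gauge_rate * t * exp (- (gauge_rate * t))) \<le> exp (gauge_rate * t) * gauge t" by (intro mult_left_mono) auto
  also have "exp (gauge_rate * t) * (gauge_rate * t * exp (- (gauge_rate * t))) = gauge_rate * t" by (simp add: mult_exp_exp mult_ac)
  also have "exp (gauge_rate * t) * gauge t \<le> exp (gauge_rate * D) * gauge t"
    using assms gauge_rate_pos by (intro mult_right_mono) (auto simp: gauge_nonneg)
  finally show ?thesis using gauge_rate_pos by (simp add: gauge_slope_def field_simps)
qed

text \<open>
  Down the column of a common branch both chains move in parallel, and the error of the current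
  observation never exceeds the bound \<open>v\<close> which is inherited from the base.
\<close>

lemma close_flight_matched:
  assumes y: "y \<in> G" "y' \<in> G" and v: "C\<Phi> * d y y' \<le> v"
    and cl: "\<And>N'. N' \<le> N \<Longrightarrow> close N' 0 (s a y, 0) (s a y', 0) v" and k: "k < r a"
  shows "close N 0 (s a y, k) (s a y', k) v"
  using cl k
proof (induction k arbitrary: N)
  case (Suc k)
  have v0: "0 \<le> v" using v C\<Phi>_nonneg d_nonneg[OF y] by (meson mult_nonneg_nonneg order_trans)
  have \<Phi>: "\<bar>\<Phi> (s a y, Suc k) - \<Phi> (s a y', Suc k)\<bar> \<le> v"
    using \<Phi>_flight[OF y Suc.prems(2)] v by simp
  show ?case
  proof (cases N)
    case 0
    then show ?thesis using close_0[OF \<Phi>] by simp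
  next
    case (Suc N')
    show ?thesis unfolding Suc
    proof (rule close_couple[where q = "return_pmf ()" and f = "\<lambda>_. (s a y, k)" and g = "\<lambda>_. (s a y', k)" and v = "\<lambda>_. v" and bv = v])
      show "close N' (0 - 1) (s a y, k) (s a y', k) v"
        using Suc.IH[of N'] Suc.prems Suc by simp
    qed (use \<Phi> v0 in auto)
  qed
qed simp

text \<open>
  Without any decay: the error of the matched branch satisfies the affine inequality
  \<open>X1 g + \<theta> X g \<le> X g\<close>, where \<open>g\<close> is the gauge of the distance and \<open>X1\<close> collects the current
  observation and a mismatch at cost \<open>2 b\<close>. The solution \<open>X = X1 / (1 - \<theta>)\<close> is then preserved by
  induction on the length of the path.
\<close>

lemma apriori_closeness:
  obtains X where "0 \<le> X" "\<And>N y y'. y \<in> G \<Longrightarrow> y' \<in> G \<Longrightarrow> close N 0 (y, 0) (y', 0) (X * gauge (d y y'))"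
proof -
  obtain \<theta> where \<theta>: "0 \<le> \<theta>" "\<theta> < 1"
    "\<And>t. 0 \<le> t \<Longrightarrow> t \<le> D \<Longrightarrow> exp (- (C * t)) * gauge (t / L) + (1 - exp (- (C * t))) \<le> \<theta> * gauge t"
    by (rule gauge_contraction) blast
  define X1 where "X1 = C\<Phi> * gauge_slope + C * gauge_slope * (2 * b)"
  define X where "X = X1 / (1 - \<theta>)"
  have X1: "0 \<le> X1" using C\<Phi>_nonneg gauge_slope_pos C_pos b_nonneg by (simp add: X1_def)
  have X: "0 \<le> X" "X1 + \<theta> * X = X" using X1 \<theta> by (auto simp: X_def field_simps)
  then have X1X: "X1 \<le> X" using \<theta> mult_nonneg_nonneg[of \<theta> X] by linarith
  have CX: "C\<Phi> * gauge_slope \<le> X1" using C_pos gauge_slope_pos b_nonneg by (simp add: X1_def)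
  have cl: "close N 0 (y, 0) (y', 0) (X * gauge (d y y'))" if "y \<in> G" "y' \<in> G" for N y y'
    using that
  proof (induction N arbitrary: y y' rule: less_induct)
    case (less N)
    let ?d = "d y y'"
    let ?e = "exp (- (C * ?d))"
    have d: "0 \<le> ?d" "?d \<le> D" using d_nonneg d_le less.prems by auto
    have h0: "0 \<le> gauge ?d" "0 \<le> gauge (?d / L)" using d L_gt by (auto intro!: gauge_nonneg)
    have dh: "?d \<le> gauge_slope * gauge ?d" by (rule le_gauge[OF d])
    have Cd: "C\<Phi> * ?d \<le> C\<Phi> * gauge_slope * gauge ?d" using mult_left_mono[OF dh C\<Phi>_nonneg] by (simp add: mult_ac)
    have "C * ?d \<le> C * gauge_slope * gauge ?d" using mult_left_mono[OF dh, of C] C_pos by (simp add: mult.assoc)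
    then have e3: "1 - ?e \<le> C * gauge_slope * gauge ?d" using one_minus_exp_le[of "C * ?d"] by linarith
    have e: "0 < ?e" "?e \<le> 1" "1 - ?e \<le> C * gauge_slope * gauge ?d" using d C_pos e3 by auto
    have "C\<Phi> * gauge_slope * gauge ?d \<le> X * gauge ?d" using CX X1X h0 by (intro mult_right_mono) auto
    then have \<Phi>0: "\<bar>\<Phi> (y, 0) - \<Phi> (y', 0)\<bar> \<le> X * gauge ?d"
      using \<Phi>_base[OF less.prems] Cd by linarith
    show ?case
    proof (cases N)
      case 0
      then show ?thesis using close_0[OF \<Phi>0] by simp
    next
      case (Suc N')
      define v where "v = C\<Phi> * ?d + X * gauge (?d / L)"
      have v: "C\<Phi> * ?d \<le> v" "0 \<le> v" using X h0 C\<Phi>_nonneg d by (auto simp: v_def)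
      have m: "close N' 0 (s a y, r a - 1) (s a y', r a - 1) v" for a
      proof (rule close_flight_matched[OF less.prems v(1)])
        fix N'' assume "N'' \<le> N'"
        then have "close N'' 0 (s a y, 0) (s a y', 0) (X * gauge (d (s a y) (s a y')))"
          using Suc less.prems by (intro less.IH) (auto intro: s_in)
        moreover have "X * gauge (d (s a y) (s a y')) \<le> v"
        proof -
          have "X * gauge (d (s a y) (s a y')) \<le> X * gauge (?d / L)"
            using X contr[OF less.prems] by (intro mult_left_mono gauge_mono)
          then show ?thesis using C\<Phi>_nonneg d by (simp add: v_def add_increasing)
        qed
        ultimately show "close N'' 0 (s a y, 0) (s a y', 0) v" by (rule close_mono) simp
      qed (use r_ge[of a] in simp)
      have "?e * (v + 0 * T 0) + (1 - ?e) * (2 * b + 0 * (3 * T 0)) \<le> X * gauge ?d"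
      proof -
        have "?e * (C\<Phi> * ?d) \<le> 1 * (C\<Phi> * ?d)"
          using e C\<Phi>_nonneg d by (intro mult_right_mono) auto
        then have "?e * (C\<Phi> * ?d) \<le> 1 * (C\<Phi> * gauge_slope * gauge ?d)" using Cd by linarith
        moreover have "(1 - ?e) * (2 * b) \<le> C * gauge_slope * gauge ?d * (2 * b)"
          using e b_nonneg by (intro mult_right_mono) auto
        moreover have "?e * (X * gauge (?d / L)) \<le> \<theta> * X * gauge ?d"
        proof -
          have "?e * gauge (?d / L) \<le> \<theta> * gauge ?d" using \<theta>(3)[OF d] e(2) by linarith
          from mult_left_mono[OF this X(1)] show ?thesis by (simp add: mult_ac)
        qed
        ultimately have "?e * v + (1 - ?e) * (2 * b) \<le> (X1 + \<theta> * X) * gauge ?d"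
          by (simp add: v_def X1_def algebra_simps)
        then show ?thesis using X(2) by simp
      qed
      then show ?thesis unfolding Suc
      proof (intro close_base[where i = 0 and ?vm1.0 = v and ?vm2.0 = 0 and ?vu1.0 = "2 * b" and ?vu2.0 = 0] less.prems)
        fix a
        show "close N' (0 - 1) (s a y, r a - 1) (s a y', r a - 1) (if r a \<le> 0 then v else v + 0)"
          using m[of a] r_ge[of a] by auto
      qed (use v b_nonneg \<Phi>0 close_trivial in auto)
    qed
  qed
  show ?thesis using that X(1) cl by blast
qed

section \<open>The coupling recursion\<close>

text \<open>
  The quantity that is propagated by coupling: \<open>M\<close> bounds the closeness after \<open>n\<close> steps of two
  base points, weighted by the gauge of their distance, and up to the factor \<open>1 + \<eta>\<close> that of a
  base point and a point of arbitrary level \<open>k\<close>, once its descent time \<open>k\<close> is added. The slack \<open>\<eta>\<close>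
  is what a pair at different levels gains by meeting at the base.
\<close>

definition profile :: "real \<Rightarrow> nat \<Rightarrow> real \<Rightarrow> bool" where
  "profile \<eta> n M \<longleftrightarrow>
     (\<forall>y\<in>G. \<forall>y'\<in>G. close_all n (y, 0) (y', 0) (M * gauge (d y y'))) \<and>
     (\<forall>y\<in>G. \<forall>y'\<in>G. \<forall>k. close_all (n + k) (y, 0) (y', k) ((1 + \<eta>) * M))"

lemma profile_mono:
  assumes P: "profile \<eta> n M" and M: "M \<le> M'" and "n \<le> n'" "0 \<le> \<eta>"
  shows "profile \<eta> n' M'"
  unfolding profile_def
proof (intro conjI ballI allI)
  fix y y' k assume y: "y \<in> G" "y' \<in> G"
  have "close_all n (y, 0) (y', 0) (M * gauge (d y y'))" using P y by (simp add: profile_def)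
  moreover have "M * gauge (d y y') \<le> M' * gauge (d y y')"
    using M d_nonneg[OF y] by (intro mult_right_mono gauge_nonneg)
  ultimately show "close_all n' (y, 0) (y', 0) (M' * gauge (d y y'))" using \<open>n \<le> n'\<close> by (rule close_all_mono)
  have "close_all (n + k) (y, 0) (y', k) ((1 + \<eta>) * M)" using P y by (simp add: profile_def)
  moreover have "(1 + \<eta>) * M \<le> (1 + \<eta>) * M'" using M \<open>0 \<le> \<eta>\<close> by (intro mult_left_mono) auto
  ultimately show "close_all (n' + k) (y, 0) (y', k) ((1 + \<eta>) * M')"
    using \<open>n \<le> n'\<close> by (auto intro: close_all_mono)
qed

text \<open>
  Both chains descend together until the lower one reaches the base.
\<close>

lemma profile_levels:
  assumes P: "profile \<eta> n M" and M: "0 \<le> M" "0 \<le> \<eta>" and G: "x \<in> G" "x' \<in> G"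
  shows "close_all (n + max l l') (x, l) (x', l') ((1 + \<eta>) * M)"
proof -
  have *: "close_all (n + l') (x, l) (x', l') ((1 + \<eta>) * M)" if "l \<le> l'" "x \<in> G" "x' \<in> G" for x x' l l'
  proof -
    have "close_all (n + (l' - l)) (x, l - l) (x', l' - l) ((1 + \<eta>) * M)"
      using P that unfolding profile_def diff_self_eq_0 by blast
    from close_all_down[OF order_refl that(1) _ this] M that(1) show ?thesis by (simp add: add.assoc)
  qed
  show ?thesis
  proof (cases "l \<le> l'")
    case True
    then show ?thesis using *[of l l' x x'] G by (simp add: max_def)
  next
    case False
    then show ?thesis using *[of l' l x' x] G by (intro close_all_sym[of _ "(x', l')"]) (simp add: max_def)
  qed
qed

text \<open>
  For two base points, the matched branch gains the factor \<open>\<theta>1\<close> of \<open>gauge_contraction\<close>, while a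
  mismatch costs \<open>(1 + \<eta>) M\<close> instead of \<open>M\<close>; since a mismatch has probability at most a constant
  times the gauge of the distance, a small \<open>\<eta>\<close> still leaves the factor \<open>(1 + \<theta>1)/2\<close>. For points of
  different levels, both chains run independently until time \<open>t0 + k\<close>. With probability at least
  \<open>c\<^sup>2\<close> they are then both at the base, where the bound is \<open>M\<close> rather than \<open>(1 + \<eta>) M\<close>, and this
  gives the factor \<open>\<theta>2\<close>. Jumps longer than \<open>i\<close>, or levels above \<open>i\<close>, are estimated trivially by
  \<open>2 b\<close> or by \<open>apriori_closeness\<close> and produce the term \<open>C1 Q i\<close>.
\<close>

lemma profile_step:
  obtains \<eta> \<theta> C1 t0 where "0 < \<eta>" "0 \<le> \<theta>" "\<theta> < 1" "0 \<le> C1" "1 \<le> t0"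
    "\<And>n i M. 0 \<le> M \<Longrightarrow> profile \<eta> n M \<Longrightarrow> profile \<eta> (n + i + t0) (\<theta> * M + C1 * Q i)"
proof -
  obtain \<theta>1 where \<theta>1: "0 \<le> \<theta>1" "\<theta>1 < 1"
    "\<And>t. 0 \<le> t \<Longrightarrow> t \<le> D \<Longrightarrow> exp (- (C * t)) * gauge (t / L) + (1 - exp (- (C * t))) \<le> \<theta>1 * gauge t"
    by (rule gauge_contraction) blast
  obtain X where X: "0 \<le> X" "\<And>N y y'. y \<in> G \<Longrightarrow> y' \<in> G \<Longrightarrow> close N 0 (y, 0) (y', 0) (X * gauge (d y y'))"
    by (rule apriori_closeness) blast
  obtain c t1 where c: "0 < c" "c \<le> 1" "\<And>k y. t1 \<le> k \<Longrightarrow> y \<in> G \<Longrightarrow> c \<le> ren k y"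
    by (rule renewal_lower_bound) blast
  define t0 where "t0 = t1 + 1"
  define X2 where "X2 = C\<Phi> * gauge_slope + X"
  \<comment> \<open>chosen so that \<open>\<theta>1 + \<eta> C gauge_slope = (1 + \<theta>1)/2\<close>\<close>
  define \<eta> where "\<eta> = (1 - \<theta>1) / (2 * (C * gauge_slope))"
  have Cc0: "0 < C * gauge_slope" using C_pos gauge_slope_pos by simp
  have \<eta>: "0 < \<eta>" "\<eta> * (C * gauge_slope) = (1 - \<theta>1) / 2" using \<theta>1 C_pos gauge_slope_pos by (simp_all add: \<eta>_def)
  define \<theta>2 where "\<theta>2 = 1 - \<eta> * c\<^sup>2 / (1 + \<eta>)"
  define \<theta> where "\<theta> = max ((1 + \<theta>1) / 2) \<theta>2"
  have "0 < \<eta> * c\<^sup>2 / (1 + \<eta>)" using \<eta> c by simp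
  then have \<theta>: "0 \<le> \<theta>" "\<theta> < 1" using \<theta>1 by (simp_all add: \<theta>_def \<theta>2_def le_max_iff_disj)
  define C1 where "C1 = max (X2 + 6 * b * (C * gauge_slope)) (4 * b)"
  have C1: "0 \<le> C1" using b_nonneg by (auto simp: C1_def)
  have "profile \<eta> (n + i + t0) (\<theta> * M + C1 * Q i)" if M: "0 \<le> M" and P: "profile \<eta> n M" for n i M
    unfolding profile_def
  proof (intro conjI ballI allI)
    fix y y' assume y: "y \<in> G" "y' \<in> G"
    let ?d = "d y y'"
    let ?e = "exp (- (C * ?d))"
    have d: "0 \<le> ?d" "?d \<le> D" using d_nonneg d_le y by auto
    have h0: "0 \<le> gauge ?d" "0 \<le> gauge (?d / L)" "0 \<le> gauge (d (s a y) (s a y'))" for a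
      using d L_gt d_nonneg[OF s_in[OF y(1)] s_in[OF y(2)]] by (auto intro!: gauge_nonneg)
    have dh: "?d \<le> gauge_slope * gauge ?d" by (rule le_gauge[OF d])
    have Cd: "C\<Phi> * ?d \<le> C\<Phi> * gauge_slope * gauge ?d" using mult_left_mono[OF dh C\<Phi>_nonneg] by (simp add: mult_ac)
    have "C * ?d \<le> C * gauge_slope * gauge ?d" using mult_left_mono[OF dh, of C] C_pos by (simp add: mult.assoc)
    then have e3: "1 - ?e \<le> C * gauge_slope * gauge ?d" using one_minus_exp_le[of "C * ?d"] by linarith
    have e: "0 < ?e" "?e \<le> 1" "1 - ?e \<le> C * gauge_slope * gauge ?d" using d C_pos e3 by auto
    have hc: "gauge (d (s a y) (s a y')) \<le> gauge (?d / L)" for a by (intro gauge_mono contr y)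
    have hL: "gauge (?d / L) \<le> gauge ?d" using d L_gt by (intro gauge_mono) (auto simp: field_simps intro: mult_left_mono[of 1 L, simplified])
    have X2: "0 \<le> X2" using X C\<Phi>_nonneg gauge_slope_pos by (simp add: X2_def)
    \<comment> \<open>same branch, short jump: descend together and use the hypothesis at the contracted distance\<close>
    have m1: "close_all (n + i + t0 - 1) (s a y, r a - 1) (s a y', r a - 1) (M * gauge (?d / L))" if "r a \<le> i" for a
    proof -
      have "close_all n (s a y, 0) (s a y', 0) (M * gauge (d (s a y) (s a y')))"
        using P s_in[OF y(1)] s_in[OF y(2)] by (simp add: profile_def)
      then have "close_all n (s a y, r a - 1 - (r a - 1)) (s a y', r a - 1 - (r a - 1)) (M * gauge (?d / L))"
        using hc[of a] M by (auto intro: close_all_mono mult_left_mono)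
      from close_all_down[OF order_refl order_refl _ this] M h0
      have "close_all (n + (r a - 1)) (s a y, r a - 1) (s a y', r a - 1) (M * gauge (?d / L))" by simp
      then show ?thesis by (rule close_all_mono) (use that in \<open>auto simp: t0_def\<close>)
    qed
    \<comment> \<open>same branch, long jump: the a priori bound, which keeps the gauge as a factor\<close>
    have m2: "close_all k (s a y, r a - 1) (s a y', r a - 1) (X2 * gauge ?d)" for a k
    proof -
      have "close N 0 (s a y, r a - 1) (s a y', r a - 1) (X2 * gauge ?d)" for N
      proof (rule close_flight_matched[OF y])
        show "C\<Phi> * ?d \<le> X2 * gauge ?d" using Cd mult_nonneg_nonneg[OF X(1) h0(1)]
          unfolding X2_def distrib_right by linarith
        fix N'
        have "X * gauge (d (s a y) (s a y')) \<le> X2 * gauge ?d"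
          using hc[of a] hL X h0 C\<Phi>_nonneg gauge_slope_pos by (intro mult_mono) (auto simp: X2_def)
        then show "close N' 0 (s a y, 0) (s a y', 0) (X2 * gauge ?d)"
          by (rule close_mono[OF X(2)[OF s_in[OF y(1)] s_in[OF y(2)]]]) simp
      qed (use r_ge[of a] in simp)
      then show ?thesis unfolding close_all_def by (auto intro: close_mono)
    qed
    \<comment> \<open>different branches with short jumps\<close>
    have u1: "close_all (n + i + t0 - 1) (s a y, r a - 1) (s a' y', r a' - 1) ((1 + \<eta>) * M)" if "r a \<le> i" "r a' \<le> i" for a a'
      by (rule close_all_mono[OF profile_levels[OF P M less_imp_le[OF \<eta>(1)] s_in[OF y(1)] s_in[OF y(2)], where l = "r a - 1" and l' = "r a' - 1"]])
        (use that in \<open>auto simp: t0_def\<close>)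
    have V: "?e * (M * gauge (?d / L) + X2 * gauge ?d * T i) + (1 - ?e) * ((1 + \<eta>) * M + 2 * b * (3 * T i))
       \<le> (\<theta> * M + C1 * Q i) * gauge ?d"
    proof -
      have "M * (?e * gauge (?d / L) + (1 - ?e)) \<le> M * (\<theta>1 * gauge ?d)" using \<theta>1(3)[OF d] M by (intro mult_left_mono)
      moreover have "(1 - ?e) * (\<eta> * M) \<le> (C * gauge_slope * gauge ?d) * (\<eta> * M)" using e M \<eta> by (intro mult_right_mono) auto
      moreover have "(C * gauge_slope * gauge ?d) * (\<eta> * M) = (1 - \<theta>1) / 2 * M * gauge ?d" unfolding \<eta>(2)[symmetric] by (simp add: mult_ac)
      moreover have "?e * (X2 * gauge ?d * T i) \<le> 1 * (X2 * gauge ?d * Q i)"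
        using e X2 h0 T_nonneg[of i] T_le_Q[of i] Q_nonneg[of i] by (intro mult_mono) auto
      moreover have "(1 - ?e) * (6 * b * T i) \<le> (C * gauge_slope * gauge ?d) * (6 * b * Q i)"
        using e T_nonneg[of i] T_le_Q[of i] Q_nonneg[of i] b_nonneg Cc0 h0 by (intro mult_mono) auto
      ultimately have "?e * (M * gauge (?d / L) + X2 * gauge ?d * T i) + (1 - ?e) * ((1 + \<eta>) * M + 2 * b * (3 * T i))
         \<le> (1 + \<theta>1) / 2 * M * gauge ?d + (X2 + 6 * b * (C * gauge_slope)) * (Q i * gauge ?d)"
        by (simp add: algebra_simps add_divide_distrib diff_divide_distrib)
      also have "\<dots> \<le> \<theta> * M * gauge ?d + C1 * (Q i * gauge ?d)"
        using M h0 Q_nonneg[of i] by (intro add_mono mult_right_mono) (auto simp: \<theta>_def C1_def)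
      finally show ?thesis by (simp add: algebra_simps)
    qed
    show "close_all (n + i + t0) (y, 0) (y', 0) ((\<theta> * M + C1 * Q i) * gauge ?d)"
      unfolding close_all_def
    proof
      fix N
      show "close N (n + i + t0) (y, 0) (y', 0) ((\<theta> * M + C1 * Q i) * gauge ?d)"
      proof (cases N)
        case 0
        then show ?thesis using \<theta> M C1 Q_nonneg[of i] h0 by (intro close_vac) (auto simp: t0_def)
      next
        case (Suc N')
        show ?thesis unfolding Suc
        proof (rule close_base[OF y, where i = i and ?vm1.0 = "M * gauge (?d / L)" and ?vm2.0 = "X2 * gauge ?d"
              and ?vu1.0 = "(1 + \<eta>) * M" and ?vu2.0 = "2 * b"])
          fix a
          show "close N' (n + i + t0 - 1) (s a y, r a - 1) (s a y', r a - 1)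
             (if r a \<le> i then M * gauge (?d / L) else M * gauge (?d / L) + X2 * gauge ?d)"
          proof (cases "r a \<le> i")
            case True
            then show ?thesis using m1[of a] by (simp add: close_all_def)
          next
            case False
            have "close N' (n + i + t0 - 1) (s a y, r a - 1) (s a y', r a - 1) (X2 * gauge ?d)"
              using m2[of _ a] unfolding close_all_def by blast
            moreover have "X2 * gauge ?d \<le> M * gauge (?d / L) + X2 * gauge ?d" using M h0 by simp
            ultimately show ?thesis using False by (auto intro: close_mono)
          qed
          fix a'
          show "close N' (n + i + t0 - 1) (s a y, r a - 1) (s a' y', r a' - 1)
             (if r a \<le> i \<and> r a' \<le> i then (1 + \<eta>) * M else (1 + \<eta>) * M + 2 * b)"
            using u1[of a a'] M \<eta> by (auto simp: close_all_def intro: close_mono[OF close_trivial])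
        qed (use V M h0 X2 \<eta> b_nonneg in \<open>auto simp: t0_def\<close>)
      qed
    qed
  next
    fix y y' k assume y: "y \<in> G" "y' \<in> G"
    \<comment> \<open>the estimate after running both chains for \<open>t0 + k\<close> steps, according to where they are\<close>
    define v where "v = (\<lambda>(w :: 'a \<times> nat, w' :: 'a \<times> nat). if snd w = 0 \<and> snd w' = 0 then M
        else if snd w \<le> i \<and> snd w' \<le> i then (1 + \<eta>) * M else (1 + \<eta>) * M + 2 * b)"
    let ?q = "pair_pmf (iter (t0 + k) (y, 0)) (iter (t0 + k) (y', k))"
    let ?Z = "{z :: 'a \<times> nat. snd z = 0}" and ?W = "{z :: 'a \<times> nat. i < snd z}"
    have M': "M \<le> (1 + \<eta>) * M" using M \<eta> by (simp add: algebra_simps)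
    have "close_all (n + i + (t0 + k)) (y, 0) (y', k) (\<integral>x. v x \<partial>measure_pmf ?q)"
    proof (rule close_all_indep[where bv = "(1 + \<eta>) * M + 2 * b"])
      fix w w' :: "'a \<times> nat"
      show "0 \<le> v (w, w')" "v (w, w') \<le> (1 + \<eta>) * M + 2 * b"
        using M M' b_nonneg \<eta> by (auto simp: v_def)
      assume w: "fst w \<in> G" "fst w' \<in> G"
      show "close_all (n + i) w w' (v (w, w'))"
      proof (cases "snd w = 0 \<and> snd w' = 0")
        case True
        then have "w = (fst w, 0)" "w' = (fst w', 0)" by (cases w; cases w'; simp)+
        moreover have "close_all n (fst w, 0) (fst w', 0) (M * gauge (d (fst w) (fst w')))"
          using P w by (simp add: profile_def)
        moreover have "M * gauge (d (fst w) (fst w')) \<le> M * 1" using M gauge_le_1 by (intro mult_left_mono)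
        ultimately show ?thesis using True by (auto simp: v_def intro: close_all_mono)
      next
        case False
        show ?thesis
        proof (cases "snd w \<le> i \<and> snd w' \<le> i")
          case True
          have "close_all (n + max (snd w) (snd w')) (fst w, snd w) (fst w', snd w') ((1 + \<eta>) * M)"
            using \<eta> by (intro profile_levels[OF P M] w) simp
          then have "close_all (n + i) w w' ((1 + \<eta>) * M)" using True by (auto intro: close_all_mono)
          moreover have "v (w, w') = (1 + \<eta>) * M" using True \<open>\<not> (snd w = 0 \<and> snd w' = 0)\<close> by (auto simp: v_def)
          ultimately show ?thesis by simp
        next
          case False
          have "2 * b \<le> v (w, w')" using False M \<eta> by (auto simp: v_def)
          then show ?thesis by (rule close_all_mono[OF close_all_trivial]) (rule order_refl)
        qed
      qed
    qed (use y in auto)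
    moreover have "(\<integral>x. v x \<partial>measure_pmf ?q) \<le> (1 + \<eta>) * (\<theta> * M + C1 * Q i)"
    proof -
      let ?f = "\<lambda>x. (1 + \<eta>) * M - \<eta> * M * (indicator ?Z (fst x) * indicator ?Z (snd x))
          + 2 * b * (indicator ?W (fst x) * indicator UNIV (snd x) + indicator UNIV (fst x) * indicator ?W (snd x))"
      have int: "integrable (measure_pmf ?q) (\<lambda>x. indicator A (fst x) * indicator A' (snd x) :: real)" for A A'
        by (rule pmf_integrable_bdd[where b = 1]) (auto split: split_indicator)
      have vf: "v x \<le> ?f x" for x
        using M b_nonneg \<eta> M' by (auto simp: v_def case_prod_unfold algebra_simps split: split_indicator)
      have intv: "integrable (measure_pmf ?q) v"
        using M M' b_nonneg \<eta> by (intro pmf_integrable_bdd[where b = "(1 + \<eta>) * M + 2 * b"]) (auto simp: v_def)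
      have "(\<integral>x. v x \<partial>measure_pmf ?q) \<le> (\<integral>x. ?f x \<partial>measure_pmf ?q)"
        using int[of ?Z ?Z] int[of ?W UNIV] int[of UNIV ?W] intv vf by (intro integral_mono Bochner_Integration.integrable_add Bochner_Integration.integrable_diff integrable_mult_right) auto
      also have "\<dots> = (1 + \<eta>) * M - \<eta> * M * (\<integral>x. (indicator ?Z (fst x) * indicator ?Z (snd x)) \<partial>measure_pmf ?q)
          + 2 * b * ((\<integral>x. indicator ?W (fst x) * indicator UNIV (snd x) \<partial>measure_pmf ?q)
           + (\<integral>x. indicator UNIV (fst x) * indicator ?W (snd x) \<partial>measure_pmf ?q))"
        using int[of ?Z ?Z] int[of ?W UNIV] int[of UNIV ?W] by simp
      also have "\<dots> = (1 + \<eta>) * M - \<eta> * M * (measure_pmf.prob (iter (t0 + k) (y, 0)) ?Z * measure_pmf.prob (iter (t0 + k) (y', k)) ?Z)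
          + 2 * b * (measure_pmf.prob (iter (t0 + k) (y, 0)) ?W + measure_pmf.prob (iter (t0 + k) (y', k)) ?W)"
        unfolding pair_pmf_prob_prod by simp
      also have "\<dots> \<le> (1 + \<eta>) * M - \<eta> * M * (c * c) + 2 * b * (Q i + Q i)"
      proof -
        have it: "iter (t0 + k) (y', k) = iter t0 (y', 0)" by (metis add.commute iter_flight_add)
        have z: "c \<le> measure_pmf.prob (iter (t0 + k) (y, 0)) ?Z" "c \<le> measure_pmf.prob (iter (t0 + k) (y', k)) ?Z"
          using c(3)[of "t0 + k" y] c(3)[of t0 y'] y unfolding it by (auto simp: ren_def t0_def)
        have w: "measure_pmf.prob (iter (t0 + k) (y, 0)) ?W \<le> Q i" "measure_pmf.prob (iter (t0 + k) (y', k)) ?W \<le> Q i"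
          unfolding it using level_tail y by auto
        have "\<eta> * M * (c * c) \<le> \<eta> * M * (measure_pmf.prob (iter (t0 + k) (y, 0)) ?Z * measure_pmf.prob (iter (t0 + k) (y', k)) ?Z)"
          using z c M \<eta> by (intro mult_left_mono mult_mono) auto
        moreover have "2 * b * (measure_pmf.prob (iter (t0 + k) (y, 0)) ?W + measure_pmf.prob (iter (t0 + k) (y', k)) ?W) \<le> 2 * b * (Q i + Q i)"
          using w b_nonneg by (intro mult_left_mono add_mono) auto
        ultimately show ?thesis by linarith
      qed
      also have "\<dots> = (1 + \<eta>) * (\<theta>2 * M) + 4 * b * Q i"
        using \<eta> by (simp add: \<theta>2_def field_simps power2_eq_square)
      also have "\<dots> \<le> (1 + \<eta>) * (\<theta> * M) + (1 + \<eta>) * (C1 * Q i)"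
      proof (intro add_mono mult_left_mono)
        have "4 * b * Q i \<le> C1 * Q i" using Q_nonneg[of i] by (intro mult_right_mono) (auto simp: C1_def)
        also have "\<dots> \<le> (1 + \<eta>) * (C1 * Q i)" using \<eta> C1 Q_nonneg[of i] by (simp add: algebra_simps)
        finally show "4 * b * Q i \<le> (1 + \<eta>) * (C1 * Q i)" .
      qed (use M \<eta> in \<open>auto simp: \<theta>_def intro: mult_right_mono\<close>)
      finally show ?thesis by (simp add: algebra_simps)
    qed
    ultimately show "close_all (n + i + t0 + k) (y, 0) (y', k) ((1 + \<eta>) * (\<theta> * M + C1 * Q i))"
      by (auto simp: add.assoc intro: close_all_mono)
  qed
  then show ?thesis using that[of \<eta> \<theta> C1 t0] \<eta> \<theta> C1 by (simp add: t0_def)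
qed

text \<open>
  The claim \<open>profile \<eta> n (A \<Psi> n)\<close> is proved by strong induction with \<open>profile_step\<close>, taking \<open>i\<close>
  close to \<open>\<kappa> n\<close>. Then \<open>\<Psi> (n - i - t0)\<close> exceeds \<open>\<Psi> n\<close> by at most the factor \<open>(1 - 2 \<kappa>)\<^sup>-\<^sup>\<gamma>\<close>, which
  a small \<open>\<kappa>\<close> makes harmless against \<open>\<theta> < 1\<close>, and \<open>Q i\<close> is at most a constant times \<open>\<Psi> n\<close>. The
  constant \<open>A1\<close> covers the finitely many \<open>n\<close> below \<open>n0\<close>, and \<open>A2\<close> absorbs the inhomogeneous term.
\<close>

theorem coupling_rate:
  assumes pos: "\<And>n. 1 \<le> n \<Longrightarrow> 0 < \<Psi> n"
    and reg: "\<And>m n. 1 \<le> m \<Longrightarrow> m \<le> n \<Longrightarrow> \<Psi> m \<le> (real n / real m) powr \<gamma> * \<Psi> n"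
    and \<gamma>: "0 < \<gamma>" and Q: "\<And>n. 1 \<le> n \<Longrightarrow> Q n \<le> \<Psi> n"
  obtains A where "0 \<le> A" "\<And>n y y' l l'. 1 \<le> n \<Longrightarrow> y \<in> G \<Longrightarrow> y' \<in> G \<Longrightarrow>
     close_all (n + max l l') (y, l) (y', l') (A * \<Psi> n)"
proof -
  obtain \<eta> \<theta> C1 t0 where st: "0 < \<eta>" "0 \<le> \<theta>" "\<theta> < 1" "0 \<le> C1" "1 \<le> t0"
    "\<And>n i M. 0 \<le> M \<Longrightarrow> profile \<eta> n M \<Longrightarrow> profile \<eta> (n + i + t0) (\<theta> * M + C1 * Q i)"
    by (rule profile_step) blast
  obtain X where X: "0 \<le> X" "\<And>N y y'. y \<in> G \<Longrightarrow> y' \<in> G \<Longrightarrow> close N 0 (y, 0) (y', 0) (X * gauge (d y y'))"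
    by (rule apriori_closeness) blast
  have ev: "eventually (\<lambda>\<kappa>. (1 / (1 - 2 * \<kappa>)) powr \<gamma> * \<theta> < (1 + \<theta>) / 2) (at_right (0::real))"
  proof (rule order_tendstoD(2))
    show "((\<lambda>\<kappa>. (1 / (1 - 2 * \<kappa>)) powr \<gamma> * \<theta>) \<longlongrightarrow> (1 / (1 - 2 * 0)) powr \<gamma> * \<theta>) (at_right 0)"
      by (intro tendsto_intros) auto
    show "(1 / (1 - 2 * 0)) powr \<gamma> * \<theta> < (1 + \<theta>) / 2" using st by simp
  qed
  have "eventually (\<lambda>\<kappa>. 0 < \<kappa> \<and> \<kappa> < 1/4) (at_right (0::real))"
    unfolding eventually_at_right_field by (auto intro!: exI[of _ "1/4"])
  with ev obtain \<kappa> where \<kappa>: "0 < \<kappa>" "\<kappa> < 1/4" "(1 / (1 - 2 * \<kappa>)) powr \<gamma> * \<theta> < (1 + \<theta>) / 2"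
    using eventually_happens[OF eventually_conj[OF ev]] trivial_limit_at_right_real by blast
  \<comment> \<open>from \<open>n0\<close> on, rounding \<open>\<kappa> n\<close> and subtracting \<open>t0\<close> cost less than another \<open>\<kappa> n\<close>\<close>
  define n0 where "n0 = nat \<lceil>(real t0 + 2) / \<kappa>\<rceil>"
  have n0: "real t0 + 2 \<le> \<kappa> * real n" if "n0 \<le> n" for n
  proof -
    have "(real t0 + 2) / \<kappa> \<le> real n" using that unfolding n0_def by linarith
    then show ?thesis using \<kappa> by (simp add: field_simps)
  qed
  define A1 where "A1 = (\<Sum>n\<in>{1..n0}. (X + 2 * b) / \<Psi> n)"
  define A2 where "A2 = C1 * (2 / \<kappa>) powr \<gamma> / ((1 - \<theta>) / 2)"
  define A where "A = A1 + A2"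
  have A1: "0 \<le> A1" unfolding A1_def using X b_nonneg pos by (intro sum_nonneg divide_nonneg_nonneg) (auto intro: less_imp_le)
  have A2: "0 \<le> A2" unfolding A2_def using st by simp
  have A: "0 \<le> A" "A1 \<le> A" "A2 \<le> A" using A1 A2 by (auto simp: A_def)
  have main: "1 \<le> n \<Longrightarrow> profile \<eta> n (A * \<Psi> n)" for n
  proof (induction n rule: less_induct)
    case (less n)
    show ?case
    proof (cases "n < n0")
      case True
      have "(X + 2 * b) / \<Psi> n \<le> A1"
        unfolding A1_def
      proof (rule member_le_sum)
        fix k assume "k \<in> {1..n0} - {n}"
        then show "0 \<le> (X + 2 * b) / \<Psi> k" using X b_nonneg pos[of k] by simp
      qed (use True less.prems in auto)
      then have "(X + 2 * b) / \<Psi> n \<le> A" using A by linarith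
      then have le: "X + 2 * b \<le> A * \<Psi> n" using pos[OF less.prems] by (simp add: field_simps)
      show ?thesis unfolding profile_def
      proof (intro conjI ballI allI)
        fix y y' k assume y: "y \<in> G" "y' \<in> G"
        have "X * gauge (d y y') \<le> A * \<Psi> n * gauge (d y y')"
          using le b_nonneg d_nonneg[OF y] by (intro mult_right_mono gauge_nonneg) auto
        then show "close_all n (y, 0) (y', 0) (A * \<Psi> n * gauge (d y y'))"
          using X(2)[OF y] by (auto simp: close_all_def intro: close_mono)
        have "2 * b \<le> (1 + \<eta>) * (A * \<Psi> n)"
          using le X st(1) mult_nonneg_nonneg[OF less_imp_le[OF st(1)] mult_nonneg_nonneg[OF A(1) less_imp_le[OF pos[OF less.prems]]]]
          by (simp add: algebra_simps)
        then show "close_all (n + k) (y, 0) (y', k) ((1 + \<eta>) * (A * \<Psi> n))"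
          by (rule close_all_mono[OF close_all_trivial]) (rule order_refl)
      qed
    next
      case False
      define i where "i = nat \<lfloor>\<kappa> * real n\<rfloor>"
      define n' where "n' = n - i - t0"
      have kn: "real t0 + 2 \<le> \<kappa> * real n" using n0 False by simp
      have i: "real i \<le> \<kappa> * real n" "\<kappa> * real n / 2 \<le> real i" "1 \<le> i"
        using kn unfolding i_def by linarith+
      have "\<kappa> * real n \<le> 1/4 * real n" using \<kappa> by (intro mult_right_mono) auto
      then have it: "real i + real t0 < real n" using i kn less.prems by linarith
      then have n': "n = n' + i + t0" "1 \<le> n'" unfolding n'_def by linarith+
      have n'': "(1 - 2 * \<kappa>) * real n \<le> real n'" using n' i kn by (simp add: algebra_simps)
      have "n' < n" using n' st by simp
      then have "profile \<eta> n' (A * \<Psi> n')" using less.IH n' by simp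
      then have P: "profile \<eta> n (\<theta> * (A * \<Psi> n') + C1 * Q i)"
        using st(6)[of "A * \<Psi> n'" n' i] n' A pos[of n'] by simp
      have P1: "\<Psi> n' \<le> (1 / (1 - 2 * \<kappa>)) powr \<gamma> * \<Psi> n"
      proof -
        have "\<Psi> n' \<le> (real n / real n') powr \<gamma> * \<Psi> n" using n' by (intro reg) auto
        also have "\<dots> \<le> (1 / (1 - 2 * \<kappa>)) powr \<gamma> * \<Psi> n"
          using n'' n' \<kappa> \<gamma> pos[OF less.prems] by (intro mult_right_mono powr_mono2) (auto simp: field_simps)
        finally show ?thesis .
      qed
      have P2: "Q i \<le> (2 / \<kappa>) powr \<gamma> * \<Psi> n"
      proof -
        have "Q i \<le> \<Psi> i" using i by (intro Q)
        also have "\<dots> \<le> (real n / real i) powr \<gamma> * \<Psi> n" using i n' by (intro reg) auto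
        also have "\<dots> \<le> (2 / \<kappa>) powr \<gamma> * \<Psi> n"
          using i \<kappa> \<gamma> pos[OF less.prems] by (intro mult_right_mono powr_mono2) (auto simp: field_simps)
        finally show ?thesis .
      qed
      have "\<theta> * (A * \<Psi> n') + C1 * Q i \<le> \<theta> * (A * ((1 / (1 - 2 * \<kappa>)) powr \<gamma> * \<Psi> n)) + C1 * ((2 / \<kappa>) powr \<gamma> * \<Psi> n)"
        using P1 P2 st A by (intro add_mono mult_left_mono) auto
      also have "\<dots> = A * ((1 / (1 - 2 * \<kappa>)) powr \<gamma> * \<theta>) * \<Psi> n + A2 * ((1 - \<theta>) / 2) * \<Psi> n"
      proof -
        have "A2 * ((1 - \<theta>) / 2) = C1 * (2 / \<kappa>) powr \<gamma>" using st by (simp add: A2_def)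
        then show ?thesis by (simp only:) (simp add: mult_ac)
      qed
      also have "\<dots> \<le> A * ((1 + \<theta>) / 2) * \<Psi> n + A * ((1 - \<theta>) / 2) * \<Psi> n"
        using \<kappa>(3) A st pos[OF less.prems] by (intro add_mono mult_right_mono mult_left_mono) auto
      also have "\<dots> = A * \<Psi> n" by (simp add: field_simps)
      finally show ?thesis using P st by (intro profile_mono[OF P]) auto
    qed
  qed
  have "close_all (n + max l l') (y, l) (y', l') ((1 + \<eta>) * A * \<Psi> n)" if "1 \<le> n" "y \<in> G" "y' \<in> G" for n y y' l l'
    using profile_levels[OF main[OF that(1)], of y y' l l'] that pos[OF that(1)] A st by (simp add: mult.assoc)
  moreover have "0 \<le> (1 + \<eta>) * A" using A st by simp
  ultimately show ?thesis using that by blast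
qed

end

section \<open>Slowly varying functions\<close>

lemma slowly_varying_pos: "slowly_varying s \<Longrightarrow> 0 < x \<Longrightarrow> 0 < s x"
  by (simp add: slowly_varying_def)

text \<open>
  A weak form of the uniform convergence theorem, proved in the additive variable with
  \<open>g = ln \<circ> s \<circ> exp\<close>. If it failed, there would be \<open>t n \<rightarrow> \<infinity>\<close> and \<open>u n \<in> [0, 1]\<close> with
  \<open>g (t n) - g (t n + u n) > 2\<close>. The shifts \<open>v \<in> [0, 2]\<close> for which \<open>g\<close> changes by at most \<open>1\<close>
  between \<open>t n\<close> and \<open>t n + v\<close> eventually have measure above \<open>3/2\<close>, and so do those for
  \<open>t n + u n\<close>. Two such sets inside \<open>[0, 3]\<close> must meet, which gives a point that is within \<open>1\<close> of
  both values of \<open>g\<close>. Measurability of \<open>s\<close> enters here.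
\<close>

lemma slowly_varying_doubling:
  assumes s: "slowly_varying s"
  obtains C X where "1 \<le> C" "0 < X" "\<And>x y. X \<le> x \<Longrightarrow> x \<le> y \<Longrightarrow> y \<le> 2 * x \<Longrightarrow> s x \<le> C * s y"
proof -
  define g where "g t = ln (s (exp t))" for t
  have spos: "0 < s (exp t)" for t using s by (simp add: slowly_varying_def)
  have s_meas: "s \<in> borel_measurable (restrict_space borel {0<..})" using s by (simp add: slowly_varying_def)
  have "exp \<in> borel \<rightarrow>\<^sub>M restrict_space borel {0::real<..}"
    by (rule measurable_restrict_space2) auto
  from measurable_compose[OF this s_meas] have [measurable]: "g \<in> borel_measurable borel"
    unfolding g_def by measurable
  have g_lim: "(\<lambda>k. g (t k + u) - g (t k)) \<longlonglongrightarrow> 0" if t: "filterlim t at_top sequentially" for t u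
  proof -
    have "((\<lambda>x. s (exp u * x) / s x) \<longlongrightarrow> 1) at_top" using s by (simp add: slowly_varying_def)
    moreover have "filterlim (\<lambda>k. exp (t k)) at_top sequentially" by (rule filterlim_compose[OF exp_at_top t])
    ultimately have "(\<lambda>k. s (exp u * exp (t k)) / s (exp (t k))) \<longlonglongrightarrow> 1" by (rule filterlim_compose)
    then have "(\<lambda>k. ln (s (exp u * exp (t k)) / s (exp (t k)))) \<longlonglongrightarrow> ln 1" by (intro tendsto_ln) auto
    moreover have "ln (s (exp u * exp (t k)) / s (exp (t k))) = g (t k + u) - g (t k)" for k
      using spos[of "t k + u"] spos[of "t k"] by (simp add: g_def ln_div exp_add mult.commute)
    ultimately show ?thesis by simp
  qed
  have "\<exists>X>0. \<forall>x y. X \<le> x \<longrightarrow> x \<le> y \<longrightarrow> y \<le> 2 * x \<longrightarrow> s x \<le> exp 2 * s y"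
  proof (rule ccontr)
    assume "\<not> ?thesis"
    then have "\<forall>n::nat. \<exists>x y. exp (real n) \<le> x \<and> x \<le> y \<and> y \<le> 2 * x \<and> exp 2 * s y < s x"
      by (metis exp_gt_zero not_le)
    then obtain x y where xy: "\<And>n. exp (real n) \<le> x n" "\<And>n. x n \<le> y n" "\<And>n. y n \<le> 2 * x n"
      "\<And>n. exp 2 * s (y n) < s (x n)" by metis
    have xpos: "0 < x n" "0 < y n" for n using xy(1,2)[of n] by (auto intro: less_le_trans[OF exp_gt_zero] order_trans)
    define t u where "t n = ln (x n)" and "u n = ln (y n) - ln (x n)" for n
    have tn: "real n \<le> t n" for n using xy(1)[of n] xpos[of n] by (simp add: t_def ln_ge_iff)
    have u: "0 \<le> u n" "u n \<le> 1" for n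
    proof -
      show "0 \<le> u n" using xy(2)[of n] xpos[of n] by (simp add: u_def)
      have "ln (y n) \<le> ln (2 * x n)" using xy(3)[of n] xpos[of n] by simp
      also have "\<dots> = ln 2 + ln (x n)" using xpos[of n] by (simp add: ln_mult)
      finally show "u n \<le> 1" using ln_2_less_1 by (simp add: u_def)
    qed
    have gt: "g (t n) - g (t n + u n) > 2" for n
    proof -
      have "ln (exp 2 * s (y n)) < ln (s (x n))"
        using xy(4)[of n] slowly_varying_pos[OF s] xpos[of n] by simp
      then show ?thesis using xpos[of n] slowly_varying_pos[OF s, of "y n"] by (simp add: g_def t_def u_def ln_mult)
    qed
    have tlim: "filterlim t at_top sequentially"
      by (rule filterlim_at_top_mono[OF filterlim_real_sequentially]) (use tn in auto)
    have tulim: "filterlim (\<lambda>n. t n + u n) at_top sequentially"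
      by (rule filterlim_at_top_mono[OF tlim]) (use u in auto)
    have big: "\<exists>n. measure lebesgue {v \<in> {0..2}. \<forall>k\<ge>n. \<bar>g (\<tau> k + v) - g (\<tau> k)\<bar> \<le> 1} > 3/2
         \<and> {v \<in> {0..2}. \<forall>k\<ge>n. \<bar>g (\<tau> k + v) - g (\<tau> k)\<bar> \<le> 1} \<in> lmeasurable
         \<and> (\<forall>m\<ge>n. measure lebesgue {v \<in> {0..2}. \<forall>k\<ge>m. \<bar>g (\<tau> k + v) - g (\<tau> k)\<bar> \<le> 1} > 3/2
         \<and> {v \<in> {0..2}. \<forall>k\<ge>m. \<bar>g (\<tau> k + v) - g (\<tau> k)\<bar> \<le> 1} \<in> lmeasurable)"
      if \<tau>: "filterlim \<tau> at_top sequentially" for \<tau>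
    proof -
      define U where "U n = {v \<in> {0..2}. \<forall>k\<ge>n. \<bar>g (\<tau> k + v) - g (\<tau> k)\<bar> \<le> 1}" for n
      have Ub: "U n \<in> sets borel" for n unfolding U_def by measurable
      have Um: "U n \<in> lmeasurable" for n
        by (rule bounded_set_imp_lmeasurable) (use Ub[of n] in \<open>auto intro: bounded_subset[of "{0..2}"] simp: U_def\<close>)
      have "incseq U" by (auto simp: incseq_def U_def)
      have UU: "(\<Union>n. U n) = {0..2}"
      proof (intro equalityI subsetI)
        fix v :: real assume v: "v \<in> {0..2}"
        have "eventually (\<lambda>k. \<bar>g (\<tau> k + v) - g (\<tau> k)\<bar> < 1) sequentially"
          using tendstoD[OF g_lim[OF \<tau>, of v], of 1] by (simp add: dist_real_def)
        then obtain n where "\<forall>k\<ge>n. \<bar>g (\<tau> k + v) - g (\<tau> k)\<bar> < 1" by (auto simp: eventually_sequentially)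
        with v show "v \<in> (\<Union>n. U n)" by (auto simp: U_def intro!: exI[of _ n] less_imp_le)
      qed (auto simp: U_def)
      have "(\<lambda>n. measure lebesgue (U n)) \<longlonglongrightarrow> measure lebesgue (\<Union>n. U n)"
        using \<open>incseq U\<close> Um UU by (intro Lim_measure_incseq) (auto simp: fmeasurable_def)
      then have "(\<lambda>n. measure lebesgue (U n)) \<longlonglongrightarrow> 2" unfolding UU by simp
      then have "eventually (\<lambda>n. measure lebesgue (U n) > 3/2) sequentially" by (rule order_tendstoD) simp
      then obtain n where "\<forall>m\<ge>n. measure lebesgue (U m) > 3/2" by (auto simp: eventually_sequentially)
      with Um show ?thesis unfolding U_def[symmetric] by blast
    qed
    obtain n1 where n1: "\<And>m. m \<ge> n1 \<Longrightarrow> measure lebesgue {v \<in> {0..2}. \<forall>k\<ge>m. \<bar>g (t k + v) - g (t k)\<bar> \<le> 1} > 3/2"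
      "\<And>m. m \<ge> n1 \<Longrightarrow> {v \<in> {0..2}. \<forall>k\<ge>m. \<bar>g (t k + v) - g (t k)\<bar> \<le> 1} \<in> lmeasurable"
      using big[OF tlim] by blast
    obtain n2 where n2: "\<And>m. m \<ge> n2 \<Longrightarrow> measure lebesgue {v \<in> {0..2}. \<forall>k\<ge>m. \<bar>g ((t k + u k) + v) - g (t k + u k)\<bar> \<le> 1} > 3/2"
      "\<And>m. m \<ge> n2 \<Longrightarrow> {v \<in> {0..2}. \<forall>k\<ge>m. \<bar>g ((t k + u k) + v) - g (t k + u k)\<bar> \<le> 1} \<in> lmeasurable"
      using big[OF tulim] by blast
    define n where "n = max n1 n2"
    define U where "U = {v \<in> {0..2}. \<forall>k\<ge>n. \<bar>g (t k + v) - g (t k)\<bar> \<le> 1}"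
    define V where "V = {v \<in> {0..2}. \<forall>k\<ge>n. \<bar>g ((t k + u k) + v) - g (t k + u k)\<bar> \<le> 1}"
    define W where "W = (+) (u n) ` V"
    have n: "n1 \<le> n" "n2 \<le> n" by (simp_all add: n_def)
    have U: "measure lebesgue U > 3/2" "U \<in> lmeasurable" unfolding U_def by (rule n1[OF n(1)])+
    have V: "measure lebesgue V > 3/2" "V \<in> lmeasurable" unfolding V_def by (rule n2[OF n(2)])+
    have W: "measure lebesgue W > 3/2" "W \<in> lmeasurable"
    proof -
      have "measure lebesgue W = measure lebesgue V" unfolding W_def by (rule measure_translation)
      then show "measure lebesgue W > 3/2" using V by simp
      show "W \<in> lmeasurable" unfolding W_def using V(2) by (rule measurable_translation)
    qed
    have "U \<inter> W \<noteq> {}"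
    proof
      assume dis: "U \<inter> W = {}"
      have "measure lebesgue (U \<union> W) = measure lebesgue U + measure lebesgue W"
      proof -
        have "W - U = W" using dis by blast
        then show ?thesis using measure_Un2[OF U(2) W(2)] by simp
      qed
      moreover have "measure lebesgue (U \<union> W) \<le> measure lebesgue {0..3::real}"
      proof (rule measure_mono_fmeasurable)
        have "U \<subseteq> {0..3}" by (auto simp: U_def)
        moreover have "W \<subseteq> {0..3}"
        proof
          fix w assume "w \<in> W"
          then obtain v where "w = u n + v" "v \<in> {0..2}" unfolding W_def V_def by blast
          then show "w \<in> {0..3}" using u[of n] by simp
        qed
        ultimately show "U \<union> W \<subseteq> {0..3}" by blast
        show "U \<union> W \<in> sets lebesgue" using U W by blast
      qed simp
      ultimately show False using U W by simp
    qed
    then obtain v where "v \<in> V" "u n + v \<in> U" unfolding W_def by blast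
    then have "\<bar>g (t n + (u n + v)) - g (t n)\<bar> \<le> 1" "\<bar>g ((t n + u n) + v) - g (t n + u n)\<bar> \<le> 1"
      by (auto simp: U_def V_def)
    with gt[of n] show False by (simp add: add.assoc)
  qed
  then obtain X where "X > 0" "\<forall>x y. X \<le> x \<longrightarrow> x \<le> y \<longrightarrow> y \<le> 2 * x \<longrightarrow> s x \<le> exp 2 * s y" by blast
  then show ?thesis using that[of "exp 2" X] by auto
qed

text \<open>
  Potter's bound: iterate the doubling estimate along \<open>x, 2 x, 4 x, \<dots>\<close>. A power \<open>x\<^sup>a\<close> with
  \<open>2\<^sup>a \<ge> C\<close> compensates the constant \<open>C\<close> lost in each step, so only the last step loses it.
\<close>

lemma slowly_varying_potter:
  assumes s: "slowly_varying s"
  obtains C X e where "1 \<le> C" "0 < X" "0 \<le> e"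
    "\<And>x y a. e \<le> a \<Longrightarrow> X \<le> x \<Longrightarrow> x \<le> y \<Longrightarrow> x powr a * s x \<le> C * (y powr a * s y)"
proof -
  obtain C X where C: "1 \<le> C" "0 < X" "\<And>x y. X \<le> x \<Longrightarrow> x \<le> y \<Longrightarrow> y \<le> 2 * x \<Longrightarrow> s x \<le> C * s y"
    by (rule slowly_varying_doubling[OF s]) blast
  define e where "e = log 2 C"
  have e: "0 \<le> e" using C by (simp add: e_def)
  have step: "x powr a * s x \<le> C * (y powr a * s y)" 
    if "e \<le> a" "X \<le> x" "x \<le> y" "y \<le> 2 ^ j * x" for x y a j
    using that
  proof (induction j arbitrary: x)
    case 0
    then have "x = y" by simp
    then show ?case using C slowly_varying_pos[OF s, of y] 0
      by (smt (verit, best) mult_left_mono mult_nonneg_nonneg mult_cancel_right2 powr_ge_zero mult_right_mono)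
  next
    case (Suc j)
    have x: "0 < x" using Suc.prems C by linarith
    have sp: "0 < s x" "0 < s y" "0 < s (2 * x)" using x Suc.prems slowly_varying_pos[OF s] by auto
    show ?case
    proof (cases "y \<le> 2 * x")
      case True
      have "x powr a * s x \<le> y powr a * (C * s y)"
        using Suc.prems C(3)[of x y] True x e sp by (intro mult_mono powr_mono2) auto
      then show ?thesis by (simp add: mult_ac)
    next
      case False
      have C2: "C \<le> 2 powr a"
      proof -
        have "C = 2 powr e" using C by (simp add: e_def)
        also have "\<dots> \<le> 2 powr a" using Suc.prems by (intro powr_mono) auto
        finally show ?thesis .
      qed
      have "x powr a * s x \<le> x powr a * (C * s (2 * x))" using C(3)[of x "2*x"] Suc.prems x by (intro mult_left_mono) auto
      also have "\<dots> \<le> x powr a * (2 powr a * s (2 * x))" using C2 sp by (intro mult_left_mono mult_right_mono) auto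
      also have "\<dots> = (2 * x) powr a * s (2 * x)" using x by (simp add: powr_mult mult_ac)
      also have "\<dots> \<le> C * (y powr a * s y)"
        using Suc.prems False x by (intro Suc.IH) (auto simp: mult_ac)
      finally show ?thesis .
    qed
  qed
  have "x powr a * s x \<le> C * (y powr a * s y)" if "e \<le> a" "X \<le> x" "x \<le> y" for x y a
  proof -
    have x: "0 < x" using that C by linarith
    obtain j where "y / x < 2 ^ j" using real_arch_pow[of 2 "y / x"] by auto
    then have "y \<le> 2 ^ j * x" using x by (simp add: field_simps)
    then show ?thesis by (rule step[OF that])
  qed
  with C e that show ?thesis by blast
qed

text \<open>
  Take \<open>\<Psi> n = n\<^sup>-\<^sup>\<gamma> Max\<^bsub>k\<le>n\<^esub> k\<^bsup>\<gamma> + q\<^esup> s(k)\<close> with \<open>\<gamma> + q\<close> large. The maximum is nondecreasing,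
  which gives the regularity, and by Potter's bound it is comparable with its last term.
\<close>

lemma regular_majorant:
  assumes s: "slowly_varying s"
  obtains \<Psi> \<gamma> K where "0 < \<gamma>" "\<And>n. 1 \<le> n \<Longrightarrow> 0 < \<Psi> n"
    "\<And>m n. 1 \<le> m \<Longrightarrow> m \<le> n \<Longrightarrow> \<Psi> m \<le> (real n / real m) powr \<gamma> * \<Psi> n"
    "\<And>n. 1 \<le> n \<Longrightarrow> real n powr q * s (real n) \<le> \<Psi> n"
    "\<And>n. 1 \<le> n \<Longrightarrow> \<Psi> n \<le> K * (real n powr q * s (real n))"
proof -
  obtain C X e where C: "1 \<le> C" "0 < X" "0 \<le> e"
    "\<And>x y a. e \<le> a \<Longrightarrow> X \<le> x \<Longrightarrow> x \<le> y \<Longrightarrow> x powr a * s x \<le> C * (y powr a * s y)"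
    by (rule slowly_varying_potter[OF s]) blast
  define \<gamma> where "\<gamma> = max 1 (e - q)"
  define a where "a n = real n powr (\<gamma> + q) * s (real n)" for n
  have apos: "0 < a n" if "1 \<le> n" for n using slowly_varying_pos[OF s] that by (simp add: a_def)
  define N where "N = nat \<lceil>X\<rceil>"
  have N: "1 \<le> N" "X \<le> real N" using C by (auto simp: N_def) linarith+
  define S where "S = (\<Sum>j\<in>{1..N}. a j)"
  define S' where "S' = (\<Sum>j\<in>{1..N}. 1 / a j)"
  have S: "0 \<le> S" "0 \<le> S'" "\<And>j. 1 \<le> j \<Longrightarrow> j \<le> N \<Longrightarrow> a j \<le> S" "\<And>j. 1 \<le> j \<Longrightarrow> j \<le> N \<Longrightarrow> 1 / a j \<le> S'"
  proof -
    have nn: "0 \<le> a j" "0 \<le> 1 / a j" if "1 \<le> j" for j using apos[OF that] by auto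
    then show "0 \<le> S" "0 \<le> S'" unfolding S_def S'_def by (auto intro!: sum_nonneg)
    show "a j \<le> S" "1 / a j \<le> S'" if "1 \<le> j" "j \<le> N" for j
      unfolding S_def S'_def using nn that
      by (intro member_le_sum[of j "{1..N}"]; simp)+
  qed
  \<comment> \<open>Potter's bound only holds beyond \<open>N\<close>; \<open>S\<close> and \<open>S'\<close> compare the finitely many earlier terms\<close>
  define K where "K = C + S * S' * C + S * S'"
  have big: "a k \<le> C * a n" if "N \<le> k" "k \<le> n" for k n
    unfolding a_def using that N by (intro C(4)) (auto simp: \<gamma>_def)
  have K: "a k \<le> K * a n" if k: "1 \<le> k" "k \<le> n" for k n
  proof -
    have an: "0 < a n" using apos k by simp
    consider "N \<le> k" | "k < N" "N \<le> n" | "n < N" by linarith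
    then show ?thesis
    proof cases
      case 1
      have "C * a n \<le> K * a n" using S C an by (intro mult_right_mono) (auto simp: K_def)
      with big[OF 1 k(2)] show ?thesis by linarith
    next
      case 2
      have "a k \<le> S * 1" using S k 2 by simp
      also have "1 = 1 / a N * a N" using apos[OF N(1)] by simp
      also have "S * (1 / a N * a N) \<le> S * (S' * (C * a n))"
        using S N apos[OF N(1)] big[OF order_refl 2(2)] by (intro mult_left_mono mult_mono) auto
      also have "\<dots> \<le> K * a n" using S C an by (simp add: K_def algebra_simps)
      finally show ?thesis .
    next
      case 3
      have "a k \<le> S * 1" using S k 3 by simp
      also have "1 = 1 / a n * a n" using an by simp
      also have "S * (1 / a n * a n) \<le> S * (S' * a n)"
        using S k 3 an by (intro mult_left_mono mult_right_mono) auto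
      also have "\<dots> \<le> K * a n" using S C an by (simp add: K_def algebra_simps)
      finally show ?thesis .
    qed
  qed
  define \<Psi> where "\<Psi> n = real n powr (-\<gamma>) * Max (a ` {1..n})" for n
  have an: "real n powr (-\<gamma>) * a n = real n powr q * s (real n)" if "1 \<le> n" for n
    using that by (simp add: a_def powr_add[symmetric] mult.assoc[symmetric])
  show ?thesis
  proof (rule that)
    show "0 < \<gamma>" by (simp add: \<gamma>_def)
    fix n :: nat assume n: "1 \<le> n"
    have "a n \<le> Max (a ` {1..n})" using n by (intro Max_ge) auto
    then show 1: "real n powr q * s (real n) \<le> \<Psi> n" unfolding an[OF n, symmetric] \<Psi>_def by (intro mult_left_mono) auto
    have "Max (a ` {1..n}) \<le> K * a n" using n K by (subst Max_le_iff) auto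
    then have "\<Psi> n \<le> real n powr (-\<gamma>) * (K * a n)" unfolding \<Psi>_def by (intro mult_left_mono) auto
    then show "\<Psi> n \<le> K * (real n powr q * s (real n))" using an[OF n] by (simp add: mult_ac)
    have "0 < real n powr q * s (real n)" using n slowly_varying_pos[OF s] by simp
    with 1 show "0 < \<Psi> n" by linarith
  next
    fix m n :: nat assume mn: "1 \<le> m" "m \<le> n"
    have "Max (a ` {1..m}) \<le> Max (a ` {1..n})" using mn by (intro Max_mono) auto
    then have "\<Psi> m \<le> real m powr (-\<gamma>) * Max (a ` {1..n})" unfolding \<Psi>_def by (intro mult_left_mono) auto
    also have "real m powr (-\<gamma>) = (real n / real m) powr \<gamma> * real n powr (-\<gamma>)"
      using mn by (simp add: powr_divide powr_minus field_simps)
    finally show "\<Psi> m \<le> (real n / real m) powr \<gamma> * \<Psi> n" by (simp add: \<Psi>_def mult_ac)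
  qed
qed

text \<open>
  The direct half of Karamata's theorem, by dyadic blocks: on \<open>[2\<^sup>j n, 2\<^sup>j\<^sup>+\<^sup>1 n)\<close> the sum of \<open>H\<close>
  is at most \<open>n\<^sup>1\<^sup>-\<^sup>p s(n)\<close> times \<open>2\<^sup>j\<^sup>(\<^sup>1\<^sup>-\<^sup>p\<^sup>) 2\<^sup>j\<^sup>q\<close>, because \<open>s\<close> grows by less than \<open>2\<^sup>q\<close> per
  doubling. With \<open>q = (p - 1)/2\<close> the blocks form a geometric series.
\<close>

lemma tail_sum_slowly_varying:
  fixes H :: "nat \<Rightarrow> real"
  assumes s: "slowly_varying s" and p: "1 < p"
    and H: "\<And>n. 0 \<le> H n" "\<And>m n. m \<le> n \<Longrightarrow> H n \<le> H m"
    and le: "\<And>n. 1 \<le> n \<Longrightarrow> H n \<le> real n powr (-p) * s (real n)"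
  obtains K where "summable H" "0 \<le> K" "\<And>n. 1 \<le> n \<Longrightarrow> (\<Sum>i. H (i + n)) \<le> K * (real n powr (1 - p) * s (real n))"
proof -
  define q where "q = (p - 1) / 2"
  have q: "0 < q" using p by (simp add: q_def)
  have "((\<lambda>x. s (2 * x) / s x) \<longlongrightarrow> 1) at_top" using s by (simp add: slowly_varying_def)
  then have "eventually (\<lambda>x. s (2 * x) / s x < 2 powr q) at_top"
    by (rule order_tendstoD) (use q in simp)
  then obtain X where X: "\<And>x. X \<le> x \<Longrightarrow> s (2 * x) / s x < 2 powr q" by (auto simp: eventually_at_top_linorder)
  define N where "N = max 1 (nat \<lceil>X\<rceil>)"
  have N: "1 \<le> N" "X \<le> real N" by (auto simp: N_def) linarith
  have dbl: "s (2 ^ j * real n) \<le> (2 powr q) ^ j * s (real n)" if "N \<le> n" for j n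
  proof (induction j)
    case (Suc j)
    have "1 * real n \<le> 2 ^ j * real n" by (intro mult_right_mono) auto
    then have x: "X \<le> 2 ^ j * real n" "0 < 2 ^ j * real n" using N that by linarith+
    have "s (2 * (2 ^ j * real n)) \<le> 2 powr q * s (2 ^ j * real n)"
      using X[OF x(1)] slowly_varying_pos[OF s x(2)] by (simp add: field_simps)
    also have "\<dots> \<le> 2 powr q * ((2 powr q) ^ j * s (real n))" using Suc by (intro mult_left_mono) auto
    finally show ?case by (simp add: mult_ac)
  qed simp
  define \<rho> where "\<rho> = 2 powr (- q)"
  have \<rho>: "0 < \<rho>" "\<rho> < 1" using q powr_less_mono[of "-q" 0 2] by (auto simp: \<rho>_def)
  define A where "A n = real n powr (1 - p) * s (real n)" for n
  have Apos: "0 < A n" if "1 \<le> n" for n using that slowly_varying_pos[OF s] by (simp add: A_def)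
  have block: "(\<Sum>i\<in>{2^j*n..<2^(Suc j)*n}. H i) \<le> A n * \<rho> ^ j" if "N \<le> n" for j n
  proof -
    have n: "0 < n" using that N by simp
    have "(\<Sum>i\<in>{2^j*n..<2^(Suc j)*n}. H i) \<le> (\<Sum>i\<in>{2^j*n..<2^(Suc j)*n}. H (2^j*n))"
      by (intro sum_mono H) auto
    also have "\<dots> = 2 ^ j * real n * H (2^j*n)" by simp
    also have "\<dots> \<le> 2 ^ j * real n * (real (2^j*n) powr (-p) * s (real (2^j*n)))"
      using n by (intro mult_left_mono le) auto
    also have "\<dots> \<le> 2 ^ j * real n * (real (2^j*n) powr (-p) * ((2 powr q) ^ j * s (real n)))"
      using dbl[OF that, of j] by (intro mult_left_mono) auto
    also have "\<dots> = (2 ^ j * (2 ^ j) powr (-p) * (2 powr q) ^ j) * (real n * real n powr (-p) * s (real n))"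
      by (simp add: powr_mult mult_ac)
    also have "2 ^ j * (2 ^ j) powr (-p) * (2 powr q) ^ j = \<rho> ^ j"
    proof -
      have "(2::real) ^ j = 2 powr (real j)" by (simp add: powr_realpow)
      then have "2 ^ j * (2 ^ j) powr (-p) * (2 powr q) ^ j = 2 powr (real j + real j * (-p) + q * real j)"
        by (simp add: powr_powr powr_add powr_diff powr_minus_divide powr_power mult.commute)
      also have "real j + real j * (-p) + q * real j = - q * real j" by (simp add: q_def field_simps)
      also have "2 powr (- q * real j) = \<rho> ^ j" by (simp add: \<rho>_def powr_power mult.commute)
      finally show ?thesis .
    qed
    also have "real n * real n powr (-p) = real n powr (1 - p)"
      using n powr_add[of "real n" 1 "-p"] by simp
    finally show ?thesis by (simp add: A_def mult.commute)
  qed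
  have partial: "(\<Sum>i\<in>{n..<2^j*n}. H i) \<le> A n / (1 - \<rho>)" if "N \<le> n" for j n
  proof -
    have "(\<Sum>i\<in>{n..<2^j*n}. H i) = (\<Sum>k<j. \<Sum>i\<in>{2^k*n..<2^(Suc k)*n}. H i)"
    proof (induction j)
      case (Suc j)
      have "n \<le> 2^j*n" "2^j*n \<le> 2^(Suc j)*n" by auto
      then have "(\<Sum>i\<in>{n..<2^(Suc j)*n}. H i) = (\<Sum>i\<in>{n..<2^j*n}. H i) + (\<Sum>i\<in>{2^j*n..<2^(Suc j)*n}. H i)"
        by (rule sum.atLeastLessThan_concat[symmetric])
      then show ?case using Suc by simp
    qed simp
    also have "\<dots> \<le> (\<Sum>k<j. A n * \<rho> ^ k)" by (intro sum_mono block that)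
    also have "\<dots> = A n * ((1 - \<rho> ^ j) / (1 - \<rho>))" using \<rho> by (simp add: sum_distrib_left[symmetric] sum_gp_strict)
    also have "\<dots> \<le> A n * (1 / (1 - \<rho>))"
      using \<rho> Apos[of n] that N by (intro mult_left_mono divide_right_mono) auto
    finally show ?thesis by simp
  qed
  have shift: "summable (\<lambda>i. H (i + n)) \<and> (\<Sum>i. H (i + n)) \<le> A n / (1 - \<rho>)" if n: "N \<le> n" for n
  proof -
    have b: "(\<Sum>i<k. H (i + n)) \<le> A n / (1 - \<rho>)" for k
    proof -
      obtain j where j: "k + n \<le> 2 ^ j * n"
      proof -
        have "k + 1 \<le> 2 ^ (k + 1)" using less_exp[of "k + 1"] by simp
        then have "(k + 1) * n \<le> 2 ^ (k + 1) * n" by (rule mult_right_mono) simp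
        moreover have "k + n \<le> (k + 1) * n" using n N by (cases n) auto
        ultimately show ?thesis using that by (meson le_trans)
      qed
      have "(\<Sum>i<k. H (i + n)) = (\<Sum>i\<in>{n..<k + n}. H i)"
        by (rule sum.reindex_bij_witness[of _ "\<lambda>i. i - n" "\<lambda>i. i + n"]) auto
      also have "\<dots> \<le> (\<Sum>i\<in>{n..<2^j*n}. H i)" using j H by (intro sum_mono2) auto
      also have "\<dots> \<le> A n / (1 - \<rho>)" by (rule partial[OF n])
      finally show ?thesis .
    qed
    have sm: "summable (\<lambda>i. H (i + n))"
      by (rule summableI_nonneg_bounded[OF H(1) b])
    then show ?thesis using b by (auto intro!: suminf_le_const)
  qed
  then have sm: "summable H" using summable_iff_shift[of H N] by blast
  \<comment> \<open>the finitely many \<open>n < N\<close>, for which the total sum is used\<close>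
  define S where "S = (\<Sum>j\<in>{1..N}. 1 / A j)"
  define K where "K = 1 / (1 - \<rho>) + (\<Sum>i. H i) * S"
  have S0: "0 \<le> S" unfolding S_def using Apos by (intro sum_nonneg) (auto intro: less_imp_le)
  have K0: "0 \<le> K" unfolding K_def using \<rho> S0 suminf_nonneg[OF sm H(1)] by simp
  have "(\<Sum>i. H (i + n)) \<le> K * A n" if n: "1 \<le> n" for n
  proof (cases "N \<le> n")
    case True
    have "A n / (1 - \<rho>) \<le> K * A n" using Apos[OF n] S0 suminf_nonneg[OF sm H(1)] by (simp add: K_def algebra_simps)
    with shift[OF True] show ?thesis by linarith
  next
    case False
    have "(\<Sum>i. H (i + n)) = (\<Sum>i. H i) - (\<Sum>i<n. H i)" using suminf_split_initial_segment[OF sm, of n] by simp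
    also have "\<dots> \<le> (\<Sum>i. H i)" using H by (simp add: sum_nonneg)
    also have "\<dots> = (\<Sum>i. H i) * (1 / A n) * A n" using Apos[OF n] by simp
    also have "\<dots> \<le> (\<Sum>i. H i) * S * A n"
    proof (intro mult_right_mono mult_left_mono)
      have "0 \<le> 1 / A j" if "1 \<le> j" for j using Apos[OF that] by simp
      then show "1 / A n \<le> S" unfolding S_def using False n by (intro member_le_sum[of n "{1..N}"]) auto
    qed (use Apos[OF n] suminf_nonneg[OF sm H(1)] in auto)
    also have "\<dots> \<le> K * A n" using \<rho> Apos[OF n] by (simp add: K_def algebra_simps)
    finally show ?thesis .
  qed
  with sm K0 that show ?thesis by (auto simp: A_def)
qed

section \<open>Existence of regular conditional laws\<close>

text \<open>
  The defining identity integrated over the events of \<open>G\<close>. In this form conditional laws can be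
  compared by generators and transported along maps.
\<close>

lemma regular_cond_law_iff_integral:
  assumes M: "prob_space M" and G: "subalgebra M G" and Z: "Z \<in> M \<rightarrow>\<^sub>M N"
  shows "regular_cond_law M G N Z \<kappa> \<longleftrightarrow> \<kappa> \<in> G \<rightarrow>\<^sub>M prob_algebra N \<and>
     (\<forall>A\<in>sets G. \<forall>B\<in>sets N. (\<integral>\<^sup>+x\<in>A. emeasure (\<kappa> x) B \<partial>M) = emeasure M (A \<inter> (Z -` B \<inter> space M)))"
proof -
  interpret prob_space M by fact
  interpret finite_measure_subalgebra M G by unfold_locales fact
  have sG: "space G = space M" using G by (simp add: subalgebra_def)
  have GM: "A \<in> sets M" if "A \<in> sets G" for A using G that by (auto simp: subalgebra_def)
  show ?thesis unfolding regular_cond_law_def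
  proof (intro conj_cong refl)
    assume \<kappa>: "\<kappa> \<in> G \<rightarrow>\<^sub>M prob_algebra N"
    have \<kappa>p: "prob_space (\<kappa> x)" "sets (\<kappa> x) = sets N" if "x \<in> space M" for x
      using measurable_space[OF \<kappa>, of x] that by (auto simp: space_prob_algebra sG)
    have B: "(AE x in M. measure (\<kappa> x) B = real_cond_exp M G (indicator (Z -` B \<inter> space M)) x) \<longleftrightarrow>
       (\<forall>A\<in>sets G. (\<integral>\<^sup>+x\<in>A. emeasure (\<kappa> x) B \<partial>M) = emeasure M (A \<inter> (Z -` B \<inter> space M)))"
      if B[measurable]: "B \<in> sets N" for B
    proof -
      have ZB[measurable]: "Z -` B \<inter> space M \<in> sets M" using Z by (rule measurable_sets) fact
      have mG: "(\<lambda>x. measure (\<kappa> x) B) \<in> borel_measurable G"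
        using measurable_compose[OF \<kappa> measurable_measure_prob_algebra[OF B]] .
      have [measurable]: "(\<lambda>x. measure (\<kappa> x) B) \<in> borel_measurable M"
        by (rule measurable_from_subalg[OF G mG])
      have i1: "integrable M (\<lambda>x. measure (\<kappa> x) B)"
        using \<kappa>p(1) by (intro integrable_const_bound[where B = 1]) (auto intro!: AE_I2 prob_space.prob_le_1)
      have i2: "integrable M (indicator (Z -` B \<inter> space M) :: _ \<Rightarrow> real)"
        by (intro integrable_real_indicator ZB) (simp add: less_top[symmetric])
      have int: "(\<integral>\<^sup>+x\<in>A. emeasure (\<kappa> x) B \<partial>M) = ennreal (\<integral>x\<in>A. measure (\<kappa> x) B \<partial>M)" if "A \<in> sets G" for A
      proof -
        have [measurable]: "A \<in> sets M" by (rule GM[OF that])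
        have "(\<integral>\<^sup>+x\<in>A. emeasure (\<kappa> x) B \<partial>M) = (\<integral>\<^sup>+x. ennreal (indicator A x *\<^sub>R measure (\<kappa> x) B) \<partial>M)"
        proof (rule nn_integral_cong)
          fix x assume "x \<in> space M"
          then interpret K: prob_space "\<kappa> x" by (rule \<kappa>p)
          show "emeasure (\<kappa> x) B * indicator A x = ennreal (indicator A x *\<^sub>R measure (\<kappa> x) B)"
            by (simp add: K.emeasure_eq_measure split: split_indicator)
        qed
        also have "\<dots> = ennreal (\<integral>x\<in>A. measure (\<kappa> x) B \<partial>M)"
          unfolding set_lebesgue_integral_def using i1
          by (intro nn_integral_eq_integral integrable_mult_indicator) auto
        finally show ?thesis .
      qed
      have ind: "(\<integral>x\<in>A. indicator (Z -` B \<inter> space M) x \<partial>M) = measure M (A \<inter> (Z -` B \<inter> space M))" if "A \<in> sets G" for A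
        using GM[OF that] by (simp add: set_lebesgue_integral_def indicator_inter_arith[symmetric])
      have "(AE x in M. measure (\<kappa> x) B = real_cond_exp M G (indicator (Z -` B \<inter> space M)) x) \<longleftrightarrow>
         (\<forall>A\<in>sets G. (\<integral>x\<in>A. measure (\<kappa> x) B \<partial>M) = measure M (A \<inter> (Z -` B \<inter> space M)))"
      proof
        assume ae: "AE x in M. measure (\<kappa> x) B = real_cond_exp M G (indicator (Z -` B \<inter> space M)) x"
        show "\<forall>A\<in>sets G. (\<integral>x\<in>A. measure (\<kappa> x) B \<partial>M) = measure M (A \<inter> (Z -` B \<inter> space M))"
        proof
          fix A assume A: "A \<in> sets G"
          have "(\<integral>x\<in>A. measure (\<kappa> x) B \<partial>M) = (\<integral>x\<in>A. real_cond_exp M G (indicator (Z -` B \<inter> space M)) x \<partial>M)"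
            unfolding set_lebesgue_integral_def
            by (rule integral_cong_AE) (use ae GM[OF A] in auto)
          then show "(\<integral>x\<in>A. measure (\<kappa> x) B \<partial>M) = measure M (A \<inter> (Z -` B \<inter> space M))"
            using real_cond_exp_intA[OF i2 A] ind[OF A] by simp
        qed
      next
        assume "\<forall>A\<in>sets G. (\<integral>x\<in>A. measure (\<kappa> x) B \<partial>M) = measure M (A \<inter> (Z -` B \<inter> space M))"
        then have "AE x in M. real_cond_exp M G (indicator (Z -` B \<inter> space M)) x = measure (\<kappa> x) B"
          using ind by (intro real_cond_exp_charact i1 i2 mG) auto
        then show "AE x in M. measure (\<kappa> x) B = real_cond_exp M G (indicator (Z -` B \<inter> space M)) x" by auto
      qed
      then show ?thesis using int
        by (simp add: emeasure_eq_measure set_lebesgue_integral_def integral_nonneg_AE)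
    qed
    show "(\<forall>B\<in>sets N. AE x in M. measure (\<kappa> x) B = real_cond_exp M G (indicator (Z -` B \<inter> space M)) x) \<longleftrightarrow>
      (\<forall>A\<in>sets G. \<forall>B\<in>sets N. (\<integral>\<^sup>+x\<in>A. emeasure (\<kappa> x) B \<partial>M) = emeasure M (A \<inter> (Z -` B \<inter> space M)))"
      using B by blast
  qed
qed

text \<open>
  The classical construction by distribution functions: choose versions \<open>c q\<close> of the conditional
  probabilities of \<open>W \<le> q\<close> for rational \<open>q\<close>. On an event of full measure they are monotone in \<open>q\<close>
  and take the right values outside \<open>[0, 1)\<close>, and their right-continuous regularisation \<open>F x\<close> is a
  distribution function. Values of \<open>W\<close> in \<open>[0, 1]\<close> make the limits at \<open>\<plusminus>\<infinity>\<close> automatic.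
\<close>

lemma regular_cond_law_unit_interval:
  fixes W :: "'a \<Rightarrow> real"
  assumes M: "prob_space M" and G: "subalgebra M G" and W: "W \<in> borel_measurable M"
    and W01: "\<And>x. x \<in> space M \<Longrightarrow> 0 \<le> W x \<and> W x \<le> 1"
  shows "\<exists>\<kappa>. regular_cond_law M G borel W \<kappa>"
proof -
  interpret prob_space M by fact
  interpret finite_measure_subalgebra M G by unfold_locales fact
  have sG: "space G = space M" using G by (simp add: subalgebra_def)
  have GM: "A \<in> sets M" if "A \<in> sets G" for A using G that by (auto simp: subalgebra_def)
  note W[measurable]
  define I where "I t = (indicator {x \<in> space M. W x \<le> t} :: 'a \<Rightarrow> real)" for t
  have Iint: "integrable M (I t)" for t
    unfolding I_def by (intro integrable_real_indicator) (auto simp: less_top[symmetric])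
  define c where "c t x = max 0 (real_cond_exp M G (I t) x)" for t x
  have c_meas[measurable]: "c t \<in> borel_measurable G" for t unfolding c_def by measurable
  have c_measM[measurable]: "c t \<in> borel_measurable M" for t
    by (rule measurable_from_subalg[OF G c_meas])
  have c_ae: "AE x in M. c t x = real_cond_exp M G (I t) x" for t
  proof -
    have "AE x in M. 0 \<le> real_cond_exp M G (I t) x"
      by (rule real_cond_exp_pos) (auto simp: I_def)
    then show ?thesis by eventually_elim (simp add: c_def)
  qed
  have c_mono: "AE x in M. c t x \<le> c t' x" if "t \<le> t'" for t t'
  proof -
    have "AE x in M. real_cond_exp M G (I t) x \<le> real_cond_exp M G (I t') x"
      by (rule real_cond_exp_mono[OF _ Iint Iint]) (use that in \<open>auto simp: I_def split: split_indicator\<close>)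
    then show ?thesis by eventually_elim (auto simp: c_def)
  qed
  have c_lo: "AE x in M. c t x = 0" if "t < 0" for t
  proof -
    have "I t = (\<lambda>x. 0)" using W01 that by (force simp: I_def fun_eq_iff split: split_indicator)
    then have "AE x in M. real_cond_exp M G (I t) x = 0" using real_cond_exp_F_meas[of "\<lambda>x. 0"] by simp
    then show ?thesis by eventually_elim (simp add: c_def)
  qed
  have c_hi: "AE x in M. c t x = 1" if "1 \<le> t" for t
  proof -
    have "AE x in M. real_cond_exp M G (I t) x = 1"
    proof (rule real_cond_exp_charact[OF _ Iint])
      fix A assume "A \<in> sets G"
      show "(\<integral>x\<in>A. I t x \<partial>M) = (\<integral>x\<in>A. 1 \<partial>M)"
        unfolding set_lebesgue_integral_def
        by (rule Bochner_Integration.integral_cong) (use W01 that in \<open>auto simp: I_def split: split_indicator\<close>, force)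
    qed auto
    then show ?thesis by eventually_elim (simp add: c_def)
  qed
  define good where "good = {x \<in> space G. (\<forall>q q' :: rat. q \<le> q' \<longrightarrow> c (of_rat q) x \<le> c (of_rat q') x) \<and>
     (\<forall>q :: rat. q < 0 \<longrightarrow> c (of_rat q) x = 0) \<and> (\<forall>q :: rat. 1 \<le> q \<longrightarrow> c (of_rat q) x = 1)}"
  have good_meas[measurable]: "good \<in> sets G" unfolding good_def by measurable
  have good_ae: "AE x in M. x \<in> good"
  proof -
    have "AE x in M. \<forall>q q' :: rat. q \<le> q' \<longrightarrow> c (of_rat q) x \<le> c (of_rat q') x"
      unfolding AE_all_countable
    proof (intro allI)
      fix q q' :: rat
      show "AE x in M. q \<le> q' \<longrightarrow> c (of_rat q) x \<le> c (of_rat q') x"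
        using c_mono[of "of_rat q" "of_rat q'"] by (cases "q \<le> q'") (auto simp: of_rat_less_eq)
    qed
    moreover have "AE x in M. \<forall>q :: rat. q < 0 \<longrightarrow> c (of_rat q) x = 0"
      unfolding AE_all_countable
    proof
      fix q :: rat
      show "AE x in M. q < 0 \<longrightarrow> c (of_rat q) x = 0"
        using c_lo[of "of_rat q"] by (cases "q < 0") auto
    qed
    moreover have "AE x in M. \<forall>q :: rat. 1 \<le> q \<longrightarrow> c (of_rat q) x = 1"
      unfolding AE_all_countable
    proof
      fix q :: rat
      show "AE x in M. 1 \<le> q \<longrightarrow> c (of_rat q) x = 1"
        using c_hi[of "of_rat q"] by (cases "1 \<le> q") auto
    qed
    ultimately show ?thesis using AE_space by eventually_elim (simp add: good_def sG)
  qed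
  define F where "F x (t :: real) = (INF q\<in>{q :: rat. t < of_rat q}. c (of_rat q) x)" for x t
  have c0: "0 \<le> c t x" for t x by (simp add: c_def)
  have bdd: "bdd_below ((\<lambda>q :: rat. c (of_rat q) x) ` S)" for S x
    by (rule bdd_belowI2[where m = 0]) (simp add: c0)
  have ne: "{q :: rat. t < of_rat q} \<noteq> {}" for t :: real
  proof -
    obtain q :: rat where "t < of_rat q" using of_rat_dense[of t "t + 1"] by auto
    then show ?thesis by auto
  qed
  have Fle: "F x t \<le> c (of_rat q) x" if "t < of_rat q" for x t q
    unfolding F_def using that by (intro cINF_lower bdd) auto
  have F0: "0 \<le> F x t" for x t unfolding F_def using ne[of t] c0 by (intro cINF_greatest) auto
  have F_mono: "F x t \<le> F x t'" if "t \<le> t'" for x t t'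
    unfolding F_def using that by (intro cINF_superset_mono ne bdd) auto
  have F_less: "\<exists>q. t < of_rat q \<and> c (of_rat q) x < F x t + e" if "0 < e" for e x t
  proof -
    have "F x t < F x t + e" using that by simp
    then show ?thesis unfolding F_def[of x t] by (subst (asm) cINF_less_iff[OF ne bdd]) auto
  qed
  have F_rc: "continuous (at_right t) (F x)" for x t
  proof (subst continuous_at_right_real_increasing)
    show "\<And>x' y. x' \<le> y \<Longrightarrow> F x x' \<le> F x y" by (rule F_mono)
    show "\<forall>e>0. \<exists>d>0. F x (t + d) - F x t < e"
    proof (intro allI impI)
      fix e :: real assume "0 < e"
      then obtain q where q: "t < of_rat q" "c (of_rat q) x < F x t + e" using F_less by blast
      define d where "d = (of_rat q - t) / 2"
      have "0 < d" "t + d < of_rat q" using q by (auto simp: d_def field_simps)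
      moreover from this have "F x (t + d) \<le> c (of_rat q) x" by (intro Fle)
      ultimately show "\<exists>d>0. F x (t + d) - F x t < e" using q by (auto intro!: exI[of _ d])
    qed
  qed
  have F_lo: "F x t = 0" if xg: "x \<in> good" and t0: "t < 0" for x t
  proof -
    obtain q where "t < of_rat q" "of_rat q < (0::real)" using of_rat_dense[OF t0] by blast
    moreover from this have "c (of_rat q) x = 0" using xg by (auto simp: good_def)
    ultimately show ?thesis using Fle[of t q x] F0[of x t] by simp
  qed
  have F_hi: "F x t = 1" if "x \<in> good" "1 \<le> t" for x t
  proof -
    have "c (of_rat q) x = 1" if "t < of_rat q" for q
    proof -
      have "1 < (of_rat q :: real)" using that \<open>1 \<le> t\<close> by linarith
      then have "1 \<le> q" by simp
      then show ?thesis using \<open>x \<in> good\<close> by (auto simp: good_def)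
    qed
    then show ?thesis unfolding F_def using ne by (subst INF_cong[OF refl, where D = "\<lambda>_. 1"]) auto
  qed
  define \<kappa> where "\<kappa> x = (if x \<in> good then interval_measure (F x) else return borel 0)" for x
  have bot: "(F x \<longlongrightarrow> 0) at_bot" if "x \<in> good" for x
    by (rule tendsto_eventually) (use F_lo[OF that] in \<open>auto simp: eventually_at_bot_dense\<close>)
  have top: "(F x \<longlongrightarrow> 1) at_top" if "x \<in> good" for x
    by (rule tendsto_eventually) (use F_hi[OF that] in \<open>auto simp: eventually_at_top_linorder\<close>)
  have \<kappa>Iic: "emeasure (\<kappa> x) {..t} = ennreal (F x t)" if "x \<in> good" for x t
    unfolding \<kappa>_def using that emeasure_interval_measure_Iic[OF F_mono F_rc bot[OF that]] by simp
  have \<kappa>p: "prob_space (\<kappa> x)" for x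
    using real_distribution_interval_measure[OF F_mono F_rc bot top, of x]
    by (auto simp: \<kappa>_def real_distribution_def intro: prob_space_return)
  have F_meas[measurable]: "(\<lambda>x. F x t) \<in> borel_measurable G" for t
    unfolding F_def by (rule borel_measurable_cINF) (auto simp: bdd)
  have \<kappa>_meas: "\<kappa> \<in> G \<rightarrow>\<^sub>M prob_algebra borel"
  proof (rule measurable_prob_algebra_generated[where \<Omega> = UNIV and G = "range atMost"])
    show "sets borel = sigma_sets UNIV (range (atMost :: real \<Rightarrow> real set))"
      by (simp add: borel_eq_atMost)
    show "Int_stable (range (atMost :: real \<Rightarrow> _))" by (auto simp: Int_stable_def)
    fix A assume "A \<in> range (atMost :: real \<Rightarrow> _)"
    then obtain t where A: "A = {..t}" by auto
    have "(\<lambda>a. emeasure (\<kappa> a) A) \<in> borel_measurable G \<longleftrightarrow>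
      (\<lambda>x. if x \<in> good then ennreal (F x t) else emeasure (return borel 0) {..t}) \<in> borel_measurable G"
      by (rule measurable_cong) (auto simp: A \<kappa>Iic, simp add: \<kappa>_def)
    also have "\<dots>" by measurable
    finally show "(\<lambda>a. emeasure (\<kappa> a) A) \<in> borel_measurable G" .
  next
    show "sets (\<kappa> x) = sets borel" for x by (simp add: \<kappa>_def)
  qed (use \<kappa>p in simp_all)
  \<comment> \<open>\<open>{..t}\<close> is approached through rationals decreasing to \<open>t\<close>, on both sides of the identity\<close>
  have key: "(\<integral>\<^sup>+x\<in>A. emeasure (\<kappa> x) {..t} \<partial>M) = emeasure M (A \<inter> {x \<in> space M. W x \<le> t})"
    if A: "A \<in> sets G" for A t
  proof -
    have [measurable]: "A \<in> sets M" by (rule GM[OF A])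
    obtain q :: "nat \<Rightarrow> rat" where q: "\<And>n. t < of_rat (q n)" "\<And>n. of_rat (q n) < t + 1 / Suc n"
    proof -
      have "\<forall>n. \<exists>q :: rat. t < of_rat q \<and> of_rat q < t + 1 / Suc n" by (intro allI of_rat_dense) simp
      then show ?thesis using that by metis
    qed
    have qlim: "(\<lambda>n. of_rat (q n) :: real) \<longlonglongrightarrow> t"
    proof (rule tendsto_sandwich[of "\<lambda>_. t" _ _ "\<lambda>n. t + 1 / Suc n"])
      show "(\<lambda>n. t + 1 / Suc n) \<longlonglongrightarrow> t"
        using tendsto_add[OF tendsto_const[of t] LIMSEQ_inverse_real_of_nat] by (simp add: inverse_eq_divide)
    qed (auto intro!: always_eventually less_imp_le q simp del: of_nat_Suc)
    have lim1: "(\<lambda>n. c (of_rat (q n)) x) \<longlonglongrightarrow> F x t" if "x \<in> good" for x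
    proof (rule LIMSEQ_I)
      fix e :: real assume "0 < e"
      then obtain r where r: "t < of_rat r" "c (of_rat r) x < F x t + e" using F_less by blast
      have "eventually (\<lambda>n. of_rat (q n) < (of_rat r :: real)) sequentially" using qlim r(1) by (rule order_tendstoD)
      then obtain N where N: "\<And>n. n \<ge> N \<Longrightarrow> of_rat (q n) < (of_rat r :: real)" by (auto simp: eventually_sequentially)
      have "norm (c (of_rat (q n)) x - F x t) < e" if n: "n \<ge> N" for n
      proof -
        have "q n \<le> r" using N[OF n] by (simp add: of_rat_less)
        then have "c (of_rat (q n)) x \<le> c (of_rat r) x" using \<open>x \<in> good\<close> by (auto simp: good_def)
        then show ?thesis using r Fle[OF q(1)[of n], of x] by simp
      qed
      then show "\<exists>N. \<forall>n\<ge>N. norm (c (of_rat (q n)) x - F x t) < e" by blast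
    qed
    have c1: "c (of_rat r) x \<le> 1" if "x \<in> good" for r x
    proof -
      have "\<forall>q q' :: rat. q \<le> q' \<longrightarrow> c (of_rat q) x \<le> c (of_rat q') x"
        "\<forall>q :: rat. 1 \<le> q \<longrightarrow> c (of_rat q) x = 1" using that by (auto simp: good_def)
      then have "c (of_rat r) x \<le> c (of_rat (max r 1)) x" "c (of_rat (max r 1)) x = 1"
        by (meson max.cobounded1 max.cobounded2)+
      then show ?thesis by linarith
    qed
    have FM[measurable]: "(\<lambda>x. F x t) \<in> borel_measurable M" by (rule measurable_from_subalg[OF G F_meas])
    have L1: "(\<lambda>n. \<integral>x. indicator A x * c (of_rat (q n)) x \<partial>M) \<longlonglongrightarrow> (\<integral>x. indicator A x * F x t \<partial>M)"
    proof (rule integral_dominated_convergence[where w = "\<lambda>_. 1"])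
      show "AE x in M. (\<lambda>n. indicator A x * c (of_rat (q n)) x) \<longlonglongrightarrow> indicator A x * F x t"
        using good_ae by eventually_elim (intro tendsto_intros lim1)
      show "AE x in M. norm (indicator A x * c (of_rat (q n)) x) \<le> 1" for n
        using good_ae by eventually_elim (use c0 c1 in \<open>auto split: split_indicator\<close>)
    qed auto
    have L2: "(\<lambda>n. \<integral>x. indicator A x * I (of_rat (q n)) x \<partial>M) \<longlonglongrightarrow> (\<integral>x. indicator A x * I t x \<partial>M)"
    proof (rule integral_dominated_convergence[where w = "\<lambda>_. 1"])
      show "AE x in M. (\<lambda>n. indicator A x * I (of_rat (q n)) x) \<longlonglongrightarrow> indicator A x * I t x"
      proof (rule AE_I2, intro tendsto_intros)
        fix x assume x: "x \<in> space M"
        show "(\<lambda>n. I (of_rat (q n)) x) \<longlonglongrightarrow> I t x"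
        proof (cases "W x \<le> t")
          case True
          then have "I (of_rat (q n)) x = I t x" for n using q(1)[of n] by (auto simp: I_def split: split_indicator)
          then show ?thesis by simp
        next
          case False
          then have "eventually (\<lambda>n. of_rat (q n) < W x) sequentially" by (intro order_tendstoD[OF qlim]) auto
          then have "eventually (\<lambda>n. I (of_rat (q n)) x = I t x) sequentially"
            by eventually_elim (use False in \<open>auto simp: I_def split: split_indicator\<close>)
          then show ?thesis by (rule tendsto_eventually)
        qed
      qed
    qed (auto simp: I_def split: split_indicator)
    have eq: "(\<integral>x. indicator A x * c r x \<partial>M) = (\<integral>x. indicator A x * I r x \<partial>M)" for r
    proof -
      have "(\<integral>x. indicator A x * c r x \<partial>M) = (\<integral>x. indicator A x * real_cond_exp M G (I r) x \<partial>M)"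
        by (rule integral_cong_AE) (use c_ae[of r] in auto)
      then show ?thesis using real_cond_exp_intA[OF Iint A, of r] by (simp add: set_lebesgue_integral_def)
    qed
    have "(\<integral>x. indicator A x * F x t \<partial>M) = (\<integral>x. indicator A x * I t x \<partial>M)"
      using LIMSEQ_unique[OF L1] L2 unfolding eq by blast
    also have "\<dots> = measure M (A \<inter> {x \<in> space M. W x \<le> t})"
      by (simp add: I_def indicator_inter_arith[symmetric])
    finally have 1: "(\<integral>x. indicator A x * F x t \<partial>M) = measure M (A \<inter> {x \<in> space M. W x \<le> t})" .
    have "(\<integral>\<^sup>+x\<in>A. emeasure (\<kappa> x) {..t} \<partial>M) = (\<integral>\<^sup>+x. ennreal (indicator A x * F x t) \<partial>M)"
      by (rule nn_integral_cong_AE) (use good_ae in \<open>auto simp: \<kappa>Iic split: split_indicator\<close>)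
    also have "\<dots> = ennreal (\<integral>x. indicator A x * F x t \<partial>M)"
    proof (rule nn_integral_eq_integral)
      have "AE x in M. F x t \<le> 1"
        using good_ae
      proof eventually_elim
        case (elim x)
        have "F x t \<le> F x (max t 1)" by (rule F_mono) simp
        then show ?case using F_hi[OF elim, of "max t 1"] by simp
      qed
      then show "integrable M (\<lambda>x. indicator A x * F x t)"
        by (intro integrable_const_bound[where B = 1]) (auto split: split_indicator simp: F0)
    qed (auto simp: F0)
    finally show ?thesis unfolding 1 by (simp add: emeasure_eq_measure)
  qed
  have "(\<integral>\<^sup>+x\<in>A. emeasure (\<kappa> x) B \<partial>M) = emeasure M (A \<inter> (W -` B \<inter> space M))"
    if A: "A \<in> sets G" and B: "B \<in> sets borel" for A B
  proof -
    have [measurable]: "A \<in> sets M" by (rule GM[OF A])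
    define N1 where "N1 = density M (indicator A) \<bind> \<kappa>"
    define N2 where "N2 = distr (density M (indicator A)) borel W"
    have \<kappa>M: "\<kappa> \<in> M \<rightarrow>\<^sub>M subprob_algebra borel"
      by (rule measurable_from_subalg[OF G measurable_prob_algebraD[OF \<kappa>_meas]])
    have \<kappa>M': "\<kappa> \<in> density M (indicator A) \<rightarrow>\<^sub>M subprob_algebra borel" using \<kappa>M by simp
    have [measurable]: "(\<lambda>x. emeasure (\<kappa> x) B) \<in> borel_measurable M" if "B \<in> sets borel" for B
      using measurable_emeasure_kernel[OF \<kappa>M that] .
    have N1: "emeasure N1 B = (\<integral>\<^sup>+x\<in>A. emeasure (\<kappa> x) B \<partial>M)" if "B \<in> sets borel" for B
      unfolding N1_def using that
      by (subst emeasure_bind[OF _ \<kappa>M']) (auto simp: not_empty nn_integral_density mult.commute)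
    have N2: "emeasure N2 B = emeasure M (A \<inter> (W -` B \<inter> space M))" if [measurable]: "B \<in> sets borel" for B
      unfolding N2_def
      by (simp add: emeasure_distr emeasure_density indicator_inter_arith[symmetric])
    have "N1 = N2"
    proof (rule measure_eqI_generator_eq[where \<Omega> = UNIV and E = "range atMost" and A = "\<lambda>i. {..real i}"])
      show "Int_stable (range (atMost :: real \<Rightarrow> _))" by (auto simp: Int_stable_def)
      show "sets N1 = sigma_sets UNIV (range atMost)"
        unfolding N1_def using sets_kernel[OF \<kappa>M'] not_empty
        by (subst sets_bind[where N = borel]) (auto simp: borel_eq_atMost)
      show "sets N2 = sigma_sets UNIV (range atMost)" by (simp add: N2_def borel_eq_atMost)
      show "(\<Union>i. {..real i}) = UNIV" by (auto intro: real_arch_simple)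
      show "emeasure N1 {..real i} \<noteq> \<infinity>" for i
        by (simp add: N1 key[OF A])
      fix X assume "X \<in> range (atMost :: real \<Rightarrow> _)"
      then obtain t where "X = {..t}" by auto
      moreover have "{x \<in> space M. W x \<le> t} = W -` {..t} \<inter> space M" by auto
      ultimately show "emeasure N1 X = emeasure N2 X" by (simp add: N1 N2 key[OF A])
    qed auto
    then show ?thesis using N1[OF B] N2[OF B] by simp
  qed
  then have "regular_cond_law M G borel W \<kappa>"
    unfolding regular_cond_law_iff_integral[OF M G W] using \<kappa>_meas by blast
  then show ?thesis by blast
qed

text \<open>
  Vectors are encoded in a single real number of \<open>[0, 1]\<close> by a sequence of binary digits written
  in base \<open>4\<close>. As digits \<open>2\<close> and \<open>3\<close> do not occur, expansions are unique and the digits are read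
  off by the measurable map \<open>y \<mapsto> frac (4 y)\<close>.
\<close>

primrec digit_state :: "nat \<Rightarrow> real \<Rightarrow> real" where
  "digit_state 0 y = y"
| "digit_state (Suc n) y = frac (4 * digit_state n y)"

definition digit :: "nat \<Rightarrow> real \<Rightarrow> int" where
  "digit n y = \<lfloor>4 * digit_state n y\<rfloor>"

definition digit_sum :: "(nat \<Rightarrow> bool) \<Rightarrow> real" where
  "digit_sum \<beta> = (\<Sum>n. of_bool (\<beta> n) * (1/4) ^ Suc n)"

lemma digit_sum_summable: "summable (\<lambda>n. of_bool (\<beta> n) * (1/4 :: real) ^ Suc n)"
  by (rule summable_comparison_test'[where g = "\<lambda>n. (1/4) ^ n" and N = 0]) (auto simp: summable_geometric)

lemma digit_sum_bounds: "0 \<le> digit_sum \<beta>" "digit_sum \<beta> \<le> 1/3"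
proof -
  show "0 \<le> digit_sum \<beta>" unfolding digit_sum_def by (intro suminf_nonneg digit_sum_summable) auto
  have "(\<lambda>n. (1/4 :: real) ^ Suc n) sums (1/3)"
    using sums_mult[OF geometric_sums[of "1/4 :: real"], of "1/4"] by simp
  moreover have "digit_sum \<beta> \<le> (\<Sum>n. (1/4) ^ Suc n)"
    unfolding digit_sum_def using calculation by (intro suminf_le digit_sum_summable) (auto dest: sums_summable)
  ultimately show "digit_sum \<beta> \<le> 1/3" by (simp add: sums_unique[symmetric])
qed

lemma digit_sum_shift: "4 * digit_sum \<beta> = of_bool (\<beta> 0) + digit_sum (\<lambda>n. \<beta> (Suc n))"
proof -
  have s: "summable (\<lambda>n. of_bool (\<beta> (Suc n)) * (1/4 :: real) ^ Suc n)" by (rule digit_sum_summable)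
  have "digit_sum \<beta> = of_bool (\<beta> 0) * (1/4) + (\<Sum>n. of_bool (\<beta> (Suc n)) * (1/4) ^ Suc (Suc n))"
    unfolding digit_sum_def using suminf_split_head[OF digit_sum_summable[of \<beta>]] by simp
  also have "(\<Sum>n. of_bool (\<beta> (Suc n)) * (1/4 :: real) ^ Suc (Suc n)) = (1/4) * digit_sum (\<lambda>n. \<beta> (Suc n))"
    unfolding digit_sum_def using suminf_mult[OF s, of "1/4"] by (simp add: mult_ac)
  finally show ?thesis by simp
qed

lemma digit_state_digit_sum: "digit_state n (digit_sum \<beta>) = digit_sum (\<lambda>j. \<beta> (n + j))"
proof (induction n)
  case (Suc n)
  have "4 * digit_sum (\<lambda>j. \<beta> (n + j)) = of_bool (\<beta> n) + digit_sum (\<lambda>j. \<beta> (Suc n + j))"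
    using digit_sum_shift[of "\<lambda>j. \<beta> (n + j)"] by simp
  moreover have "frac (of_bool b + x) = x" if "0 \<le> x" "x \<le> 1/3" for b and x :: real
    using that by (cases b) (auto simp: frac_eq frac_1_eq add.commute[of 1])
  ultimately show ?case using Suc digit_sum_bounds by simp
qed simp

lemma digit_digit_sum: "digit n (digit_sum \<beta>) = of_bool (\<beta> n)"
proof -
  have "4 * digit_sum (\<lambda>j. \<beta> (n + j)) = of_bool (\<beta> n) + digit_sum (\<lambda>j. \<beta> (Suc n + j))"
    using digit_sum_shift[of "\<lambda>j. \<beta> (n + j)"] by simp
  then show ?thesis
    using digit_sum_bounds[of "\<lambda>j. \<beta> (Suc n + j)"]
    unfolding digit_def digit_state_digit_sum by (cases "\<beta> n") (auto simp: floor_eq_iff)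
qed

lemma digit_state_measurable[measurable]: "digit_state n \<in> borel_measurable borel"
  by (induction n) (auto simp: frac_def intro!: borel_measurable_diff)

lemma digit_measurable[measurable]: "digit n \<in> borel \<rightarrow>\<^sub>M count_space UNIV"
  unfolding digit_def by measurable

text \<open>
  A vector is determined by the truth values of \<open>z i \<le> q\<close> for all \<open>i\<close> and rational \<open>q\<close>.
\<close>

definition encode_vec :: "nat \<Rightarrow> (nat \<Rightarrow> real) \<Rightarrow> real" where
  "encode_vec k z = digit_sum (\<lambda>n. case prod_decode n of (i, q) \<Rightarrow> i \<in> {1..k} \<and> z i \<le> of_rat (from_nat q))"

text \<open>
  The extended reals make the infimum over the rationals above \<open>z i\<close> total and measurable; on
  codes of vectors it is finite.
\<close>

definition decode_vec :: "nat \<Rightarrow> real \<Rightarrow> nat \<Rightarrow> real" where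
  "decode_vec k y = (\<lambda>i\<in>{1..k}. real_of_ereal
     (INF q. if digit (prod_encode (i, q)) y = 1 then ereal (of_rat (from_nat q)) else \<infinity>))"

lemma decode_encode_vec:
  assumes "z \<in> space (real_vectors k)"
  shows "decode_vec k (encode_vec k z) = z"
proof
  fix i
  show "decode_vec k (encode_vec k z) i = z i"
  proof (cases "i \<in> {1..k}")
    case False
    then show ?thesis using assms
      by (auto simp: decode_vec_def real_vectors_def space_PiM PiE_def extensional_def)
  next
    case True
    have d: "digit (prod_encode (i, q)) (encode_vec k z) = 1 \<longleftrightarrow> z i \<le> of_rat (from_nat q)" for q
      unfolding encode_vec_def digit_digit_sum using True by simp
    have "(INF q. if digit (prod_encode (i, q)) (encode_vec k z) = 1 then ereal (of_rat (from_nat q)) else \<infinity>) = ereal (z i)"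
      unfolding d
    proof (rule INF_eqI)
      fix y assume y: "\<And>q. q \<in> UNIV \<Longrightarrow> y \<le> (if z i \<le> of_rat (from_nat q) then ereal (of_rat (from_nat q)) else \<infinity>)"
      show "y \<le> ereal (z i)"
      proof (rule ereal_le_epsilon2)
          fix e :: real assume "0 < e"
          then obtain r :: rat where r: "z i < of_rat r" "of_rat r < z i + e" using of_rat_dense[of "z i" "z i + e"] by auto
          have "y \<le> ereal (of_rat r)" using y[of "to_nat r"] r by simp
          also have "\<dots> \<le> ereal (z i) + ereal e" using r by simp
          finally show "y \<le> ereal (z i) + ereal e" .
      qed
    qed auto
    then show ?thesis using True by (simp add: decode_vec_def)
  qed
qed

lemma encode_vec_measurable: "encode_vec k \<in> borel_measurable (real_vectors k)"
proof -
  define P where "P n z \<longleftrightarrow> (case prod_decode n of (i, q) \<Rightarrow> i \<in> {1..k} \<and> z i \<le> of_rat (from_nat q))"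
    for n and z :: "nat \<Rightarrow> real"
  have P: "(\<lambda>z. of_bool (P n z) :: real) \<in> borel_measurable (real_vectors k)" for n
  proof -
    obtain i q where iq: "prod_decode n = (i, q)" by fastforce
    show ?thesis
    proof (cases "i \<in> {1..k}")
      case True
      then have "(\<lambda>z. z i) \<in> borel_measurable (real_vectors k)"
        unfolding real_vectors_def by (rule measurable_component_singleton)
      then have "{z \<in> space (real_vectors k). P n z} \<in> sets (real_vectors k)"
        using True by (simp add: P_def iq)
      then show ?thesis unfolding of_bool_def by (intro measurable_If borel_measurable_const)
    next
      case False
      then have "P n = (\<lambda>z. False)" unfolding P_def iq by (auto simp: fun_eq_iff)
      then show ?thesis by simp
    qed
  qed
  have "(\<lambda>z. \<Sum>n. of_bool (P n z) * (1/4 :: real) ^ Suc n) \<in> borel_measurable (real_vectors k)"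
    by (rule borel_measurable_suminf, rule borel_measurable_times[OF P borel_measurable_const])
  then show ?thesis unfolding encode_vec_def[abs_def] digit_sum_def P_def .
qed

lemma decode_vec_measurable: "decode_vec k \<in> borel \<rightarrow>\<^sub>M real_vectors k"
  unfolding decode_vec_def real_vectors_def
proof (rule measurable_restrict)
  fix i
  have [measurable]: "(\<lambda>y. if digit (prod_encode (i, q)) y = 1 then ereal (of_rat (from_nat q)) else \<infinity>) \<in> borel_measurable borel" for q
    by measurable
  show "(\<lambda>y. real_of_ereal (INF q. if digit (prod_encode (i, q)) y = 1 then ereal (of_rat (from_nat q)) else \<infinity>)) \<in> borel_measurable borel"
    by measurable
qed

text \<open>
  Condition the code of \<open>Z\<close> and push the conditional law forward along the decoding.
\<close>

theorem regular_cond_law_exists: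
  assumes M: "prob_space M" and G: "subalgebra M G" and Z: "Z \<in> M \<rightarrow>\<^sub>M real_vectors k"
  shows "\<exists>\<kappa>. regular_cond_law M G (real_vectors k) Z \<kappa>"
proof -
  define W where "W x = encode_vec k (Z x)" for x
  have W: "W \<in> borel_measurable M" unfolding W_def by (rule measurable_compose[OF Z encode_vec_measurable])
  have "0 \<le> W x \<and> W x \<le> 1" for x
    unfolding W_def encode_vec_def using digit_sum_bounds by (auto intro: order_trans[of _ "1/3"])
  then obtain \<kappa> where \<kappa>: "regular_cond_law M G borel W \<kappa>"
    using regular_cond_law_unit_interval[OF M G W] by blast
  then have \<kappa>m: "\<kappa> \<in> G \<rightarrow>\<^sub>M prob_algebra borel"
    and \<kappa>i: "\<And>A B. A \<in> sets G \<Longrightarrow> B \<in> sets borel \<Longrightarrow> (\<integral>\<^sup>+x\<in>A. emeasure (\<kappa> x) B \<partial>M) = emeasure M (A \<inter> (W -` B \<inter> space M))"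
    unfolding regular_cond_law_iff_integral[OF M G W] by auto
  let ?N = "real_vectors k"
  define K where "K x = distr (\<kappa> x) ?N (decode_vec k)" for x
  have "regular_cond_law M G ?N Z K"
    unfolding regular_cond_law_iff_integral[OF M G Z]
  proof (intro conjI ballI)
    show "K \<in> G \<rightarrow>\<^sub>M prob_algebra ?N"
      unfolding K_def by (rule measurable_compose[OF \<kappa>m measurable_distr_prob_space[OF decode_vec_measurable]])
    fix A B assume A: "A \<in> sets G" and B: "B \<in> sets ?N"
    have sG: "space G = space M" using G by (simp add: subalgebra_def)
    have dB: "decode_vec k -` B \<in> sets borel" using measurable_sets[OF decode_vec_measurable B] by simp
    have "emeasure (K x) B = emeasure (\<kappa> x) (decode_vec k -` B)" if "x \<in> space M" for x
    proof -
      have "\<kappa> x \<in> space (prob_algebra borel)" using measurable_space[OF \<kappa>m] that by (simp add: sG)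
      then have s: "sets (\<kappa> x) = sets borel" by (simp add: space_prob_algebra)
      then have "decode_vec k \<in> \<kappa> x \<rightarrow>\<^sub>M ?N" using decode_vec_measurable by (simp cong: measurable_cong_sets)
      then show ?thesis unfolding K_def using B sets_eq_imp_space_eq[OF s] by (simp add: emeasure_distr)
    qed
    then have "(\<integral>\<^sup>+x\<in>A. emeasure (K x) B \<partial>M) = (\<integral>\<^sup>+x\<in>A. emeasure (\<kappa> x) (decode_vec k -` B) \<partial>M)"
      by (intro nn_integral_cong) simp
    also have "\<dots> = emeasure M (A \<inter> (W -` (decode_vec k -` B) \<inter> space M))" by (rule \<kappa>i[OF A dB])
    also have "W -` (decode_vec k -` B) \<inter> space M = Z -` B \<inter> space M"
      using decode_encode_vec[OF measurable_space[OF Z]] by (auto simp: W_def)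
    finally show "(\<integral>\<^sup>+x\<in>A. emeasure (K x) B \<partial>M) = emeasure M (A \<inter> (Z -` B \<inter> space M))" .
  qed
  then show ?thesis by blast
qed

section \<open>Estimating the coefficient by events\<close>

definition l1_dist :: "nat \<Rightarrow> (nat \<Rightarrow> real) \<Rightarrow> (nat \<Rightarrow> real) \<Rightarrow> real" where
  "l1_dist k x y = (\<Sum>i = 1..k. \<bar>x i - y i\<bar>)"

text \<open>
  The countable dense set of vectors with rational coordinates, padded by \<open>0\<close>.
\<close>

definition grid_point :: "nat \<Rightarrow> rat list \<Rightarrow> nat \<Rightarrow> real" where
  "grid_point k q = (\<lambda>i\<in>{1..k}. if i - 1 < length q then of_rat (q ! (i - 1)) else 0)"

text \<open>
  The minimum of finitely many cones \<open>q + |z - x|\<close> with rational apex: a countable family of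
  Lipschitz functions which suffices for the supremum in the definition of \<open>\<tau>\<close>.
\<close>

fun lip_min :: "nat \<Rightarrow> (rat list \<times> rat) list \<Rightarrow> (nat \<Rightarrow> real) \<Rightarrow> real" where
  "lip_min k [] z = 0"
| "lip_min k [a] z = of_rat (snd a) + l1_dist k z (grid_point k (fst a))"
| "lip_min k (a # a' # l) z = min (of_rat (snd a) + l1_dist k z (grid_point k (fst a))) (lip_min k (a' # l) z)"

lemma l1_dist_nonneg: "0 \<le> l1_dist k x y" and l1_dist_sym: "l1_dist k x y = l1_dist k y x"
  and l1_dist_triangle: "l1_dist k x z \<le> l1_dist k x y + l1_dist k y z"
proof -
  show "0 \<le> l1_dist k x y" by (auto simp: l1_dist_def sum_nonneg)
  show "l1_dist k x y = l1_dist k y x" by (auto simp: l1_dist_def abs_minus_commute)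
  show "l1_dist k x z \<le> l1_dist k x y + l1_dist k y z"
    unfolding l1_dist_def sum.distrib[symmetric] by (intro sum_mono) linarith
qed

lemma lipschitz_l1_iff: "g \<in> lipschitz_l1 k \<longleftrightarrow> (\<forall>x\<in>space (real_vectors k). \<forall>y\<in>space (real_vectors k). \<bar>g x - g y\<bar> \<le> l1_dist k x y)"
  by (simp add: lipschitz_l1_def l1_dist_def)

lemma grid_point_space: "grid_point k q \<in> space (real_vectors k)"
  by (auto simp: grid_point_def real_vectors_def space_PiM PiE_def)

lemma l1_dist_measurable[measurable]: "(\<lambda>z. l1_dist k z y) \<in> borel_measurable (real_vectors k)"
  unfolding l1_dist_def real_vectors_def by measurable

lemma lip_min_lipschitz: "\<bar>lip_min k l x - lip_min k l y\<bar> \<le> l1_dist k x y"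
proof (induction k l x rule: lip_min.induct)
  case (1 k z) then show ?case by (simp add: l1_dist_nonneg)
next
  case (2 k a z)
  show ?case using l1_dist_triangle[of k z "grid_point k (fst a)" y] l1_dist_triangle[of k y "grid_point k (fst a)" z] l1_dist_sym[of k z y]
    by simp
next
  case (3 k a a' l z)
  then show ?case using l1_dist_triangle[of k z "grid_point k (fst a)" y] l1_dist_triangle[of k y "grid_point k (fst a)" z] l1_dist_sym[of k z y]
    by (simp add: min_def) linarith
qed

lemma lip_min_in_lipschitz_l1: "lip_min k l \<in> lipschitz_l1 k"
  using lip_min_lipschitz by (auto simp: lipschitz_l1_iff)

lemma lip_min_measurable[measurable]: "lip_min k l \<in> borel_measurable (real_vectors k)"
proof (induction k l "undefined :: nat \<Rightarrow> real" rule: lip_min.induct)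
  case (3 k a a' l)
  then show ?case unfolding lip_min.simps by measurable
qed (unfold lip_min.simps, measurable)

lemma lip_min_eq_Min: "l \<noteq> [] \<Longrightarrow> lip_min k l z = Min ((\<lambda>a. of_rat (snd a) + l1_dist k z (grid_point k (fst a))) ` set l)"
  by (induction k l z rule: lip_min.induct) auto

lemma grid_dense:
  assumes e: "0 < e"
  shows "\<exists>q. l1_dist k z (grid_point k q) < e"
proof -
  have "\<forall>i. \<exists>r :: rat. z i < of_rat r \<and> of_rat r < z i + e / (k + 1)"
    using e by (intro allI of_rat_dense) (simp add: field_simps add_pos_pos)
  then obtain r :: "nat \<Rightarrow> rat" where r: "\<And>i. z i < of_rat (r i)" "\<And>i. of_rat (r i) < z i + e / (k + 1)" by metis
  define q where "q = map (\<lambda>i. r (i + 1)) [0..<k]"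
  have "l1_dist k z (grid_point k q) \<le> (\<Sum>i = 1..k. e / (k + 1))"
    unfolding l1_dist_def
  proof (rule sum_mono)
    fix i assume i: "i \<in> {1..k}"
    then have "grid_point k q i = of_rat (r i)" by (auto simp: grid_point_def q_def)
    then show "\<bar>z i - grid_point k q i\<bar> \<le> e / (k + 1)" using r(1)[of i] r(2)[of i] by simp
  qed
  also have "\<dots> < e" using e by (simp add: field_simps)
  finally show ?thesis by blast
qed

text \<open>
  A Lipschitz function is the infimum of its cones \<open>g x + |z - x|\<close> over the dense grid. Taking the
  first \<open>n\<close> grid points and rational heights within \<open>1/n\<close> above \<open>g x\<close> approximates it from above.
  The origin comes first in the enumeration, so that its cone provides a common bound.
\<close>

lemma lipschitz_l1_approx:
  assumes g: "g \<in> lipschitz_l1 k"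
  shows "\<exists>l. \<forall>z\<in>space (real_vectors k). (\<lambda>n. lip_min k (l n) z) \<longlonglongrightarrow> g z \<and>
    (\<forall>n. \<bar>lip_min k (l n) z\<bar> \<le> \<bar>g z\<bar> + \<bar>g (grid_point k [])\<bar> + 1 + l1_dist k z (grid_point k []))"
proof -
  define q :: "nat \<Rightarrow> rat list" where "q i = (if i = 0 then [] else from_nat (i - 1))" for i
  have q_surj: "\<exists>i. q i = x" for x by (rule exI[of _ "Suc (to_nat x)"]) (simp add: q_def)
  have "\<forall>n i. \<exists>r :: rat. g (grid_point k (q i)) < of_rat r \<and> of_rat r < g (grid_point k (q i)) + 1 / Suc n"
    by (intro allI of_rat_dense) simp
  then obtain r :: "nat \<Rightarrow> nat \<Rightarrow> rat" where r: "\<And>n i. g (grid_point k (q i)) < of_rat (r n i)"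
    "\<And>n i. of_rat (r n i) < g (grid_point k (q i)) + 1 / Suc n" by metis
  define l where "l n = map (\<lambda>i. (q i, r n i)) [0..<Suc n]" for n
  have lM: "lip_min k (l n) z = Min ((\<lambda>i. of_rat (r n i) + l1_dist k z (grid_point k (q i))) ` {0..<Suc n})" for n z
    by (subst lip_min_eq_Min) (auto simp: l_def image_image simp del: upt_Suc)
  have lower: "g z \<le> lip_min k (l n) z" if z: "z \<in> space (real_vectors k)" for n z
    unfolding lM
  proof (rule Min.boundedI)
    fix x assume "x \<in> (\<lambda>i. of_rat (r n i) + l1_dist k z (grid_point k (q i))) ` {0..<Suc n}"
    then obtain i where x: "x = of_rat (r n i) + l1_dist k z (grid_point k (q i))" by blast
    have "\<bar>g z - g (grid_point k (q i))\<bar> \<le> l1_dist k z (grid_point k (q i))"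
      using g z grid_point_space[of k "q i"] unfolding lipschitz_l1_iff by blast
    then show "g z \<le> x" using r(1)[of i n] unfolding x by linarith
  qed auto
  have upper: "lip_min k (l n) z \<le> g (grid_point k (q i)) + 1 / Suc n + l1_dist k z (grid_point k (q i))" if "i \<le> n" for n i z
  proof -
    have "lip_min k (l n) z \<le> of_rat (r n i) + l1_dist k z (grid_point k (q i))"
      unfolding lM using that by (intro Min_le) auto
    then show ?thesis using r(2)[of n i] by linarith
  qed
  show ?thesis
  proof (intro exI[of _ l] ballI conjI allI)
    fix z assume z: "z \<in> space (real_vectors k)"
    show "(\<lambda>n. lip_min k (l n) z) \<longlonglongrightarrow> g z"
    proof (rule LIMSEQ_I)
      fix e :: real assume e: "0 < e"
      obtain x where x: "l1_dist k z (grid_point k x) < e / 4" using grid_dense[of "e/4" k z] e by auto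
      obtain i where i: "q i = x" using q_surj by blast
      obtain m where m: "1 / Suc m < e / 2" using e by (metis half_gt_zero nat_approx_posE)
      have "norm (lip_min k (l n) z - g z) < e" if n: "max i m \<le> n" for n
      proof -
        have "lip_min k (l n) z \<le> g (grid_point k x) + 1 / Suc n + l1_dist k z (grid_point k x)"
          using upper[of i n z] n i by auto
        moreover have "\<bar>g z - g (grid_point k x)\<bar> \<le> l1_dist k z (grid_point k x)"
          using g z grid_point_space[of k x] unfolding lipschitz_l1_iff by blast
        moreover have "1 / real (Suc n) \<le> 1 / real (Suc m)" using n by (intro divide_left_mono) auto
        ultimately have "lip_min k (l n) z < g z + e" using x m by linarith
        then show ?thesis using lower[OF z, of n] by simp
      qed
      then show "\<exists>N. \<forall>n\<ge>N. norm (lip_min k (l n) z - g z) < e" by blast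
    qed
    fix n
    have "1 / real (Suc n) \<le> 1" by simp
    moreover have "lip_min k (l n) z \<le> g (grid_point k []) + 1 / real (Suc n) + l1_dist k z (grid_point k [])"
      using upper[of 0 n z] by (simp add: q_def del: of_nat_Suc)
    ultimately have "lip_min k (l n) z \<le> g (grid_point k []) + 1 + l1_dist k z (grid_point k [])" by linarith
    then show "\<bar>lip_min k (l n) z\<bar> \<le> \<bar>g z\<bar> + \<bar>g (grid_point k [])\<bar> + 1 + l1_dist k z (grid_point k [])"
      using lower[OF z, of n] l1_dist_nonneg[of k z "grid_point k []"] by linarith
  qed
qed

lemma lipschitz_l1_measurable:
  assumes "g \<in> lipschitz_l1 k"
  shows "g \<in> borel_measurable (real_vectors k)"
proof -
  obtain l where l: "\<And>z. z \<in> space (real_vectors k) \<Longrightarrow> (\<lambda>n. lip_min k (l n) z) \<longlonglongrightarrow> g z"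
    using lipschitz_l1_approx[OF assms] by metis
  show ?thesis by (rule borel_measurable_LIMSEQ_real[OF l lip_min_measurable])
qed

text \<open>
  Lipschitz functions are bounded on a box, so every law of this kind integrates all of them.
\<close>

definition box_law :: "nat \<Rightarrow> real \<Rightarrow> (nat \<Rightarrow> real) measure \<Rightarrow> bool" where
  "box_law k b N \<longleftrightarrow> prob_space N \<and> sets N = sets (real_vectors k) \<and> (AE z in N. \<forall>i\<in>{1..k}. \<bar>z i\<bar> \<le> b)"

lemma lipschitz_l1_bounded_on_box:
  assumes g: "g \<in> lipschitz_l1 k"
  obtains c where "0 \<le> c" "\<And>z. z \<in> space (real_vectors k) \<Longrightarrow> \<forall>i\<in>{1..k}. \<bar>z i\<bar> \<le> b \<Longrightarrow>
     \<bar>g z\<bar> \<le> c \<and> l1_dist k z (grid_point k []) \<le> c"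
proof -
  define c where "c = \<bar>g (grid_point k [])\<bar> + real k * \<bar>b\<bar>"
  have "\<bar>g z\<bar> \<le> c \<and> l1_dist k z (grid_point k []) \<le> c"
    if z: "z \<in> space (real_vectors k)" "\<forall>i\<in>{1..k}. \<bar>z i\<bar> \<le> b" for z
  proof -
    have "l1_dist k z (grid_point k []) \<le> (\<Sum>i = 1..k. \<bar>b\<bar>)"
      unfolding l1_dist_def
    proof (rule sum_mono)
      fix i assume i: "i \<in> {1..k}"
      then have "\<bar>z i\<bar> \<le> b" using z(2) by blast
      then show "\<bar>z i - grid_point k [] i\<bar> \<le> \<bar>b\<bar>" using i by (simp add: grid_point_def)
    qed
    then have 1: "l1_dist k z (grid_point k []) \<le> real k * \<bar>b\<bar>" by simp
    have "\<bar>g z - g (grid_point k [])\<bar> \<le> l1_dist k z (grid_point k [])"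
      using g z(1) grid_point_space by (auto simp: lipschitz_l1_iff)
    with 1 show ?thesis by (auto simp: c_def)
  qed
  moreover have "0 \<le> c" by (simp add: c_def)
  ultimately show ?thesis using that by blast
qed

lemma box_law_integrable:
  assumes N: "box_law k b N" and g: "g \<in> lipschitz_l1 k"
  shows "integrable N g"
proof -
  interpret prob_space N using N by (simp add: box_law_def)
  have sN: "sets N = sets (real_vectors k)" using N by (simp add: box_law_def)
  obtain c where c: "\<And>z. z \<in> space (real_vectors k) \<Longrightarrow> \<forall>i\<in>{1..k}. \<bar>z i\<bar> \<le> b \<Longrightarrow> \<bar>g z\<bar> \<le> c"
    using lipschitz_l1_bounded_on_box[OF g] by metis
  have "AE z in N. \<forall>i\<in>{1..k}. \<bar>z i\<bar> \<le> b" using N by (simp add: box_law_def)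
  then have "AE z in N. norm (g z) \<le> c" using AE_space
  proof eventually_elim
    case (elim z)
    then show ?case using c[of z] sets_eq_imp_space_eq[OF sN] by simp
  qed
  moreover have "g \<in> borel_measurable N"
    unfolding measurable_cong_sets[OF sN refl] by (rule lipschitz_l1_measurable[OF g])
  ultimately show ?thesis by (intro integrable_const_bound)
qed

lemma box_law_approx:
  assumes N: "box_law k b N" and g: "g \<in> lipschitz_l1 k"
    and lim: "\<And>z. z \<in> space (real_vectors k) \<Longrightarrow> (\<lambda>n. lip_min k (l n) z) \<longlonglongrightarrow> g z"
    and bd: "\<And>n z. z \<in> space (real_vectors k) \<Longrightarrow>
      \<bar>lip_min k (l n) z\<bar> \<le> \<bar>g z\<bar> + \<bar>g (grid_point k [])\<bar> + 1 + l1_dist k z (grid_point k [])"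
  shows "(\<lambda>n. \<integral>z. lip_min k (l n) z \<partial>N) \<longlonglongrightarrow> (\<integral>z. g z \<partial>N)"
proof -
  interpret prob_space N using N by (simp add: box_law_def)
  have sN: "sets N = sets (real_vectors k)" using N by (simp add: box_law_def)
  have spN: "space N = space (real_vectors k)" by (rule sets_eq_imp_space_eq[OF sN])
  obtain c where c: "\<And>z. z \<in> space (real_vectors k) \<Longrightarrow> \<forall>i\<in>{1..k}. \<bar>z i\<bar> \<le> b \<Longrightarrow> \<bar>g z\<bar> \<le> c \<and> l1_dist k z (grid_point k []) \<le> c"
    using lipschitz_l1_bounded_on_box[OF g] by metis
  show ?thesis
  proof (rule integral_dominated_convergence[where w = "\<lambda>_. c + \<bar>g (grid_point k [])\<bar> + 1 + c"])
    show "g \<in> borel_measurable N" unfolding measurable_cong_sets[OF sN refl] by (rule lipschitz_l1_measurable[OF g])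
    show "(\<lambda>z. lip_min k (l n) z) \<in> borel_measurable N" for n
      unfolding measurable_cong_sets[OF sN refl] by (rule lip_min_measurable)
    show "AE z in N. (\<lambda>n. lip_min k (l n) z) \<longlonglongrightarrow> g z" by (rule AE_I2) (simp add: lim spN)
    have ae: "AE z in N. \<forall>i\<in>{1..k}. \<bar>z i\<bar> \<le> b" using N by (simp add: box_law_def)
    show "AE z in N. norm (lip_min k (l n) z) \<le> c + \<bar>g (grid_point k [])\<bar> + 1 + c" for n
      using ae AE_space
    proof eventually_elim
      case (elim z)
      then show ?case using bd[of z n] c[of z] by (simp add: spN)
    qed
  qed simp
qed

lemma lipschitz_sup_eq_countable_sup:
  assumes N: "box_law k b N" and P: "box_law k b P"
  shows "(SUP g\<in>lipschitz_l1 k. ennreal \<bar>(\<integral>z. g z \<partial>N) - (\<integral>z. g z \<partial>P)\<bar>)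
     = (SUP l. ennreal \<bar>(\<integral>z. lip_min k l z \<partial>N) - (\<integral>z. lip_min k l z \<partial>P)\<bar>)"
proof (rule antisym)
  show "(SUP l. ennreal \<bar>(\<integral>z. lip_min k l z \<partial>N) - (\<integral>z. lip_min k l z \<partial>P)\<bar>)
    \<le> (SUP g\<in>lipschitz_l1 k. ennreal \<bar>(\<integral>z. g z \<partial>N) - (\<integral>z. g z \<partial>P)\<bar>)"
    by (rule SUP_mono) (use lip_min_in_lipschitz_l1 in blast)
  show "(SUP g\<in>lipschitz_l1 k. ennreal \<bar>(\<integral>z. g z \<partial>N) - (\<integral>z. g z \<partial>P)\<bar>)
    \<le> (SUP l. ennreal \<bar>(\<integral>z. lip_min k l z \<partial>N) - (\<integral>z. lip_min k l z \<partial>P)\<bar>)"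
  proof (rule SUP_least)
    fix g assume g: "g \<in> lipschitz_l1 k"
    obtain l where l: "\<And>z. z \<in> space (real_vectors k) \<Longrightarrow> (\<lambda>n. lip_min k (l n) z) \<longlonglongrightarrow> g z"
      "\<And>n z. z \<in> space (real_vectors k) \<Longrightarrow>
        \<bar>lip_min k (l n) z\<bar> \<le> \<bar>g z\<bar> + \<bar>g (grid_point k [])\<bar> + 1 + l1_dist k z (grid_point k [])"
      using lipschitz_l1_approx[OF g] by metis
    have "(\<lambda>n. ennreal \<bar>(\<integral>z. lip_min k (l n) z \<partial>N) - (\<integral>z. lip_min k (l n) z \<partial>P)\<bar>)
      \<longlonglongrightarrow> ennreal \<bar>(\<integral>z. g z \<partial>N) - (\<integral>z. g z \<partial>P)\<bar>"
      by (intro tendsto_ennrealI tendsto_rabs tendsto_diff box_law_approx[OF N g l] box_law_approx[OF P g l])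
    then show "ennreal \<bar>(\<integral>z. g z \<partial>N) - (\<integral>z. g z \<partial>P)\<bar>
      \<le> (SUP l. ennreal \<bar>(\<integral>z. lip_min k l z \<partial>N) - (\<integral>z. lip_min k l z \<partial>P)\<bar>)"
      by (rule LIMSEQ_le_const2) (auto intro!: exI[of _ 0] SUP_upper)
  qed
qed

text \<open>
  Partition the space according to the index and the sign for which \<open>\<bar>D j\<bar>\<close> is largest. On each
  piece the integral of the supremum is the absolute value of a single integral, bounded by \<open>\<Lambda>\<close>,
  and superadditivity adds up the pieces. The sets are in \<open>G\<close> because the \<open>D j\<close> are
  \<open>G\<close>-measurable. Finite suprema suffice by monotone convergence.
\<close>

lemma nn_integral_sup_le_superadditive:
  fixes D :: "nat \<Rightarrow> 'a \<Rightarrow> real" and \<Lambda> :: "'a set \<Rightarrow> ennreal"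
  assumes sG: "\<And>A. A \<in> sets G \<Longrightarrow> A \<in> sets M" and spG: "space G = space M"
    and \<Lambda>: "\<And>A A'. A \<in> sets G \<Longrightarrow> A' \<in> sets G \<Longrightarrow> A \<inter> A' = {} \<Longrightarrow> \<Lambda> A + \<Lambda> A' \<le> \<Lambda> (A \<union> A')"
    and Dm: "\<And>j. D j \<in> borel_measurable G" and Di: "\<And>j. integrable M (D j)"
    and le: "\<And>j A. A \<in> sets G \<Longrightarrow> ennreal \<bar>\<integral>x. indicator A x * D j x \<partial>M\<bar> \<le> \<Lambda> A"
  shows "(\<integral>\<^sup>+x. (SUP j. ennreal \<bar>D j x\<bar>) \<partial>M) \<le> \<Lambda> (space M)"
proof -
  note Dm[measurable]
  have DM[measurable]: "D j \<in> borel_measurable M" for j using Di by (rule borel_measurable_integrable)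
  define S where "S n x = Max ((\<lambda>j. \<bar>D j x\<bar>) ` {..n})" for n x
  have S_Suc: "S (Suc n) x = max \<bar>D (Suc n) x\<bar> (S n x)" for n x
    unfolding S_def by (simp add: atMost_Suc)
  have S_0: "S 0 x = \<bar>D 0 x\<bar>" for x by (simp add: S_def)
  have SG[measurable]: "S n \<in> borel_measurable G" for n
    by (induction n) (auto simp: S_Suc[abs_def] S_0[abs_def])
  have SM[measurable]: "S n \<in> borel_measurable M" for n
    by (induction n) (auto simp: S_Suc[abs_def] S_0[abs_def])
  have one_sided: "(\<integral>\<^sup>+x. ennreal (indicator A x * (c * D j x)) \<partial>M) \<le> \<Lambda> A"
    if A: "A \<in> sets G" and c: "c = 1 \<or> c = -1" and pos: "\<And>x. x \<in> A \<Longrightarrow> 0 \<le> c * D j x" for A c j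
  proof -
    have [measurable]: "A \<in> sets M" using sG A by blast
    have i: "integrable M (\<lambda>x. indicator A x * (c * D j x))"
      using integrable_mult_indicator[of A M "\<lambda>x. c * D j x"] Di by simp
    have "(\<integral>\<^sup>+x. ennreal (indicator A x * (c * D j x)) \<partial>M) = ennreal (\<integral>x. indicator A x * (c * D j x) \<partial>M)"
      using i pos by (intro nn_integral_eq_integral) (auto split: split_indicator)
    also have "(\<integral>x. indicator A x * (c * D j x) \<partial>M) = c * (\<integral>x. indicator A x * D j x \<partial>M)"
      by (subst integral_mult_right_zero[symmetric]) (simp add: mult_ac)
    also have "ennreal \<dots> \<le> ennreal \<bar>\<integral>x. indicator A x * D j x \<partial>M\<bar>" using c by (intro ennreal_leI) auto
    also have "\<dots> \<le> \<Lambda> A" by (rule le[OF A])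
    finally show ?thesis .
  qed
  have single: "(\<integral>\<^sup>+x. indicator A x * ennreal \<bar>D j x\<bar> \<partial>M) \<le> \<Lambda> A" if A[measurable]: "A \<in> sets G" for A j
  proof -
    define A1 A2 where "A1 = A \<inter> {x \<in> space G. 0 \<le> D j x}" and "A2 = A \<inter> {x \<in> space G. D j x < 0}"
    have [measurable]: "A1 \<in> sets G" "A2 \<in> sets G" unfolding A1_def A2_def by measurable
    have AM: "A1 \<in> sets M" "A2 \<in> sets M" using sG by auto
    have AA: "A = A1 \<union> A2" "A1 \<inter> A2 = {}" using sets.sets_into_space[OF A] by (auto simp: A1_def A2_def)
    have "(\<integral>\<^sup>+x. indicator A x * ennreal \<bar>D j x\<bar> \<partial>M)
       = (\<integral>\<^sup>+x. ennreal (indicator A1 x * (1 * D j x)) + ennreal (indicator A2 x * ((-1) * D j x)) \<partial>M)"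
      by (intro nn_integral_cong) (auto simp: A1_def A2_def spG split: split_indicator)
    also have "\<dots> = (\<integral>\<^sup>+x. ennreal (indicator A1 x * (1 * D j x)) \<partial>M) + (\<integral>\<^sup>+x. ennreal (indicator A2 x * ((-1) * D j x)) \<partial>M)"
      using AM by (intro nn_integral_add) auto
    also have "\<dots> \<le> \<Lambda> A1 + \<Lambda> A2"
      by (intro add_mono one_sided) (auto simp: A1_def A2_def)
    also have "\<dots> \<le> \<Lambda> A" unfolding AA(1) by (intro \<Lambda> AA(2)) auto
    finally show ?thesis .
  qed
  have fin: "(\<integral>\<^sup>+x. indicator A x * ennreal (S n x) \<partial>M) \<le> \<Lambda> A" if "A \<in> sets G" for A n
    using that
  proof (induction n arbitrary: A)
    case 0
    then show ?case using single[of A 0] by (simp add: S_0)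
  next
    case (Suc n)
    note Suc.prems[measurable]
    define A1 A2 where "A1 = A \<inter> {x \<in> space G. S n x \<le> \<bar>D (Suc n) x\<bar>}" and "A2 = A \<inter> {x \<in> space G. \<not> S n x \<le> \<bar>D (Suc n) x\<bar>}"
    have [measurable]: "A1 \<in> sets G" "A2 \<in> sets G" unfolding A1_def A2_def by measurable
    have AM: "A1 \<in> sets M" "A2 \<in> sets M" using sG by auto
    have AA: "A = A1 \<union> A2" "A1 \<inter> A2 = {}" using sets.sets_into_space[OF Suc.prems] by (auto simp: A1_def A2_def)
    have "(\<integral>\<^sup>+x. indicator A x * ennreal (S (Suc n) x) \<partial>M)
       = (\<integral>\<^sup>+x. indicator A1 x * ennreal \<bar>D (Suc n) x\<bar> + indicator A2 x * ennreal (S n x) \<partial>M)"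
      by (intro nn_integral_cong) (auto simp: A1_def A2_def spG S_Suc max_def split: split_indicator)
    also have "\<dots> = (\<integral>\<^sup>+x. indicator A1 x * ennreal \<bar>D (Suc n) x\<bar> \<partial>M) + (\<integral>\<^sup>+x. indicator A2 x * ennreal (S n x) \<partial>M)"
      using AM by (intro nn_integral_add) auto
    also have "\<dots> \<le> \<Lambda> A1 + \<Lambda> A2"
      by (intro add_mono single Suc.IH) auto
    also have "\<dots> \<le> \<Lambda> A" unfolding AA(1) by (intro \<Lambda> AA(2)) auto
    finally show ?case .
  qed
  have inc: "incseq (\<lambda>n x. ennreal (S n x))"
    by (intro incseq_SucI le_funI ennreal_leI) (simp add: S_Suc)
  have "(\<integral>\<^sup>+x. (SUP j. ennreal \<bar>D j x\<bar>) \<partial>M) \<le> (\<integral>\<^sup>+x. (SUP n. ennreal (S n x)) \<partial>M)"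
    by (intro nn_integral_mono SUP_mono) (auto simp: S_def intro!: ennreal_leI Max_ge)
  also have "\<dots> = (SUP n. \<integral>\<^sup>+x. ennreal (S n x) \<partial>M)"
    using inc by (intro nn_integral_monotone_convergence_SUP) auto
  also have "\<dots> \<le> \<Lambda> (space M)"
  proof (rule SUP_least)
    fix n
    have "(\<integral>\<^sup>+x. ennreal (S n x) \<partial>M) = (\<integral>\<^sup>+x. indicator (space M) x * ennreal (S n x) \<partial>M)"
      by (intro nn_integral_cong) auto
    also have "\<dots> \<le> \<Lambda> (space M)" using fin[of "space M" n] spG sets.top[of G] by simp
    finally show "(\<integral>\<^sup>+x. ennreal (S n x) \<partial>M) \<le> \<Lambda> (space M)" .
  qed
  finally show ?thesis .
qed

text \<open>
  By the countable family \<open>lip_min\<close> the supremum in \<open>\<tau>\<close> becomes countable. The function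
  \<open>D j = E(g j (Z) | G) - E g j (Z)\<close> has the same integrals over events of \<open>G\<close> as
  \<open>g j (Z) - E g j (Z)\<close>, so the partition argument applies. For a bounded \<open>Z\<close>, almost all
  conditional laws live on the same box.
\<close>

theorem tau_le_superadditive:
  fixes \<Lambda> :: "'a set \<Rightarrow> ennreal"
  assumes M: "prob_space M" and G: "subalgebra M G" and Z: "Z \<in> M \<rightarrow>\<^sub>M real_vectors k"
    and b: "\<And>x i. x \<in> space M \<Longrightarrow> i \<in> {1..k} \<Longrightarrow> \<bar>Z x i\<bar> \<le> b"
    and \<Lambda>: "\<And>A A'. A \<in> sets G \<Longrightarrow> A' \<in> sets G \<Longrightarrow> A \<inter> A' = {} \<Longrightarrow> \<Lambda> A + \<Lambda> A' \<le> \<Lambda> (A \<union> A')"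
    and le: "\<And>A g. A \<in> sets G \<Longrightarrow> g \<in> lipschitz_l1 k \<Longrightarrow>
       ennreal \<bar>\<integral>x. indicator A x * (g (Z x) - (\<integral>y. g (Z y) \<partial>M)) \<partial>M\<bar> \<le> \<Lambda> A"
  shows "tau M G k Z \<le> \<Lambda> (space M)"
proof -
  interpret prob_space M by fact
  have sG: "space G = space M" using G by (simp add: subalgebra_def)
  have GM: "A \<in> sets M" if "A \<in> sets G" for A using G that by (auto simp: subalgebra_def)
  note Z[measurable]
  let ?N = "real_vectors k"
  define \<kappa> where "\<kappa> = (SOME \<kappa>. regular_cond_law M G ?N Z \<kappa>)"
  have "regular_cond_law M G ?N Z \<kappa>"
    unfolding \<kappa>_def by (rule someI_ex[OF regular_cond_law_exists[OF M G Z]])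
  then have \<kappa>m: "\<kappa> \<in> G \<rightarrow>\<^sub>M prob_algebra ?N"
    and \<kappa>i: "\<And>A B. A \<in> sets G \<Longrightarrow> B \<in> sets ?N \<Longrightarrow> (\<integral>\<^sup>+x\<in>A. emeasure (\<kappa> x) B \<partial>M) = emeasure M (A \<inter> (Z -` B \<inter> space M))"
    unfolding regular_cond_law_iff_integral[OF M G Z] by auto
  have \<kappa>M[measurable]: "\<kappa> \<in> M \<rightarrow>\<^sub>M subprob_algebra ?N"
    by (rule measurable_from_subalg[OF G measurable_prob_algebraD[OF \<kappa>m]])
  have \<kappa>p: "prob_space (\<kappa> x)" "sets (\<kappa> x) = sets ?N" if "x \<in> space M" for x
    using measurable_space[OF \<kappa>m, of x] that by (auto simp: space_prob_algebra sG)
  \<comment> \<open>the identity defining \<open>\<kappa>\<close>, extended from events to nonnegative functions\<close>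
  have \<kappa>int: "(\<integral>\<^sup>+x. indicator A x * (\<integral>\<^sup>+z. g z \<partial>\<kappa> x) \<partial>M) = (\<integral>\<^sup>+x. indicator A x * g (Z x) \<partial>M)"
    if A: "A \<in> sets G" and g[measurable]: "g \<in> borel_measurable ?N" for A and g :: "(nat \<Rightarrow> real) \<Rightarrow> ennreal"
  proof -
    have [measurable]: "A \<in> sets M" by (rule GM[OF A])
    have \<kappa>M': "\<kappa> \<in> density M (indicator A) \<rightarrow>\<^sub>M subprob_algebra ?N" by simp
    have ne: "space (density M (indicator A)) \<noteq> {}" by (simp add: not_empty)
    have eq: "density M (indicator A) \<bind> \<kappa> = distr (density M (indicator A)) ?N Z"
    proof (rule measure_eqI)
      have s: "sets (density M (indicator A) \<bind> \<kappa>) = sets ?N"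
        using sets_kernel[OF \<kappa>M'] ne by (subst sets_bind[where N = ?N]) auto
      then show "sets (density M (indicator A) \<bind> \<kappa>) = sets (distr (density M (indicator A)) ?N Z)" by simp
      fix B assume "B \<in> sets (density M (indicator A) \<bind> \<kappa>)"
      then have B[measurable]: "B \<in> sets ?N" by (simp add: s)
      have [measurable]: "(\<lambda>x. emeasure (\<kappa> x) B) \<in> borel_measurable M" using measurable_emeasure_kernel[OF \<kappa>M B] .
      have "emeasure (density M (indicator A) \<bind> \<kappa>) B = (\<integral>\<^sup>+x\<in>A. emeasure (\<kappa> x) B \<partial>M)"
        by (subst emeasure_bind[OF ne \<kappa>M' B]) (auto simp: nn_integral_density mult.commute)
      also have "\<dots> = emeasure M (A \<inter> (Z -` B \<inter> space M))" by (rule \<kappa>i[OF A B])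
      also have "\<dots> = emeasure (distr (density M (indicator A)) ?N Z) B"
        by (simp add: emeasure_distr emeasure_density indicator_inter_arith[symmetric])
      finally show "emeasure (density M (indicator A) \<bind> \<kappa>) B = emeasure (distr (density M (indicator A)) ?N Z) B" .
    qed
    have nm: "(\<lambda>x. \<integral>\<^sup>+z. g z \<partial>\<kappa> x) \<in> borel_measurable M"
      by (rule measurable_compose[OF \<kappa>M nn_integral_measurable_subprob_algebra[OF g]])
    have "(\<integral>\<^sup>+x. indicator A x * (\<integral>\<^sup>+z. g z \<partial>\<kappa> x) \<partial>M) = (\<integral>\<^sup>+z. g z \<partial>(density M (indicator A) \<bind> \<kappa>))"
      using nm by (subst nn_integral_bind[OF g \<kappa>M']) (simp add: nn_integral_density)
    also have "\<dots> = (\<integral>\<^sup>+x. indicator A x * g (Z x) \<partial>M)"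
      unfolding eq by (simp add: nn_integral_distr nn_integral_density)
    finally show ?thesis .
  qed
  define P where "P = distr M ?N Z"
  have Bx: "{z \<in> space ?N. \<forall>i\<in>{1..k}. \<bar>z i\<bar> \<le> b} \<in> sets ?N" unfolding real_vectors_def by measurable
  have "AE z in distr M ?N Z. \<forall>i\<in>{1..k}. \<bar>z i\<bar> \<le> b"
    unfolding AE_distr_iff[OF Z Bx] using b by (intro AE_I2) blast
  then have Pbox: "box_law k b P"
    unfolding box_law_def P_def using prob_space_distr[OF Z] by simp
  have \<kappa>box: "AE x in M. box_law k b (\<kappa> x)"
  proof -
    define Bx where "Bx = {z \<in> space ?N. \<forall>i\<in>{1..k}. \<bar>z i\<bar> \<le> b}"
    have Bx[measurable]: "Bx \<in> sets ?N" unfolding Bx_def real_vectors_def by measurable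
    have "(\<integral>\<^sup>+x. indicator (space M) x * (\<integral>\<^sup>+z. indicator (space ?N - Bx) z \<partial>\<kappa> x) \<partial>M)
       = (\<integral>\<^sup>+x. indicator (space M) x * indicator (space ?N - Bx) (Z x) \<partial>M)"
      using sG sets.top[of G] by (intro \<kappa>int) auto
    also have "\<dots> = 0"
    proof -
      have "(\<integral>\<^sup>+x. indicator (space M) x * indicator (space ?N - Bx) (Z x) \<partial>M) = (\<integral>\<^sup>+x. 0 \<partial>M)"
        using measurable_space[OF Z] b by (intro nn_integral_cong) (auto simp: Bx_def split: split_indicator)
      then show ?thesis by simp
    qed
    finally have "AE x in M. indicator (space M) x * (\<integral>\<^sup>+z. indicator (space ?N - Bx) z \<partial>\<kappa> x) = (0 :: ennreal)"
      by (subst (asm) nn_integral_0_iff_AE) (auto intro!: borel_measurable_times_ennreal measurable_compose[OF \<kappa>M nn_integral_measurable_subprob_algebra])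
    then show ?thesis using AE_space
    proof eventually_elim
      case (elim x)
      then have s: "sets (\<kappa> x) = sets ?N" "prob_space (\<kappa> x)" using \<kappa>p by auto
      then have sp: "space (\<kappa> x) = space ?N" by (intro sets_eq_imp_space_eq)
      have "emeasure (\<kappa> x) (space ?N - Bx) = 0" using elim s by simp
      then have "AE z in \<kappa> x. z \<notin> space ?N - Bx" using s by (intro AE_not_in) (auto simp: null_sets_def)
      then have "AE z in \<kappa> x. \<forall>i\<in>{1..k}. \<bar>z i\<bar> \<le> b" using AE_space
        by eventually_elim (auto simp: Bx_def sp)
      then show ?case using s by (simp add: box_law_def)
    qed
  qed
  define L where "L = (from_nat :: nat \<Rightarrow> (rat list \<times> rat) list)"
  define D where "D j x = (\<integral>z. lip_min k (L j) z \<partial>\<kappa> x) - (\<integral>z. lip_min k (L j) z \<partial>P)" for j x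
  have DG: "D j \<in> borel_measurable G" for j
  proof -
    have "(\<lambda>x. \<integral>z. lip_min k (L j) z \<partial>\<kappa> x) \<in> borel_measurable G"
      by (rule measurable_compose[OF measurable_prob_algebraD[OF \<kappa>m] integral_measurable_subprob_algebra]) measurable
    then show ?thesis unfolding D_def by simp
  qed
  have Dint: "integrable M (D j)" 
    and DA: "A \<in> sets G \<Longrightarrow> (\<integral>x. indicator A x * D j x \<partial>M) = (\<integral>x. indicator A x * (lip_min k (L j) (Z x) - (\<integral>y. lip_min k (L j) (Z y) \<partial>M)) \<partial>M)" for j A
  proof -
    let ?g = "lip_min k (L j)"
    obtain c where c: "0 \<le> c" "\<And>z. z \<in> space ?N \<Longrightarrow> \<forall>i\<in>{1..k}. \<bar>z i\<bar> \<le> b \<Longrightarrow> \<bar>?g z\<bar> \<le> c"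
      using lipschitz_l1_bounded_on_box[OF lip_min_in_lipschitz_l1, of k b "L j"] by metis
    define E where "E x = (\<integral>z. ?g z \<partial>\<kappa> x)" for x
    have EG: "E \<in> borel_measurable G" unfolding E_def
      by (rule measurable_compose[OF measurable_prob_algebraD[OF \<kappa>m] integral_measurable_subprob_algebra]) measurable
    have EM[measurable]: "E \<in> borel_measurable M" by (rule measurable_from_subalg[OF G EG])
    \<comment> \<open>adding the bound \<open>c\<close> makes the integrand nonnegative\<close>
    have nnE: "AE x in M. (\<integral>\<^sup>+z. ennreal (?g z + c) \<partial>\<kappa> x) = ennreal (E x + c) \<and> \<bar>E x\<bar> \<le> c"
      using \<kappa>box AE_space
    proof eventually_elim
      case (elim x)
      interpret K: prob_space "\<kappa> x" using elim by (simp add: box_law_def)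
      have s: "sets (\<kappa> x) = sets ?N" using elim by (simp add: box_law_def)
      have int: "integrable (\<kappa> x) ?g" by (rule box_law_integrable[OF elim(1) lip_min_in_lipschitz_l1])
      have "AE z in \<kappa> x. \<forall>i\<in>{1..k}. \<bar>z i\<bar> \<le> b" using elim by (simp add: box_law_def)
      then have ae: "AE z in \<kappa> x. \<bar>?g z\<bar> \<le> c" using AE_space
        by eventually_elim (use c(2) sets_eq_imp_space_eq[OF s] in auto)
      have "(\<integral>\<^sup>+z. ennreal (?g z + c) \<partial>\<kappa> x) = ennreal (\<integral>z. ?g z + c \<partial>\<kappa> x)"
        using int ae by (intro nn_integral_eq_integral) auto
      moreover have "(\<integral>z. ?g z + c \<partial>\<kappa> x) = E x + c" using int by (simp add: E_def K.prob_space)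
      moreover have "E x \<le> c" "- c \<le> E x" unfolding E_def
        using int ae by (auto intro!: K.integral_le_const K.integral_ge_const)
      ultimately show ?case by auto
    qed
    have iE: "integrable M E" by (rule integrable_const_bound[where B = c]) (use nnE in auto)
    have gZ: "\<bar>?g (Z x)\<bar> \<le> c" if "x \<in> space M" for x
      using c(2)[OF measurable_space[OF Z that]] b[OF that] by blast
    have gZ0: "0 \<le> ?g (Z x) + c" if "x \<in> space M" for x using gZ[OF that] by linarith
    have igZ: "integrable M (\<lambda>x. ?g (Z x))" by (rule integrable_const_bound[where B = c]) (use gZ in auto)
    have P: "(\<integral>z. ?g z \<partial>P) = (\<integral>y. ?g (Z y) \<partial>M)" unfolding P_def by (rule integral_distr) measurable
    have "D j = (\<lambda>x. E x - (\<integral>z. ?g z \<partial>P))" by (simp add: D_def E_def fun_eq_iff)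
    then show "integrable M (D j)" using iE by simp
    assume A: "A \<in> sets G"
    have [measurable]: "A \<in> sets M" by (rule GM[OF A])
    have iA: "integrable M (\<lambda>x. indicator A x * E x)" "integrable M (\<lambda>x. indicator A x * ?g (Z x))"
       "integrable M (\<lambda>x. indicator A x * (c :: real))"
      using integrable_mult_indicator[of A M E] integrable_mult_indicator[of A M "\<lambda>x. ?g (Z x)"]
        integrable_mult_indicator[of A M "\<lambda>x. c"] iE igZ by auto
    have "ennreal (\<integral>x. indicator A x * (E x + c) \<partial>M) = (\<integral>\<^sup>+x. ennreal (indicator A x * (E x + c)) \<partial>M)"
      using iA nnE by (intro nn_integral_eq_integral[symmetric]) (auto simp: distrib_left split: split_indicator)
    also have "\<dots> = (\<integral>\<^sup>+x. indicator A x * (\<integral>\<^sup>+z. ennreal (?g z + c) \<partial>\<kappa> x) \<partial>M)"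
      by (rule nn_integral_cong_AE) (use nnE in \<open>auto split: split_indicator\<close>)
    also have "\<dots> = (\<integral>\<^sup>+x. indicator A x * ennreal (?g (Z x) + c) \<partial>M)"
      by (rule \<kappa>int[OF A]) measurable
    also have "\<dots> = (\<integral>\<^sup>+x. ennreal (indicator A x * (?g (Z x) + c)) \<partial>M)"
      by (intro nn_integral_cong) (auto split: split_indicator)
    also have "\<dots> = ennreal (\<integral>x. indicator A x * (?g (Z x) + c) \<partial>M)"
      using iA gZ0 by (intro nn_integral_eq_integral) (auto simp: distrib_left split: split_indicator intro!: AE_I2)
    finally have "(\<integral>x. indicator A x * (E x + c) \<partial>M) = (\<integral>x. indicator A x * (?g (Z x) + c) \<partial>M)"
    proof (subst (asm) ennreal_inj)
      show "0 \<le> (\<integral>x. indicator A x * (E x + c) \<partial>M)"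
        by (rule integral_nonneg_AE) (use nnE in \<open>auto split: split_indicator\<close>)
      show "0 \<le> (\<integral>x. indicator A x * (?g (Z x) + c) \<partial>M)"
        by (rule integral_nonneg_AE) (use gZ0 in \<open>auto split: split_indicator intro!: AE_I2\<close>)
    qed
    then have "(\<integral>x. indicator A x * E x \<partial>M) = (\<integral>x. indicator A x * ?g (Z x) \<partial>M)"
      using iA by (simp add: distrib_left)
    moreover have "integrable M (\<lambda>x. indicator A x * (e :: real))" for e
      using integrable_mult_indicator[of A M "\<lambda>x. e"] by simp
    ultimately show "(\<integral>x. indicator A x * D j x \<partial>M) = (\<integral>x. indicator A x * (?g (Z x) - (\<integral>y. ?g (Z y) \<partial>M)) \<partial>M)"
      using iA unfolding D_def P E_def[symmetric] by (simp add: right_diff_distrib)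
  qed
  have "tau M G k Z = (\<integral>\<^sup>+x. (SUP g\<in>lipschitz_l1 k. ennreal \<bar>(\<integral>z. g z \<partial>\<kappa> x) - (\<integral>z. g z \<partial>P)\<bar>) \<partial>M)"
    by (simp add: tau_def \<kappa>_def P_def)
  also have "\<dots> = (\<integral>\<^sup>+x. (SUP j. ennreal \<bar>D j x\<bar>) \<partial>M)"
  proof (rule nn_integral_cong_AE)
    have L: "range L = UNIV" by (simp add: L_def)
    show "AE x in M. (SUP g\<in>lipschitz_l1 k. ennreal \<bar>(\<integral>z. g z \<partial>\<kappa> x) - (\<integral>z. g z \<partial>P)\<bar>) = (SUP j. ennreal \<bar>D j x\<bar>)"
      using \<kappa>box
    proof eventually_elim
      case (elim x)
      have "(SUP l. ennreal \<bar>(\<integral>z. lip_min k l z \<partial>\<kappa> x) - (\<integral>z. lip_min k l z \<partial>P)\<bar>) = (SUP j. ennreal \<bar>D j x\<bar>)"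
        unfolding D_def L[symmetric] by (simp add: image_image)
      then show ?case unfolding lipschitz_sup_eq_countable_sup[OF elim Pbox] .
    qed
  qed
  also have "\<dots> \<le> \<Lambda> (space M)"
  proof (rule nn_integral_sup_le_superadditive[OF GM sG \<Lambda> DG Dint])
    fix j A assume A: "A \<in> sets G"
    show "ennreal \<bar>\<integral>x. indicator A x * D j x \<partial>M\<bar> \<le> \<Lambda> A"
      unfolding DA[OF A] by (rule le[OF A lip_min_in_lipschitz_l1])
  qed
  finally show ?thesis .
qed

section \<open>Inverse branches of the induced map\<close>

text \<open>
  The induced map seen through its inverse branches: \<open>a n\<close> enumerates the partition, \<open>s n\<close> is the
  inverse of \<open>a n \<rightarrow> Y\<close> and \<open>J n\<close> is the inverse Jacobian along it, so that \<open>change_vars\<close> holds. A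
  branch is only a bijection up to null sets; the inverse and metric properties are therefore
  asserted on a set \<open>B\<close> of full measure, common to all branches.
\<close>

locale inverse_branches =
  fixes f :: "'a::polish_space \<Rightarrow> 'a" and Y :: "'a set" and m :: "'a measure" and R :: "'a \<Rightarrow> nat"
    and a :: "nat \<Rightarrow> 'a set" and r :: "nat \<Rightarrow> nat" and s :: "nat \<Rightarrow> 'a \<Rightarrow> 'a"
    and J :: "nat \<Rightarrow> 'a \<Rightarrow> real" and B :: "'a set" and L K :: real
  assumes f_meas: "f \<in> borel_measurable borel"
    and finite_m: "finite_measure m"
    and Y_borel: "Y \<in> sets borel"
    and space_mY: "space m = Y"
    and sets_mY: "sets m = sets (restrict_space borel Y)"
    and a_sets: "\<And>n. a n \<in> sets m" and a_disj: "disjoint_family a" and a_Un: "(\<Union>n. a n) = Y"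
    and r_pos: "\<And>n. 1 \<le> r n" and r_R: "\<And>n y. y \<in> a n \<Longrightarrow> R y = r n" and r_Gcd: "Gcd (range r) = 1"
    and R_int: "integrable m (\<lambda>y. real (R y))"
    and F_Y: "\<And>y. y \<in> Y \<Longrightarrow> induced_map f R y \<in> Y"
    and s_meas: "\<And>n. s n \<in> m \<rightarrow>\<^sub>M m" and s_a: "\<And>n y. y \<in> Y \<Longrightarrow> s n y \<in> a n"
    and J_meas: "\<And>n. J n \<in> borel_measurable m" and J_pos: "\<And>n y. y \<in> Y \<Longrightarrow> 0 < J n y"
    and B_sets: "B \<in> sets m" and B_full: "emeasure m (Y - B) = 0"
    and F_s: "\<And>n y. y \<in> B \<Longrightarrow> induced_map f R (s n y) = y"
    and L_gt1: "1 < L" and K_pos: "0 < K"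
    and s_contr: "\<And>n y y'. y \<in> B \<Longrightarrow> y' \<in> B \<Longrightarrow> dist (s n y) (s n y') \<le> dist y y' / L"
    and s_flight: "\<And>n y y' k. y \<in> B \<Longrightarrow> y' \<in> B \<Longrightarrow> k \<le> r n \<Longrightarrow>
          dist ((f ^^ k) (s n y)) ((f ^^ k) (s n y')) \<le> K * dist y y'"
    and J_ratio: "\<And>n y y'. y \<in> B \<Longrightarrow> y' \<in> B \<Longrightarrow> J n y \<le> exp (K * dist y y') * J n y'"
    and change_vars: "\<And>n v. v \<in> borel_measurable m \<Longrightarrow>
          (\<integral>\<^sup>+x. v x * indicator (a n) x \<partial>m) = (\<integral>\<^sup>+y. v (s n y) * ennreal (J n y) \<partial>m)"

lemma (in nonuniformly_expanding) finite_measure_m: "finite_measure m"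
proof
  have "integrable m (\<lambda>y. 1 :: real)"
  proof (rule Bochner_Integration.integrable_bound[OF R_integrable])
    show "AE x in m. norm (1 :: real) \<le> norm (real (R x))"
      using R_ge_1 by (intro AE_I2) (auto simp: space_m)
  qed simp
  then have "emeasure m (space m) < \<infinity>"
    by (simp add: integrable_iff_bounded)
  then show "emeasure m (space m) \<noteq> \<infinity>" by simp
qed

text \<open>
  The identity \<open>dm = \<zeta> d(m \<circ> F)\<close> becomes the change of variables because \<open>m \<circ> F\<close> is the image of
  \<open>m\<close> under the inverse branch. Outside \<open>B\<close> the branch takes the arbitrary value \<open>y0\<close>, which keeps
  it measurable with values in \<open>a\<close>.
\<close>

lemma (in nonuniformly_expanding) branch_exists:
  assumes a: "a \<in> \<Gamma>" and y0: "y0 \<in> a"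
    and inj: "inj_on (induced_map f R) a"
    and \<zeta>: "inverse_jacobian m (induced_map f R) a \<zeta>"
  shows "\<exists>s B. s \<in> m \<rightarrow>\<^sub>M m \<and> (\<forall>y. s y \<in> a) \<and> B \<in> sets m \<and> emeasure m (Y - B) = 0 \<and>
     (\<forall>y\<in>B. induced_map f R (s y) = y) \<and>
     (\<lambda>y. \<zeta> (s y)) \<in> borel_measurable m \<and>
     (\<forall>v\<in>borel_measurable m. (\<integral>\<^sup>+x. v x * indicator a x \<partial>m) = (\<integral>\<^sup>+y. v (s y) * ennreal (\<zeta> (s y)) \<partial>m))"
proof -
  let ?F = "induced_map f R"
  have a_sets: "a \<in> sets m" using measurable_\<Gamma> a by blast
  have aY: "a \<subseteq> Y" using sets.sets_into_space[OF a_sets] by (simp add: space_m)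
  let ?ma = "restrict_space m a"
  have spa: "space ?ma = a" using aY by (simp add: space_restrict_space space_m Int_absorb2)
  have seta: "N \<in> sets ?ma \<longleftrightarrow> N \<in> sets m \<and> N \<subseteq> a" for N
    using a_sets by (subst sets_restrict_space_iff) (auto simp: space_m aY Int_absorb2)
  obtain A B where AB: "A \<in> sets ?ma" "B \<in> sets m" "emeasure ?ma (a - A) = 0" "emeasure m (Y - B) = 0"
    "bij_betw ?F A B" "?F \<in> restrict_space ?ma A \<rightarrow>\<^sub>M restrict_space m B"
    "the_inv_into A ?F \<in> restrict_space m B \<rightarrow>\<^sub>M restrict_space ?ma A"
    using mt_bij[OF a] unfolding mt_bijection_def spa space_m by blast
  have A: "A \<in> sets m" "A \<subseteq> a" using AB(1) seta by auto
  have BY: "B \<subseteq> Y" using sets.sets_into_space[OF AB(2)] by (simp add: space_m)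
  have a_A: "emeasure m (a - A) = 0" using AB(3) a_sets by (subst (asm) emeasure_restrict_space) auto
  define s where "s y = (if y \<in> B then the_inv_into A ?F y else y0)" for y
  have sB: "s y \<in> A" "?F (s y) = y" if "y \<in> B" for y
    using that AB(5) the_inv_into_into[of ?F A y A] f_the_inv_into_f[of ?F A y]
    by (auto simp: s_def bij_betw_def)
  have sF: "s (?F x) = x" if "x \<in> A" for x
    using that AB(5) by (auto simp: s_def bij_betw_def the_inv_into_f_f)
  have sa: "s y \<in> a" for y using sB(1)[of y] A y0 by (cases "y \<in> B") (auto simp: s_def)
  have s_meas: "s \<in> m \<rightarrow>\<^sub>M m"
    unfolding s_def
  proof (rule measurable_If_restrict_space_iff[THEN iffD2])
    show "{x \<in> space m. x \<in> B} \<in> sets m" using AB(2) by simp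
    have "the_inv_into A ?F \<in> restrict_space m B \<rightarrow>\<^sub>M m"
      using AB(7) A by (auto simp: measurable_restrict_space2_iff)
    then have "the_inv_into A ?F \<in> restrict_space m {x. x \<in> B} \<rightarrow>\<^sub>M m" by simp
    moreover have "(\<lambda>x. y0) \<in> restrict_space m {x. x \<notin> B} \<rightarrow>\<^sub>M m"
      using y0 aY by (intro measurable_const) (auto simp: space_m)
    ultimately show "the_inv_into A ?F \<in> restrict_space m {x. x \<in> B} \<rightarrow>\<^sub>M m \<and> (\<lambda>x. y0) \<in> restrict_space m {x. x \<notin> B} \<rightarrow>\<^sub>M m" ..
  qed
  have s_meas_a: "s \<in> m \<rightarrow>\<^sub>M ?ma"
    using s_meas sa by (intro measurable_restrict_space2) auto
  let ?c = "comp_measure m ?F a"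
  have \<zeta>_meas: "\<zeta> \<in> borel_measurable ?ma" and \<zeta>_pos: "\<And>x. x \<in> a \<Longrightarrow> 0 < \<zeta> x"
    and dens: "density ?c (\<lambda>x. ennreal (\<zeta> x)) = ?ma"
    using \<zeta> by (auto simp: inverse_jacobian_def)
  have pow: "sets ?ma \<subseteq> Pow a" using seta by auto
  have sig: "sigma_sets a (sets ?ma) = sets ?ma" using sets.sigma_sets_eq[of ?ma] by (simp add: spa)
  have c_sets: "sets ?c = sets ?ma" and c_space: "space ?c = a"
    unfolding comp_measure_def using pow sig by (auto simp: space_measure_of_conv)
  have \<zeta>_c: "\<zeta> \<in> borel_measurable ?c" using \<zeta>_meas by (simp cong: measurable_cong_sets add: c_sets)
  have c_em: "emeasure ?c N = emeasure m (?F ` N)" if N: "N \<in> sets ?ma" for N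
  proof -
    have "measure_space a (sigma_sets a (sets ?ma)) (\<lambda>A. emeasure m (?F ` A))"
    \<comment> \<open>\<open>comp_measure\<close> is the trivial measure if its set function were not a measure, and then
      \<open>m\<close> would vanish on \<open>a\<close>\<close>
    proof (rule ccontr)
      assume not: "\<not> ?thesis"
      have "emeasure ?c M = 0" for M
        unfolding comp_measure_def emeasure_measure_of_conv using not by simp
      then have "emeasure (density ?c (\<lambda>x. ennreal (\<zeta> x))) a = 0"
        using \<zeta>_c sets.top[of ?c] by (simp add: emeasure_density c_space null_sets_def nn_integral_null_set)
      then have "emeasure ?ma a = 0" unfolding dens .
      then show False using positive_\<Gamma>[OF a] a_sets by (simp add: emeasure_restrict_space)
    qed
    then show ?thesis
      unfolding comp_measure_def emeasure_measure_of_conv using N pow sig by simp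
  qed
  have c_null: "emeasure ?c (a - A) = 0"
  proof -
    have aA: "a - A \<in> sets ?c" using c_sets seta A a_sets by auto
    have "emeasure (density ?c (\<lambda>x. ennreal (\<zeta> x))) (a - A) = 0" unfolding dens by (rule AB(3))
    then have "(\<integral>\<^sup>+x. ennreal (\<zeta> x) * indicator (a - A) x \<partial>?c) = 0"
      using \<zeta>_c aA by (simp add: emeasure_density)
    then have "AE x in ?c. ennreal (\<zeta> x) * indicator (a - A) x = 0"
      using \<zeta>_c aA by (subst (asm) nn_integral_0_iff_AE) auto
    then have "AE x in ?c. x \<notin> a - A" using AE_space
      by eventually_elim (auto simp: c_space ennreal_eq_0_iff dest: \<zeta>_pos split: split_indicator_asm)
    then show ?thesis using AE_iff_null_sets[OF aA] by (auto simp: null_sets_def)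
  qed
  have c_distr: "?c = distr m ?ma s"
  proof (rule measure_eqI)
    show "sets ?c = sets (distr m ?ma s)" by (simp add: c_sets)
    fix N assume "N \<in> sets ?c"
    then have N: "N \<in> sets ?ma" by (simp add: c_sets)
    have NA: "N \<inter> A \<in> sets ?ma" "N - A \<in> sets ?ma" using N A seta by auto
    have "emeasure ?c (N - A) \<le> emeasure ?c (a - A)"
      using N NA seta A a_sets by (intro emeasure_mono) (auto simp: c_sets)
    then have "emeasure ?c (N - A) = 0" using c_null by simp
    moreover have "emeasure ?c N = emeasure ?c (N \<inter> A) + emeasure ?c (N - A)"
      using NA by (subst plus_emeasure) (auto simp: c_sets intro!: arg_cong[where f = "emeasure _"])
    ultimately have "emeasure ?c N = emeasure m (?F ` (N \<inter> A))" using c_em[OF NA(1)] by simp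
    also have "?F ` (N \<inter> A) = s -` N \<inter> space m \<inter> B"
    proof (intro equalityI subsetI)
      fix y assume "y \<in> ?F ` (N \<inter> A)"
      then obtain x where x: "x \<in> N" "x \<in> A" "y = ?F x" by auto
      then have "y \<in> B" using AB(5) by (auto simp: bij_betw_def)
      then show "y \<in> s -` N \<inter> space m \<inter> B" using x sF[OF x(2)] BY by (auto simp: space_m)
    next
      fix y assume "y \<in> s -` N \<inter> space m \<inter> B"
      then show "y \<in> ?F ` (N \<inter> A)" using sB[of y] by (intro image_eqI[where x = "s y"]) auto
    qed
    also have "emeasure m (s -` N \<inter> space m \<inter> B) = emeasure m (s -` N \<inter> space m)"
    proof -
      have sN: "s -` N \<inter> space m \<in> sets m" using measurable_sets[OF s_meas_a N] .
      have "AE y in m. y \<in> B"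
      proof (rule AE_I[where N = "Y - B"])
        show "Y - B \<in> sets m" using AB(2) sets.top[of m] by (auto simp: space_m)
      qed (use AB(4) in \<open>auto simp: space_m\<close>)
      then show ?thesis using sN AB(2) by (intro emeasure_eq_AE) auto
    qed
    also have "\<dots> = emeasure (distr m ?ma s) N" using s_meas_a N by (simp add: emeasure_distr)
    finally show "emeasure ?c N = emeasure (distr m ?ma s) N" .
  qed
  have cv: "(\<integral>\<^sup>+x. v x * indicator a x \<partial>m) = (\<integral>\<^sup>+y. v (s y) * ennreal (\<zeta> (s y)) \<partial>m)"
    if v: "v \<in> borel_measurable m" for v
  proof -
    have va: "v \<in> borel_measurable ?ma" using v by (rule measurable_restrict_space1)
    have "(\<integral>\<^sup>+x. v x * indicator a x \<partial>m) = (\<integral>\<^sup>+x. v x \<partial>?ma)"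
      using a_sets by (simp add: nn_integral_restrict_space)
    also have "\<dots> = (\<integral>\<^sup>+x. v x \<partial>density ?c (\<lambda>x. ennreal (\<zeta> x)))" unfolding dens ..
    also have "\<dots> = (\<integral>\<^sup>+x. ennreal (\<zeta> x) * v x \<partial>?c)"
      using \<zeta>_c va by (subst nn_integral_density) (auto cong: measurable_cong_sets simp: c_sets)
    also have "\<dots> = (\<integral>\<^sup>+y. ennreal (\<zeta> (s y)) * v (s y) \<partial>m)"
      unfolding c_distr using s_meas_a \<zeta>_meas va by (subst nn_integral_distr) auto
    finally show ?thesis by (simp add: mult.commute)
  qed
  have "(\<lambda>y. \<zeta> (s y)) \<in> borel_measurable m" by (rule measurable_compose[OF s_meas_a \<zeta>_meas])
  then show ?thesis using s_meas sa AB(2,4) sB(2) cv by blast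
qed

lemma (in nonuniformly_expanding) inverse_branches_exist:
  "\<exists>a r s J B L K. inverse_branches f Y m R a r s J B L K"
proof -
  let ?F = "induced_map f R"
  obtain L K where LK: "1 < L" "0 < K" and exp: "\<And>a x y. a \<in> \<Gamma> \<Longrightarrow> x \<in> a \<Longrightarrow> y \<in> a \<Longrightarrow> L * dist x y \<le> dist (?F x) (?F y)"
    and flight: "\<And>a x y k. a \<in> \<Gamma> \<Longrightarrow> x \<in> a \<Longrightarrow> y \<in> a \<Longrightarrow> k \<le> R x \<Longrightarrow> dist ((f ^^ k) x) ((f ^^ k) y) \<le> K * dist (?F x) (?F y)"
    and jac: "\<And>a. a \<in> \<Gamma> \<Longrightarrow> \<exists>\<zeta>. inverse_jacobian m ?F a \<zeta> \<and> (\<forall>x\<in>a. \<forall>y\<in>a. \<bar>ln \<bar>\<zeta> x\<bar> - ln \<bar>\<zeta> y\<bar>\<bar> \<le> K * dist (?F x) (?F y))"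
    using expansion_distortion by (auto 0 4)
  define a where "a = from_nat_into \<Gamma>"
  have bij: "bij_betw a UNIV \<Gamma>" unfolding a_def using countable_\<Gamma> infinite_\<Gamma> by (rule bij_betw_from_nat_into)
  have a\<Gamma>: "a n \<in> \<Gamma>" for n using bij by (auto simp: bij_betw_def)
  have a_ne: "a n \<noteq> {}" for n using partition a\<Gamma>[of n] by (auto simp: partition_on_def)
  define y0 where "y0 n = (SOME y. y \<in> a n)" for n
  have y0: "y0 n \<in> a n" for n unfolding y0_def using a_ne[of n] by (simp add: some_in_eq)
  have a_disj: "disjoint_family a"
    unfolding disjoint_family_on_def
  proof (intro ballI impI)
    fix i j :: nat assume "i \<noteq> j"
    then have "a i \<noteq> a j" using bij by (auto simp: bij_betw_def inj_on_def)
    then show "a i \<inter> a j = {}" using partition a\<Gamma> by (auto simp: partition_on_def disjoint_def)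
  qed
  have aUn: "(\<Union>n. a n) = Y" using bij partition by (auto simp: bij_betw_def partition_on_def)
  have aY: "a n \<subseteq> Y" for n using aUn by blast
  define r where "r n = R (y0 n)" for n
  have rR: "R y = r n" if "y \<in> a n" for y n unfolding r_def by (rule R_constant[OF a\<Gamma> that y0])
  have inj: "inj_on ?F (a n)" for n
  proof (rule inj_onI)
    fix x y assume xy: "x \<in> a n" "y \<in> a n" "?F x = ?F y"
    then have "L * dist x y \<le> 0" using exp[OF a\<Gamma> xy(1,2)] by simp
    then show "x = y" using LK by (smt (verit) mult_pos_pos zero_less_dist_iff)
  qed
  obtain \<zeta> where \<zeta>: "\<And>n. inverse_jacobian m ?F (a n) (\<zeta> n)"
    "\<And>n x y. x \<in> a n \<Longrightarrow> y \<in> a n \<Longrightarrow> \<bar>ln \<bar>\<zeta> n x\<bar> - ln \<bar>\<zeta> n y\<bar>\<bar> \<le> K * dist (?F x) (?F y)"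
    using jac[OF a\<Gamma>] by metis
  have "\<forall>n. \<exists>s B. s \<in> m \<rightarrow>\<^sub>M m \<and> (\<forall>y. s y \<in> a n) \<and> B \<in> sets m \<and> emeasure m (Y - B) = 0 \<and>
     (\<forall>y\<in>B. ?F (s y) = y) \<and> (\<lambda>y. \<zeta> n (s y)) \<in> borel_measurable m \<and>
     (\<forall>v\<in>borel_measurable m. (\<integral>\<^sup>+x. v x * indicator (a n) x \<partial>m) = (\<integral>\<^sup>+y. v (s y) * ennreal (\<zeta> n (s y)) \<partial>m))"
    by (intro allI branch_exists[OF a\<Gamma> y0 inj \<zeta>(1)])
  then obtain s where s: "\<forall>n. \<exists>B. s n \<in> m \<rightarrow>\<^sub>M m \<and> (\<forall>y. s n y \<in> a n) \<and> B \<in> sets m \<and> emeasure m (Y - B) = 0 \<and>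
     (\<forall>y\<in>B. ?F (s n y) = y) \<and> (\<lambda>y. \<zeta> n (s n y)) \<in> borel_measurable m \<and>
     (\<forall>v\<in>borel_measurable m. (\<integral>\<^sup>+x. v x * indicator (a n) x \<partial>m) = (\<integral>\<^sup>+y. v (s n y) * ennreal (\<zeta> n (s n y)) \<partial>m))"
    by (rule choice[THEN exE])
  then obtain BB where BB: "\<forall>n. s n \<in> m \<rightarrow>\<^sub>M m \<and> (\<forall>y. s n y \<in> a n) \<and> BB n \<in> sets m \<and> emeasure m (Y - BB n) = 0 \<and>
     (\<forall>y\<in>BB n. ?F (s n y) = y) \<and> (\<lambda>y. \<zeta> n (s n y)) \<in> borel_measurable m \<and>
     (\<forall>v\<in>borel_measurable m. (\<integral>\<^sup>+x. v x * indicator (a n) x \<partial>m) = (\<integral>\<^sup>+y. v (s n y) * ennreal (\<zeta> n (s n y)) \<partial>m))"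
    by (rule choice[THEN exE])
  define B where "B = (\<Inter>n. BB n)"
  have B_sets: "B \<in> sets m" unfolding B_def using BB by (intro sets.countable_INT) auto
  have B_full: "emeasure m (Y - B) = 0"
  proof -
    have "Y - B = (\<Union>n. Y - BB n)" by (auto simp: B_def)
    moreover have "(\<Union>n. Y - BB n) \<in> null_sets m"
      using BB sets.top[of m] by (intro null_sets_UN) (auto simp: null_sets_def space_m)
    ultimately show ?thesis by (auto simp: null_sets_def)
  qed
  have sB: "?F (s n y) = y" "s n y \<in> a n" if "y \<in> B" for n y using BB that by (auto simp: B_def)
  have \<zeta>pos: "0 < \<zeta> n x" if "x \<in> a n" for n x using \<zeta>(1)[of n] that by (auto simp: inverse_jacobian_def)
  have "inverse_branches f Y m R a r s (\<lambda>n y. \<zeta> n (s n y)) B L K"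
  proof (rule inverse_branches.intro)
    show "f \<in> borel_measurable borel" by (rule f_measurable)
    show "finite_measure m" by (rule finite_measure_m)
    show "Y \<in> sets borel" using closed_Y by (rule borel_closed)
    show "space m = Y" "sets m = sets (restrict_space borel Y)" by (rule space_m sets_m)+
    show "a n \<in> sets m" for n by (rule measurable_\<Gamma>[OF a\<Gamma>])
    show "disjoint_family a" "(\<Union>n. a n) = Y" by (rule a_disj aUn)+
    show "1 \<le> r n" for n unfolding r_def using R_ge_1 y0 aY by blast
    show "y \<in> a n \<Longrightarrow> R y = r n" for n y by (rule rR)
    have "R ` Y = range r"
    proof (intro equalityI subsetI)
      fix x assume "x \<in> R ` Y"
      then show "x \<in> range r" using rR aUn by force
    next
      fix x assume "x \<in> range r"
      then show "x \<in> R ` Y" using y0 aY by (force simp: r_def)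
    qed
    then show "Gcd (range r) = 1" using R_gcd by simp
    show "integrable m (\<lambda>y. real (R y))" by (rule R_integrable)
    show "y \<in> Y \<Longrightarrow> ?F y \<in> Y" for y using returns by (simp add: induced_map_def)
    show "s n \<in> m \<rightarrow>\<^sub>M m" "(\<lambda>y. \<zeta> n (s n y)) \<in> borel_measurable m" for n using BB by auto
    show "s n y \<in> a n" "0 < \<zeta> n (s n y)" for n y using BB \<zeta>pos by auto
    show "B \<in> sets m" "emeasure m (Y - B) = 0" by (rule B_sets B_full)+
    show "y \<in> B \<Longrightarrow> ?F (s n y) = y" for n y by (rule sB)
    show "1 < L" "0 < K" by (rule LK)+
    show "dist (s n y) (s n y') \<le> dist y y' / L" if "y \<in> B" "y' \<in> B" for n y y'
    proof -
      have "L * dist (s n y) (s n y') \<le> dist y y'"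
        using exp[OF a\<Gamma> sB(2)[OF that(1)] sB(2)[OF that(2)]] sB(1)[OF that(1)] sB(1)[OF that(2)] by simp
      then show ?thesis using LK by (simp add: field_simps)
    qed
    show "dist ((f ^^ k) (s n y)) ((f ^^ k) (s n y')) \<le> K * dist y y'" if "y \<in> B" "y' \<in> B" "k \<le> r n" for n y y' k
      using flight[OF a\<Gamma> sB(2)[OF that(1)] sB(2)[OF that(2)], of k] sB(1)[OF that(1)] sB(1)[OF that(2)]
        rR[OF sB(2)[OF that(1)]] that by simp
    show "\<zeta> n (s n y) \<le> exp (K * dist y y') * \<zeta> n (s n y')" if "y \<in> B" "y' \<in> B" for n y y'
    proof -
      have p: "0 < \<zeta> n (s n y)" "0 < \<zeta> n (s n y')" using \<zeta>pos sB that by auto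
      have "ln (\<zeta> n (s n y)) \<le> K * dist y y' + ln (\<zeta> n (s n y'))"
        using \<zeta>(2)[OF sB(2)[OF that(1), of n] sB(2)[OF that(2), of n]] sB(1)[OF that(1), of n] sB(1)[OF that(2), of n] p
        by (simp add: abs_le_iff)
      then have "exp (ln (\<zeta> n (s n y))) \<le> exp (K * dist y y' + ln (\<zeta> n (s n y')))" by simp
      then show ?thesis using p by (simp add: exp_add)
    qed
    show "v \<in> borel_measurable m \<Longrightarrow> (\<integral>\<^sup>+x. v x * indicator (a n) x \<partial>m) = (\<integral>\<^sup>+y. v (s n y) * ennreal (\<zeta> n (s n y)) \<partial>m)" for n v
      using BB by blast
  qed
  then show ?thesis by blast
qed

section \<open>Lipschitz functions are dense in \<open>L\<^sup>1\<close>\<close>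

text \<open>
  Regularity of finite measures encloses \<open>A\<close> between a compact \<open>K\<close> and an open \<open>U\<close> of nearly the
  same measure. As \<open>K\<close> has positive distance \<open>\<delta>\<close> from the complement of \<open>U\<close>, the function
  \<open>max 0 (1 - infdist x K / \<delta>)\<close> separates them.
\<close>

lemma lipschitz_dense_L1_indicator:
  fixes M :: "'a::polish_space measure"
  assumes M: "finite_measure M" and sb: "sets M = sets borel" and A: "A \<in> sets M" and e: "0 < e"
  shows "\<exists>u c. (\<forall>x y. \<bar>u x - u y\<bar> \<le> c * dist x y) \<and> integrable M u \<and> (\<integral>x. \<bar>indicator A x - u x\<bar> \<partial>M) < (e::real)"
proof -
  interpret finite_measure M by fact
  have fin: "emeasure M X \<noteq> \<infinity>" for X by simp
  have Ab: "A \<in> sets borel" using A sb by simp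
  have eM: "emeasure M A < emeasure M A + ennreal (e/2)" using e by (simp add: ennreal_add_left_cancel_less[of _ 0, simplified])
  have "\<exists>U. A \<subseteq> U \<and> open U \<and> emeasure M U < emeasure M A + ennreal (e/2)"
    using eM unfolding outer_regular[OF sb fin Ab] INF_less_iff by auto
  then obtain U where U: "A \<subseteq> U" "open U" "emeasure M U < emeasure M A + ennreal (e/2)" by blast
  have "\<exists>K. K \<subseteq> A \<and> compact K \<and> emeasure M A < emeasure M K + ennreal (e/2)"
  proof (cases "emeasure M A = 0")
    case True
    then show ?thesis using e by (intro exI[of _ "{}"]) auto
  next
    case False
    have "emeasure M A - ennreal (e/2) < emeasure M A"
    proof -
      have "0 < measure M A" using False by (simp add: emeasure_eq_measure zero_less_measure_iff)
      then show ?thesis using e by (simp add: emeasure_eq_measure ennreal_minus ennreal_lessI)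
    qed
    then have "emeasure M A - ennreal (e/2) < (SUP K\<in>{K. K \<subseteq> A \<and> compact K}. emeasure M K)"
      by (simp only: inner_regular[OF sb fin Ab, symmetric])
    then obtain K where K: "K \<subseteq> A" "compact K" "emeasure M A - ennreal (e/2) < emeasure M K"
      unfolding less_SUP_iff by blast
    then have "emeasure M A < emeasure M K + ennreal (e/2)"
    proof -
      have "ennreal (measure M A - e/2) < ennreal (measure M K)"
        using K(3) e by (simp add: emeasure_eq_measure ennreal_minus)
      then have "measure M A - e/2 < measure M K"
        by (metis ennreal_leI linorder_not_less)
      then have "ennreal (measure M A) < ennreal (measure M K + e/2)" using e by (intro ennreal_lessI) (auto intro: add_nonneg_pos)
      then show ?thesis using e by (simp add: emeasure_eq_measure)
    qed
    with K show ?thesis by blast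
  qed
  then obtain K where K: "K \<subseteq> A" "compact K" "emeasure M A < emeasure M K + ennreal (e/2)" by blast
  have Us: "U \<in> sets M" "K \<in> sets M" using U K by (auto simp: sb borel_compact)
  have UK: "measure M (U - K) < e"
  proof -
    have "measure M U < measure M A + e/2"
      using U(3) e by (simp add: emeasure_eq_measure ennreal_plus[symmetric] ennreal_less_iff del: ennreal_plus)
    moreover have "measure M A < measure M K + e/2"
      using K(3) e by (simp add: emeasure_eq_measure ennreal_plus[symmetric] ennreal_less_iff del: ennreal_plus)
    moreover have "measure M (U - K) = measure M U - measure M K"
      using Us U K by (intro finite_measure_Diff) auto
    ultimately show ?thesis by linarith
  qed
  obtain u c where u: "\<And>x y. \<bar>u x - u y\<bar> \<le> c * dist x y" "\<And>x. 0 \<le> u x" "\<And>x. u x \<le> (1::real)" "\<And>x. x \<in> K \<Longrightarrow> u x = 1" "\<And>x. x \<notin> U \<Longrightarrow> u x = 0"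
  proof (cases "K = {}")
    case True
    then show ?thesis using that[of "\<lambda>_. 0" 0] by auto
  next
    case False
    obtain \<delta> where \<delta>: "0 < \<delta>" "\<And>x y. x \<in> K \<Longrightarrow> y \<in> - U \<Longrightarrow> \<delta> \<le> dist x y"
    proof (cases "- U = {}")
      case True
      show ?thesis by (rule that[of 1]) (use True in \<open>simp_all only: empty_iff zero_less_one\<close>)
    next
      case U': False
      have "continuous_on K (\<lambda>x. infdist x (- U))" by (intro continuous_intros)
      then obtain x0 where x0: "x0 \<in> K" "\<And>x. x \<in> K \<Longrightarrow> infdist x0 (- U) \<le> infdist x (- U)"
        using continuous_attains_inf[OF K(2) False] by blast
      have "x0 \<notin> - U" using x0(1) K U by blast
      then have "0 < infdist x0 (- U)"
        using in_closed_iff_infdist_zero[of "- U" x0] U U' infdist_nonneg[of x0 "- U"] by (auto simp: less_le)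
      moreover have "infdist x0 (- U) \<le> dist x y" if "x \<in> K" "y \<in> - U" for x y
        using x0(2)[OF that(1)] infdist_le[OF that(2), of x] by linarith
      ultimately show ?thesis by (rule that)
    qed
    define u where "u x = max 0 (1 - infdist x K / \<delta>)" for x
    show ?thesis
    proof (rule that[of u "1/\<delta>"])
      fix x y
      have "\<bar>infdist x K - infdist y K\<bar> \<le> dist x y" by (rule infdist_triangle_abs)
      then have "\<bar>infdist x K / \<delta> - infdist y K / \<delta>\<bar> \<le> dist x y / \<delta>"
        using \<delta> by (simp add: diff_divide_distrib[symmetric] abs_divide divide_right_mono)
      then show "\<bar>u x - u y\<bar> \<le> 1 / \<delta> * dist x y" by (auto simp: u_def)
    next
      fix x show "0 \<le> u x" "u x \<le> 1" using \<delta> infdist_nonneg[of x K] by (auto simp: u_def)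
    next
      fix x assume "x \<in> K" then show "u x = 1" by (simp add: u_def)
    next
      fix x assume x: "x \<notin> U"
      have "\<delta> \<le> infdist x K" unfolding infdist_notempty[OF False]
        using x \<delta>(2) False by (intro cINF_greatest) (auto simp: dist_commute)
      then show "u x = 0" using \<delta> by (simp add: u_def)
    qed
  qed
  have "continuous_on UNIV u"
  proof (rule continuous_onI)
    fix x e' assume e': "0 < (e'::real)"
    show "\<exists>d>0. \<forall>x'\<in>UNIV. dist x' x < d \<longrightarrow> dist (u x') (u x) \<le> e'"
    proof (intro exI[of _ "e' / (\<bar>c\<bar> + 1)"] conjI ballI impI)
      show "0 < e' / (\<bar>c\<bar> + 1)" using e' by simp
      fix x' assume d: "dist x' x < e' / (\<bar>c\<bar> + 1)"
      have "\<bar>u x' - u x\<bar> \<le> c * dist x' x" by (rule u)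
      also have "\<dots> \<le> (\<bar>c\<bar> + 1) * dist x' x" by (intro mult_right_mono) auto
      also have "\<dots> \<le> e'" using d by (simp add: field_simps)
      finally show "dist (u x') (u x) \<le> e'" by (simp add: dist_real_def)
    qed
  qed
  then have um: "u \<in> borel_measurable M"
    using borel_measurable_continuous_onI[of u] by (simp cong: measurable_cong_sets add: sb)
  have ui: "integrable M u" by (rule integrable_const_bound[where B = 1]) (use u um in auto)
  have "(\<integral>x. \<bar>indicator A x - u x\<bar> \<partial>M) \<le> (\<integral>x. indicator (U - K) x \<partial>M)"
  proof (rule integral_mono)
    show "integrable M (\<lambda>x. \<bar>indicator A x - u x\<bar>)"
      using ui A by (intro integrable_abs Bochner_Integration.integrable_diff integrable_real_indicator) (auto simp: less_top[symmetric])
    show "integrable M (indicator (U - K) :: _ \<Rightarrow> real)" using Us by (intro integrable_real_indicator) (auto simp: less_top[symmetric])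
    fix x
    show "\<bar>indicator A x - u x\<bar> \<le> indicator (U - K) x"
      using u(2,3,4,5)[of x] U(1) K(1) by (auto split: split_indicator)
  qed
  also have "\<dots> = measure M (U - K)" using sets_eq_imp_space_eq[OF sb] by simp
  finally show ?thesis using u(1) ui UK by (intro exI[of _ u] exI[of _ c]) auto
qed

lemma lipschitz_dense_L1:
  fixes M :: "'a::polish_space measure" and h :: "'a \<Rightarrow> real"
  assumes M: "finite_measure M" and sb: "sets M = sets borel" and h: "integrable M h"
  shows "\<forall>e>0. \<exists>u c. (\<forall>x y. \<bar>u x - u y\<bar> \<le> c * dist x y) \<and> integrable M u \<and> (\<integral>x. \<bar>h x - u x\<bar> \<partial>M) < (e::real)"
  using h
proof (induction rule: integrable_induct)
  case (base A c)
  show ?case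
  proof (intro allI impI)
    fix e :: real assume e: "0 < e"
    then obtain u k where u: "\<And>x y. \<bar>u x - u y\<bar> \<le> k * dist x y" "integrable M u"
      "(\<integral>x. \<bar>indicator A x - u x\<bar> \<partial>M) < e / (\<bar>c\<bar> + 1)"
      using lipschitz_dense_L1_indicator[OF M sb base(1), of "e / (\<bar>c\<bar> + 1)"] by auto
    show "\<exists>u k. (\<forall>x y. \<bar>u x - u y\<bar> \<le> k * dist x y) \<and> integrable M u \<and> (\<integral>x. \<bar>indicator A x *\<^sub>R c - u x\<bar> \<partial>M) < e"
    proof (intro exI[of _ "\<lambda>x. u x * c"] exI[of _ "k * \<bar>c\<bar>"] conjI allI)
      fix x y
      have "\<bar>u x * c - u y * c\<bar> = \<bar>u x - u y\<bar> * \<bar>c\<bar>" by (simp add: abs_mult[symmetric] left_diff_distrib)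
      also have "\<dots> \<le> (k * dist x y) * \<bar>c\<bar>" using u(1) by (intro mult_right_mono) auto
      finally show "\<bar>u x * c - u y * c\<bar> \<le> k * \<bar>c\<bar> * dist x y" by (simp add: mult_ac)
    next
      show "integrable M (\<lambda>x. u x * c)" using u by simp
      have "(\<integral>x. \<bar>indicator A x *\<^sub>R c - u x * c\<bar> \<partial>M) = (\<integral>x. \<bar>indicator A x - u x\<bar> * \<bar>c\<bar> \<partial>M)"
        by (intro Bochner_Integration.integral_cong) (auto simp: abs_mult[symmetric] left_diff_distrib)
      also have "\<dots> = (\<integral>x. \<bar>indicator A x - u x\<bar> \<partial>M) * \<bar>c\<bar>" by simp
      also have "\<dots> \<le> (e / (\<bar>c\<bar> + 1)) * \<bar>c\<bar>" using u by (intro mult_right_mono) auto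
      also have "\<dots> < e" using e by (simp add: field_simps)
      finally show "(\<integral>x. \<bar>indicator A x *\<^sub>R c - u x * c\<bar> \<partial>M) < e" .
    qed
  qed
next
  case (add f g)
  show ?case
  proof (intro allI impI)
    fix e :: real assume "0 < e"
    then have e2: "0 < e / 2" by simp
    obtain u k where u: "\<And>x y. \<bar>u x - u y\<bar> \<le> k * dist x y" "integrable M u" "(\<integral>x. \<bar>f x - u x\<bar> \<partial>M) < e / 2"
      using add(3) e2 by blast
    obtain v k' where v: "\<And>x y. \<bar>v x - v y\<bar> \<le> k' * dist x y" "integrable M v" "(\<integral>x. \<bar>g x - v x\<bar> \<partial>M) < e / 2"
      using add(4) e2 by blast
    have i: "integrable M (\<lambda>x. \<bar>f x - u x\<bar>)" "integrable M (\<lambda>x. \<bar>g x - v x\<bar>)"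
      "integrable M (\<lambda>x. \<bar>f x + g x - (u x + v x)\<bar>)" using add(1,2) u v by auto
    show "\<exists>u k. (\<forall>x y. \<bar>u x - u y\<bar> \<le> k * dist x y) \<and> integrable M u \<and> (\<integral>x. \<bar>f x + g x - u x\<bar> \<partial>M) < e"
    proof (intro exI[of _ "\<lambda>x. u x + v x"] exI[of _ "k + k'"] conjI allI)
      fix x y show "\<bar>u x + v x - (u y + v y)\<bar> \<le> (k + k') * dist x y"
        using u(1)[of x y] v(1)[of x y] by (simp add: distrib_right)
    next
      show "integrable M (\<lambda>x. u x + v x)" using u v by simp
      have "(\<integral>x. \<bar>f x + g x - (u x + v x)\<bar> \<partial>M) \<le> (\<integral>x. \<bar>f x - u x\<bar> + \<bar>g x - v x\<bar> \<partial>M)"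
        using i by (intro integral_mono) auto
      also have "\<dots> = (\<integral>x. \<bar>f x - u x\<bar> \<partial>M) + (\<integral>x. \<bar>g x - v x\<bar> \<partial>M)" using i by simp
      finally show "(\<integral>x. \<bar>f x + g x - (u x + v x)\<bar> \<partial>M) < e" using u v by linarith
    qed
  qed
next
  case (lim f t)
  show ?case
  proof (intro allI impI)
    fix e :: real assume "0 < e"
    then have e2: "0 < e / 2" by simp
    have fi: "integrable M f" by (rule lim)
    have ti: "integrable M (t i)" for i by (rule lim)
    have "(\<lambda>i. \<integral>x. \<bar>f x - t i x\<bar> \<partial>M) \<longlonglongrightarrow> (\<integral>x. 0 \<partial>M)"
    proof (rule integral_dominated_convergence[where w = "\<lambda>x. 3 * \<bar>f x\<bar>"])
      show "AE x in M. (\<lambda>i. \<bar>f x - t i x\<bar>) \<longlonglongrightarrow> 0"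
      proof (rule AE_I2)
        fix x assume "x \<in> space M"
        then have "(\<lambda>i. t i x) \<longlonglongrightarrow> f x" by (rule lim)
        then have "(\<lambda>i. f x - t i x) \<longlonglongrightarrow> f x - f x" by (intro tendsto_intros)
        then show "(\<lambda>i. \<bar>f x - t i x\<bar>) \<longlonglongrightarrow> 0" using tendsto_rabs_zero by simp
      qed
      show "AE x in M. norm \<bar>f x - t i x\<bar> \<le> 3 * \<bar>f x\<bar>" for i
      proof (rule AE_I2)
        fix x assume "x \<in> space M"
        then have "norm (t i x) \<le> 2 * norm (f x)" by (rule lim)
        then show "norm \<bar>f x - t i x\<bar> \<le> 3 * \<bar>f x\<bar>" by simp
      qed
    qed (use fi ti in auto)
    then have "eventually (\<lambda>i. (\<integral>x. \<bar>f x - t i x\<bar> \<partial>M) < e / 2) sequentially"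
      using e2 by (intro order_tendstoD) auto
    then obtain i where i: "(\<integral>x. \<bar>f x - t i x\<bar> \<partial>M) < e / 2" by (auto simp: eventually_sequentially)
    obtain u k where u: "\<And>x y. \<bar>u x - u y\<bar> \<le> k * dist x y" "integrable M u" "(\<integral>x. \<bar>t i x - u x\<bar> \<partial>M) < e / 2"
      using lim(5)[of i] e2 by blast
    have "(\<integral>x. \<bar>f x - u x\<bar> \<partial>M) \<le> (\<integral>x. \<bar>f x - t i x\<bar> + \<bar>t i x - u x\<bar> \<partial>M)"
      using fi ti u by (intro integral_mono) auto
    also have "\<dots> = (\<integral>x. \<bar>f x - t i x\<bar> \<partial>M) + (\<integral>x. \<bar>t i x - u x\<bar> \<partial>M)"
      using fi ti u by simp
    finally have "(\<integral>x. \<bar>f x - u x\<bar> \<partial>M) < e" using i u by linarith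
    then show "\<exists>u k. (\<forall>x y. \<bar>u x - u y\<bar> \<le> k * dist x y) \<and> integrable M u \<and> (\<integral>x. \<bar>f x - u x\<bar> \<partial>M) < e"
      using u by blast
  qed
qed

context inverse_branches
begin

section \<open>The transfer operator and the invariant density\<close>

abbreviation F :: "'a \<Rightarrow> 'a" where "F \<equiv> induced_map f R"

lemma mem_sets_m: "A \<in> sets m \<longleftrightarrow> A \<in> sets borel \<and> A \<subseteq> Y"
  unfolding sets_mY using Y_borel by (subst sets_restrict_space_iff) auto

lemma measurable_id_m: "(\<lambda>x. x) \<in> m \<rightarrow>\<^sub>M borel"
proof (rule measurableI)
  fix A :: "'a set" assume "A \<in> sets borel"
  then show "(\<lambda>x. x) -` A \<inter> space m \<in> sets m" using Y_borel by (auto simp: mem_sets_m space_mY)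
qed auto

lemma AE_B: "AE y in m. y \<in> B"
proof (rule AE_I[where N = "Y - B"])
  show "Y - B \<in> sets m" using B_sets sets.top[of m] by (auto simp: space_mY)
qed (use B_full in \<open>auto simp: space_mY\<close>)

lemma B_Y: "B \<subseteq> Y" using sets.sets_into_space[OF B_sets] by (simp add: space_mY)

lemma a_Y: "a n \<subseteq> Y" using a_Un by blast

lemma s_Y: "y \<in> Y \<Longrightarrow> s n y \<in> Y" using s_a a_Y by blast

text \<open>
  Inverse branches are nonsingular, since their Jacobians are positive.
\<close>

lemma AE_branch:
  assumes "AE y in m. Q y"
  shows "AE y in m. Q (s n y)"
proof -
  obtain N where N: "{y \<in> space m. \<not> Q y} \<subseteq> N" "N \<in> sets m" "emeasure m N = 0"
    using assms by (auto elim: AE_E)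
  have "(\<integral>\<^sup>+y. indicator N (s n y) * ennreal (J n y) \<partial>m) = (\<integral>\<^sup>+x. indicator N x * indicator (a n) x \<partial>m)"
    using N by (intro change_vars[symmetric]) auto
  also have "\<dots> \<le> (\<integral>\<^sup>+x. indicator N x \<partial>m)"
    by (intro nn_integral_mono) (auto split: split_indicator)
  also have "\<dots> = 0" using N by simp
  finally have "AE y in m. indicator N (s n y) * ennreal (J n y) = 0"
    using N s_meas J_meas by (subst (asm) le_zero_eq, subst (asm) nn_integral_0_iff_AE)
      (auto intro!: borel_measurable_times_ennreal measurable_compose[OF s_meas])
  then show ?thesis using AE_space
  proof eventually_elim
    case (elim y)
    then have "s n y \<notin> N" using J_pos[of y n] by (auto simp: space_mY ennreal_eq_0_iff split: split_indicator_asm)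
    moreover have "s n y \<in> space m" using elim s_Y by (simp add: space_mY)
    ultimately show ?case using N by blast
  qed
qed

primrec word_branch :: "nat list \<Rightarrow> 'a \<Rightarrow> 'a" where
  "word_branch [] y = y"
| "word_branch (n # w) y = word_branch w (s n y)"

lemma AE_word_branch: "(AE y in m. Q y) \<Longrightarrow> AE y in m. Q (word_branch w y)"
proof (induction w)
  case (Cons n w)
  then show ?case using AE_branch[of "\<lambda>y. Q (word_branch w y)" n] by simp
qed simp

lemma word_branch_meas: "word_branch w \<in> m \<rightarrow>\<^sub>M m"
proof (induction w)
  case (Cons n w)
  then show ?case using measurable_compose[OF s_meas[of n] Cons] by simp
qed simp

text \<open>
  The points all of whose backward orbits stay in \<open>P\<close>. There are countably many words, so almost
  everywhere statements can be made to hold along complete backward orbits.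
\<close>

definition invariant_core :: "'a set \<Rightarrow> 'a set" where
  "invariant_core P = {y \<in> Y. \<forall>w. word_branch w y \<in> P}"

lemma invariant_core:
  assumes "P \<in> sets m" "AE y in m. y \<in> P"
  shows "invariant_core P \<in> sets m" "AE y in m. y \<in> invariant_core P" "invariant_core P \<subseteq> P"
    "y \<in> invariant_core P \<Longrightarrow> s n y \<in> invariant_core P"
proof -
  have "invariant_core P = (\<Inter>w. word_branch w -` P \<inter> space m)"
    by (auto simp: invariant_core_def space_mY)
  also have "\<dots> \<in> sets m"
    by (rule sets.countable_INT') (use measurable_sets[OF word_branch_meas assms(1)] in auto)
  finally show "invariant_core P \<in> sets m" .
  have "AE y in m. \<forall>w. word_branch w y \<in> P"
    unfolding AE_all_countable using AE_word_branch[OF assms(2)] by blast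
  then show "AE y in m. y \<in> invariant_core P" using AE_space
    by eventually_elim (simp add: invariant_core_def space_mY)
  show "invariant_core P \<subseteq> P"
  proof
    fix y assume "y \<in> invariant_core P"
    then have "word_branch [] y \<in> P" unfolding invariant_core_def by blast
    then show "y \<in> P" by simp
  qed
  assume "y \<in> invariant_core P"
  then have y: "y \<in> Y" "\<And>w. word_branch w y \<in> P" by (auto simp: invariant_core_def)
  have "word_branch w (s n y) \<in> P" for w using y(2)[of "n # w"] by simp
  then show "s n y \<in> invariant_core P" using s_Y[OF y(1)] by (simp add: invariant_core_def)
qed

definition transfer :: "('a \<Rightarrow> ennreal) \<Rightarrow> 'a \<Rightarrow> ennreal" where
  "transfer u y = (\<Sum>n. ennreal (J n y) * u (s n y))"

lemma transfer_meas[measurable (raw)]: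
  assumes "u \<in> borel_measurable m"
  shows "transfer u \<in> borel_measurable m"
proof -
  have *: "(\<lambda>y. u (s n y)) \<in> borel_measurable m" "(\<lambda>y. ennreal (J n y)) \<in> borel_measurable m" for n
    using J_meas[of n] measurable_compose[OF s_meas[of n] assms] by auto
  show ?thesis unfolding transfer_def[abs_def] by (intro borel_measurable_suminf_order borel_measurable_times_ennreal *)
qed

lemma nn_integral_partition:
  assumes "w \<in> borel_measurable m"
  shows "(\<integral>\<^sup>+x. w x \<partial>m) = (\<Sum>n. \<integral>\<^sup>+x. w x * indicator (a n) x \<partial>m)"
proof -
  have "w x = (\<Sum>n. w x * indicator (a n) x)" if "x \<in> space m" for x
  proof -
    have "(\<Sum>n. indicator (a n) x :: ennreal) = indicator (\<Union>n. a n) x"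
      using a_disj by (rule suminf_indicator)
    then show ?thesis using that by (simp add: a_Un space_mY ennreal_suminf_cmult)
  qed
  then have "(\<integral>\<^sup>+x. w x \<partial>m) = (\<integral>\<^sup>+x. (\<Sum>n. w x * indicator (a n) x) \<partial>m)"
    by (intro nn_integral_cong) auto
  also have "\<dots> = (\<Sum>n. \<integral>\<^sup>+x. w x * indicator (a n) x \<partial>m)"
    using assms a_sets by (intro nn_integral_suminf) auto
  finally show ?thesis .
qed

text \<open>
  The duality between the induced map and its transfer operator, for functions of the point and
  its image.
\<close>

lemma nn_integral_transfer:
  assumes F: "F \<in> m \<rightarrow>\<^sub>M m" and w: "case_prod w \<in> borel_measurable (m \<Otimes>\<^sub>M m)"
  shows "(\<integral>\<^sup>+x. w (F x) x \<partial>m) = (\<integral>\<^sup>+y. (\<Sum>n. ennreal (J n y) * w y (s n y)) \<partial>m)"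
proof -
  have wm: "(\<lambda>x. w (\<alpha> x) (\<beta> x)) \<in> borel_measurable m" if "\<alpha> \<in> m \<rightarrow>\<^sub>M m" "\<beta> \<in> m \<rightarrow>\<^sub>M m" for \<alpha> \<beta>
    using measurable_compose[OF measurable_Pair[OF that] w] by simp
  have "(\<integral>\<^sup>+x. w (F x) x \<partial>m) = (\<Sum>n. \<integral>\<^sup>+x. w (F x) x * indicator (a n) x \<partial>m)"
    by (intro nn_integral_partition wm F) simp
  also have "\<dots> = (\<Sum>n. \<integral>\<^sup>+y. w (F (s n y)) (s n y) * ennreal (J n y) \<partial>m)"
    by (intro suminf_cong change_vars wm F) simp
  also have "\<dots> = (\<Sum>n. \<integral>\<^sup>+y. ennreal (J n y) * w y (s n y) \<partial>m)"
  proof (intro suminf_cong nn_integral_cong_AE)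
    fix n show "AE y in m. w (F (s n y)) (s n y) * ennreal (J n y) = ennreal (J n y) * w y (s n y)"
      using AE_B by eventually_elim (simp add: F_s mult.commute)
  qed
  also have "\<dots> = (\<integral>\<^sup>+y. (\<Sum>n. ennreal (J n y) * w y (s n y)) \<partial>m)"
    using J_meas s_meas by (intro nn_integral_suminf[symmetric] borel_measurable_times_ennreal wm) auto
  finally show ?thesis .
qed

lemma nn_integral_transfer_1:
  assumes "u \<in> borel_measurable m"
  shows "(\<integral>\<^sup>+y. transfer u y \<partial>m) = (\<integral>\<^sup>+x. u x \<partial>m)"
proof -
  have "(\<integral>\<^sup>+x. u x \<partial>m) = (\<Sum>n. \<integral>\<^sup>+x. u x * indicator (a n) x \<partial>m)"
    by (rule nn_integral_partition[OF assms])
  also have "\<dots> = (\<Sum>n. \<integral>\<^sup>+y. ennreal (J n y) * u (s n y) \<partial>m)"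
    by (intro suminf_cong) (simp add: change_vars[OF assms] mult.commute)
  also have "\<dots> = (\<integral>\<^sup>+y. transfer u y \<partial>m)"
    unfolding transfer_def using J_meas measurable_compose[OF s_meas assms]
    by (intro nn_integral_suminf[symmetric] borel_measurable_times_ennreal) auto
  finally show ?thesis ..
qed

lemma transfer_add: "transfer (\<lambda>x. u x + v x) y = transfer u y + transfer v y"
  unfolding transfer_def by (simp add: suminf_add[symmetric] distrib_left)

text \<open>
  Log-Lipschitz functions, in a multiplicative form that also makes sense for the values \<open>0\<close> and
  \<open>\<infinity>\<close>.
\<close>

definition cone :: "'a set \<Rightarrow> real \<Rightarrow> ('a \<Rightarrow> ennreal) \<Rightarrow> bool" where
  "cone G c U \<longleftrightarrow> (\<forall>y\<in>G. \<forall>y'\<in>G. U y \<le> ennreal (exp (c * dist y y')) * U y')"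

text \<open>
  The transfer operator maps the cone \<open>c\<close> into the cone \<open>K + c/L\<close>: distortion of the Jacobian adds
  \<open>K\<close>, contraction of the branch divides \<open>c\<close> by \<open>L\<close>.
\<close>

lemma cone_transfer:
  assumes G: "G \<subseteq> B" "\<And>n y. y \<in> G \<Longrightarrow> s n y \<in> G" and U: "cone G c U" and c: "0 \<le> c"
  shows "cone G (K + c / L) (transfer U)"
  unfolding cone_def
proof (intro ballI)
  fix y y' assume y: "y \<in> G" "y' \<in> G"
  have "transfer U y \<le> (\<Sum>n. ennreal (exp ((K + c / L) * dist y y')) * (ennreal (J n y') * U (s n y')))"
    unfolding transfer_def
  proof (intro suminf_le)
    fix n
    have "U (s n y) \<le> ennreal (exp (c * dist (s n y) (s n y'))) * U (s n y')"
      using U G y unfolding cone_def by blast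
    also have "\<dots> \<le> ennreal (exp (c * (dist y y' / L))) * U (s n y')"
    proof -
      have "c * dist (s n y) (s n y') \<le> c * (dist y y' / L)"
        using s_contr[of y y' n] y G c by (intro mult_left_mono) auto
      then show ?thesis by (intro mult_right_mono ennreal_leI) auto
    qed
    finally have 1: "U (s n y) \<le> ennreal (exp (c * (dist y y' / L))) * U (s n y')" .
    have 2: "ennreal (J n y) \<le> ennreal (exp (K * dist y y')) * ennreal (J n y')"
      using J_ratio[of y y' n] y G by (subst ennreal_mult[symmetric]) (auto intro!: ennreal_leI less_imp_le[OF J_pos] subsetD[OF B_Y])
    have "ennreal (J n y) * U (s n y) \<le> (ennreal (exp (K * dist y y')) * ennreal (J n y')) * (ennreal (exp (c * (dist y y' / L))) * U (s n y'))"
      by (intro mult_mono 1 2) auto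
    also have "\<dots> = (ennreal (exp (K * dist y y')) * ennreal (exp (c * (dist y y' / L)))) * (ennreal (J n y') * U (s n y'))"
      by (simp add: mult_ac)
    also have "ennreal (exp (K * dist y y')) * ennreal (exp (c * (dist y y' / L))) = ennreal (exp ((K + c / L) * dist y y'))"
      by (subst ennreal_mult[symmetric]) (auto simp: exp_add[symmetric] algebra_simps)
    finally show "ennreal (J n y) * U (s n y) \<le> ennreal (exp ((K + c / L) * dist y y')) * (ennreal (J n y') * U (s n y'))" .
  qed auto
  then show "transfer U y \<le> ennreal (exp ((K + c / L) * dist y y')) * transfer U y'"
    by (simp add: transfer_def ennreal_suminf_cmult)
qed

lemma cone_mono: "cone G c U \<Longrightarrow> c \<le> c' \<Longrightarrow> cone G c' U"
  unfolding cone_def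
  by (meson ennreal_leI exp_le_cancel_iff mult_right_mono order_trans zero_le_dist zero_le)

text \<open>
  A constant above the fixed point \<open>K L / (L - 1)\<close> of \<open>c \<mapsto> K + c/L\<close>, so that the iterates of every
  initial constant end up below it.
\<close>

definition C0 :: real where "C0 = K * L / (L - 1) + 1"

lemma cone_transfer_iterate:
  assumes G: "G \<subseteq> B" "\<And>n y. y \<in> G \<Longrightarrow> s n y \<in> G" and U: "cone G c U" and c: "0 \<le> c"
  shows "\<exists>n. cone G C0 ((transfer ^^ n) U)"
proof -
  have it: "cone G (K * L / (L - 1) + c / L ^ n) ((transfer ^^ n) U)" for n
  proof (induction n)
    case 0
    have "c \<le> K * L / (L - 1) + c / L ^ 0" using L_gt1 K_pos by simp
    then show ?case using cone_mono[OF U] by simp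
  next
    case (Suc n)
    have "K + (K * L / (L - 1) + c / L ^ n) / L = K * L / (L - 1) + c / L ^ Suc n"
      using L_gt1 by (simp add: field_simps)
    then show ?case
      using cone_transfer[OF G Suc] c L_gt1 K_pos by simp
  qed
  obtain n where n: "c < L ^ n" using real_arch_pow[OF L_gt1] by blast
  have "c / L ^ n \<le> 1" using n L_gt1 by (simp add: field_simps)
  then have "cone G C0 ((transfer ^^ n) U)" by (intro cone_mono[OF it]) (simp add: C0_def)
  then show ?thesis ..
qed

lemma AE_measurable_set:
  assumes "AE y in m. Q y"
  shows "\<exists>P\<in>sets m. (AE y in m. y \<in> P) \<and> (\<forall>y\<in>P. Q y)"
proof -
  obtain N where N: "{y \<in> space m. \<not> Q y} \<subseteq> N" "N \<in> sets m" "emeasure m N = 0"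
    using assms by (auto elim: AE_E)
  have "AE y in m. y \<in> space m - N" by (rule AE_I[where N = N]) (use N in auto)
  with N show ?thesis by (intro bexI[of _ "space m - N"]) auto
qed

lemma AE_transfer_mono:
  assumes "AE x in m. u x \<le> v x"
  shows "AE y in m. (transfer ^^ n) u y \<le> (transfer ^^ n) v y"
proof (induction n)
  case (Suc n)
  have "AE y in m. \<forall>k. (transfer ^^ n) u (s k y) \<le> (transfer ^^ n) v (s k y)"
    unfolding AE_all_countable using AE_branch[OF Suc] by blast
  then show ?case
  proof eventually_elim
    case (elim y)
    then show ?case unfolding funpow.simps o_def transfer_def by (intro suminf_le mult_left_mono) auto
  qed
qed (use assms in simp)

lemma transfer_iter_add: "(transfer ^^ n) (\<lambda>x. u x + v x) = (\<lambda>x. (transfer ^^ n) u x + (transfer ^^ n) v x)"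
proof (induction n)
  case (Suc n)
  have "(transfer ^^ Suc n) (\<lambda>x. u x + v x) = transfer (\<lambda>x. (transfer ^^ n) u x + (transfer ^^ n) v x)"
    by (simp add: Suc)
  then show ?case by (simp add: transfer_add[abs_def])
qed simp

lemma transfer_iter_meas: "u \<in> borel_measurable m \<Longrightarrow> (transfer ^^ n) u \<in> borel_measurable m"
  by (induction n) (auto intro: transfer_meas)

lemma nn_integral_transfer_iter: "u \<in> borel_measurable m \<Longrightarrow> (\<integral>\<^sup>+y. (transfer ^^ n) u y \<partial>m) = (\<integral>\<^sup>+y. u y \<partial>m)"
  by (induction n) (auto simp: nn_integral_transfer_1 transfer_iter_meas)

lemma lipschitz_positive_cone:
  fixes v :: "'a \<Rightarrow> real"
  assumes e: "0 < e" "\<And>x. e \<le> v x" and lip: "\<And>x y. \<bar>v x - v y\<bar> \<le> c * dist x y" and c: "0 \<le> c"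
  shows "cone G (c / e) (\<lambda>x. ennreal (v x))"
  unfolding cone_def
proof (intro ballI)
  fix y y'
  have v: "0 < v y'" using e less_le_trans by blast
  have "v y \<le> v y' + c * dist y y'" using lip[of y y'] by linarith
  also have "\<dots> \<le> v y' + (c / e * dist y y') * v y'"
  proof -
    have "c * dist y y' * e \<le> c * dist y y' * v y'" using e c by (intro mult_left_mono) auto
    then show ?thesis using e by (simp add: field_simps)
  qed
  also have "\<dots> = (1 + c / e * dist y y') * v y'" by (simp add: algebra_simps)
  also have "\<dots> \<le> exp (c / e * dist y y') * v y'" using v by (intro mult_right_mono exp_ge_add_one_self) auto
  finally show "ennreal (v y) \<le> ennreal (exp (c / e * dist y y')) * ennreal (v y')"
    using v by (subst ennreal_mult[symmetric]) (auto intro: ennreal_leI)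
qed

text \<open>
  Invariance of \<open>\<nu>\<close> is the fixed point equation of the transfer operator, by duality.
\<close>

lemma invariant_density_transfer:
  assumes \<nu>: "abs_cont_invariant_prob m F \<nu>"
  shows "AE y in m. RN_deriv m \<nu> y = transfer (RN_deriv m \<nu>) y"
proof -
  interpret finite_measure m by (rule finite_m)
  let ?h = "RN_deriv m \<nu>"
  have sn: "sets \<nu> = sets m" and F\<nu>: "F \<in> \<nu> \<rightarrow>\<^sub>M \<nu>" and inv: "distr \<nu> \<nu> F = \<nu>" and ac: "absolutely_continuous m \<nu>"
    using \<nu> by (auto simp: abs_cont_invariant_prob_def)
  have Fm[measurable]: "F \<in> m \<rightarrow>\<^sub>M m" using F\<nu> by (simp cong: measurable_cong_sets add: sn)
  have dens: "density m ?h = \<nu>" by (rule density_RN_deriv[OF ac sn])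
  have "density m ?h = density m (transfer ?h)"
  proof (rule measure_eqI)
    fix A assume "A \<in> sets (density m ?h)"
    then have A[measurable]: "A \<in> sets m" by simp
    have "emeasure (density m ?h) A = emeasure (distr \<nu> \<nu> F) A" unfolding dens inv ..
    also have "\<dots> = emeasure \<nu> (F -` A \<inter> space \<nu>)" using F\<nu> A by (simp add: emeasure_distr sn)
    also have "\<dots> = emeasure (density m ?h) (F -` A \<inter> space m)"
      using sets_eq_imp_space_eq[OF sn] by (simp add: dens)
    also have "\<dots> = (\<integral>\<^sup>+x. ?h x * indicator A (F x) \<partial>m)"
      by (subst emeasure_density) (auto intro!: nn_integral_cong split: split_indicator)
    also have "\<dots> = (\<integral>\<^sup>+y. (\<Sum>n. ennreal (J n y) * (?h (s n y) * indicator A y)) \<partial>m)"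
      by (rule nn_integral_transfer[OF Fm, where w = "\<lambda>y x. ?h x * indicator A y"]) measurable
    also have "\<dots> = (\<integral>\<^sup>+y. transfer ?h y * indicator A y \<partial>m)"
      unfolding transfer_def by (simp add: mult.assoc[symmetric] ennreal_suminf_multc)
    also have "\<dots> = emeasure (density m (transfer ?h)) A"
      by (subst emeasure_density) (auto intro: transfer_meas)
    finally show "emeasure (density m ?h) A = emeasure (density m (transfer ?h)) A" .
  qed simp
  then show ?thesis by (intro density_unique) (auto intro: transfer_meas)
qed

lemma lipschitz_approximations:
  fixes g :: "'a \<Rightarrow> real"
  assumes g: "integrable m g"
  shows "\<forall>k::nat. \<exists>u c. 0 \<le> c \<and> (\<forall>x y. \<bar>u x - u y\<bar> \<le> c * dist x y) \<and> u \<in> borel_measurable m \<and>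
    (\<integral>\<^sup>+x. ennreal \<bar>g x - u x\<bar> \<partial>m) \<le> ennreal ((1/2)^k)"
proof
  fix k :: nat
  interpret finite_measure m by (rule finite_m)
  define M where "M = distr m borel (\<lambda>x. x)"
  have fM: "finite_measure M" unfolding M_def by (rule finite_measure_distr[OF measurable_id_m])
  define g' where "g' x = indicator Y x *\<^sub>R g x" for x
  have g'm: "g' \<in> borel_measurable borel"
  proof -
    have "g \<in> borel_measurable (restrict_space borel Y)"
      using borel_measurable_integrable[OF g] by (simp cong: measurable_cong_sets add: sets_mY)
    then show ?thesis unfolding g'_def using Y_borel
      by (subst (asm) borel_measurable_restrict_space_iff) auto
  qed
  have g'i: "integrable M g'"
    unfolding M_def
  proof (subst integrable_distr_eq[OF measurable_id_m g'm])
    show "integrable m g'"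
      by (rule Bochner_Integration.integrable_cong[THEN iffD1, OF refl _ g]) (simp add: g'_def space_mY)
  qed
  obtain u c where u: "\<And>x y. \<bar>u x - u y\<bar> \<le> c * dist x y" "integrable M u" "(\<integral>x. \<bar>g' x - u x\<bar> \<partial>M) < (1/2)^k"
    using lipschitz_dense_L1[OF fM _ g'i, rule_format, of "(1/2)^k"] by (auto simp: M_def)
  have um: "u \<in> borel_measurable borel" using borel_measurable_integrable[OF u(2)] by (simp add: M_def)
  have umm: "u \<in> borel_measurable m" using measurable_compose[OF measurable_id_m um] .
  have "(\<integral>\<^sup>+x. ennreal \<bar>g x - u x\<bar> \<partial>m) = (\<integral>\<^sup>+x. ennreal \<bar>g' x - u x\<bar> \<partial>m)"
    by (intro nn_integral_cong) (simp add: g'_def space_mY)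
  also have "\<dots> = (\<integral>\<^sup>+x. ennreal \<bar>g' x - u x\<bar> \<partial>M)"
    unfolding M_def using g'm um by (subst nn_integral_distr[OF measurable_id_m]) auto
  also have "\<dots> = ennreal (\<integral>x. \<bar>g' x - u x\<bar> \<partial>M)"
    using g'i u by (intro nn_integral_eq_integral) auto
  also have "\<dots> \<le> ennreal ((1/2)^k)" using u by (intro ennreal_leI) simp
  finally have "(\<integral>\<^sup>+x. ennreal \<bar>g x - u x\<bar> \<partial>m) \<le> ennreal ((1/2)^k)" .
  moreover have "\<bar>u x - u y\<bar> \<le> \<bar>c\<bar> * dist x y" for x y
    using u(1)[of x y] by (rule order_trans) (intro mult_right_mono, auto)
  ultimately show "\<exists>u c. 0 \<le> c \<and> (\<forall>x y. \<bar>u x - u y\<bar> \<le> c * dist x y) \<and> u \<in> borel_measurable m \<and>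
    (\<integral>\<^sup>+x. ennreal \<bar>g x - u x\<bar> \<partial>m) \<le> ennreal ((1/2)^k)"
    using umm by (intro exI[of _ u] exI[of _ "\<bar>c\<bar>"]) auto
qed

lemma C0_pos: "0 < C0" using L_gt1 K_pos by (simp add: C0_def add_nonneg_pos)

text \<open>
  The density \<open>h\<close> of the given measure is a limit of iterates of regular functions: approximate
  \<open>h\<close> in \<open>L\<^sup>1\<close>, up to a constant times \<open>2\<^sup>-\<^sup>k\<close>, by Lipschitz functions \<open>v k\<close> bounded below by a
  positive constant, hence in some cone. After sufficiently many steps the transfer operator
  brings \<open>v k\<close> into the cone \<open>C0\<close>; it fixes \<open>h\<close> and does not increase the \<open>L\<^sup>1\<close> error. The errors
  \<open>E k\<close> are summable in \<open>L\<^sup>1\<close>, so they tend to \<open>0\<close> almost everywhere and the cone inequality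
  passes to the limit.
\<close>

lemma invariant_density_cone:
  assumes \<nu>: "abs_cont_invariant_prob m F \<nu>"
  obtains P where "P \<in> sets m" "AE y in m. y \<in> P" "cone P C0 (RN_deriv m \<nu>)"
proof -
  interpret finite_measure m by (rule finite_m)
  let ?h = "RN_deriv m \<nu>"
  have pr: "prob_space \<nu>" and sn: "sets \<nu> = sets m" and ac: "absolutely_continuous m \<nu>"
    using \<nu> by (auto simp: abs_cont_invariant_prob_def)
  have dens: "density m ?h = \<nu>" by (rule density_RN_deriv[OF ac sn])
  have "(\<integral>\<^sup>+x. ?h x \<partial>m) = emeasure (density m ?h) (space m)"
    by (subst emeasure_density) (auto intro!: nn_integral_cong)
  also have "\<dots> = 1" unfolding dens using pr sets_eq_imp_space_eq[OF sn] by (metis prob_space.emeasure_space_1)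
  finally have int1: "(\<integral>\<^sup>+x. ?h x \<partial>m) = 1" .
  have hfin: "AE x in m. ?h x \<noteq> \<infinity>" by (rule nn_integral_noteq_infinite) (auto simp: int1)
  define g where "g x = enn2real (?h x)" for x
  have gm[measurable]: "g \<in> borel_measurable m" unfolding g_def by measurable
  have "(\<integral>\<^sup>+x. ennreal (norm (g x)) \<partial>m) \<le> (\<integral>\<^sup>+x. ?h x \<partial>m)"
    by (intro nn_integral_mono) (auto simp: g_def ennreal_enn2real_if)
  then have gi: "integrable m g" using int1 by (intro integrableI_bounded) (auto intro: le_less_trans)
  obtain u c where u: "\<And>k::nat. 0 \<le> c k" "\<And>k x y. \<bar>u k x - u k y\<bar> \<le> c k * dist x y" "\<And>k. u k \<in> borel_measurable m"
    "\<And>k. (\<integral>\<^sup>+x. ennreal \<bar>g x - u k x\<bar> \<partial>m) \<le> ennreal ((1/2)^k)"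
  proof -
    from choice[OF lipschitz_approximations[OF gi]] obtain u where
      "\<forall>k. \<exists>c. 0 \<le> c \<and> (\<forall>x y. \<bar>u k x - u k y\<bar> \<le> c * dist x y) \<and> u k \<in> borel_measurable m \<and>
        (\<integral>\<^sup>+x. ennreal \<bar>g x - u k x\<bar> \<partial>m) \<le> ennreal ((1/2)^k)" ..
    from choice[OF this] obtain c where
      "\<forall>k. 0 \<le> c k \<and> (\<forall>x y. \<bar>u k x - u k y\<bar> \<le> c k * dist x y) \<and> u k \<in> borel_measurable m \<and>
        (\<integral>\<^sup>+x. ennreal \<bar>g x - u k x\<bar> \<partial>m) \<le> ennreal ((1/2)^k)" ..
    then show ?thesis by (intro that[of c u]) auto
  qed
  \<comment> \<open>adding \<open>2\<^sup>-\<^sup>k\<close> keeps \<open>v k\<close> away from \<open>0\<close> at the price of an error of the same size\<close>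
  define v where "v k x = max (u k x) 0 + (1/2)^k" for k x
  define e where "e k x = ennreal \<bar>g x - u k x\<bar> + ennreal ((1/2)^k)" for k x
  have e_meas: "e k \<in> borel_measurable m" for k unfolding e_def using u(3)[of k] by measurable
  have v_meas: "(\<lambda>x. ennreal (v k x)) \<in> borel_measurable m" for k unfolding v_def using u(3)[of k] by measurable
  have ve: "?h x \<le> ennreal (v k x) + e k x" "ennreal (v k x) \<le> ?h x + e k x" if "?h x \<noteq> \<infinity>" for k x
  proof -
    have h: "?h x = ennreal (g x)"
      unfolding g_def by (rule ennreal_enn2real[symmetric]) (use that in \<open>simp add: less_top\<close>)
    have g0: "0 \<le> g x" by (simp add: g_def)
    have v0: "0 \<le> v k x" by (simp add: v_def)
    have ee: "e k x = ennreal (\<bar>g x - u k x\<bar> + (1/2)^k)" by (simp add: e_def)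
    have arith: "a \<le> max b 0 + d + (\<bar>a - b\<bar> + d)" "max b 0 + d \<le> a + (\<bar>a - b\<bar> + d)"
      if "0 \<le> a" "0 \<le> d" for a b d :: real using that by (auto simp: max_def abs_if)
    have "g x \<le> v k x + (\<bar>g x - u k x\<bar> + (1/2)^k)" "v k x \<le> g x + (\<bar>g x - u k x\<bar> + (1/2)^k)"
      unfolding v_def by (rule arith[OF g0]; simp)+
    from this[THEN ennreal_leI] have le: "ennreal (g x) \<le> ennreal (v k x + (\<bar>g x - u k x\<bar> + (1/2)^k))"
      "ennreal (v k x) \<le> ennreal (g x + (\<bar>g x - u k x\<bar> + (1/2)^k))" .
    have nn: "0 \<le> \<bar>g x - u k x\<bar> + (1/2)^k" by simp
    show "?h x \<le> ennreal (v k x) + e k x"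
      using le(1) unfolding h ee ennreal_plus[OF v0 nn] .
    show "ennreal (v k x) \<le> ?h x + e k x"
      using le(2) unfolding h ee ennreal_plus[OF g0 nn] .
  qed
  define G where "G = invariant_core B"
  note core = invariant_core[OF B_sets AE_B, folded G_def]
  have "\<exists>n. cone G C0 ((transfer ^^ n) (\<lambda>x. ennreal (v k x)))" for k
  proof (rule cone_transfer_iterate[OF core(3) core(4)])
    show "cone G (c k / (1/2)^k) (\<lambda>x. ennreal (v k x))"
    proof (rule lipschitz_positive_cone)
      show "\<bar>v k x - v k y\<bar> \<le> c k * dist x y" for x y using u(2)[of k x y] by (auto simp: v_def)
    qed (use u(1) in \<open>auto simp: v_def\<close>)
  qed (use u(1) in auto)
  then obtain n where n: "\<And>k. cone G C0 ((transfer ^^ n k) (\<lambda>x. ennreal (v k x)))" by metis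
  define U where "U k = (transfer ^^ n k) (\<lambda>x. ennreal (v k x))" for k
  define E where "E k = (transfer ^^ n k) (e k)" for k
  have E_meas: "E k \<in> borel_measurable m" for k unfolding E_def by (rule transfer_iter_meas[OF e_meas])
  have h_iter: "AE y in m. (transfer ^^ n) ?h y = ?h y" for n
  proof (induction n)
    case (Suc n)
    have "AE y in m. \<forall>k. (transfer ^^ n) ?h (s k y) = ?h (s k y)"
      unfolding AE_all_countable using AE_branch[OF Suc] by blast
    with invariant_density_transfer[OF \<nu>] show ?case
    proof eventually_elim
      case (elim y)
      have "(transfer ^^ Suc n) ?h y = (\<Sum>k. ennreal (J k y) * (transfer ^^ n) ?h (s k y))"
        by (simp add: transfer_def[of "(transfer ^^ n) ?h"])
      also have "\<dots> = transfer ?h y" using elim(2) by (simp add: transfer_def[of ?h])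
      finally show ?case using elim(1) by simp
    qed
  qed simp
  have hU: "AE y in m. ?h y \<le> U k y + E k y" for k
  proof -
    have "AE y in m. ?h y \<le> ennreal (v k y) + e k y" using hfin by eventually_elim (rule ve)
    then have "AE y in m. (transfer ^^ n k) ?h y \<le> (transfer ^^ n k) (\<lambda>y. ennreal (v k y) + e k y) y"
      by (rule AE_transfer_mono)
    with h_iter[of "n k"] show ?thesis
      by eventually_elim (simp add: U_def E_def transfer_iter_add)
  qed
  have Uh: "AE y in m. U k y \<le> ?h y + E k y" for k
  proof -
    have "AE y in m. ennreal (v k y) \<le> ?h y + e k y" using hfin by eventually_elim (rule ve)
    then have "AE y in m. (transfer ^^ n k) (\<lambda>y. ennreal (v k y)) y \<le> (transfer ^^ n k) (\<lambda>y. ?h y + e k y) y"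
      by (rule AE_transfer_mono)
    with h_iter[of "n k"] show ?thesis
      by eventually_elim (simp add: U_def E_def transfer_iter_add)
  qed
  have E_int: "(\<integral>\<^sup>+y. E k y \<partial>m) \<le> ennreal ((1/2)^k * (1 + measure m (space m)))" for k
  proof -
    have "(\<integral>\<^sup>+y. E k y \<partial>m) = (\<integral>\<^sup>+y. e k y \<partial>m)" unfolding E_def by (rule nn_integral_transfer_iter[OF e_meas])
    also have "\<dots> = (\<integral>\<^sup>+x. ennreal \<bar>g x - u k x\<bar> \<partial>m) + (\<integral>\<^sup>+x. ennreal ((1/2)^k) \<partial>m)"
      unfolding e_def using u(3)[of k] by (intro nn_integral_add) auto
    also have "\<dots> \<le> ennreal ((1/2)^k) + ennreal ((1/2)^k * measure m (space m))"
      using u(4)[of k] by (intro add_mono) (auto simp: emeasure_eq_measure ennreal_mult)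
    also have "\<dots> = ennreal ((1/2)^k * (1 + measure m (space m)))"
      by (subst ennreal_plus[symmetric]) (auto simp: algebra_simps)
    finally show ?thesis .
  qed
  have "(\<integral>\<^sup>+y. (\<Sum>k. E k y) \<partial>m) = (\<Sum>k. \<integral>\<^sup>+y. E k y \<partial>m)" by (rule nn_integral_suminf[OF E_meas])
  also have "\<dots> \<le> (\<Sum>k. ennreal ((1/2)^k * (1 + measure m (space m))))" by (intro suminf_le E_int) auto
  also have "\<dots> = ennreal (\<Sum>k. (1/2)^k * (1 + measure m (space m)))"
    by (intro suminf_ennreal2 summable_mult2 summable_geometric) auto
  finally have "(\<integral>\<^sup>+y. (\<Sum>k. E k y) \<partial>m) \<noteq> \<infinity>" by (auto simp: top_unique)
  then have "AE y in m. (\<Sum>k. E k y) \<noteq> \<infinity>"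
    by (intro nn_integral_noteq_infinite borel_measurable_suminf_order E_meas)
  moreover have "AE y in m. \<forall>k. ?h y \<le> U k y + E k y \<and> U k y \<le> ?h y + E k y"
    unfolding AE_all_countable using hU Uh by (auto intro: AE_conjI)
  ultimately have "AE y in m. y \<in> G \<and> (\<Sum>k. E k y) \<noteq> \<infinity> \<and> (\<forall>k. ?h y \<le> U k y + E k y \<and> U k y \<le> ?h y + E k y)"
    using core(2) by eventually_elim simp
  from AE_measurable_set[OF this] obtain P where PP: "P \<in> sets m" "AE y in m. y \<in> P"
    "\<forall>y\<in>P. y \<in> G \<and> (\<Sum>k. E k y) \<noteq> \<infinity> \<and> (\<forall>k. ?h y \<le> U k y + E k y \<and> U k y \<le> ?h y + E k y)"
    by (elim bexE conjE)
  note P = PP(1,2) PP(3)[rule_format]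
  have "cone P C0 ?h"
    unfolding cone_def
  proof (intro ballI)
    fix y y' assume y: "y \<in> P" "y' \<in> P"
    let ?c = "ennreal (exp (C0 * dist y y'))"
    have "?h y \<le> ?c * (?h y' + E k y') + E k y" for k
    proof -
      have "?h y \<le> U k y + E k y" using P(3)[OF y(1)] by blast
      also have "\<dots> \<le> ?c * U k y' + E k y"
        using n[of k] P(3)[OF y(1)] P(3)[OF y(2)] unfolding cone_def U_def by (intro add_right_mono) blast
      also have "\<dots> \<le> ?c * (?h y' + E k y') + E k y"
        using P(3)[OF y(2)] by (intro add_right_mono mult_left_mono) auto
      finally show ?thesis .
    qed
    moreover have "(\<lambda>k. ?c * (?h y' + E k y') + E k y) \<longlonglongrightarrow> ?c * (?h y' + 0) + 0"
      using P(3)[OF y(1)] P(3)[OF y(2)]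
      by (intro tendsto_add ennreal_tendsto_cmult tendsto_const suminf_finite_tendsto_0) auto
    ultimately have "?h y \<le> ?c * (?h y' + 0) + 0" by (intro LIMSEQ_le_const) auto
    then show "?h y \<le> ?c * ?h y'" by simp
  qed
  with P(1,2) show ?thesis by (rule that)
qed

text \<open>
  A function in a cone that vanishes at one point vanishes everywhere, so the density is positive.
  It is modified off a set of full measure to be positive everywhere, and \<open>G\<close> is chosen closed
  under inverse branches so that the fixed point equation and the cone inequality can be used
  along backward orbits without exceptional sets.
\<close>

lemma invariant_density:
  assumes \<nu>: "abs_cont_invariant_prob m F \<nu>"
  shows "\<exists>h G. h \<in> borel_measurable m \<and> (\<forall>y. 0 < h y) \<and> \<nu> = density m (\<lambda>y. ennreal (h y)) \<and>
    G \<in> sets m \<and> (AE y in m. y \<in> G) \<and> G \<noteq> {} \<and> G \<subseteq> B \<and> (\<forall>y\<in>G. \<forall>n. s n y \<in> G) \<and>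
    (\<forall>y\<in>G. \<forall>y'\<in>G. h y \<le> exp (C0 * dist y y') * h y') \<and>
    (\<forall>y\<in>G. (\<lambda>n. J n y * h (s n y)) sums h y)"
proof -
  interpret finite_measure m by (rule finite_m)
  let ?h = "RN_deriv m \<nu>"
  have pr: "prob_space \<nu>" and sn: "sets \<nu> = sets m" and ac: "absolutely_continuous m \<nu>"
    using \<nu> by (auto simp: abs_cont_invariant_prob_def)
  have dens: "density m ?h = \<nu>" by (rule density_RN_deriv[OF ac sn])
  have "(\<integral>\<^sup>+x. ?h x \<partial>m) = emeasure (density m ?h) (space m)"
    by (subst emeasure_density) (auto intro!: nn_integral_cong)
  also have "\<dots> = 1" unfolding dens using pr sets_eq_imp_space_eq[OF sn] by (metis prob_space.emeasure_space_1)
  finally have int1: "(\<integral>\<^sup>+x. ?h x \<partial>m) = 1" .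
  have hfin: "AE x in m. ?h x \<noteq> \<infinity>" by (rule nn_integral_noteq_infinite) (auto simp: int1)
  obtain P0 where P0: "P0 \<in> sets m" "AE y in m. y \<in> P0" "cone P0 C0 ?h"
    by (rule invariant_density_cone[OF \<nu>])
  have ae: "AE y in m. y \<in> P0 \<and> y \<in> B \<and> ?h y \<noteq> \<infinity> \<and> ?h y = transfer ?h y"
    using P0(2) AE_B hfin invariant_density_transfer[OF \<nu>] by eventually_elim simp
  from AE_measurable_set[OF ae] obtain P where PP: "P \<in> sets m" "AE y in m. y \<in> P"
    "\<forall>y\<in>P. y \<in> P0 \<and> y \<in> B \<and> ?h y \<noteq> \<infinity> \<and> ?h y = transfer ?h y"
    by (elim bexE conjE)
  note P = PP(1,2) PP(3)[rule_format]
  have "\<exists>y1\<in>P. ?h y1 \<noteq> 0"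
  proof (rule ccontr)
    assume "\<not> ?thesis"
    then have "AE y in m. ?h y = 0" using P(2) by (auto elim: eventually_mono)
    then have "(\<integral>\<^sup>+x. ?h x \<partial>m) = (\<integral>\<^sup>+x. 0 \<partial>m)" by (intro nn_integral_cong_AE)
    then show False using int1 by simp
  qed
  then obtain y1 where y1: "y1 \<in> P" "?h y1 \<noteq> 0" by blast
  have hpos: "?h y \<noteq> 0" if "y \<in> P" for y
  proof
    assume "?h y = 0"
    moreover have "?h y1 \<le> ennreal (exp (C0 * dist y1 y)) * ?h y"
      using P0(3) P(3)[OF y1(1)] P(3)[OF that] unfolding cone_def by blast
    ultimately show False using y1(2) by simp
  qed
  define h where "h y = (if y \<in> P then enn2real (?h y) else 1)" for y
  have hP: "?h y = ennreal (h y)" if "y \<in> P" for y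
  proof -
    have "?h y \<noteq> \<infinity>" using P(3)[OF that] by blast
    then have "?h y < top" by (simp add: less_top)
    then have "ennreal (enn2real (?h y)) = ?h y" by (rule ennreal_enn2real)
    then show ?thesis using that by (simp add: h_def)
  qed
  have h_meas: "h \<in> borel_measurable m" unfolding h_def using P(1) by measurable
  have h_pos: "0 < h y" for y
  proof (cases "y \<in> P")
    case True
    then have "0 < ennreal (h y)" using hpos[OF True] hP[OF True] by (simp add: zero_less_iff_neq_zero)
    then show ?thesis by simp
  qed (simp add: h_def)
  have \<nu>h: "\<nu> = density m (\<lambda>y. ennreal (h y))"
  proof -
    have "AE y in m. ?h y = ennreal (h y)" using P(2) by eventually_elim (rule hP)
    then have "density m ?h = density m (\<lambda>y. ennreal (h y))" using h_meas by (intro density_cong) auto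
    then show ?thesis using dens by simp
  qed
  define G where "G = invariant_core P"
  note core = invariant_core[OF P(1,2), folded G_def]
  have "G \<noteq> {}"
  proof
    assume "G = {}"
    then have "AE y in m. False" using core(2) by simp
    then have "(\<integral>\<^sup>+x. ?h x \<partial>m) = (\<integral>\<^sup>+x. 0 \<partial>m)" by (intro nn_integral_cong_AE) (auto elim: eventually_mono)
    then show False using int1 by simp
  qed
  moreover have "G \<subseteq> B" using core(3) P(3) by blast
  moreover have "h y \<le> exp (C0 * dist y y') * h y'" if "y \<in> G" "y' \<in> G" for y y'
  proof -
    have yP: "y \<in> P" "y' \<in> P" using core(3) that by auto
    have "?h y \<le> ennreal (exp (C0 * dist y y')) * ?h y'"
      using P0(3) P(3)[OF yP(1)] P(3)[OF yP(2)] unfolding cone_def by blast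
    then have "ennreal (h y) \<le> ennreal (exp (C0 * dist y y') * h y')"
      unfolding hP[OF yP(1)] hP[OF yP(2)] using h_pos[of y'] by (simp add: ennreal_mult)
    then show ?thesis using h_pos[of y'] by (simp add: ennreal_le_iff)
  qed
  moreover have "(\<lambda>n. J n y * h (s n y)) sums h y" if y: "y \<in> G" for y
  proof -
    have yP: "y \<in> P" "\<And>n. s n y \<in> P" using core(3) core(4)[OF y] y by auto
    have yY: "y \<in> Y" using P(3)[OF yP(1)] B_Y by auto
    have nn: "0 \<le> J n y * h (s n y)" for n using J_pos[OF yY, of n] h_pos[of "s n y"] by simp
    have "ennreal (h y) = transfer ?h y" using P(3)[OF yP(1)] hP[OF yP(1)] by simp
    also have "\<dots> = (\<Sum>n. ennreal (J n y * h (s n y)))"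
      unfolding transfer_def hP[OF yP(2)] using J_pos[OF yY] h_pos by (intro suminf_cong) (simp add: ennreal_mult less_imp_le)
    finally have "(\<lambda>n. ennreal (J n y * h (s n y))) sums ennreal (h y)"
      by (metis summableI summable_sums)
    then show ?thesis using nn h_pos[of y] by (subst (asm) sums_ennreal) auto
  qed
  ultimately show ?thesis
    by (intro exI[of _ h] exI[of _ G] conjI allI ballI h_meas h_pos \<nu>h core(1,2)) (auto intro: core(4))
qed

end

section \<open>The tower and its backward chain\<close>

text \<open>
  The dynamical data together with the positive version \<open>h\<close> of the density on the good set \<open>G\<close>,
  and a bounded Hoelder observable. The space has diameter at most \<open>M\<close>.
\<close>

locale tower = inverse_branches +
  fixes \<nu> :: "'a measure" and h :: "'a \<Rightarrow> real" and G :: "'a set" and \<phi> :: "'a \<Rightarrow> real" and \<alpha> C\<phi> b M :: real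
  assumes \<nu>_inv: "abs_cont_invariant_prob m (induced_map f R) \<nu>"
    and h_meas: "h \<in> borel_measurable m" and h_pos: "\<And>y. 0 < h y"
    and \<nu>_eq: "\<nu> = density m (\<lambda>y. ennreal (h y))"
    and G_sets: "G \<in> sets m" and G_AE: "AE y in m. y \<in> G" and G_ne: "G \<noteq> {}" and G_B: "G \<subseteq> B"
    and s_G: "\<And>y n. y \<in> G \<Longrightarrow> s n y \<in> G"
    and h_ratio: "\<And>y y'. y \<in> G \<Longrightarrow> y' \<in> G \<Longrightarrow> h y \<le> exp (C0 * dist y y') * h y'"
    and h_sums: "\<And>y. y \<in> G \<Longrightarrow> (\<lambda>n. J n y * h (s n y)) sums h y"
    and R_tail_summable: "summable (\<lambda>n. measure m {y \<in> Y. n < R y})"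
    and \<alpha>: "0 < \<alpha>" "\<alpha> \<le> 1" and C\<phi>_nonneg: "0 \<le> C\<phi>"
    and \<phi>_hoelder: "\<And>x y. \<bar>\<phi> x - \<phi> y\<bar> \<le> C\<phi> * dist x y powr \<alpha>"
    and \<phi>_bound: "\<And>x. \<bar>\<phi> x\<bar> \<le> b"
    and \<phi>_meas: "\<phi> \<in> borel_measurable borel"
    and M_ge_1: "1 \<le> M" and dist_le_M: "\<And>x y :: 'a. dist x y \<le> M"
begin

text \<open>
  The conditional law of the branch containing \<open>y\<^sub>0\<close> given \<open>F y\<^sub>0 = y\<close>, when \<open>y\<^sub>0\<close> has law \<open>\<nu>\<close>.
  The value off \<open>G\<close> only serves measurability.
\<close>

definition p :: "'a \<Rightarrow> nat pmf" where
  "p y = (if y \<in> G then embed_pmf (\<lambda>n. J n y * h (s n y) / h y) else return_pmf 0)"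

text \<open>
  With this metric a Hoelder observable is Lipschitz.
\<close>

definition dpow :: "'a \<Rightarrow> 'a \<Rightarrow> real" where "dpow x y = dist x y powr \<alpha>"

text \<open>
  The factor \<open>M\<close> converts distances into their powers, by \<open>dist \<le> M dpow\<close>.
\<close>

definition Cd :: real where "Cd = (K + 2 * C0) * M"

definition hmax :: real where "hmax = exp (C0 * M) * h (SOME y. y \<in> G)"

definition tail_bound :: "nat \<Rightarrow> real" where
  "tail_bound n = exp (Cd * M) * hmax * measure m {y \<in> Y. n < R y}"

lemma G_Y: "G \<subseteq> Y" using G_B B_Y by blast

lemma pmf_p: "pmf (p y) n = (if y \<in> G then J n y * h (s n y) / h y else indicator {0} n)"
proof (cases "y \<in> G")
  case True
  have nn: "0 \<le> J n y * h (s n y) / h y" for n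
    using J_pos[of y n] h_pos[of y] h_pos[of "s n y"] True G_Y by auto
  have "(\<lambda>n. J n y * h (s n y) / h y) sums (h y / h y)" by (rule sums_divide[OF h_sums[OF True]])
  then have s: "(\<lambda>n. J n y * h (s n y) / h y) sums 1" using h_pos[of y] by simp
  have "(\<integral>\<^sup>+n. ennreal (J n y * h (s n y) / h y) \<partial>count_space UNIV) = (\<Sum>n. ennreal (J n y * h (s n y) / h y))"
    by (rule nn_integral_count_space_nat)
  also have "\<dots> = ennreal 1" using s nn by (intro sums_unique[symmetric] sums_ennreal[THEN iffD2]) auto
  finally have "pmf (embed_pmf (\<lambda>n. J n y * h (s n y) / h y)) n = J n y * h (s n y) / h y"
    using nn by (intro pmf_embed_pmf) auto
  then show ?thesis using True by (simp add: p_def)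
qed (auto simp: p_def split: split_indicator)

lemma pmf_p_meas[measurable]: "(\<lambda>y. pmf (p y) n) \<in> borel_measurable m"
proof -
  have [measurable]: "(\<lambda>y. h (s n y)) \<in> borel_measurable m" "J n \<in> borel_measurable m" "h \<in> borel_measurable m" "G \<in> sets m"
    using measurable_compose[OF s_meas h_meas] J_meas h_meas G_sets by auto
  show ?thesis unfolding pmf_p by measurable
qed

lemma nn_integral_p: "(\<integral>\<^sup>+n. g n \<partial>measure_pmf (p y)) = (\<Sum>n. ennreal (pmf (p y) n) * g n)"
  by (simp add: nn_integral_measure_pmf nn_integral_count_space_nat)

lemma sets_\<nu>[measurable_cong]: "sets \<nu> = sets m" by (simp add: \<nu>_eq)

lemma space_\<nu>: "space \<nu> = Y" by (simp add: \<nu>_eq space_mY)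

lemma F_meas[measurable]: "F \<in> m \<rightarrow>\<^sub>M m"
proof -
  have "F \<in> \<nu> \<rightarrow>\<^sub>M \<nu>" using \<nu>_inv by (simp add: abs_cont_invariant_prob_def)
  then show ?thesis unfolding measurable_cong_sets[OF sets_\<nu> sets_\<nu>] .
qed

lemma AE_\<nu>: "AE y in m. Q y \<Longrightarrow> AE y in \<nu>. Q y"
  unfolding \<nu>_eq using h_meas by (subst AE_density) (auto elim: eventually_mono)

lemma AE_\<nu>_G: "AE y in \<nu>. y \<in> G" by (rule AE_\<nu>[OF G_AE])

lemma prob_\<nu>: "prob_space \<nu>" using \<nu>_inv by (simp add: abs_cont_invariant_prob_def)

text \<open>
  Given \<open>F x\<close>, the point \<open>x\<close> is distributed as \<open>s n (F x)\<close> with \<open>n\<close> of law \<open>p (F x)\<close>.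
\<close>

lemma base_duality:
  assumes w: "case_prod w \<in> borel_measurable (m \<Otimes>\<^sub>M m)"
  shows "(\<integral>\<^sup>+x. w (F x) x \<partial>\<nu>) = (\<integral>\<^sup>+y. (\<integral>\<^sup>+n. w y (s n y) \<partial>measure_pmf (p y)) \<partial>\<nu>)"
proof -
  have wm: "(\<lambda>x. w (u x) (v x)) \<in> borel_measurable m" if "u \<in> m \<rightarrow>\<^sub>M m" "v \<in> m \<rightarrow>\<^sub>M m" for u v
    using measurable_compose[OF measurable_Pair[OF that] w] by simp
  note h_meas[measurable]
  have wF: "(\<lambda>x. w (F x) x) \<in> borel_measurable m" "(\<lambda>y. w y (s n y)) \<in> borel_measurable m" for n
    using s_meas by (auto intro!: wm)
  have hw: "case_prod (\<lambda>y x. ennreal (h x) * w y x) \<in> borel_measurable (m \<Otimes>\<^sub>M m)"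
    using w by (simp add: case_prod_unfold)
  have "(\<integral>\<^sup>+x. w (F x) x \<partial>\<nu>) = (\<integral>\<^sup>+x. ennreal (h x) * w (F x) x \<partial>m)"
    unfolding \<nu>_eq using wF by (subst nn_integral_density) auto
  also have "\<dots> = (\<integral>\<^sup>+y. (\<Sum>n. ennreal (J n y) * (ennreal (h (s n y)) * w y (s n y))) \<partial>m)"
    by (rule nn_integral_transfer[OF F_meas hw])
  also have "\<dots> = (\<integral>\<^sup>+y. ennreal (h y) * (\<Sum>n. ennreal (pmf (p y) n) * w y (s n y)) \<partial>m)"
  proof (rule nn_integral_cong_AE)
    show "AE y in m. (\<Sum>n. ennreal (J n y) * (ennreal (h (s n y)) * w y (s n y))) = ennreal (h y) * (\<Sum>n. ennreal (pmf (p y) n) * w y (s n y))"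
      using G_AE
    proof eventually_elim
      case (elim y)
      have "ennreal (J n y) * (ennreal (h (s n y)) * w y (s n y)) = ennreal (h y) * (ennreal (pmf (p y) n) * w y (s n y))" for n
      proof -
        have "J n y * h (s n y) = h y * pmf (p y) n" using elim h_pos[of y] by (simp add: pmf_p)
        moreover have "0 < J n y" using elim G_Y J_pos by blast
        ultimately show ?thesis using h_pos[of y] h_pos[of "s n y"]
          by (simp add: mult.assoc[symmetric] ennreal_mult[symmetric] less_imp_le)
      qed
      then show ?case by (simp add: ennreal_suminf_cmult)
    qed
  qed
  also have "\<dots> = (\<integral>\<^sup>+y. (\<Sum>n. ennreal (pmf (p y) n) * w y (s n y)) \<partial>\<nu>)"
    unfolding \<nu>_eq using wF by (subst nn_integral_density) (auto intro!: borel_measurable_suminf_order borel_measurable_times_ennreal)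
  finally show ?thesis by (simp add: nn_integral_p)
qed

lemma R_meas[measurable]: "R \<in> m \<rightarrow>\<^sub>M count_space UNIV"
proof -
  have rm: "(\<lambda>y. real (R y)) \<in> borel_measurable m" using R_int by (rule borel_measurable_integrable)
  have "(\<lambda>y. nat \<lfloor>real (R y)\<rfloor>) \<in> m \<rightarrow>\<^sub>M count_space UNIV"
    using rm by measurable
  then show ?thesis by simp
qed

lemma R_ge1: "y \<in> Y \<Longrightarrow> 1 \<le> R y"
  using a_Un r_pos r_R by fastforce

lemma hmax: "y \<in> G \<Longrightarrow> h y \<le> hmax" and hmax_pos: "0 < hmax"
proof -
  define y0 where "y0 = (SOME y. y \<in> G)"
  have y0: "y0 \<in> G" unfolding y0_def using G_ne by (simp add: some_in_eq)
  show "0 < hmax" using h_pos by (simp add: hmax_def)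
  assume "y \<in> G"
  then have "h y \<le> exp (C0 * dist y y0) * h y0" using h_ratio y0 by blast
  also have "\<dots> \<le> exp (C0 * M) * h y0"
    using C0_pos dist_le_M[of y y0] h_pos[of y0] by (intro mult_right_mono) (auto intro: mult_left_mono)
  finally show "h y \<le> hmax" by (simp add: hmax_def y0_def)
qed

lemma Cd_pos: "0 < Cd" using K_pos C0_pos M_ge_1 by (simp add: Cd_def add_pos_pos)

lemma dist_le_dpow: "dist x y \<le> M * dpow x y"
proof (cases "x = y")
  case False
  then have d: "0 < dist x y" by simp
  have "dist x y = dist x y powr \<alpha> * dist x y powr (1 - \<alpha>)" using d by (simp add: powr_add[symmetric])
  also have "\<dots> \<le> dist x y powr \<alpha> * M powr (1 - \<alpha>)"
    using d \<alpha> dist_le_M[of x y] by (intro mult_left_mono powr_mono2) auto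
  also have "\<dots> \<le> dist x y powr \<alpha> * M powr 1"
    using M_ge_1 \<alpha> by (intro mult_left_mono powr_mono) auto
  finally show ?thesis using M_ge_1 by (simp add: dpow_def mult.commute)
qed (simp add: dpow_def)

lemma dpow_le: "dpow x y \<le> M"
proof -
  have "dpow x y \<le> M powr \<alpha>" unfolding dpow_def using \<alpha> dist_le_M[of x y] by (intro powr_mono2) auto
  also have "\<dots> \<le> M powr 1" using M_ge_1 \<alpha> by (intro powr_mono) auto
  finally show ?thesis using M_ge_1 by simp
qed

text \<open>
  Three factors are distorted: the Jacobian by \<open>K\<close>, and \<open>h\<close> at the preimages and at the points
  themselves by \<open>C0\<close> each.
\<close>

lemma p_ratio:
  assumes y: "y \<in> G" "y' \<in> G"
  shows "pmf (p y) n \<le> exp (Cd * dpow y y') * pmf (p y') n"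
proof -
  let ?d = "dist y y'"
  have sy: "s n y \<in> G" "s n y' \<in> G" using y s_G by auto
  have BB: "y \<in> B" "y' \<in> B" using y G_B by auto
  have Yy: "y \<in> Y" "y' \<in> Y" using y G_Y by auto
  have "dist (s n y) (s n y') \<le> ?d / L" by (rule s_contr[OF BB])
  also have "\<dots> \<le> ?d" using L_gt1 by (simp add: divide_le_eq mult_left_le_one_le mult_le_cancel_left1)
  finally have ds: "dist (s n y) (s n y') \<le> ?d" .
  have 1: "J n y \<le> exp (K * ?d) * J n y'" by (rule J_ratio[OF BB])
  have "h (s n y) \<le> exp (C0 * dist (s n y) (s n y')) * h (s n y')" by (rule h_ratio[OF sy])
  also have "\<dots> \<le> exp (C0 * ?d) * h (s n y')"
    using ds C0_pos h_pos[of "s n y'"] by (intro mult_right_mono) auto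
  finally have 2: "h (s n y) \<le> exp (C0 * ?d) * h (s n y')" .
  have "h y' \<le> exp (C0 * ?d) * h y" using h_ratio[OF y(2,1)] by (simp add: dist_commute)
  then have 3: "inverse (h y) \<le> exp (C0 * ?d) * inverse (h y')" using h_pos[of y] h_pos[of y'] by (simp add: field_simps)
  have "J n y * h (s n y) * inverse (h y)
     \<le> (exp (K * ?d) * J n y') * (exp (C0 * ?d) * h (s n y')) * (exp (C0 * ?d) * inverse (h y'))"
    using h_pos J_pos[OF Yy(1)] J_pos[OF Yy(2)] by (intro mult_mono 1 2 3) (auto intro: less_imp_le mult_nonneg_nonneg)
  also have "\<dots> = (exp (K * ?d) * exp (C0 * ?d) * exp (C0 * ?d)) * (J n y' * h (s n y') * inverse (h y'))"
    by (simp add: mult_ac)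
  also have "exp (K * ?d) * exp (C0 * ?d) * exp (C0 * ?d) = exp ((K + 2 * C0) * ?d)"
    by (simp add: exp_add[symmetric] algebra_simps)
  also have "exp ((K + 2 * C0) * ?d) * (J n y' * h (s n y') * inverse (h y'))
     \<le> exp (Cd * dpow y y') * (J n y' * h (s n y') * inverse (h y'))"
  proof (intro mult_right_mono)
    have "(K + 2 * C0) * ?d \<le> (K + 2 * C0) * (M * dpow y y')"
      using K_pos C0_pos by (intro mult_left_mono dist_le_dpow) auto
    then show "exp ((K + 2 * C0) * ?d) \<le> exp (Cd * dpow y y')" by (simp add: Cd_def mult.assoc)
    show "0 \<le> J n y' * h (s n y') * inverse (h y')" using h_pos J_pos[OF Yy(2)] by (simp add: less_imp_le)
  qed
  finally show ?thesis using y by (simp add: pmf_p divide_inverse)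
qed

text \<open>
  By \<open>p_ratio\<close> the tail at one point is comparable with the tail at all other points, hence with
  its \<open>\<nu>\<close>-mean, which is \<open>\<nu>(R > n)\<close> by duality.
\<close>

lemma p_tail:
  assumes y: "y \<in> G"
  shows "measure_pmf.prob (p y) {i. n < r i} \<le> tail_bound n"
proof -
  interpret prob_space \<nu> by (rule prob_\<nu>)
  interpret fm: finite_measure m by (rule finite_m)
  let ?E = "exp (Cd * M)"
  define q where "q = measure_pmf.prob (p y) {i. n < r i}"
  have pt: "ennreal q \<le> ennreal ?E * emeasure (measure_pmf (p y')) {i. n < r i}" if y': "y' \<in> G" for y'
  proof -
    have "ennreal q = (\<Sum>i. ennreal (pmf (p y) i) * indicator {i. n < r i} i)"
      unfolding q_def measure_pmf.emeasure_eq_measure[symmetric] nn_integral_p[symmetric] by simp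
    also have "\<dots> \<le> (\<Sum>i. ennreal ?E * (ennreal (pmf (p y') i) * indicator {i. n < r i} i))"
    proof (intro suminf_le)
      fix i
      have "pmf (p y) i \<le> exp (Cd * dpow y y') * pmf (p y') i" by (rule p_ratio[OF y y'])
      also have "\<dots> \<le> ?E * pmf (p y') i" using Cd_pos dpow_le by (intro mult_right_mono) auto
      finally have "ennreal (pmf (p y) i) \<le> ennreal ?E * ennreal (pmf (p y') i)"
        by (subst ennreal_mult[symmetric]) (auto intro: ennreal_leI)
      then show "ennreal (pmf (p y) i) * indicator {i. n < r i} i \<le> ennreal ?E * (ennreal (pmf (p y') i) * indicator {i. n < r i} i)"
        by (auto split: split_indicator)
    qed auto
    also have "\<dots> = ennreal ?E * emeasure (measure_pmf (p y')) {i. n < r i}"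
      unfolding ennreal_suminf_cmult nn_integral_p[symmetric] by simp
    finally show ?thesis .
  qed
  have Rn[measurable]: "{x \<in> Y. n < R x} \<in> sets m"
    using measurable_sets[OF R_meas, of "{n<..}"] by (simp add: space_mY vimage_def Int_def conj_commute)
  have "ennreal q = (\<integral>\<^sup>+y'. ennreal q \<partial>\<nu>)" by (simp add: emeasure_space_1)
  also have "\<dots> \<le> (\<integral>\<^sup>+y'. ennreal ?E * emeasure (measure_pmf (p y')) {i. n < r i} \<partial>\<nu>)"
    by (rule nn_integral_mono_AE) (use AE_\<nu>_G pt in \<open>auto elim: eventually_mono\<close>)
  also have "\<dots> = ennreal ?E * (\<integral>\<^sup>+y'. (\<integral>\<^sup>+i. indicator {i. n < r i} i \<partial>measure_pmf (p y')) \<partial>\<nu>)"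
  proof -
    have "(\<lambda>y'. \<integral>\<^sup>+i. indicator {i. n < r i} i \<partial>measure_pmf (p y')) \<in> borel_measurable m"
      unfolding nn_integral_p by (intro borel_measurable_suminf_order borel_measurable_times_ennreal) auto
    then show ?thesis by (subst nn_integral_cmult[symmetric]) auto
  qed
  also have "(\<integral>\<^sup>+y'. (\<integral>\<^sup>+i. indicator {i. n < r i} i \<partial>measure_pmf (p y')) \<partial>\<nu>)
     = (\<integral>\<^sup>+y'. (\<integral>\<^sup>+i. indicator {x \<in> Y. n < R x} (s i y') \<partial>measure_pmf (p y')) \<partial>\<nu>)"
  proof (intro nn_integral_cong)
    fix y' i assume "y' \<in> space \<nu>"
    then have "y' \<in> Y" by (simp add: space_\<nu>)
    then have "R (s i y') = r i" "s i y' \<in> Y" using r_R s_a s_Y by auto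
    then show "(indicator {i. n < r i} i :: ennreal) = indicator {x \<in> Y. n < R x} (s i y')" by (simp split: split_indicator)
  qed
  also have "\<dots> = (\<integral>\<^sup>+x. indicator {x \<in> Y. n < R x} x \<partial>\<nu>)"
    by (rule base_duality[symmetric, where w = "\<lambda>y x. indicator {x \<in> Y. n < R x} x"]) measurable
  also have "\<dots> = (\<integral>\<^sup>+x. ennreal (h x) * indicator {x \<in> Y. n < R x} x \<partial>m)"
    unfolding \<nu>_eq using h_meas by (subst nn_integral_density) auto
  also have "\<dots> \<le> (\<integral>\<^sup>+x. ennreal hmax * indicator {x \<in> Y. n < R x} x \<partial>m)"
    by (rule nn_integral_mono_AE) (use G_AE hmax in \<open>auto elim!: eventually_mono intro!: mult_right_mono ennreal_leI\<close>)
  also have "\<dots> = ennreal hmax * emeasure m {x \<in> Y. n < R x}" by (simp add: nn_integral_cmult_indicator)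
  also have "ennreal ?E * (ennreal hmax * emeasure m {x \<in> Y. n < R x}) = ennreal (tail_bound n)"
    using hmax_pos by (simp add: tail_bound_def fm.emeasure_eq_measure ennreal_mult[symmetric] mult.assoc)
  finally have "ennreal q \<le> ennreal (tail_bound n)" by (auto simp: mult_left_mono)
  moreover have "0 \<le> tail_bound n" using hmax_pos by (simp add: tail_bound_def)
  ultimately show ?thesis by (simp add: q_def)
qed

definition \<Phi> :: "'a \<times> nat \<Rightarrow> real" where "\<Phi> z = \<phi> ((f ^^ snd z) (fst z))"

sublocale chain: observed_chain G p s r dpow M Cd "L powr \<alpha>" tail_bound \<Phi> b "C\<phi> * (1 + K powr \<alpha>)"
proof (unfold_locales)
  show "G \<noteq> {}" by (rule G_ne)
  show "s n y \<in> G" if "y \<in> G" for y n by (rule s_G[OF that])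
  show "1 \<le> r n" for n by (rule r_pos)
  show "0 \<le> dpow y y'" for y y' by (simp add: dpow_def)
  show "dpow y y' \<le> M" for y y' by (rule dpow_le)
  show "dpow y y' = dpow y' y" for y y' by (simp add: dpow_def dist_commute)
  show "1 < L powr \<alpha>" using L_gt1 \<alpha> by (metis gr_one_powr)
  show "0 < Cd" by (rule Cd_pos)
  show "dpow (s n y) (s n y') \<le> dpow y y' / L powr \<alpha>" if "y \<in> G" "y' \<in> G" for y y' n
  proof -
    have "dpow (s n y) (s n y') \<le> (dist y y' / L) powr \<alpha>"
      unfolding dpow_def using s_contr[of y y' n] that G_B \<alpha> by (intro powr_mono2) auto
    then show ?thesis using L_gt1 by (simp add: dpow_def powr_divide)
  qed
  show "pmf (p y) n \<le> exp (Cd * dpow y y') * pmf (p y') n" if "y \<in> G" "y' \<in> G" for y y' n by (rule p_ratio[OF that])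
  show "0 < pmf (p y) n" if "y \<in> G" for y n
    using that J_pos[of y n] G_Y h_pos[of y] h_pos[of "s n y"] by (auto simp: pmf_p)
  show "Gcd (range r) = 1" by (rule r_Gcd)
  show "measure_pmf.prob (p y) {i. n < r i} \<le> tail_bound n" if "y \<in> G" for y n by (rule p_tail[OF that])
  show "summable tail_bound" unfolding tail_bound_def by (intro summable_mult R_tail_summable)
  show "\<bar>\<Phi> z\<bar> \<le> b" for z by (simp add: \<Phi>_def \<phi>_bound)
  show "0 \<le> C\<phi> * (1 + K powr \<alpha>)" using C\<phi>_nonneg by simp
  show "\<bar>\<Phi> (y, 0) - \<Phi> (y', 0)\<bar> \<le> C\<phi> * (1 + K powr \<alpha>) * dpow y y'" for y y'
  proof -
    have "\<bar>\<phi> y - \<phi> y'\<bar> \<le> C\<phi> * 1 * dpow y y'" using \<phi>_hoelder[of y y'] by (simp add: dpow_def)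
    also have "\<dots> \<le> C\<phi> * (1 + K powr \<alpha>) * dpow y y'"
      using C\<phi>_nonneg by (intro mult_right_mono mult_left_mono) (auto simp: dpow_def)
    finally show ?thesis by (simp add: \<Phi>_def)
  qed
  show "\<bar>\<Phi> (s n y, k) - \<Phi> (s n y', k)\<bar> \<le> C\<phi> * (1 + K powr \<alpha>) * dpow y y'" if "y \<in> G" "y' \<in> G" "k < r n" for y y' n k
  proof -
    have "\<bar>\<Phi> (s n y, k) - \<Phi> (s n y', k)\<bar> \<le> C\<phi> * dist ((f ^^ k) (s n y)) ((f ^^ k) (s n y')) powr \<alpha>"
      unfolding \<Phi>_def by (simp add: \<phi>_hoelder)
    also have "\<dots> \<le> C\<phi> * (K * dist y y') powr \<alpha>"
      using s_flight[of y y' k n] that G_B \<alpha> C\<phi>_nonneg by (intro mult_left_mono powr_mono2) auto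
    also have "\<dots> = C\<phi> * K powr \<alpha> * dpow y y'" using K_pos by (simp add: powr_mult dpow_def)
    also have "\<dots> \<le> C\<phi> * (1 + K powr \<alpha>) * dpow y y'"
      using C\<phi>_nonneg by (intro mult_right_mono mult_left_mono) (auto simp: dpow_def)
    finally show ?thesis .
  qed
qed

text \<open>
  The tower map. Points \<open>(y, k)\<close> with \<open>k \<ge> R y\<close> are not in the tower; the measures below do not
  charge them.
\<close>

definition tmap :: "'a \<times> nat \<Rightarrow> 'a \<times> nat" where
  "tmap z = (if Suc (snd z) < R (fst z) then (fst z, Suc (snd z)) else (F (fst z), 0))"

definition tproj :: "'a \<times> nat \<Rightarrow> 'a" where "tproj z = (f ^^ snd z) (fst z)"

text \<open>
  Integration against the unnormalised invariant measure of the tower, which is used as a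
  functional so that few facts about product measures are required.
\<close>

definition tint :: "('a \<times> nat \<Rightarrow> ennreal) \<Rightarrow> ennreal" where
  "tint U = (\<integral>\<^sup>+y. (\<Sum>k<R y. U (y, k)) \<partial>\<nu>)"

abbreviation \<Delta> :: "('a \<times> nat) measure" where "\<Delta> \<equiv> m \<Otimes>\<^sub>M count_space UNIV"

lemma level_meas: "U \<in> borel_measurable \<Delta> \<Longrightarrow> (\<lambda>y. U (y, k)) \<in> borel_measurable m"
  by (rule measurable_compose[where N = \<Delta>]) auto

lemma tint_integrand_meas:
  assumes "\<And>k. (\<lambda>y. V k y) \<in> borel_measurable m"
  shows "(\<lambda>y. \<Sum>k<R y. V k y :: ennreal) \<in> borel_measurable m"
  by (rule measurable_compose_countable[where g = R and f = "\<lambda>n y. \<Sum>k<n. V k y"]) (use assms in auto)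

lemma tint_mono: "(\<And>y k. y \<in> Y \<Longrightarrow> k < R y \<Longrightarrow> y \<in> G \<Longrightarrow> U (y, k) \<le> V (y, k)) \<Longrightarrow> tint U \<le> tint V"
  unfolding tint_def
  by (rule nn_integral_mono_AE) (use AE_\<nu>_G in \<open>auto elim!: eventually_mono intro!: sum_mono simp: G_Y[THEN subsetD]\<close>)

lemma tint_add:
  assumes "U \<in> borel_measurable \<Delta>" "V \<in> borel_measurable \<Delta>"
  shows "tint (\<lambda>z. U z + V z) = tint U + tint V"
  unfolding tint_def sum.distrib
  by (intro nn_integral_add) (use assms in \<open>auto intro!: tint_integrand_meas level_meas cong: measurable_cong_sets simp: sets_\<nu>\<close>)

lemma tint_cmult:
  assumes "U \<in> borel_measurable \<Delta>"
  shows "tint (\<lambda>z. c * U z) = c * tint U"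
  unfolding tint_def sum_distrib_left[symmetric]
  by (intro nn_integral_cmult) (use assms in \<open>auto intro!: tint_integrand_meas level_meas cong: measurable_cong_sets simp: sets_\<nu>\<close>)

text \<open>
  The backward step is the conditional law of a tower point given its image. Inside a column both
  sides agree term by term; the top of the columns is handled by \<open>base_duality\<close>.
\<close>

lemma tint_step:
  assumes u: "case_prod u \<in> borel_measurable (\<Delta> \<Otimes>\<^sub>M \<Delta>)"
  shows "tint (\<lambda>z. u (tmap z) z) = tint (\<lambda>z. \<integral>\<^sup>+w. u z w \<partial>measure_pmf (chain.step z))"
proof -
  have um: "(\<lambda>x. u (v x) (w x)) \<in> borel_measurable X" if "v \<in> X \<rightarrow>\<^sub>M \<Delta>" "w \<in> X \<rightarrow>\<^sub>M \<Delta>" for v w X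
    using measurable_compose[OF measurable_Pair[OF that] u] by simp
  define A where "A y = (\<Sum>k<R y - 1. u (y, Suc k) (y, k))" for y
  have Am: "A \<in> borel_measurable \<nu>"
  proof -
    have "(\<lambda>y. \<Sum>k<n - 1. u (y, Suc k) (y, k)) \<in> borel_measurable m" for n by (intro borel_measurable_sum um) auto
    then have "A \<in> borel_measurable m" unfolding A_def
      by (rule measurable_compose_countable[where g = R and f = "\<lambda>n y. \<Sum>k<n - 1. u (y, Suc k) (y, k)"]) auto
    then show ?thesis by simp
  qed
  have "(\<lambda>x. (x, R x - 1)) \<in> m \<rightarrow>\<^sub>M \<Delta>" by measurable
  then have wm: "case_prod (\<lambda>y x. u (y, 0) (x, R x - 1)) \<in> borel_measurable (m \<Otimes>\<^sub>M m)"
    unfolding case_prod_unfold by (intro um) (auto intro: measurable_compose[OF measurable_snd])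
  have Rpos: "R y = Suc (R y - 1)" if "y \<in> Y" for y using R_ge1[OF that] by simp
  have L: "tint (\<lambda>z. u (tmap z) z) = (\<integral>\<^sup>+y. A y + u (F y, 0) (y, R y - 1) \<partial>\<nu>)"
    unfolding tint_def
  proof (intro nn_integral_cong)
    fix y assume "y \<in> space \<nu>"
    then have y: "y \<in> Y" by (simp add: space_\<nu>)
    have "(\<Sum>k<R y. u (tmap (y, k)) (y, k)) = (\<Sum>k<Suc (R y - 1). u (tmap (y, k)) (y, k))" using Rpos[OF y] by simp
    also have "\<dots> = (\<Sum>k<R y - 1. u (tmap (y, k)) (y, k)) + u (tmap (y, R y - 1)) (y, R y - 1)" by (rule sum.lessThan_Suc)
    also have "(\<Sum>k<R y - 1. u (tmap (y, k)) (y, k)) = A y"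
      unfolding A_def by (intro sum.cong) (auto simp: tmap_def)
    also have "tmap (y, R y - 1) = (F y, 0)" by (simp add: tmap_def)
    finally show "(\<Sum>k<R y. u (tmap (y, k)) (y, k)) = A y + u (F y, 0) (y, R y - 1)" .
  qed
  have Rt: "tint (\<lambda>z. \<integral>\<^sup>+w. u z w \<partial>measure_pmf (chain.step z))
     = (\<integral>\<^sup>+y. A y + (\<integral>\<^sup>+n. u (y, 0) (s n y, R (s n y) - 1) \<partial>measure_pmf (p y)) \<partial>\<nu>)"
    unfolding tint_def
  proof (intro nn_integral_cong)
    fix y assume "y \<in> space \<nu>"
    then have y: "y \<in> Y" by (simp add: space_\<nu>)
    have "(\<Sum>k<R y. \<integral>\<^sup>+w. u (y, k) w \<partial>measure_pmf (chain.step (y, k)))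
        = (\<Sum>k<Suc (R y - 1). \<integral>\<^sup>+w. u (y, k) w \<partial>measure_pmf (chain.step (y, k)))" using Rpos[OF y] by simp
    also have "\<dots> = (\<integral>\<^sup>+w. u (y, 0) w \<partial>measure_pmf (chain.step (y, 0)))
        + (\<Sum>k<R y - 1. \<integral>\<^sup>+w. u (y, Suc k) w \<partial>measure_pmf (chain.step (y, Suc k)))" by (rule sum.lessThan_Suc_shift)
    also have "(\<Sum>k<R y - 1. \<integral>\<^sup>+w. u (y, Suc k) w \<partial>measure_pmf (chain.step (y, Suc k))) = A y"
      unfolding A_def by simp
    also have "(\<integral>\<^sup>+w. u (y, 0) w \<partial>measure_pmf (chain.step (y, 0))) = (\<integral>\<^sup>+n. u (y, 0) (s n y, R (s n y) - 1) \<partial>measure_pmf (p y))"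
      using r_R[OF s_a[OF y]] by simp
    finally show "(\<Sum>k<R y. \<integral>\<^sup>+w. u (y, k) w \<partial>measure_pmf (chain.step (y, k)))
       = A y + (\<integral>\<^sup>+n. u (y, 0) (s n y, R (s n y) - 1) \<partial>measure_pmf (p y))" by (simp add: add.commute)
  qed
  have m1: "(\<lambda>y. u (F y, 0) (y, R y - 1)) \<in> borel_measurable \<nu>"
  proof -
    have "(\<lambda>y. u (F y, 0) (y, R y - 1)) \<in> borel_measurable m" by (intro um) measurable
    then show ?thesis by simp
  qed
  have m2: "(\<lambda>y. \<integral>\<^sup>+n. u (y, 0) (s n y, R (s n y) - 1) \<partial>measure_pmf (p y)) \<in> borel_measurable \<nu>"
  proof -
    note s_meas[measurable]
    have "(\<lambda>y. u (y, 0) (s n y, R (s n y) - 1)) \<in> borel_measurable m" for n by (intro um) measurable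
    then have "(\<lambda>y. \<integral>\<^sup>+n. u (y, 0) (s n y, R (s n y) - 1) \<partial>measure_pmf (p y)) \<in> borel_measurable m"
      unfolding nn_integral_p by (intro borel_measurable_suminf_order borel_measurable_times_ennreal) auto
    then show ?thesis by simp
  qed
  show ?thesis
    unfolding L Rt nn_integral_add[OF Am m1] nn_integral_add[OF Am m2] base_duality[OF wm] ..
qed

section \<open>Duality between orbits and backward paths\<close>

abbreviation Pw :: "(nat \<Rightarrow> real) measure" where "Pw \<equiv> \<Pi>\<^sub>M i\<in>UNIV. borel"

lemma measurable_tower_product:
  assumes "\<And>k. (\<lambda>q. g (fst q, (snd q, k))) \<in> X \<Otimes>\<^sub>M m \<rightarrow>\<^sub>M N"
  shows "g \<in> X \<Otimes>\<^sub>M \<Delta> \<rightarrow>\<^sub>M N"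
proof -
  have "(\<lambda>q. (\<lambda>k q. g (fst q, (fst (snd q), k))) (snd (snd q)) q) \<in> X \<Otimes>\<^sub>M \<Delta> \<rightarrow>\<^sub>M N"
  proof (rule measurable_compose_countable[where f = "\<lambda>k q. g (fst q, (fst (snd q), k))" and g = "\<lambda>q. snd (snd q)"])
    fix k
    have "(\<lambda>q. (fst q, fst (snd q))) \<in> X \<Otimes>\<^sub>M \<Delta> \<rightarrow>\<^sub>M X \<Otimes>\<^sub>M m" by measurable
    from measurable_compose[OF this assms[of k]]
    show "(\<lambda>q. g (fst q, (fst (snd q), k))) \<in> X \<Otimes>\<^sub>M \<Delta> \<rightarrow>\<^sub>M N" by simp
  qed measurable
  then show ?thesis by simp
qed

lemma measurable_tower:
  assumes "\<And>k. (\<lambda>y. g (y, k)) \<in> m \<rightarrow>\<^sub>M N"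
  shows "g \<in> \<Delta> \<rightarrow>\<^sub>M N"
proof -
  have "(\<lambda>q. (\<lambda>k q. g (fst q, k)) (snd q) q) \<in> \<Delta> \<rightarrow>\<^sub>M N"
    by (rule measurable_compose_countable[where f = "\<lambda>k q. g (fst q, k)" and g = snd])
      (use measurable_compose[OF measurable_fst assms] in auto)
  then show ?thesis by simp
qed

lemma tproj_meas[measurable]: "tproj \<in> \<Delta> \<rightarrow>\<^sub>M borel"
proof (rule measurable_tower)
  fix k
  have "(f ^^ k) \<in> borel \<rightarrow>\<^sub>M borel"
    by (induction k) (use f_meas in \<open>auto intro: measurable_comp\<close>)
  from measurable_compose[OF measurable_id_m this] show "(\<lambda>y. tproj (y, k)) \<in> m \<rightarrow>\<^sub>M borel"
    by (simp add: tproj_def)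
qed

lemma \<Phi>_meas[measurable]: "\<Phi> \<in> borel_measurable \<Delta>"
  using measurable_compose[OF tproj_meas \<phi>_meas] by (simp add: \<Phi>_def[abs_def] tproj_def[abs_def])

lemma tmap_meas[measurable]: "tmap \<in> \<Delta> \<rightarrow>\<^sub>M \<Delta>"
proof (rule measurable_tower)
  fix k
  have "(\<lambda>y. if Suc k < R y then (y, Suc k) else (F y, 0)) \<in> m \<rightarrow>\<^sub>M \<Delta>" by measurable
  then show "(\<lambda>y. tmap (y, k)) \<in> m \<rightarrow>\<^sub>M \<Delta>"
    unfolding tmap_def fst_conv snd_conv .
qed

text \<open>
  Measurability on the tower is checked level by level, and at level \<open>0\<close> the expectation is a
  countable sum over branches.
\<close>

lemma step_meas:
  assumes g: "g \<in> borel_measurable (X \<Otimes>\<^sub>M \<Delta>)"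
  shows "(\<lambda>q. \<integral>\<^sup>+w. g (fst q, w) \<partial>measure_pmf (chain.step (snd q))) \<in> borel_measurable (X \<Otimes>\<^sub>M \<Delta>)"
proof (rule measurable_tower_product)
  fix k
  show "(\<lambda>q. \<integral>\<^sup>+w. g (fst (fst q, (snd q, k)), w) \<partial>measure_pmf (chain.step (snd (fst q, (snd q, k)))))
     \<in> borel_measurable (X \<Otimes>\<^sub>M m)"
  proof (cases k)
    case 0
    have [measurable]: "s n \<in> m \<rightarrow>\<^sub>M m" for n by (rule s_meas)
    have "(\<lambda>q. (fst q, (s n (snd q), r n - 1))) \<in> X \<Otimes>\<^sub>M m \<rightarrow>\<^sub>M X \<Otimes>\<^sub>M \<Delta>" for n by measurable
    from measurable_compose[OF this g]
    have "(\<lambda>q. \<Sum>n. ennreal (pmf (p (snd q)) n) * g (fst q, (s n (snd q), r n - 1))) \<in> borel_measurable (X \<Otimes>\<^sub>M m)"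
      by (intro borel_measurable_suminf_order borel_measurable_times_ennreal) auto
    then show ?thesis by (simp add: 0 nn_integral_p)
  next
    case (Suc k')
    have "(\<lambda>q. (fst q, (snd q, k'))) \<in> X \<Otimes>\<^sub>M m \<rightarrow>\<^sub>M X \<Otimes>\<^sub>M \<Delta>" by measurable
    from measurable_compose[OF this g] show ?thesis by (simp add: Suc)
  qed
qed

text \<open>
  The path whose first \<open>j\<close> observations are already known. This generalisation makes the induction
  in \<open>obs_meas_splice\<close> go through, since a step of the chain reveals one observation.
\<close>

definition splice :: "nat \<Rightarrow> (nat \<Rightarrow> real) \<Rightarrow> (nat \<Rightarrow> real) \<Rightarrow> nat \<Rightarrow> real" where
  "splice j \<rho> \<omega> = (\<lambda>i. if i < j then \<rho> i else \<omega> (i - j))"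

lemma splice_case_nat: "splice j \<rho> (case_nat t \<omega>) = splice (Suc j) (\<rho>(j := t)) \<omega>"
proof
  fix i
  consider "i < j" | "i = j" | d where "i = j + Suc d" by (metis less_iff_Suc_add linorder_neqE_nat add_Suc_right)
  then show "splice j \<rho> (case_nat t \<omega>) i = splice (Suc j) (\<rho>(j := t)) \<omega> i"
    by cases (auto simp: splice_def)
qed

lemma Pw_measurableI:
  assumes "\<And>i. (\<lambda>x. g x i) \<in> borel_measurable X"
  shows "g \<in> X \<rightarrow>\<^sub>M Pw"
  by (rule measurable_PiM_single') (use assms in auto)

lemma Pw_component: "(\<lambda>\<omega>. \<omega> i) \<in> borel_measurable Pw"
  by (rule measurable_component_singleton) simp

lemma obs_meas_splice:
  assumes H: "case_prod H \<in> borel_measurable (X \<Otimes>\<^sub>M Pw)"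
  shows "(\<lambda>q. \<integral>\<^sup>+\<omega>. H (fst (fst q)) (splice j (snd (fst q)) \<omega>) \<partial>measure_pmf (chain.obs N (snd q)))
     \<in> borel_measurable ((X \<Otimes>\<^sub>M Pw) \<Otimes>\<^sub>M \<Delta>)"
proof (induction N arbitrary: j)
  have Hm: "(\<lambda>x. H (u x) (v x)) \<in> borel_measurable Z" if "u \<in> Z \<rightarrow>\<^sub>M X" "v \<in> Z \<rightarrow>\<^sub>M Pw" for u v Z
    using measurable_compose[OF measurable_Pair[OF that] H] by simp
  case 0
  have "(\<lambda>q. splice j (snd (fst q)) (\<lambda>_. \<Phi> (snd q))) \<in> (X \<Otimes>\<^sub>M Pw) \<Otimes>\<^sub>M \<Delta> \<rightarrow>\<^sub>M Pw"
  proof (rule Pw_measurableI)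
    fix i
    have "(\<lambda>q. snd (fst q) i) \<in> borel_measurable ((X \<Otimes>\<^sub>M Pw) \<Otimes>\<^sub>M \<Delta>)"
      by (rule measurable_compose[OF _ Pw_component]) measurable
    then show "(\<lambda>q. splice j (snd (fst q)) (\<lambda>_. \<Phi> (snd q)) i) \<in> borel_measurable ((X \<Otimes>\<^sub>M Pw) \<Otimes>\<^sub>M \<Delta>)"
      by (cases "i < j") (auto simp: splice_def)
  qed
  then show ?case by (simp add: Hm)
next
  case (Suc N)
  let ?X = "(X \<Otimes>\<^sub>M Pw) \<Otimes>\<^sub>M \<Delta>"
  define g where "g q = (\<integral>\<^sup>+\<omega>. H (fst (fst q)) (splice (Suc j) (snd (fst q)) \<omega>) \<partial>measure_pmf (chain.obs N (snd q)))" for q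
  have g: "g \<in> borel_measurable ((X \<Otimes>\<^sub>M Pw) \<Otimes>\<^sub>M \<Delta>)" unfolding g_def by (rule Suc)
  have upd: "(\<lambda>q. (snd (fst (fst q)))(j := \<Phi> (snd (fst q)))) \<in> ?X \<Otimes>\<^sub>M \<Delta> \<rightarrow>\<^sub>M Pw"
  proof (rule Pw_measurableI)
    fix i
    have "(\<lambda>q. snd (fst (fst q)) i) \<in> borel_measurable (?X \<Otimes>\<^sub>M \<Delta>)"
      by (rule measurable_compose[OF _ Pw_component]) measurable
    then show "(\<lambda>q. ((snd (fst (fst q)))(j := \<Phi> (snd (fst q)))) i) \<in> borel_measurable (?X \<Otimes>\<^sub>M \<Delta>)"
      by (cases "i = j") auto
  qed
  have "(\<lambda>q. g ((fst (fst (fst q)), (snd (fst (fst q)))(j := \<Phi> (snd (fst q)))), snd q)) \<in> borel_measurable (?X \<Otimes>\<^sub>M \<Delta>)"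
    by (rule measurable_compose[OF _ g], intro measurable_Pair upd) measurable
  then have "(\<lambda>q. \<integral>\<^sup>+w. g ((fst (fst (fst q)), (snd (fst (fst q)))(j := \<Phi> (snd (fst q)))), w) \<partial>measure_pmf (chain.step (snd q))) \<in> borel_measurable (?X \<Otimes>\<^sub>M \<Delta>)"
    by (rule step_meas[of "\<lambda>q. g ((fst (fst (fst q)), (snd (fst (fst q)))(j := \<Phi> (snd (fst q)))), snd q)" ?X, unfolded fst_conv snd_conv])
  moreover have "(\<lambda>q. (q, snd q)) \<in> ?X \<rightarrow>\<^sub>M ?X \<Otimes>\<^sub>M \<Delta>" by measurable
  ultimately have "(\<lambda>q. (\<lambda>q. \<integral>\<^sup>+w. g ((fst (fst (fst q)), (snd (fst (fst q)))(j := \<Phi> (snd (fst q)))), w) \<partial>measure_pmf (chain.step (snd q))) (q, snd q)) \<in> borel_measurable ?X"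
    by (rule measurable_compose[rotated])
  then have "(\<lambda>q. \<integral>\<^sup>+w. g ((fst (fst q), (snd (fst q))(j := \<Phi> (snd q))), w) \<partial>measure_pmf (chain.step (snd q))) \<in> borel_measurable ?X"
    unfolding fst_conv snd_conv .
  then show ?case by (simp add: splice_case_nat g_def)
qed

lemma obs_meas:
  assumes H: "case_prod H \<in> borel_measurable (X \<Otimes>\<^sub>M Pw)"
  shows "(\<lambda>q. \<integral>\<^sup>+\<omega>. H (fst q) \<omega> \<partial>measure_pmf (chain.obs N (snd q))) \<in> borel_measurable (X \<Otimes>\<^sub>M \<Delta>)"
proof -
  have "(\<lambda>q. ((fst q, (\<lambda>_. 0)), snd q)) \<in> X \<Otimes>\<^sub>M \<Delta> \<rightarrow>\<^sub>M (X \<Otimes>\<^sub>M Pw) \<Otimes>\<^sub>M \<Delta>"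
  proof (intro measurable_Pair)
    show "(\<lambda>q. (\<lambda>_. 0)) \<in> X \<Otimes>\<^sub>M \<Delta> \<rightarrow>\<^sub>M Pw" by (rule Pw_measurableI) auto
  qed auto
  from measurable_compose[OF this obs_meas_splice[OF H, where j = 0 and N = N]] show ?thesis
    by (simp add: splice_def)
qed

text \<open>
  Under the invariant measure, the observations along an orbit of length \<open>N\<close>, read backwards from
  its endpoint \<open>z\<close>, have the conditional law \<open>obs N z\<close> given \<open>z\<close>. Each induction step applies
  \<open>tint_step\<close> to the last step of the orbit, which is the first backward step.
\<close>

lemma path_duality:
  assumes U: "case_prod U \<in> borel_measurable (\<Delta> \<Otimes>\<^sub>M Pw)"
  shows "tint (\<lambda>w. U ((tmap ^^ N) w) (\<lambda>j. \<Phi> ((tmap ^^ (N - j)) w))) = tint (\<lambda>z. \<integral>\<^sup>+\<omega>. U z \<omega> \<partial>measure_pmf (chain.obs N z))"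
  using U
proof (induction N arbitrary: U)
  case (Suc N)
  have Um: "(\<lambda>x. U (u x) (v x)) \<in> borel_measurable Z" if "u \<in> Z \<rightarrow>\<^sub>M \<Delta>" "v \<in> Z \<rightarrow>\<^sub>M Pw" for u v Z
    using measurable_compose[OF measurable_Pair[OF that] Suc.prems] by simp
  have case_nat_m: "(\<lambda>q. case_nat (\<Phi> (u q)) (v q)) \<in> Z \<rightarrow>\<^sub>M Pw" if "u \<in> Z \<rightarrow>\<^sub>M \<Delta>" "v \<in> Z \<rightarrow>\<^sub>M Pw" for u v Z
  proof (rule Pw_measurableI)
    fix i
    show "(\<lambda>x. (case i of 0 \<Rightarrow> \<Phi> (u x) | Suc i' \<Rightarrow> v x i')) \<in> borel_measurable Z"
      using measurable_compose[OF that(1) \<Phi>_meas] measurable_compose[OF that(2) Pw_component] by (cases i) auto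
  qed
  have shift: "(\<lambda>j. \<Phi> ((tmap ^^ (Suc N - j)) w)) = case_nat (\<Phi> (tmap ((tmap ^^ N) w))) (\<lambda>j. \<Phi> ((tmap ^^ (N - j)) w))" for w
    by (auto simp: fun_eq_iff split: nat.split)
  have "tint (\<lambda>w. U ((tmap ^^ Suc N) w) (\<lambda>j. \<Phi> ((tmap ^^ (Suc N - j)) w)))
     = tint (\<lambda>z. \<integral>\<^sup>+\<omega>. U (tmap z) (case_nat (\<Phi> (tmap z)) \<omega>) \<partial>measure_pmf (chain.obs N z))"
    unfolding shift funpow.simps o_def
  proof (rule Suc.IH[where U = "\<lambda>z \<omega>. U (tmap z) (case_nat (\<Phi> (tmap z)) \<omega>)"])
    have t: "(\<lambda>x. tmap (fst x)) \<in> \<Delta> \<Otimes>\<^sub>M Pw \<rightarrow>\<^sub>M \<Delta>" by measurable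
    show "(\<lambda>(z, \<omega>). U (tmap z) (case_nat (\<Phi> (tmap z)) \<omega>)) \<in> borel_measurable (\<Delta> \<Otimes>\<^sub>M Pw)"
      unfolding case_prod_unfold by (intro Um t case_nat_m measurable_snd)
  qed
  also have "\<dots> = tint (\<lambda>z. \<integral>\<^sup>+w. (\<integral>\<^sup>+\<omega>. U z (case_nat (\<Phi> z) \<omega>) \<partial>measure_pmf (chain.obs N w)) \<partial>measure_pmf (chain.step z))"
  proof (rule tint_step[where u = "\<lambda>z' z. \<integral>\<^sup>+\<omega>. U z' (case_nat (\<Phi> z') \<omega>) \<partial>measure_pmf (chain.obs N z)"])
    have "(\<lambda>(z, \<omega>). U z (case_nat (\<Phi> z) \<omega>)) \<in> borel_measurable (\<Delta> \<Otimes>\<^sub>M Pw)"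
      unfolding case_prod_unfold by (intro Um case_nat_m measurable_fst measurable_snd)
    from obs_meas[OF this, of N]
    show "(\<lambda>(z', z). \<integral>\<^sup>+\<omega>. U z' (case_nat (\<Phi> z') \<omega>) \<partial>measure_pmf (chain.obs N z)) \<in> borel_measurable (\<Delta> \<Otimes>\<^sub>M \<Delta>)"
      by (simp add: case_prod_unfold)
  qed
  also have "\<dots> = tint (\<lambda>z. \<integral>\<^sup>+\<omega>. U z \<omega> \<partial>measure_pmf (chain.obs (Suc N) z))" by simp
  finally show ?case .
qed simp

lemma tint_invariant:
  assumes "U \<in> borel_measurable \<Delta>"
  shows "tint (\<lambda>w. U ((tmap ^^ N) w)) = tint U"
proof -
  have "case_prod (\<lambda>z \<omega>. U z) \<in> borel_measurable (\<Delta> \<Otimes>\<^sub>M Pw)"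
    unfolding case_prod_unfold by (rule measurable_compose[OF measurable_fst assms])
  from path_duality[OF this, of N] show ?thesis by simp
qed

definition Rbar :: ennreal where "Rbar = (\<integral>\<^sup>+y. of_nat (R y) \<partial>\<nu>)"

lemma tint_const: "tint (\<lambda>_. c) = c * Rbar"
proof -
  have "(\<lambda>y. of_nat (R y) :: ennreal) \<in> borel_measurable \<nu>"
    by (rule measurable_compose[where N = "count_space UNIV"]) auto
  then show ?thesis unfolding tint_def Rbar_def
    by (subst nn_integral_cmult[symmetric]) (auto simp: mult.commute)
qed

lemma Rbar_pos: "0 < Rbar" and Rbar_finite: "Rbar < \<infinity>"
proof -
  interpret prob_space \<nu> by (rule prob_\<nu>)
  have "(1 :: ennreal) = (\<integral>\<^sup>+y. 1 \<partial>\<nu>)" by (simp add: emeasure_space_1)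
  also have "\<dots> \<le> Rbar" unfolding Rbar_def
  proof (intro nn_integral_mono)
    fix y assume "y \<in> space \<nu>"
    then have "1 \<le> R y" using R_ge1 by (simp add: space_\<nu>)
    then show "(1 :: ennreal) \<le> of_nat (R y)" by (metis of_nat_1 of_nat_mono)
  qed
  finally show "0 < Rbar" by (metis less_le_trans zero_less_one)
  have Rm: "(\<lambda>y. of_nat (R y) :: ennreal) \<in> borel_measurable m"
    by (rule measurable_compose[where N = "count_space UNIV"]) auto
  have "Rbar = (\<integral>\<^sup>+y. ennreal (h y) * of_nat (R y) \<partial>m)"
    unfolding Rbar_def by (subst \<nu>_eq, subst nn_integral_density) (use h_meas Rm in auto)
  also have "\<dots> \<le> (\<integral>\<^sup>+y. ennreal hmax * ennreal (real (R y)) \<partial>m)"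
    by (rule nn_integral_mono_AE) (use G_AE hmax in \<open>auto elim!: eventually_mono intro!: mult_mono ennreal_leI simp: ennreal_of_nat_eq_real_of_nat\<close>)
  also have "\<dots> = ennreal hmax * (\<integral>\<^sup>+y. ennreal (real (R y)) \<partial>m)"
    using borel_measurable_integrable[OF R_int] by (intro nn_integral_cmult) auto
  also have "\<dots> < \<infinity>" using R_int by (simp add: nn_integral_eq_integral ennreal_mult_less_top)
  finally show "Rbar < \<infinity>" .
qed

lemma inverse_Rbar: "inverse Rbar * Rbar = 1"
  using Rbar_pos Rbar_finite ennreal_divide_self[of Rbar] by (simp add: divide_ennreal_def mult.commute)

definition avg :: "('a \<times> nat \<Rightarrow> ennreal) \<Rightarrow> ennreal" where "avg U = inverse Rbar * tint U"

lemma avg_const: "avg (\<lambda>_. c) = c"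
  unfolding avg_def tint_const by (metis inverse_Rbar mult.assoc mult.commute mult_1_right)

lemma avg_mono: "(\<And>y k. y \<in> Y \<Longrightarrow> k < R y \<Longrightarrow> y \<in> G \<Longrightarrow> U (y, k) \<le> V (y, k)) \<Longrightarrow> avg U \<le> avg V"
  unfolding avg_def by (intro mult_left_mono tint_mono) auto

lemma avg_cong: "(\<And>y k. y \<in> Y \<Longrightarrow> k < R y \<Longrightarrow> y \<in> G \<Longrightarrow> U (y, k) = V (y, k)) \<Longrightarrow> avg U = avg V"
  by (intro antisym avg_mono) auto

lemma avg_add:
  "U \<in> borel_measurable \<Delta> \<Longrightarrow> V \<in> borel_measurable \<Delta> \<Longrightarrow> avg (\<lambda>z. U z + V z) = avg U + avg V"
  unfolding avg_def by (simp add: tint_add distrib_left)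

lemma avg_cmult: "U \<in> borel_measurable \<Delta> \<Longrightarrow> avg (\<lambda>z. c * U z) = c * avg U"
  unfolding avg_def by (simp add: tint_cmult mult_ac)

lemma avg_invariant: "U \<in> borel_measurable \<Delta> \<Longrightarrow> avg (\<lambda>w. U ((tmap ^^ N) w)) = avg U"
  unfolding avg_def by (simp add: tint_invariant)

text \<open>
  The tower measure as an actual measure, needed only to identify its projection with
  \<open>lifted_measure\<close>.
\<close>

definition tower_measure :: "('a \<times> nat) measure" where
  "tower_measure = density (\<nu> \<Otimes>\<^sub>M count_space UNIV) (indicator {z. snd z < R (fst z)})"

lemma nn_integral_tower_measure:
  assumes U: "U \<in> borel_measurable \<Delta>"
  shows "(\<integral>\<^sup>+z. U z \<partial>tower_measure) = tint U"
proof -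
  interpret cs: sigma_finite_measure "count_space (UNIV :: nat set)"
    by (rule sigma_finite_measure_count_space)
  have sD: "sets (\<nu> \<Otimes>\<^sub>M count_space (UNIV :: nat set)) = sets \<Delta>"
    by (intro sets_pair_measure_cong sets_\<nu> refl)
  have Um: "U \<in> borel_measurable (\<nu> \<Otimes>\<^sub>M count_space UNIV)"
    unfolding measurable_cong_sets[OF sD refl] by (rule U)
  have [measurable]: "(\<lambda>z. R (fst z)) \<in> \<Delta> \<rightarrow>\<^sub>M count_space UNIV" by (rule measurable_compose[OF measurable_fst R_meas])
  have "(\<lambda>z. real (R (fst z))) \<in> borel_measurable \<Delta>" "(\<lambda>z. real (snd z)) \<in> borel_measurable \<Delta>"
    by (rule measurable_compose[where N = "count_space UNIV"]; measurable)+
  then have "{z \<in> space \<Delta>. real (snd z) < real (R (fst z))} \<in> sets \<Delta>"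
    by (intro borel_measurable_less)
  then have "{z \<in> space \<Delta>. snd z < R (fst z)} \<in> sets \<Delta>" by simp
  then have im: "(indicator {z. snd z < R (fst z)} :: _ \<Rightarrow> ennreal) \<in> borel_measurable (\<nu> \<Otimes>\<^sub>M count_space UNIV)"
    unfolding measurable_cong_sets[OF sD refl] by (subst borel_measurable_indicator_iff) (simp add: Int_def conj_commute)
  have "(\<integral>\<^sup>+z. U z \<partial>tower_measure) = (\<integral>\<^sup>+z. indicator {z. snd z < R (fst z)} z * U z \<partial>(\<nu> \<Otimes>\<^sub>M count_space UNIV))"
    unfolding tower_measure_def using Um im by (rule nn_integral_density[rotated])
  also have "\<dots> = (\<integral>\<^sup>+y. (\<integral>\<^sup>+k. indicator {z. snd z < R (fst z)} (y, k) * U (y, k) \<partial>count_space UNIV) \<partial>\<nu>)"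
    using Um im by (intro cs.nn_integral_fst[symmetric] borel_measurable_times_ennreal)
  also have "\<dots> = tint U"
    unfolding tint_def
  proof (intro nn_integral_cong)
    fix y
    have "(\<integral>\<^sup>+k. indicator {z. snd z < R (fst z)} (y, k) * U (y, k) \<partial>count_space UNIV)
       = (\<Sum>k. indicator {z. snd z < R (fst z)} (y, k) * U (y, k))" by (rule nn_integral_count_space_nat)
    also have "\<dots> = (\<Sum>k<R y. indicator {z. snd z < R (fst z)} (y, k) * U (y, k))"
      by (rule suminf_finite) auto
    also have "\<dots> = (\<Sum>k<R y. U (y, k))" by (intro sum.cong) auto
    finally show "(\<integral>\<^sup>+k. indicator {z. snd z < R (fst z)} (y, k) * U (y, k) \<partial>count_space UNIV) = (\<Sum>k<R y. U (y, k))" .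
  qed
  finally show ?thesis .
qed

abbreviation \<mu> :: "'a measure" where "\<mu> \<equiv> lifted_measure f R \<nu>"

text \<open>
  The sum over levels of the images of \<open>\<nu>\<close> restricted to \<open>{R > k}\<close> under \<open>f\<^sup>k\<close> is the image of the
  tower measure. In particular the set function in the definition of \<open>lifted_measure\<close> is a
  measure.
\<close>

lemma lifted_measure_distr: "\<mu> = scale_measure (inverse Rbar) (distr tower_measure borel tproj)"
proof -
  let ?D = "distr tower_measure borel tproj"
  have sT: "sets tower_measure = sets \<Delta>"
    unfolding tower_measure_def by (simp add: sets_pair_measure_cong[OF sets_\<nu> refl])
  have tm: "tproj \<in> tower_measure \<rightarrow>\<^sub>M borel"
    unfolding measurable_cong_sets[OF sT refl] by (rule tproj_meas)
  have lev: "(\<Sum>n. emeasure (distr (restrict_space \<nu> {y. R y > n}) borel (f ^^ n)) A) = emeasure ?D A"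
    if A: "A \<in> sets borel" for A
  proof -
    have fk[measurable]: "(\<lambda>y. (f ^^ k) y) \<in> m \<rightarrow>\<^sub>M borel" for k
      using measurable_compose[OF _ tproj_meas, of "\<lambda>y. (y, k)" m] by (simp add: tproj_def)
    have set1: "{y \<in> Y. k < R y \<and> (f ^^ k) y \<in> A} \<in> sets m" for k
    proof -
      have "{y \<in> space m. k < R y \<and> (f ^^ k) y \<in> A} \<in> sets m" using A by measurable
      then show ?thesis by (simp add: space_mY)
    qed
    have "emeasure (distr (restrict_space \<nu> {y. R y > k}) borel (f ^^ k)) A
        = (\<integral>\<^sup>+y. indicator {y \<in> Y. k < R y \<and> (f ^^ k) y \<in> A} y \<partial>\<nu>)" for k
    proof -
      have "{y. R y > k} \<inter> space \<nu> \<in> sets \<nu>"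
      proof -
        have "{y \<in> space m. k < R y} \<in> sets m" by measurable
        then show ?thesis by (simp add: sets_\<nu> space_\<nu> space_mY Int_def conj_commute)
      qed
      moreover have "(f ^^ k) \<in> restrict_space \<nu> {y. R y > k} \<rightarrow>\<^sub>M borel"
        using fk[of k] by (intro measurable_restrict_space1) simp
      ultimately have "emeasure (distr (restrict_space \<nu> {y. R y > k}) borel (f ^^ k)) A
         = emeasure \<nu> ((f ^^ k) -` A \<inter> space (restrict_space \<nu> {y. R y > k}))"
        using A by (subst emeasure_distr) (auto intro!: emeasure_restrict_space simp: space_restrict_space)
      also have "(f ^^ k) -` A \<inter> space (restrict_space \<nu> {y. R y > k}) = {y \<in> Y. k < R y \<and> (f ^^ k) y \<in> A}"
        by (auto simp: space_restrict_space space_\<nu>)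
      finally show ?thesis using set1[of k] by (simp add: sets_\<nu>)
    qed
    then have "(\<Sum>n. emeasure (distr (restrict_space \<nu> {y. R y > n}) borel (f ^^ n)) A)
       = (\<integral>\<^sup>+y. (\<Sum>k. indicator {y \<in> Y. k < R y \<and> (f ^^ k) y \<in> A} y) \<partial>\<nu>)"
      using set1 by (simp add: nn_integral_suminf)
    also have "\<dots> = tint (\<lambda>z. indicator A (tproj z))"
      unfolding tint_def
    proof (intro nn_integral_cong)
      fix y assume "y \<in> space \<nu>"
      then have y: "y \<in> Y" by (simp add: space_\<nu>)
      have "(\<Sum>k. indicator {y \<in> Y. k < R y \<and> (f ^^ k) y \<in> A} y :: ennreal) = (\<Sum>k<R y. indicator {y \<in> Y. k < R y \<and> (f ^^ k) y \<in> A} y)"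
        by (rule suminf_finite) auto
      also have "\<dots> = (\<Sum>k<R y. indicator A (tproj (y, k)))"
        using y by (intro sum.cong) (auto simp: tproj_def split: split_indicator)
      finally show "(\<Sum>k. indicator {y \<in> Y. k < R y \<and> (f ^^ k) y \<in> A} y :: ennreal) = (\<Sum>k<R y. indicator A (tproj (y, k)))" .
    qed
    also have "\<dots> = (\<integral>\<^sup>+z. indicator A (tproj z) \<partial>tower_measure)"
      by (rule nn_integral_tower_measure[symmetric], rule measurable_compose[OF tproj_meas], rule borel_measurable_indicator) (rule A)
    also have "\<dots> = (\<integral>\<^sup>+x. indicator A x \<partial>?D)" using A tm by (subst nn_integral_distr) auto
    also have "\<dots> = emeasure ?D A" using A by simp
    finally show ?thesis .
  qed
  have "measure_of UNIV (sets borel) (\<lambda>A. \<Sum>n. emeasure (distr (restrict_space \<nu> {y. R y > n}) borel (f ^^ n)) A)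
     = measure_of UNIV (sets borel) (emeasure ?D)"
    by (rule measure_of_eq) (auto simp: lev sets.sigma_sets_eq[of borel, simplified])
  also have "\<dots> = ?D" using measure_of_of_measure[of ?D] by simp
  finally show ?thesis unfolding lifted_measure_def Rbar_def by simp
qed

lemma sets_\<mu>: "sets \<mu> = sets borel" and space_\<mu>: "space \<mu> = UNIV"
  by (simp_all add: lifted_measure_distr space_scale_measure)

lemma nn_integral_\<mu>:
  assumes v: "v \<in> borel_measurable borel"
  shows "(\<integral>\<^sup>+x. v x \<partial>\<mu>) = avg (\<lambda>z. v (tproj z))"
proof -
  have sT: "sets tower_measure = sets \<Delta>"
    unfolding tower_measure_def by (simp add: sets_pair_measure_cong[OF sets_\<nu> refl])
  have tm: "tproj \<in> tower_measure \<rightarrow>\<^sub>M borel"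
    unfolding measurable_cong_sets[OF sT refl] by (rule tproj_meas)
  have "(\<integral>\<^sup>+x. v x \<partial>\<mu>) = inverse Rbar * (\<integral>\<^sup>+x. v x \<partial>distr tower_measure borel tproj)"
    unfolding lifted_measure_distr using v by (intro nn_integral_scale_measure) auto
  also have "(\<integral>\<^sup>+x. v x \<partial>distr tower_measure borel tproj) = (\<integral>\<^sup>+z. v (tproj z) \<partial>tower_measure)"
    by (subst nn_integral_distr) (use v tm in auto)
  also have "\<dots> = tint (\<lambda>z. v (tproj z))"
    by (rule nn_integral_tower_measure[OF measurable_compose[OF tproj_meas v]])
  finally show ?thesis by (simp add: avg_def)
qed

lemma prob_\<mu>: "prob_space \<mu>"
proof
  have "emeasure \<mu> (space \<mu>) = (\<integral>\<^sup>+x. 1 \<partial>\<mu>)" by simp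
  also have "\<dots> = 1" by (subst nn_integral_\<mu>) (auto simp: avg_const)
  finally show "emeasure \<mu> (space \<mu>) = 1" .
qed

text \<open>
  Orbits stay in the tower, and the projection intertwines the tower map with \<open>f\<close>. When the top of
  a column is left, \<open>f\<^sup>k\<^sup>+\<^sup>1 y\<close> is \<open>F y\<close>.
\<close>

lemma tower_orbit:
  assumes "y \<in> Y" "k < R y"
  shows "fst ((tmap ^^ n) (y, k)) \<in> Y \<and> snd ((tmap ^^ n) (y, k)) < R (fst ((tmap ^^ n) (y, k)))
    \<and> tproj ((tmap ^^ n) (y, k)) = (f ^^ n) (tproj (y, k))"
proof (induction n)
  case (Suc n)
  obtain x j where xj: "(tmap ^^ n) (y, k) = (x, j)" by fastforce
  have x: "x \<in> Y" "j < R x" "tproj (x, j) = (f ^^ n) (tproj (y, k))" using Suc by (auto simp: xj)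
  have step: "(tmap ^^ Suc n) (y, k) = tmap (x, j)" by (simp add: xj)
  show ?case
    unfolding step
  proof (cases "Suc j < R x")
    case True
    then show "fst (tmap (x, j)) \<in> Y \<and> snd (tmap (x, j)) < R (fst (tmap (x, j))) \<and> tproj (tmap (x, j)) = (f ^^ Suc n) (tproj (y, k))"
      using x by (simp add: tmap_def tproj_def)
  next
    case False
    then have "R x = Suc j" using x by simp
    then have "F x = f ((f ^^ j) x)" by (simp add: induced_map_def)
    moreover have "F x \<in> Y" by (rule F_Y[OF x(1)])
    moreover have "1 \<le> R (F x)" by (rule R_ge1) fact
    ultimately show "fst (tmap (x, j)) \<in> Y \<and> snd (tmap (x, j)) < R (fst (tmap (x, j))) \<and> tproj (tmap (x, j)) = (f ^^ Suc n) (tproj (y, k))"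
      using x False by (simp add: tmap_def tproj_def Suc_le_eq)
  qed
qed (use assms in simp)

section \<open>Mixing estimates on the tower\<close>

definition far :: "nat \<Rightarrow> 'a \<times> nat \<Rightarrow> ennreal" where "far lev z = indicator {lev<..} (snd z)"

text \<open>
  The estimate of the influence of the endpoint \<open>z\<close> on \<open>l\<close> earlier observations: \<open>\<kappa>\<close> between two
  points of level at most \<open>lev\<close>, and the trivial bound \<open>2 b\<close> for each of the points above \<open>lev\<close>,
  one of them being averaged.
\<close>

definition spread :: "nat \<Rightarrow> real \<Rightarrow> nat \<Rightarrow> 'a \<times> nat \<Rightarrow> ennreal" where
  "spread l \<kappa> lev z = ennreal (real l) * (ennreal \<kappa> + ennreal (2 * b) * far lev z + ennreal (2 * b) * avg (far lev))"

lemma b_nonneg: "0 \<le> b" using \<phi>_bound[of undefined] by linarith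

lemma far_meas[measurable]: "far lev \<in> borel_measurable \<Delta>"
  unfolding far_def[abs_def] by (rule measurable_compose[OF measurable_snd]) simp

lemma spread_meas[measurable]: "spread l \<kappa> lev \<in> borel_measurable \<Delta>"
  unfolding spread_def[abs_def] by measurable

lemma avg_spread: "avg (spread l \<kappa> lev) = ennreal (real l) * (ennreal \<kappa> + ennreal (4 * b) * avg (far lev))"
proof -
  have "avg (spread l \<kappa> lev) = ennreal (real l) * (avg (\<lambda>z. ennreal \<kappa>) + ennreal (2 * b) * avg (far lev) + avg (\<lambda>z. ennreal (2 * b) * avg (far lev)))"
    unfolding spread_def[abs_def]
    by (subst avg_cmult, measurable, subst avg_add, measurable, subst avg_add, measurable, subst avg_cmult, measurable)
  also have "\<dots> = ennreal (real l) * (ennreal \<kappa> + (ennreal (2 * b) + ennreal (2 * b)) * avg (far lev))"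
    unfolding avg_const by (simp only: distrib_right add.assoc)
  also have "ennreal (2 * b) + ennreal (2 * b) = ennreal (4 * b)"
    using b_nonneg by (simp add: ennreal_plus[symmetric] del: ennreal_plus)
  finally show ?thesis .
qed

lemma obs_meas_single:
  assumes "case_prod U \<in> borel_measurable (\<Delta> \<Otimes>\<^sub>M Pw)"
  shows "(\<lambda>z. \<integral>\<^sup>+\<omega>. U z \<omega> \<partial>measure_pmf (chain.obs N z)) \<in> borel_measurable \<Delta>"
proof -
  have "(\<lambda>z. (z, z)) \<in> \<Delta> \<rightarrow>\<^sub>M \<Delta> \<Otimes>\<^sub>M \<Delta>" by (intro measurable_Pair measurable_ident_sets refl)
  from measurable_compose[OF this obs_meas[OF assms, of N]] show ?thesis by simp
qed

text \<open>
  Compare \<open>V z\<close> with \<open>V z'\<close> for each \<open>z'\<close> and average over \<open>z'\<close>.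
\<close>

lemma path_functional_close:
  assumes lipH: "chain.lip N c H" and c: "\<And>j. 0 \<le> c j" "\<And>j. j < n \<Longrightarrow> c j = 0" and sum_c: "(\<Sum>j\<le>N. c j) = real l"
    and H: "H \<in> borel_measurable Pw" and cc: "\<And>\<omega>. (\<And>j. \<bar>\<omega> j\<bar> \<le> b) \<Longrightarrow> \<bar>H \<omega>\<bar> \<le> cc" and cc0: "0 \<le> cc"
    and cl: "\<And>y y' k k'. y \<in> G \<Longrightarrow> y' \<in> G \<Longrightarrow> k \<le> lev \<Longrightarrow> k' \<le> lev \<Longrightarrow> chain.close_all n (y, k) (y', k') \<kappa>"
    and \<kappa>: "0 \<le> \<kappa>"
  defines "V \<equiv> \<lambda>z. \<integral>\<^sup>+\<omega>. ennreal (H \<omega> + cc) \<partial>measure_pmf (chain.obs N z)"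
  shows "V \<in> borel_measurable \<Delta>"
    and "y \<in> G \<Longrightarrow> V (y, k) \<le> avg V + spread l \<kappa> lev (y, k)"
    and "y \<in> G \<Longrightarrow> avg V \<le> V (y, k) + spread l \<kappa> lev (y, k)"
proof -
  define E where "E z = (\<integral>\<omega>. H \<omega> \<partial>measure_pmf (chain.obs N z))" for z
  have bdd: "\<bar>H \<omega>\<bar> \<le> cc" if "\<omega> \<in> set_pmf (chain.obs N z)" for \<omega> z
    by (rule cc, rule chain.obs_bdd[OF that])
  have V: "V z = ennreal (E z + cc)" and Ecc: "0 \<le> E z + cc" for z
  proof -
    have i: "integrable (measure_pmf (chain.obs N z)) H" by (rule pmf_integrable_bdd[OF bdd])
    have "(\<integral>\<omega>. H \<omega> + cc \<partial>measure_pmf (chain.obs N z)) = E z + cc" using i by (simp add: E_def)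
    moreover have "V z = ennreal (\<integral>\<omega>. H \<omega> + cc \<partial>measure_pmf (chain.obs N z))"
      unfolding V_def
    proof (rule nn_integral_eq_integral)
      show "integrable (measure_pmf (chain.obs N z)) (\<lambda>\<omega>. H \<omega> + cc)" using i by simp
      show "AE \<omega> in measure_pmf (chain.obs N z). 0 \<le> H \<omega> + cc"
        unfolding AE_measure_pmf_iff using bdd[of _ z] by (metis abs_le_D2 add.commute diff_ge_0_iff_ge minus_diff_eq diff_minus_eq_add)
    qed
    ultimately show "V z = ennreal (E z + cc)" by simp
    have "\<bar>E z\<bar> \<le> cc" unfolding E_def by (rule pmf_integral_abs_le[OF bdd])
    then show "0 \<le> E z + cc" by linarith
  qed
  show Vm: "V \<in> borel_measurable \<Delta>"
    unfolding V_def
  proof (rule obs_meas_single)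
    show "(\<lambda>(z, \<omega>). ennreal (H \<omega> + cc)) \<in> borel_measurable (\<Delta> \<Otimes>\<^sub>M Pw)"
      unfolding case_prod_unfold using measurable_compose[OF measurable_snd H] by measurable
  qed
  have Ed: "E (y, k) \<le> E (y', k') + real l * (\<kappa> + 2 * b * indicator {lev<..} k + 2 * b * indicator {lev<..} k')"
    if y: "y \<in> G" "y' \<in> G" for y y' k k'
  proof -
    have "\<bar>E (y, k) - E (y', k')\<bar> \<le> real l * (\<kappa> + 2 * b * indicator {lev<..} k + 2 * b * indicator {lev<..} k')"
    proof (cases "k \<le> lev \<and> k' \<le> lev")
      case True
      then have "chain.close N n (y, k) (y', k') \<kappa>" using cl y by (simp add: chain.close_all_def)
      then have "\<bar>E (y, k) - E (y', k')\<bar> \<le> \<kappa> * (\<Sum>j\<le>N. c j)"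
        unfolding chain.close_def E_def using c lipH by blast
      then show ?thesis using True by (simp add: sum_c mult.commute)
    next
      case False
      have "\<bar>E (y, k) - E (y', k')\<bar> \<le> (2 * b) * (\<Sum>j\<le>N. c j)"
        using chain.close_trivial[of N n "(y, k)" "(y', k')"] unfolding chain.close_def E_def using c lipH by blast
      also have "\<dots> = real l * (2 * b)" by (simp add: sum_c)
      also have "\<dots> \<le> real l * (\<kappa> + 2 * b * indicator {lev<..} k + 2 * b * indicator {lev<..} k')"
        using False \<kappa> b_nonneg by (intro mult_left_mono) (auto split: split_indicator)
      finally show ?thesis .
    qed
    then show ?thesis by linarith
  qed
  have far_eq: "ennreal (2 * b) * far lev (y, k) = ennreal (2 * b * indicator {lev<..} k)" for y k
    by (simp add: far_def split: split_indicator)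
  have Vd: "V (y, k) \<le> V (y', k') + ennreal (real l) * (ennreal \<kappa> + ennreal (2 * b) * far lev (y, k) + ennreal (2 * b) * far lev (y', k'))"
    if y: "y \<in> G" "y' \<in> G" for y y' k k'
  proof -
    have "V (y, k) \<le> ennreal ((E (y', k') + cc) + real l * (\<kappa> + 2 * b * indicator {lev<..} k + 2 * b * indicator {lev<..} k'))"
      unfolding V using Ed[OF y, of k k'] by (intro ennreal_leI) linarith
    also have "\<dots> = V (y', k') + ennreal (real l) * (ennreal \<kappa> + ennreal (2 * b) * far lev (y, k) + ennreal (2 * b) * far lev (y', k'))"
      unfolding V far_eq using Ecc[of "(y', k')"] \<kappa> b_nonneg
      by (simp add: ennreal_plus ennreal_mult)
    finally show ?thesis .
  qed
  have avgV: "avg (\<lambda>z'. V z' + ennreal (real l) * (ennreal \<kappa> + ennreal (2 * b) * far lev (y, k) + ennreal (2 * b) * far lev z'))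
      = avg V + spread l \<kappa> lev (y, k)" for y k
    unfolding spread_def using Vm
    by (subst avg_add, measurable, subst avg_cmult, measurable, subst avg_add, measurable, subst avg_cmult, measurable) (simp add: avg_const)
  show "V (y, k) \<le> avg V + spread l \<kappa> lev (y, k)" if "y \<in> G"
  proof -
    have "V (y, k) = avg (\<lambda>_. V (y, k))" by (simp add: avg_const)
    also have "\<dots> \<le> avg (\<lambda>z'. V z' + ennreal (real l) * (ennreal \<kappa> + ennreal (2 * b) * far lev (y, k) + ennreal (2 * b) * far lev z'))"
      by (rule avg_mono) (rule Vd[OF that])
    finally show ?thesis unfolding avgV .
  qed
  show "avg V \<le> V (y, k) + spread l \<kappa> lev (y, k)" if "y \<in> G"
  proof -
    have "avg V \<le> avg (\<lambda>z'. V (y, k) + ennreal (real l) * (ennreal \<kappa> + ennreal (2 * b) * far lev z' + ennreal (2 * b) * far lev (y, k)))"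
      by (rule avg_mono) (rule Vd[OF _ that])
    also have "\<dots> = V (y, k) + ennreal (real l) * (ennreal \<kappa> + ennreal (2 * b) * avg (far lev) + ennreal (2 * b) * far lev (y, k))"
      by (subst avg_add, measurable, subst avg_cmult, measurable, subst avg_add, measurable, subst avg_add, measurable, subst avg_cmult, measurable) (simp add: avg_const)
    also have "\<dots> = V (y, k) + spread l \<kappa> lev (y, k)" by (simp add: spread_def add_ac)
    finally show ?thesis .
  qed
qed

lemma funpow_f_meas[measurable]: "(f ^^ k) \<in> borel \<rightarrow>\<^sub>M borel"
  by (induction k) (use f_meas in \<open>auto intro: measurable_comp\<close>)

lemma obs_process_meas: "(\<phi> \<circ> (f ^^ j)) \<in> borel_measurable borel"
  using measurable_comp[OF funpow_f_meas \<phi>_meas] .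

text \<open>
  The future after time \<open>N\<close> is a function of the point reached at time \<open>N\<close>.
\<close>

lemma generated_algebra_preimage:
  assumes "A \<in> sets (generated_algebra \<mu> (\<lambda>j. \<phi> \<circ> (f ^^ j)) {N..})"
  shows "\<exists>A'\<in>sets borel. A = (f ^^ N) -` A'"
proof -
  let ?S = "{(\<phi> \<circ> (f ^^ j)) -` B \<inter> space \<mu> | j B. j \<in> {N..} \<and> B \<in> sets borel}"
  have "A \<in> sigma_sets UNIV ?S"
    using assms unfolding generated_algebra_def space_\<mu> by (subst (asm) sets_measure_of) auto
  then show ?thesis
  proof induction
    case (Basic A)
    then obtain j B where jB: "N \<le> j" "B \<in> sets borel" "A = (\<phi> \<circ> (f ^^ j)) -` B" by (auto simp: space_\<mu>)
    have "(f ^^ j) x = (f ^^ (j - N)) ((f ^^ N) x)" for x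
      using jB(1) funpow_add[of "j - N" N f] by simp
    then have "A = (f ^^ N) -` ((\<phi> \<circ> (f ^^ (j - N))) -` B)" using jB by auto
    moreover have "(\<phi> \<circ> (f ^^ (j - N))) -` B \<in> sets borel"
      using measurable_sets[OF obs_process_meas jB(2), of "j - N"] by simp
    ultimately show ?case by blast
  next
    case Empty
    then show ?case by (intro bexI[of _ "{}"]) auto
  next
    case (Compl A)
    then obtain A' where "A' \<in> sets borel" "A = (f ^^ N) -` A'" by blast
    then show ?case by (intro bexI[of _ "- A'"]) auto
  next
    case (Union A)
    then have "\<forall>i. \<exists>A'. A' \<in> sets borel \<and> A i = (f ^^ N) -` A'" by blast
    then obtain A' where "\<forall>i. A' i \<in> sets borel \<and> A i = (f ^^ N) -` A' i" by (rule choice[THEN exE])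
    then show ?case by (intro bexI[of _ "\<Union>i. A' i"]) auto
  qed
qed

lemma subalgebra_generated: "subalgebra \<mu> (generated_algebra \<mu> (\<lambda>j. \<phi> \<circ> (f ^^ j)) S)"
proof -
  have "sigma_sets (space \<mu>) {(\<phi> \<circ> (f ^^ j)) -` B \<inter> space \<mu> | j B. j \<in> S \<and> B \<in> sets borel} \<subseteq> sets \<mu>"
  proof (rule sets.sigma_sets_subset, safe)
    fix j and B :: "real set" assume "B \<in> sets borel"
    then show "(\<phi> \<circ> (f ^^ j)) -` B \<inter> space \<mu> \<in> sets \<mu>"
      using measurable_sets[OF obs_process_meas, of B j] by (simp add: sets_\<mu> space_\<mu>)
  qed
  then show ?thesis
    by (simp add: subalgebra_def generated_algebra_def space_\<mu>)
qed

text \<open>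
  An event of the future and a functional of the past, which is listed backwards from time \<open>N\<close>:
  given the position on the tower at time \<open>N\<close>, the event is decided and the functional is averaged
  over the backward chain.
\<close>

lemma nn_integral_past_future:
  assumes A': "A' \<in> sets borel" and H: "H \<in> borel_measurable Pw"
  shows "(\<integral>\<^sup>+x. indicator ((f ^^ N) -` A') x * ennreal (H (\<lambda>j. \<phi> ((f ^^ (N - j)) x)) + cc) \<partial>\<mu>)
    = avg (\<lambda>z. indicator A' (tproj z) * (\<integral>\<^sup>+\<omega>. ennreal (H \<omega> + cc) \<partial>measure_pmf (chain.obs N z)))"
proof -
  have tr: "(\<lambda>x. (\<lambda>j. \<phi> ((f ^^ (N - j)) x))) \<in> borel \<rightarrow>\<^sub>M Pw"
    using obs_process_meas by (intro Pw_measurableI) (simp add: o_def)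
  have vm: "(\<lambda>x. indicator ((f ^^ N) -` A') x * ennreal (H (\<lambda>j. \<phi> ((f ^^ (N - j)) x)) + cc)) \<in> borel_measurable borel"
    using measurable_compose[OF tr H] measurable_sets[OF funpow_f_meas A', of N]
    by (intro borel_measurable_times_ennreal) auto
  have Hs: "(\<lambda>q. H (snd q)) \<in> borel_measurable (\<Delta> \<Otimes>\<^sub>M Pw)" by (rule measurable_compose[OF measurable_snd H])
  have ind: "(\<lambda>q. indicator A' (tproj (fst q)) :: ennreal) \<in> borel_measurable (\<Delta> \<Otimes>\<^sub>M Pw)"
    by (rule measurable_compose[OF measurable_compose[OF measurable_fst tproj_meas] borel_measurable_indicator[OF A']])
  have U: "case_prod (\<lambda>z \<omega>. indicator A' (tproj z) * ennreal (H \<omega> + cc)) \<in> borel_measurable (\<Delta> \<Otimes>\<^sub>M Pw)"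
    unfolding case_prod_unfold using Hs ind by measurable
  have "(\<integral>\<^sup>+x. indicator ((f ^^ N) -` A') x * ennreal (H (\<lambda>j. \<phi> ((f ^^ (N - j)) x)) + cc) \<partial>\<mu>)
    = avg (\<lambda>w. indicator ((f ^^ N) -` A') (tproj w) * ennreal (H (\<lambda>j. \<phi> ((f ^^ (N - j)) (tproj w))) + cc))"
    by (rule nn_integral_\<mu>[OF vm])
  also have "\<dots> = avg (\<lambda>w. indicator A' (tproj ((tmap ^^ N) w)) * ennreal (H (\<lambda>j. \<Phi> ((tmap ^^ (N - j)) w)) + cc))"
  proof (rule avg_cong)
    fix y k assume "y \<in> Y" "k < R y"
    then have o: "tproj ((tmap ^^ n) (y, k)) = (f ^^ n) (tproj (y, k))" for n using tower_orbit by blast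
    have \<Phi>: "\<Phi> z = \<phi> (tproj z)" for z by (simp add: \<Phi>_def tproj_def)
    show "indicator ((f ^^ N) -` A') (tproj (y, k)) * ennreal (H (\<lambda>j. \<phi> ((f ^^ (N - j)) (tproj (y, k)))) + cc)
      = indicator A' (tproj ((tmap ^^ N) (y, k))) * ennreal (H (\<lambda>j. \<Phi> ((tmap ^^ (N - j)) (y, k))) + cc)"
      unfolding \<Phi> o by (simp add: indicator_def)
  qed
  also have "\<dots> = avg (\<lambda>z. \<integral>\<^sup>+\<omega>. indicator A' (tproj z) * ennreal (H \<omega> + cc) \<partial>measure_pmf (chain.obs N z))"
    unfolding avg_def path_duality[OF U] ..
  also have "\<dots> = avg (\<lambda>z. indicator A' (tproj z) * (\<integral>\<^sup>+\<omega>. ennreal (H \<omega> + cc) \<partial>measure_pmf (chain.obs N z)))"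
    by (intro arg_cong[where f = avg] ext nn_integral_cmult) simp
  finally show ?thesis .
qed

text \<open>
  The set function \<open>\<Lambda> A\<close> is the mean of \<open>spread\<close> at time \<open>N\<close> over the event \<open>A\<close>. The coordinate
  \<open>X (i r)\<close> of the vector is the backward observation number \<open>N - i r \<ge> n\<close>, so a Lipschitz
  function of the vector is a functional of the backward path with weights \<open>c\<close> that vanish before
  \<open>n\<close> and have sum \<open>l\<close>.
\<close>

theorem tower_tau_bound:
  assumes i: "strict_mono_on {1..l} i" and l: "1 \<le> l" and \<kappa>: "0 \<le> \<kappa>"
    and cl: "\<And>y y' k k'. y \<in> G \<Longrightarrow> y' \<in> G \<Longrightarrow> k \<le> lev \<Longrightarrow> k' \<le> lev \<Longrightarrow> chain.close_all n (y, k) (y', k') \<kappa>"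
  defines "X \<equiv> \<lambda>j. \<phi> \<circ> (f ^^ j)"
  shows "tau \<mu> (generated_algebra \<mu> X {i l + n..}) l (\<lambda>x. \<lambda>r\<in>{1..l}. X (i r) x)
    \<le> ennreal (real l) * (ennreal \<kappa> + ennreal (4 * b) * avg (far lev))"
proof -
  define N where "N = i l + n"
  define Z where "Z = (\<lambda>x. \<lambda>r\<in>{1..l}. X (i r) x)"
  define \<Lambda> where "\<Lambda> A = avg (\<lambda>w. indicator A (tproj w) * spread l \<kappa> lev ((tmap ^^ N) w))" for A
  \<comment> \<open>the number of coordinates of the vector observed at backward time \<open>j\<close>\<close>
  define c where "c j = (\<Sum>r=1..l. of_bool (N - i r = j) :: real)" for j
  have ir: "i r \<le> i l" if "r \<in> {1..l}" for r
    using strict_mono_on_leD[OF i that, of l] that l by auto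
  have c0: "0 \<le> c j" for j by (simp add: c_def sum_nonneg)
  have cn: "c j = 0" if "j < n" for j
    unfolding c_def by (rule sum.neutral) (use ir that in \<open>fastforce simp: N_def\<close>)
  have pick: "(\<Sum>j\<le>N. of_bool (N - i r = j) * v j) = (v (N - i r) :: real)" for r v
  proof -
    have "(\<Sum>j\<le>N. of_bool (N - i r = j) * v j) = (\<Sum>j\<le>N. if j = N - i r then v j else 0)"
      by (intro sum.cong) auto
    then show ?thesis by simp
  qed
  have cs: "(\<Sum>j\<le>N. c j * v j) = (\<Sum>r=1..l. v (N - i r))" for v
    unfolding c_def sum_distrib_right by (subst sum.swap) (simp add: pick)
  have sum_c: "(\<Sum>j\<le>N. c j) = real l" using cs[of "\<lambda>_. 1"] by simp
  interpret prob_space \<mu> by (rule prob_\<mu>)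
  have Xm: "X j \<in> borel_measurable \<mu>" for j
    unfolding X_def measurable_cong_sets[OF sets_\<mu> refl] by (rule obs_process_meas)
  have Zm: "Z \<in> \<mu> \<rightarrow>\<^sub>M real_vectors l"
    unfolding Z_def real_vectors_def by (intro measurable_restrict Xm)
  have tpm: "(\<lambda>w. (tmap ^^ N) w) \<in> \<Delta> \<rightarrow>\<^sub>M \<Delta>"
    by (induction N) (auto intro: measurable_compose[OF _ tmap_meas])
  have "tau \<mu> (generated_algebra \<mu> X {N..}) l Z \<le> \<Lambda> (space \<mu>)"
  proof (rule tau_le_superadditive)
    show "prob_space \<mu>" by (rule prob_\<mu>)
    show "subalgebra \<mu> (generated_algebra \<mu> X {N..})" unfolding X_def by (rule subalgebra_generated)
    show "Z \<in> \<mu> \<rightarrow>\<^sub>M real_vectors l" by (rule Zm)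
    show "\<bar>Z x r\<bar> \<le> b" if "r \<in> {1..l}" for x r using that by (simp add: Z_def X_def \<phi>_bound)
    have GB: "A \<in> sets borel" if "A \<in> sets (generated_algebra \<mu> X {N..})" for A
      using that subalgebra_generated[of "{N..}"] by (auto simp: subalgebra_def X_def sets_\<mu>)
    show "\<Lambda> A + \<Lambda> A' \<le> \<Lambda> (A \<union> A')"
      if A: "A \<in> sets (generated_algebra \<mu> X {N..})" "A' \<in> sets (generated_algebra \<mu> X {N..})" "A \<inter> A' = {}" for A A'
    proof -
      have m: "(\<lambda>w. indicator A (tproj w) * spread l \<kappa> lev ((tmap ^^ N) w)) \<in> borel_measurable \<Delta>"
        if "A \<in> sets (generated_algebra \<mu> X {N..})" for A
        by (intro borel_measurable_times_ennreal measurable_compose[OF tpm spread_meas]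
            measurable_compose[OF tproj_meas borel_measurable_indicator[OF GB[OF that]]])
      show ?thesis
        unfolding \<Lambda>_def avg_add[OF m[OF A(1)] m[OF A(2)], symmetric]
        by (rule avg_mono) (use A(3) in \<open>auto split: split_indicator\<close>)
    qed
    fix A g assume A: "A \<in> sets (generated_algebra \<mu> X {N..})" and g: "g \<in> lipschitz_l1 l"
    obtain A' where A': "A' \<in> sets borel" "A = (f ^^ N) -` A'"
      using generated_algebra_preimage[of A N] A unfolding X_def by blast
    define H where "H \<omega> = g (\<lambda>r\<in>{1..l}. \<omega> (N - i r))" for \<omega> :: "nat \<Rightarrow> real"
    have lipH: "chain.lip N c H"
      unfolding chain.lip_def
    proof (intro allI)
      fix \<omega> \<omega>' :: "nat \<Rightarrow> real"
      have "(\<lambda>r\<in>{1..l}. \<rho> (N - i r)) \<in> space (real_vectors l)" for \<rho> :: "nat \<Rightarrow> real"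
        by (auto simp: real_vectors_def space_PiM)
      then have "\<bar>H \<omega> - H \<omega>'\<bar> \<le> (\<Sum>r=1..l. \<bar>(\<lambda>r\<in>{1..l}. \<omega> (N - i r)) r - (\<lambda>r\<in>{1..l}. \<omega>' (N - i r)) r\<bar>)"
        using g unfolding lipschitz_l1_def H_def by blast
      also have "\<dots> = (\<Sum>r=1..l. \<bar>\<omega> (N - i r) - \<omega>' (N - i r)\<bar>)" by (intro sum.cong) auto
      finally show "\<bar>H \<omega> - H \<omega>'\<bar> \<le> (\<Sum>j\<le>N. c j * \<bar>\<omega> j - \<omega>' j\<bar>)" unfolding cs .
    qed
    define cc where "cc = \<bar>H (\<lambda>_. 0)\<bar> + real l * b"
    have cc0: "0 \<le> cc" using b_nonneg by (simp add: cc_def)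
    have cc: "\<bar>H \<omega>\<bar> \<le> cc" if "\<And>j. \<bar>\<omega> j\<bar> \<le> b" for \<omega>
      using chain.lip_bdd[OF lipH c0 that] by (simp add: cc_def sum_c)
    have Hm: "H \<in> borel_measurable Pw"
    proof -
      have "(\<lambda>\<omega>. \<lambda>r\<in>{1..l}. \<omega> (N - i r)) \<in> Pw \<rightarrow>\<^sub>M real_vectors l"
        unfolding real_vectors_def by (intro measurable_restrict Pw_component)
      from measurable_compose[OF this lipschitz_l1_measurable[OF g]] show ?thesis by (simp add: H_def[abs_def])
    qed
    define V where "V z = (\<integral>\<^sup>+\<omega>. ennreal (H \<omega> + cc) \<partial>measure_pmf (chain.obs N z))" for z
    note V = path_functional_close[where lev = lev and \<kappa> = \<kappa>, OF lipH c0 cn sum_c Hm cc cc0 cl \<kappa>, folded V_def]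
    have Vm: "V \<in> borel_measurable \<Delta>"
      unfolding V_def[abs_def] by (rule path_functional_close(1)[OF lipH c0 cn sum_c Hm cc cc0 cl \<kappa>])
    have gZ: "g (Z x) = H (\<lambda>j. \<phi> ((f ^^ (N - j)) x))" for x
    proof -
      have "N - (N - i r) = i r" if "r \<in> {1..l}" for r using ir[OF that] by (simp add: N_def)
      then have "Z x = (\<lambda>r\<in>{1..l}. \<phi> ((f ^^ (N - (N - i r))) x))"
        unfolding Z_def X_def by (intro restrict_ext) simp
      then show ?thesis by (simp add: H_def)
    qed
    have gZm: "(\<lambda>x. g (Z x)) \<in> borel_measurable \<mu>"
      by (rule measurable_compose[OF Zm lipschitz_l1_measurable[OF g]])
    have gb: "\<bar>g (Z x)\<bar> \<le> cc" for x unfolding gZ by (rule cc) (rule \<phi>_bound)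
    have gi: "integrable \<mu> (\<lambda>x. g (Z x))"
      by (rule integrable_const_bound[where B = cc]) (use gb gZm in auto)
    have As: "A \<in> sets \<mu>" using GB[OF A] by (simp add: sets_\<mu>)
    define P where "P = (\<integral>y. g (Z y) \<partial>\<mu>)"
    define I where "I = (\<integral>x. indicator A x * (g (Z x) + cc) \<partial>\<mu>)"
    define I' where "I' = (\<integral>x. indicator A x * (P + cc) \<partial>\<mu>)"
    have g0: "0 \<le> g (Z x) + cc" for x using gb[of x] by linarith
    have P0: "0 \<le> P + cc"
    proof -
      have "P + cc = (\<integral>x. g (Z x) + cc \<partial>\<mu>)" using gi by (simp add: P_def prob_space)
      then show ?thesis using g0 by (simp add: integral_nonneg_AE)
    qed
    have i1: "integrable \<mu> (\<lambda>x. indicator A x * (g (Z x) + cc))"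
      using integrable_mult_indicator[OF As, of "\<lambda>x. g (Z x) + cc"] gi by simp
    have i2: "integrable \<mu> (\<lambda>x. indicator A x * (P + cc))"
      using integrable_mult_indicator[OF As, of "\<lambda>x. P + cc"] by simp
    have PV: "ennreal (P + cc) = avg V"
    proof -
      have "ennreal (P + cc) = (\<integral>\<^sup>+x. ennreal (g (Z x) + cc) \<partial>\<mu>)"
        by (subst nn_integral_eq_integral) (use gi g0 in \<open>auto simp: P_def prob_space\<close>)
      also have "\<dots> = avg V"
        using nn_integral_past_future[of UNIV H N cc] Hm by (simp add: gZ V_def[abs_def])
      finally show ?thesis .
    qed
    have eI: "ennreal I = avg (\<lambda>z. indicator A' (tproj z) * V z)"
    proof -
      have "ennreal I = (\<integral>\<^sup>+x. ennreal (indicator A x * (g (Z x) + cc)) \<partial>\<mu>)"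
        unfolding I_def by (rule nn_integral_eq_integral[symmetric, OF i1]) (use g0 in auto)
      also have "\<dots> = (\<integral>\<^sup>+x. indicator ((f ^^ N) -` A') x * ennreal (H (\<lambda>j. \<phi> ((f ^^ (N - j)) x)) + cc) \<partial>\<mu>)"
        unfolding gZ A'(2) by (intro nn_integral_cong) (simp split: split_indicator)
      finally show ?thesis unfolding nn_integral_past_future[OF A'(1) Hm] V_def .
    qed
    have iA': "(\<lambda>z. indicator A' (tproj z) :: ennreal) \<in> borel_measurable \<Delta>"
      by (rule measurable_compose[OF tproj_meas borel_measurable_indicator[OF A'(1)]])
    have inv: "avg (\<lambda>w. U ((tmap ^^ N) w)) = avg U" if "U \<in> borel_measurable \<Delta>" for U
      by (rule avg_invariant[OF that])
    have iA: "indicator A (tproj (y, k)) = (indicator A' (tproj ((tmap ^^ N) (y, k))) :: ennreal)"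
      if "y \<in> Y" "k < R y" for y k
      using tower_orbit[OF that, of N] by (simp add: A'(2) indicator_def)
    have eI': "ennreal I' = avg (\<lambda>z. indicator A' (tproj z) * avg V)"
    proof -
      have "ennreal I' = (\<integral>\<^sup>+x. ennreal (indicator A x * (P + cc)) \<partial>\<mu>)"
        unfolding I'_def by (rule nn_integral_eq_integral[symmetric, OF i2]) (use P0 in auto)
      also have "\<dots> = (\<integral>\<^sup>+x. indicator A x * avg V \<partial>\<mu>)"
        unfolding PV[symmetric] by (intro nn_integral_cong) (simp split: split_indicator)
      also have "\<dots> = avg (\<lambda>w. indicator A (tproj w) * avg V)"
        by (rule nn_integral_\<mu>) (use GB[OF A] in auto)
      also have "\<dots> = avg (\<lambda>w. indicator A' (tproj ((tmap ^^ N) w)) * avg V)"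
        by (rule avg_cong) (simp add: iA)
      also have "\<dots> = avg (\<lambda>z. indicator A' (tproj z) * avg V)"
        by (rule inv) (use iA' in measurable)
      finally show ?thesis .
    qed
    have e\<Lambda>: "\<Lambda> A = avg (\<lambda>z. indicator A' (tproj z) * spread l \<kappa> lev z)"
    proof -
      have "\<Lambda> A = avg (\<lambda>w. indicator A' (tproj ((tmap ^^ N) w)) * spread l \<kappa> lev ((tmap ^^ N) w))"
        unfolding \<Lambda>_def by (rule avg_cong) (simp add: iA)
      also have "\<dots> = avg (\<lambda>z. indicator A' (tproj z) * spread l \<kappa> lev z)"
        by (rule inv) (use iA' in measurable)
      finally show ?thesis .
    qed
    \<comment> \<open>\<open>I\<close> and \<open>I'\<close> are the integrals of \<open>g(Z) + cc\<close> and of its mean over \<open>A\<close>, both written as averages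
      over the tower\<close>
    have "ennreal I \<le> ennreal I' + \<Lambda> A"
    proof -
      have "ennreal I \<le> avg (\<lambda>z. indicator A' (tproj z) * avg V + indicator A' (tproj z) * spread l \<kappa> lev z)"
        unfolding eI distrib_left[symmetric] by (intro avg_mono mult_left_mono V(2)) auto
      also have "\<dots> = ennreal I' + \<Lambda> A" unfolding eI' e\<Lambda> by (rule avg_add) (use iA' in measurable)
      finally show ?thesis .
    qed
    moreover have "ennreal I' \<le> ennreal I + \<Lambda> A"
    proof -
      have "ennreal I' \<le> avg (\<lambda>z. indicator A' (tproj z) * V z + indicator A' (tproj z) * spread l \<kappa> lev z)"
        unfolding eI' distrib_left[symmetric] by (intro avg_mono mult_left_mono V(3)) auto
      also have "\<dots> = ennreal I + \<Lambda> A" unfolding eI e\<Lambda> by (rule avg_add) (use iA' Vm in measurable)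
      finally show ?thesis .
    qed
    ultimately have "ennreal \<bar>I - I'\<bar> \<le> \<Lambda> A"
      by (intro ennreal_abs_diff_le) (use g0 P0 in \<open>auto simp: I_def I'_def intro!: integral_nonneg_AE\<close>)
    moreover have "I - I' = (\<integral>x. indicator A x * (g (Z x) - P) \<partial>\<mu>)"
      unfolding I_def I'_def by (subst Bochner_Integration.integral_diff[OF i1 i2, symmetric]) (simp add: algebra_simps)
    ultimately show "ennreal \<bar>\<integral>x. indicator A x * (g (Z x) - (\<integral>y. g (Z y) \<partial>\<mu>)) \<partial>\<mu>\<bar> \<le> \<Lambda> A"
      by (simp add: P_def)
  qed
  also have "\<Lambda> (space \<mu>) = avg (\<lambda>w. spread l \<kappa> lev ((tmap ^^ N) w))"
    by (simp add: \<Lambda>_def space_\<mu>)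
  also have "\<dots> = avg (spread l \<kappa> lev)" by (rule avg_invariant) measurable
  finally show ?thesis unfolding avg_spread N_def Z_def .
qed

text \<open>
  Before normalisation, the tower above level \<open>lev\<close> has mass \<open>\<Sum>k>lev. \<nu>(R > k)\<close>, and \<open>hmax\<close> bounds
  the density of \<open>\<nu>\<close>.
\<close>

lemma avg_far_le:
  "avg (far lev) \<le> inverse Rbar * ennreal (hmax * (\<Sum>i. measure m {y \<in> Y. i + lev < R y}))"
proof -
  interpret fm: finite_measure m by (rule finite_m)
  have Rn: "{x \<in> Y. n < R x} \<in> sets m" for n
    using measurable_sets[OF R_meas, of "{n<..}"] by (simp add: space_mY vimage_def Int_def conj_commute)
  have sm: "summable (\<lambda>i. measure m {y \<in> Y. i + Suc lev < R y})"
    using summable_ignore_initial_segment[OF R_tail_summable, of "Suc lev"] .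
  have sm0: "summable (\<lambda>i. measure m {y \<in> Y. i + lev < R y})"
    using summable_ignore_initial_segment[OF R_tail_summable, of lev] .
  have "tint (far lev) \<le> (\<integral>\<^sup>+y. (\<Sum>i. indicator {x \<in> Y. i + lev < R x} y) \<partial>\<nu>)"
    unfolding tint_def
  proof (intro nn_integral_mono)
    fix y assume "y \<in> space \<nu>"
    then have y: "y \<in> Y" by (simp add: space_\<nu>)
    have "(\<Sum>k<R y. far lev (y, k)) = (\<Sum>k\<in>{lev<..<R y}. 1 :: ennreal)"
      by (rule sum.mono_neutral_cong_right) (auto simp: far_def)
    also have "\<dots> \<le> of_nat (R y - lev)" by (simp del: of_nat_diff)
    also have "\<dots> = (\<Sum>i<R y - lev. indicator {x \<in> Y. i + lev < R x} y)"
      using y by (simp add: less_diff_conv)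
    also have "\<dots> \<le> (\<Sum>i. indicator {x \<in> Y. i + lev < R x} y)" by (rule sum_le_suminf) auto
    finally show "(\<Sum>k<R y. far lev (y, k)) \<le> (\<Sum>i. indicator {x \<in> Y. i + lev < R x} y)" .
  qed
  also have "\<dots> = (\<Sum>i. \<integral>\<^sup>+y. indicator {x \<in> Y. i + lev < R x} y \<partial>\<nu>)"
    using Rn by (intro nn_integral_suminf) (simp add: measurable_cong_sets[OF sets_\<nu> refl])
  also have "\<dots> \<le> (\<Sum>i. ennreal (hmax * measure m {x \<in> Y. i + lev < R x}))"
  proof (intro suminf_le)
    fix i
    have "(\<integral>\<^sup>+y. indicator {x \<in> Y. i + lev < R x} y \<partial>\<nu>) = (\<integral>\<^sup>+x. ennreal (h x) * indicator {x \<in> Y. i + lev < R x} x \<partial>m)"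
      by (subst \<nu>_eq, subst nn_integral_density) (use h_meas Rn in auto)
    also have "\<dots> \<le> (\<integral>\<^sup>+x. ennreal hmax * indicator {x \<in> Y. i + lev < R x} x \<partial>m)"
      by (rule nn_integral_mono_AE) (use G_AE hmax in \<open>auto elim!: eventually_mono intro!: mult_right_mono ennreal_leI\<close>)
    also have "\<dots> = ennreal (hmax * measure m {x \<in> Y. i + lev < R x})"
      using hmax_pos Rn by (simp add: nn_integral_cmult_indicator fm.emeasure_eq_measure ennreal_mult)
    finally show "(\<integral>\<^sup>+y. indicator {x \<in> Y. i + lev < R x} y \<partial>\<nu>) \<le> ennreal (hmax * measure m {x \<in> Y. i + lev < R x})" .
  qed auto
  also have "\<dots> = ennreal (\<Sum>i. hmax * measure m {x \<in> Y. i + lev < R x})"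
    using hmax_pos by (intro suminf_ennreal2 summable_mult sm0) auto
  also have "(\<Sum>i. hmax * measure m {x \<in> Y. i + lev < R x}) = hmax * (\<Sum>i. measure m {x \<in> Y. i + lev < R x})"
    by (rule suminf_mult[OF sm0])
  finally show ?thesis unfolding avg_def by (rule mult_left_mono) simp
qed

section \<open>The rate of mixing\<close>

lemma tau_coeff_le:
  assumes "0 \<le> \<kappa>" "\<And>y y' k k'. y \<in> G \<Longrightarrow> y' \<in> G \<Longrightarrow> k \<le> lev \<Longrightarrow> k' \<le> lev \<Longrightarrow> chain.close_all n (y, k) (y', k') \<kappa>"
  shows "tau_coeff \<mu> (\<lambda>j. \<phi> \<circ> (f ^^ j)) n \<le> ennreal \<kappa> + ennreal (4 * b) * avg (far lev)"
  unfolding tau_coeff_def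
proof (rule SUP_least)
  fix l :: nat assume "l \<in> {1..}"
  then have l: "1 \<le> l" by simp
  let ?W = "ennreal \<kappa> + ennreal (4 * b) * avg (far lev)"
  have "(SUP i \<in> {i :: nat \<Rightarrow> nat. 1 \<le> i 1 \<and> strict_mono_on {1..l} i}.
      tau \<mu> (generated_algebra \<mu> (\<lambda>j. \<phi> \<circ> (f ^^ j)) {i l + n..}) l (\<lambda>x. \<lambda>r\<in>{1..l}. (\<phi> \<circ> (f ^^ i r)) x))
     \<le> ennreal (real l) * ?W"
  proof (rule SUP_least)
    fix i :: "nat \<Rightarrow> nat" assume "i \<in> {i. 1 \<le> i 1 \<and> strict_mono_on {1..l} i}"
    then have "strict_mono_on {1..l} i" by simp
    from tower_tau_bound[OF this l assms]
    show "tau \<mu> (generated_algebra \<mu> (\<lambda>j. \<phi> \<circ> (f ^^ j)) {i l + n..}) l (\<lambda>x. \<lambda>r\<in>{1..l}. (\<phi> \<circ> (f ^^ i r)) x)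
      \<le> ennreal (real l) * ?W" .
  qed
  then have "ennreal (1 / real l) * (SUP i \<in> {i :: nat \<Rightarrow> nat. 1 \<le> i 1 \<and> strict_mono_on {1..l} i}.
      tau \<mu> (generated_algebra \<mu> (\<lambda>j. \<phi> \<circ> (f ^^ j)) {i l + n..}) l (\<lambda>x. \<lambda>r\<in>{1..l}. (\<phi> \<circ> (f ^^ i r)) x))
     \<le> ennreal (1 / real l) * (ennreal (real l) * ?W)" by (intro mult_left_mono) auto
  also have "\<dots> = ?W"
  proof -
    have "ennreal (1 / real l) * ennreal (real l) = 1" using l by (subst ennreal_mult[symmetric]) auto
    then show ?thesis by (simp only: mult.assoc[symmetric] mult_1)
  qed
  finally show "ennreal (1 / real l) * (SUP i \<in> {i :: nat \<Rightarrow> nat. 1 \<le> i 1 \<and> strict_mono_on {1..l} i}.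
      tau \<mu> (generated_algebra \<mu> (\<lambda>j. \<phi> \<circ> (f ^^ j)) {i l + n..}) l (\<lambda>x. \<lambda>r\<in>{1..l}. (\<phi> \<circ> (f ^^ i r)) x)) \<le> ?W" .
qed

text \<open>
  The trivial estimate \<open>2 b\<close> for any two starting points.
\<close>

lemma tau_coeff_finite: "tau_coeff \<mu> (\<lambda>j. \<phi> \<circ> (f ^^ j)) n < \<infinity>"
proof -
  have "chain.close_all n z z' (2 * b)" for z z' by (simp add: chain.close_all_def chain.close_trivial)
  then have "tau_coeff \<mu> (\<lambda>j. \<phi> \<circ> (f ^^ j)) n \<le> ennreal (2 * b) + ennreal (4 * b) * avg (far 0)"
    using b_nonneg by (intro tau_coeff_le) auto
  also have "avg (far 0) \<le> avg (\<lambda>_. 1)" by (rule avg_mono) (simp add: far_def split: split_indicator)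
  then have "ennreal (2 * b) + ennreal (4 * b) * avg (far 0) \<le> ennreal (2 * b) + ennreal (4 * b) * 1"
    unfolding avg_const by (intro add_left_mono mult_left_mono) auto
  also have "\<dots> < \<infinity>" by simp
  finally show ?thesis .
qed

text \<open>
  The coupling bound holds for two points of level at most \<open>k\<close> after \<open>k + k\<close> steps, with error of
  order \<open>\<Psi> k\<close>, and the points above level \<open>k\<close> have mass of the same order. Taking \<open>k = n div 2\<close>
  and using the regularity of \<open>\<Psi>\<close> gives the order \<open>\<Psi> n\<close>.
\<close>

theorem tau_coeff_rate:
  assumes \<sigma>: "slowly_varying \<sigma>" and K1: "0 \<le> K1"
    and tail: "\<And>n. 1 \<le> n \<Longrightarrow> (\<Sum>i. measure m {y \<in> Y. i + n < R y}) \<le> K1 * (real n powr q * \<sigma> (real n))"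
  shows "\<exists>C. \<forall>n\<ge>2. tau_coeff \<mu> (\<lambda>j. \<phi> \<circ> (f ^^ j)) n \<le> ennreal (C * (real n powr q * \<sigma> (real n)))"
proof -
  define w where "w n = real n powr q * \<sigma> (real n)" for n
  obtain \<Psi> \<gamma> K2 where \<Psi>: "0 < \<gamma>" "\<And>n. 1 \<le> n \<Longrightarrow> 0 < \<Psi> n"
    "\<And>m n. 1 \<le> m \<Longrightarrow> m \<le> n \<Longrightarrow> \<Psi> m \<le> (real n / real m) powr \<gamma> * \<Psi> n"
    "\<And>n. 1 \<le> n \<Longrightarrow> w n \<le> \<Psi> n" "\<And>n. 1 \<le> n \<Longrightarrow> \<Psi> n \<le> K2 * w n"
  proof (rule regular_majorant[OF \<sigma>, of q])
    fix \<Psi> \<gamma> K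
    assume a: "0 < \<gamma>" "\<And>n. 1 \<le> n \<Longrightarrow> 0 < \<Psi> n"
      "\<And>m n. 1 \<le> m \<Longrightarrow> m \<le> n \<Longrightarrow> \<Psi> m \<le> (real n / real m) powr \<gamma> * \<Psi> n"
      "\<And>n. 1 \<le> n \<Longrightarrow> real n powr q * \<sigma> (real n) \<le> \<Psi> n"
      "\<And>n. 1 \<le> n \<Longrightarrow> \<Psi> n \<le> K * (real n powr q * \<sigma> (real n))"
    show thesis by (rule that[of \<gamma> \<Psi> K, unfolded w_def, OF a])
  qed
  define c where "c = exp (Cd * M) * hmax"
  define D where "D = c * K1 + 1"
  have c0: "0 \<le> c" using hmax_pos by (simp add: c_def)
  have D0: "0 < D" using c0 K1 by (simp add: D_def add_nonneg_pos)
  have tail\<Psi>: "(\<Sum>i. measure m {y \<in> Y. i + n < R y}) \<le> K1 * \<Psi> n" if "1 \<le> n" for n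
    using tail[OF that] mult_left_mono[OF \<Psi>(4)[OF that] K1] unfolding w_def by linarith
  have Q: "chain.Q n \<le> D * \<Psi> n" if n: "1 \<le> n" for n
  proof -
    have "chain.Q n = (\<Sum>i. c * measure m {y \<in> Y. i + n < R y})"
      unfolding chain.Q_def tail_bound_def c_def ..
    also have "\<dots> = c * (\<Sum>i. measure m {y \<in> Y. i + n < R y})"
      by (rule suminf_mult) (use summable_ignore_initial_segment[OF R_tail_summable, of n] in simp)
    also have "\<dots> \<le> c * (K1 * \<Psi> n)" by (rule mult_left_mono[OF tail\<Psi>[OF n] c0])
    also have "\<dots> \<le> D * \<Psi> n" using \<Psi>(2)[OF n] by (simp add: D_def algebra_simps)
    finally show ?thesis .
  qed
  obtain A where A: "0 \<le> A" "\<And>n y y' l l'. 1 \<le> n \<Longrightarrow> y \<in> G \<Longrightarrow> y' \<in> G \<Longrightarrow>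
     chain.close_all (n + max l l') (y, l) (y', l') (A * (D * \<Psi> n))"
  proof (rule chain.coupling_rate[where \<Psi> = "\<lambda>n. D * \<Psi> n" and \<gamma> = \<gamma>])
    show "0 < D * \<Psi> n" if "1 \<le> n" for n using D0 \<Psi>(2)[OF that] by simp
    show "D * \<Psi> m \<le> (real n / real m) powr \<gamma> * (D * \<Psi> n)" if "1 \<le> m" "m \<le> n" for m n
      using mult_left_mono[OF \<Psi>(3)[OF that] less_imp_le[OF D0]] by (simp add: mult_ac)
    show "0 < \<gamma>" by (rule \<Psi>(1))
    show "chain.Q n \<le> D * \<Psi> n" if "1 \<le> n" for n by (rule Q[OF that])
  qed (rule that)
  define \<rho> where "\<rho> = enn2real (inverse Rbar)"
  have \<rho>: "inverse Rbar = ennreal \<rho>" "0 \<le> \<rho>"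
    using Rbar_pos by (auto simp: \<rho>_def ennreal_inverse_eq_top_iff less_top[symmetric])
  define C where "C = (A * D + 4 * b * \<rho> * hmax * K1) * (3 powr \<gamma> * K2)"
  have "tau_coeff \<mu> (\<lambda>j. \<phi> \<circ> (f ^^ j)) n \<le> ennreal (C * w n)" if n: "2 \<le> n" for n
  proof -
    define k where "k = n div 2"
    \<comment> \<open>\<open>n \<ge> 2\<close> makes \<open>k\<close> positive, and \<open>n \<le> 2 k + 1 \<le> 3 k\<close>\<close>
    have k: "1 \<le> k" "k \<le> n" "k + k \<le> n" "n \<le> 3 * k" using n by (auto simp: k_def)
    have \<Psi>k: "\<Psi> k \<le> 3 powr \<gamma> * (K2 * w n)"
    proof -
      have "\<Psi> k \<le> (real n / real k) powr \<gamma> * \<Psi> n" by (rule \<Psi>(3)[OF k(1,2)])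
      also have "\<dots> \<le> 3 powr \<gamma> * (K2 * w n)"
      proof (intro mult_mono powr_mono2)
        have "real n \<le> 3 * real k" using k(4) by linarith
        then show "real n / real k \<le> 3" using k(1) by (simp add: divide_le_eq)
        show "0 \<le> \<Psi> n" using \<Psi>(2)[of n] n by simp
      qed (use \<Psi>(1) \<Psi>(5)[of n] n in auto)
      finally show ?thesis .
    qed
    have \<Psi>k0: "0 \<le> \<Psi> k" using \<Psi>(2)[OF k(1)] by simp
    have "tau_coeff \<mu> (\<lambda>j. \<phi> \<circ> (f ^^ j)) n \<le> ennreal (A * (D * \<Psi> k)) + ennreal (4 * b) * avg (far k)"
    proof (rule tau_coeff_le)
      show "0 \<le> A * (D * \<Psi> k)" using A(1) D0 \<Psi>k0 by simp
      show "chain.close_all n (y, l) (y', l') (A * (D * \<Psi> k))"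
        if "y \<in> G" "y' \<in> G" "l \<le> k" "l' \<le> k" for y y' l l'
        by (rule chain.close_all_mono[OF A(2)[OF k(1) that(1,2)] order_refl]) (use that k(3) in auto)
    qed
    also have "avg (far k) \<le> ennreal \<rho> * ennreal (hmax * (K1 * \<Psi> k))"
      unfolding \<rho>(1)[symmetric]
      by (rule order_trans[OF avg_far_le], intro mult_left_mono ennreal_leI tail\<Psi>[OF k(1)])
        (use hmax_pos in auto)
    then have "ennreal (A * (D * \<Psi> k)) + ennreal (4 * b) * avg (far k)
      \<le> ennreal (A * (D * \<Psi> k)) + ennreal (4 * b) * (ennreal \<rho> * ennreal (hmax * (K1 * \<Psi> k)))"
      by (intro add_left_mono mult_left_mono) auto
    also have "\<dots> = ennreal ((A * D + 4 * b * \<rho> * hmax * K1) * \<Psi> k)"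
    proof -
      have nn: "0 \<le> A * (D * \<Psi> k)" "0 \<le> hmax * (K1 * \<Psi> k)" "0 \<le> 4 * b"
        using A(1) D0 \<Psi>k0 b_nonneg hmax_pos K1 by auto
      then have "ennreal (A * (D * \<Psi> k)) + ennreal (4 * b) * (ennreal \<rho> * ennreal (hmax * (K1 * \<Psi> k)))
        = ennreal (A * (D * \<Psi> k) + 4 * b * (\<rho> * (hmax * (K1 * \<Psi> k))))"
        using \<rho>(2) by (simp only: ennreal_mult ennreal_plus mult_nonneg_nonneg)
      also have "A * (D * \<Psi> k) + 4 * b * (\<rho> * (hmax * (K1 * \<Psi> k))) = (A * D + 4 * b * \<rho> * hmax * K1) * \<Psi> k"
        by (simp add: algebra_simps)
      finally show ?thesis .
    qed
    also have "\<dots> \<le> ennreal (C * w n)"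
    proof (rule ennreal_leI)
      have "0 \<le> A * D + 4 * b * \<rho> * hmax * K1"
        using A(1) D0 \<rho>(2) b_nonneg hmax_pos K1 by simp
      from mult_left_mono[OF \<Psi>k this]
      show "(A * D + 4 * b * \<rho> * hmax * K1) * \<Psi> k \<le> C * w n" by (simp add: C_def mult.assoc)
    qed
    finally show ?thesis .
  qed
  then show ?thesis unfolding w_def by blast
qed

end

theorem proposition2p1:
  fixes f :: "'a::polish_space \<Rightarrow> 'a"
    and Y :: "'a set" and m :: "'a measure" and \<Gamma> :: "'a set set" and R :: "'a \<Rightarrow> nat"
    and \<nu> \<mu> :: "'a measure"
    and p :: real and s :: "real \<Rightarrow> real" and u :: "nat \<Rightarrow> real"
    and \<phi> :: "'a \<Rightarrow> real"
  assumes "nonuniformly_expanding f Y m \<Gamma> R"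
    and "abs_cont_invariant_prob m (induced_map f R) \<nu>"
    and "\<mu> = lifted_measure f R \<nu>"
    and "p > 1"
    and "slowly_varying s"
    and "\<And>n. n \<ge> 1 \<Longrightarrow> u n > 0"
    and "u \<longlonglongrightarrow> 0"
    and "\<And>n. n \<ge> 1 \<Longrightarrow> exp (- (real n * u n)) \<le> measure m {y \<in> Y. R y > n}"
    and "\<And>n. n \<ge> 1 \<Longrightarrow> measure m {y \<in> Y. R y > n} \<le> real n powr (- p) * s (real n)"
    and "hoelder_continuous \<phi>"
  shows "(\<forall>n. tau_coeff \<mu> (\<lambda>j. \<phi> \<circ> (f ^^ j)) n < \<infinity>) \<and>
         (\<lambda>n. enn2real (tau_coeff \<mu> (\<lambda>j. \<phi> \<circ> (f ^^ j)) n))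
           \<in> O(\<lambda>n. real n powr (1 - p) * s (real n))"
proof -
  interpret E: nonuniformly_expanding f Y m \<Gamma> R by fact
  obtain a r \<xi> J B L K where "inverse_branches f Y m R a r \<xi> J B L K"
    using E.inverse_branches_exist by (elim exE)
  then interpret I: inverse_branches f Y m R a r \<xi> J B L K .
  obtain h G where hG: "h \<in> borel_measurable m \<and> (\<forall>y. 0 < h y) \<and> \<nu> = density m (\<lambda>y. ennreal (h y)) \<and>
    G \<in> sets m \<and> (AE y in m. y \<in> G) \<and> G \<noteq> {} \<and> G \<subseteq> B \<and> (\<forall>y\<in>G. \<forall>n. \<xi> n y \<in> G) \<and>
    (\<forall>y\<in>G. \<forall>y'\<in>G. h y \<le> exp (I.C0 * dist y y') * h y') \<and>
    (\<forall>y\<in>G. (\<lambda>n. J n y * h (\<xi> n y)) sums h y)"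
    using I.invariant_density[OF assms(2)] by (elim exE)
  define H where "H n = measure m {y \<in> Y. n < R y}" for n
  have Hm: "H n \<le> H k" if "k \<le> n" for n k
  proof -
    interpret finite_measure m by (rule I.finite_m)
    have "{y \<in> Y. j < R y} \<in> sets m" for j
    proof -
      have "{y \<in> space m. real j < real (R y)} \<in> sets m"
        using borel_measurable_integrable[OF I.R_int] by measurable
      then show ?thesis by (simp add: I.space_mY)
    qed
    then show ?thesis unfolding H_def using that by (intro finite_measure_mono) auto
  qed
  obtain K1 where K1: "summable H" "0 \<le> K1"
    "\<And>n. 1 \<le> n \<Longrightarrow> (\<Sum>i. H (i + n)) \<le> K1 * (real n powr (1 - p) * s (real n))"
  proof (rule tail_sum_slowly_varying[OF assms(5,4)])
    show "0 \<le> H n" for n by (simp add: H_def)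
    show "H n \<le> H k" if "k \<le> n" for n k by (rule Hm[OF that])
    show "H n \<le> real n powr (- p) * s (real n)" if "1 \<le> n" for n unfolding H_def by (rule assms(9)[OF that])
  qed (rule that)
  obtain \<alpha> C where \<alpha>: "0 < \<alpha>" "\<alpha> \<le> 1" and C: "\<And>x y. \<bar>\<phi> x - \<phi> y\<bar> \<le> C * dist x y powr \<alpha>"
    using assms(10) unfolding hoelder_continuous_def by blast
  have hoelder: "\<bar>\<phi> x - \<phi> y\<bar> \<le> \<bar>C\<bar> * dist x y powr \<alpha>" for x y
    by (rule order_trans[OF C]) (simp add: mult_right_mono)
  obtain e where "\<forall>x\<in>UNIV. \<forall>y\<in>UNIV. dist x (y :: 'a) \<le> e"
    using E.bounded_space[unfolded bounded_two_points] by (elim exE)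
  then have e: "dist x y \<le> e" for x y :: 'a by simp
  define M where "M = max 1 e"
  have M: "1 \<le> M" "\<And>x y :: 'a. dist x y \<le> M" by (simp_all add: M_def max.coboundedI2[OF e])
  define b where "b = \<bar>\<phi> undefined\<bar> + \<bar>C\<bar> * M powr \<alpha>"
  have bound: "\<bar>\<phi> x\<bar> \<le> b" for x
  proof -
    have "\<bar>\<phi> x - \<phi> undefined\<bar> \<le> \<bar>C\<bar> * M powr \<alpha>"
      by (rule order_trans[OF hoelder]) (use M \<alpha> in \<open>auto intro!: mult_left_mono powr_mono2\<close>)
    then show ?thesis by (simp add: b_def)
  qed
  have "isCont \<phi> x" for x
    unfolding isCont_def
  proof (rule tendsto_dist_iff[THEN iffD2], rule tendsto_sandwich[OF _ _ tendsto_const])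
    show "\<forall>\<^sub>F y in at x. dist (\<phi> y) (\<phi> x) \<le> \<bar>C\<bar> * dist y x powr \<alpha>" using hoelder by (simp add: dist_real_def)
    have "((\<lambda>y. dist y x) \<longlongrightarrow> dist x x) (at x)" by (intro tendsto_intros)
    then have "((\<lambda>y. dist y x powr \<alpha>) \<longlongrightarrow> dist x x powr \<alpha>) (at x)"
      using \<alpha> by (intro tendsto_powr') auto
    from tendsto_mult_left[OF this, of "\<bar>C\<bar>"] show "((\<lambda>y. \<bar>C\<bar> * dist y x powr \<alpha>) \<longlongrightarrow> 0) (at x)" by simp
  qed simp
  then have \<phi>_meas: "\<phi> \<in> borel_measurable borel"
    by (intro borel_measurable_continuous_onI) (simp add: continuous_at_imp_continuous_on)
  interpret T: tower f Y m R a r \<xi> J B L K \<nu> h G \<phi> \<alpha> "\<bar>C\<bar>" b M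
  proof
    show "summable (\<lambda>n. measure m {y \<in> Y. n < R y})" using K1(1) by (simp add: H_def[abs_def])
  qed (use hG assms(2) \<alpha> hoelder bound \<phi>_meas M in \<open>auto\<close>)
  have "\<exists>C. \<forall>n\<ge>2. tau_coeff T.\<mu> (\<lambda>j. \<phi> \<circ> (f ^^ j)) n \<le> ennreal (C * (real n powr (1 - p) * s (real n)))"
    by (rule T.tau_coeff_rate[OF assms(5) K1(2)]) (use K1(3) in \<open>simp add: H_def\<close>)
  then obtain C' where C': "\<And>n. 2 \<le> n \<Longrightarrow> tau_coeff \<mu> (\<lambda>j. \<phi> \<circ> (f ^^ j)) n \<le> ennreal (C' * (real n powr (1 - p) * s (real n)))"
    unfolding assms(3) by blast
  show ?thesis
  proof (intro conjI allI)
    show "tau_coeff \<mu> (\<lambda>j. \<phi> \<circ> (f ^^ j)) n < \<infinity>" for n unfolding assms(3) by (rule T.tau_coeff_finite)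
    show "(\<lambda>n. enn2real (tau_coeff \<mu> (\<lambda>j. \<phi> \<circ> (f ^^ j)) n)) \<in> O(\<lambda>n. real n powr (1 - p) * s (real n))"
    proof (rule bigoI[where c = "\<bar>C'\<bar>"], rule eventually_sequentiallyI[of 2])
      fix n :: nat assume n: "2 \<le> n"
      have w: "0 \<le> real n powr (1 - p) * s (real n)"
        using slowly_varying_pos[OF assms(5), of "real n"] n by simp
      have "tau_coeff \<mu> (\<lambda>j. \<phi> \<circ> (f ^^ j)) n \<le> ennreal (\<bar>C'\<bar> * (real n powr (1 - p) * s (real n)))"
        by (rule order_trans[OF C'[OF n] ennreal_leI]) (rule mult_right_mono[OF abs_ge_self w])
      then have "enn2real (tau_coeff \<mu> (\<lambda>j. \<phi> \<circ> (f ^^ j)) n) \<le> \<bar>C'\<bar> * (real n powr (1 - p) * s (real n))"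
        using w by (intro enn2real_leI) auto
      then show "norm (enn2real (tau_coeff \<mu> (\<lambda>j. \<phi> \<circ> (f ^^ j)) n)) \<le> \<bar>C'\<bar> * norm (real n powr (1 - p) * s (real n))"
        using w by simp
    qed
  qed
qed

end
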